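(* Let $d\ge3$ and let $\rho,\rho_1,\rho_2,\bar\rho_1,\bar\rho_2\in[1,\infty]$ with $\frac1\rho=\frac1{\rho_1}+\frac1{\rho_2}=\frac1{\bar\rho_1}+\frac1{\bar\rho_2}$. Let $1\le q\le p\le2q$, $p<d$ and $$\frac1q<\frac1p+\frac2d .$$ Then there is a constant $C$ (independent of $T$) such that for any $T>0$ and all $a,b$ for which the right-hand side is finite, $$\|ab\|_{\tilde L^\rho_T(\dot B^{\frac dq-2}_{q,\infty})}\le C\Big(\|a\|_{\tilde L^{\rho_1}_T(\dot B^{\frac dp-2}_{p,\infty})}\|b\|_{\tilde L^{\rho_2}_T(\dot B^{\frac dp}_{p,\infty})}+\|b\|_{\tilde L^{\bar\rho_1}_T(\dot B^{\frac dp-2}_{p,\infty})}\|a\|_{\tilde L^{\bar\rho_2}_T(\dot B^{\frac dp}_{p,\infty})}\Big).$$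
   Context: Let $\chi$ be smooth with values in $[0,1]$, supported in $\{|\xi|\le\frac43\}$, such that $\varphi(\xi)=\chi(\xi/2)-\chi(\xi)$ is supported in $\{\frac34\le|\xi|\le\frac83\}$ and $\sum_{j\in\mathbb Z}\varphi(2^{-j}\xi)=1$ for $\xi\ne0$. Put $\dot\Delta_j=\varphi(2^{-j}D)$, $\dot S_j=\chi(2^{-j}D)$ (Fourier multipliers in $x\in\mathbb R^d$). For functions of $(t,x)$ with values in $\mathcal S_0'$ (tempered distributions modulo polynomials), the Chemin-Lerner norm is $\|f\|_{\tilde L^\theta_T(\dot B^s_{p,r})}=\big\|2^{js}\|\dot\Delta_jf\|_{L^\theta(0,T;L^p(\mathbb R^d))}\big\|_{\ell^r(\mathbb Z)}$. Products are understood, at each time, through Bony's decomposition $ab=T_ab+R(a,b)+T_ba$ with $T_ab=\sum_j\dot S_{j-1}a\,\dot\Delta_jb$ and $R(a,b)=\sum_j\tilde{\dot\Delta}_ja\,\dot\Delta_jb$, $\tilde{\dot\Delta}_j=\sum_{|k-j|\le1}\dot\Delta_k$. *)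

theory Defs
  imports "HOL-Analysis.Analysis" "HOL-Probability.Essential_Supremum"
begin

section \<open>Schwartz functions and tempered distributions\<close>

definition partial :: "'n::finite \<Rightarrow> (real^'n \<Rightarrow> 'b::real_normed_vector) \<Rightarrow> real^'n \<Rightarrow> 'b" where
  "partial i f x = frechet_derivative f (at x) (axis i 1)"

text \<open>A list of coordinate indices plays the role of a multi-index.\<close>

definition partials :: "'n::finite list \<Rightarrow> (real^'n \<Rightarrow> 'b::real_normed_vector) \<Rightarrow> real^'n \<Rightarrow> 'b" where
  "partials \<alpha> f = foldr partial \<alpha> f"

definition smooth :: "(real^'n::finite \<Rightarrow> 'b::real_normed_vector) \<Rightarrow> bool" where
  "smooth f \<longleftrightarrow> (\<forall>\<alpha> x. partials \<alpha> f differentiable (at x))"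

definition schwartz :: "(real^'n::finite \<Rightarrow> complex) set" where
  "schwartz = {f. smooth f \<and> (\<forall>N \<alpha>. \<exists>B. \<forall>x. (1 + norm x) ^ N * norm (partials \<alpha> f x) \<le> B)}"

text \<open>
  A distribution is a functional on test functions; only its values on \<^const>\<open>schwartz\<close> matter.
  The continuity clause says that \<open>\<bar>u \<phi>\<bar>\<close> is at most \<open>C\<close> times the Schwartz seminorm of order \<open>N\<close>,
  that is, at most \<open>C * B\<close> for every bound \<open>B\<close> of that seminorm.
\<close>

type_synonym 'n distr = "(real^'n \<Rightarrow> complex) \<Rightarrow> complex"

definition tempered :: "'n::finite distr \<Rightarrow> bool" where
  "tempered u \<longleftrightarrow>
     (\<forall>\<phi>\<in>schwartz. \<forall>\<psi>\<in>schwartz. u (\<lambda>x. \<phi> x + \<psi> x) = u \<phi> + u \<psi>) \<and>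
     (\<forall>c. \<forall>\<phi>\<in>schwartz. u (\<lambda>x. c * \<phi> x) = c * u \<phi>) \<and>
     (\<exists>C N. \<forall>\<phi>\<in>schwartz. \<forall>B.
        (\<forall>\<alpha> x. length \<alpha> \<le> N \<longrightarrow> (1 + norm x) ^ N * norm (partials \<alpha> \<phi> x) \<le> B)
        \<longrightarrow> norm (u \<phi>) \<le> C * B)"

definition represents :: "(real^'n::finite \<Rightarrow> complex) \<Rightarrow> 'n distr \<Rightarrow> bool" where
  "represents f u \<longleftrightarrow> f \<in> borel_measurable borel \<and>
     (\<forall>\<phi>\<in>schwartz. integrable lborel (\<lambda>x. f x * \<phi> x) \<and> u \<phi> = (\<integral>x. f x * \<phi> x \<partial>lborel))"

text \<open>
  The continuous function representing \<open>u\<close>; it is unique if it exists, and it always exists for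
  \<open>u = m(D) v\<close> with \<open>v\<close> tempered and \<open>m\<close> smooth and compactly supported.
\<close>

definition fun_of :: "'n::finite distr \<Rightarrow> real^'n \<Rightarrow> complex" where
  "fun_of u = (SOME f. continuous_on UNIV f \<and> represents f u)"

section \<open>Tempered distributions modulo polynomials\<close>

definition poly_equiv :: "('n::finite distr \<times> 'n distr) set" where
  "poly_equiv = {(u, v). tempered u \<and> tempered v \<and>
     (\<exists>P::real^'n \<Rightarrow> complex. polynomial_function P \<and>
        (\<forall>\<phi>\<in>schwartz. u \<phi> - v \<phi> = (\<integral>x. P x * \<phi> x \<partial>lborel)))}"

definition S0' :: "'n::finite distr set set" where
  "S0' = {u. tempered u} // poly_equiv"

definition poly_class :: "'n::finite distr \<Rightarrow> 'n distr set" where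
  "poly_class u = poly_equiv `` {u}"

definition rep :: "'n::finite distr set \<Rightarrow> 'n distr" where
  "rep A = (SOME u. u \<in> A)"

section \<open>Fourier multipliers and the Littlewood-Paley decomposition\<close>

definition fourier :: "(real^'n::finite \<Rightarrow> complex) \<Rightarrow> real^'n \<Rightarrow> complex" where
  "fourier f \<xi> = (\<integral>x. cis (- (x \<bullet> \<xi>)) * f x \<partial>lborel)"

definition inv_fourier :: "(real^'n::finite \<Rightarrow> complex) \<Rightarrow> real^'n \<Rightarrow> complex" where
  "inv_fourier g x = (\<integral>\<xi>. cis (x \<bullet> \<xi>) * g \<xi> \<partial>lborel) / of_real ((2 * pi) ^ CARD('n))"

text \<open>
  \<open>m(D) u\<close> is the inverse Fourier transform of \<open>m\<close> times the Fourier transform of \<open>u\<close>, the Fourier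
  transforms of distributions and the multiplication by \<open>m\<close> being moved to the test function.
\<close>

definition multiplier :: "(real^'n::finite \<Rightarrow> real) \<Rightarrow> 'n distr \<Rightarrow> 'n distr" where
  "multiplier m u \<phi> = u (fourier (\<lambda>\<xi>. of_real (m \<xi>) * inv_fourier \<phi> \<xi>))"

definition annulus_fun :: "(real^'n::finite \<Rightarrow> real) \<Rightarrow> real^'n \<Rightarrow> real" where
  "annulus_fun chi \<xi> = chi ((1/2) *\<^sub>R \<xi>) - chi \<xi>"

definition littlewood_paley :: "(real^'n::finite \<Rightarrow> real) \<Rightarrow> bool" where
  "littlewood_paley chi \<longleftrightarrow>
     smooth chi \<and> range chi \<subseteq> {0..1} \<and>
     closure {\<xi>. chi \<xi> \<noteq> 0} \<subseteq> {\<xi>. norm \<xi> \<le> 4/3} \<and>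
     closure {\<xi>. annulus_fun chi \<xi> \<noteq> 0} \<subseteq> {\<xi>. 3/4 \<le> norm \<xi> \<and> norm \<xi> \<le> 8/3} \<and>
     (\<forall>\<xi>. \<xi> \<noteq> 0 \<longrightarrow> ((\<lambda>j::int. annulus_fun chi ((2 powi (-j)) *\<^sub>R \<xi>)) has_sum 1) UNIV)"

definition Delta :: "(real^'n::finite \<Rightarrow> real) \<Rightarrow> int \<Rightarrow> 'n distr \<Rightarrow> 'n distr" where
  "Delta chi j = multiplier (\<lambda>\<xi>. annulus_fun chi ((2 powi (-j)) *\<^sub>R \<xi>))"

definition Slow :: "(real^'n::finite \<Rightarrow> real) \<Rightarrow> int \<Rightarrow> 'n distr \<Rightarrow> 'n distr" where
  "Slow chi j = multiplier (\<lambda>\<xi>. chi ((2 powi (-j)) *\<^sub>R \<xi>))"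

section \<open>Bony's decomposition of the product\<close>

definition paraproduct :: "(real^'n::finite \<Rightarrow> real) \<Rightarrow> 'n distr \<Rightarrow> 'n distr \<Rightarrow> 'n distr" where
  "paraproduct chi u v \<phi> =
     (\<Sum>\<^sub>\<infinity>j::int. \<integral>x. fun_of (Slow chi (j - 1) u) x * fun_of (Delta chi j v) x * \<phi> x \<partial>lborel)"

definition remainder :: "(real^'n::finite \<Rightarrow> real) \<Rightarrow> 'n distr \<Rightarrow> 'n distr \<Rightarrow> 'n distr" where
  "remainder chi u v \<phi> =
     (\<Sum>\<^sub>\<infinity>j::int. \<integral>x. (\<Sum>k | \<bar>k - j\<bar> \<le> 1. fun_of (Delta chi k u) x) * fun_of (Delta chi j v) x * \<phi> x \<partial>lborel)"

definition bony :: "(real^'n::finite \<Rightarrow> real) \<Rightarrow> 'n distr \<Rightarrow> 'n distr \<Rightarrow> 'n distr" where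
  "bony chi u v \<phi> = paraproduct chi u v \<phi> + remainder chi u v \<phi> + paraproduct chi v u \<phi>"

text \<open>Convergence of the three series defining \<^const>\<open>bony\<close> in the space of tempered distributions.\<close>

definition bony_converges :: "(real^'n::finite \<Rightarrow> real) \<Rightarrow> 'n distr \<Rightarrow> 'n distr \<Rightarrow> bool" where
  "bony_converges chi u v \<longleftrightarrow> tempered (bony chi u v) \<and> (\<forall>\<phi>\<in>schwartz.
     (\<lambda>j::int. \<integral>x. fun_of (Slow chi (j - 1) u) x * fun_of (Delta chi j v) x * \<phi> x \<partial>lborel) summable_on UNIV \<and>
     (\<lambda>j::int. \<integral>x. (\<Sum>k | \<bar>k - j\<bar> \<le> 1. fun_of (Delta chi k u) x) * fun_of (Delta chi j v) x * \<phi> x \<partial>lborel)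
       summable_on UNIV \<and>
     (\<lambda>j::int. \<integral>x. fun_of (Slow chi (j - 1) v) x * fun_of (Delta chi j u) x * \<phi> x \<partial>lborel) summable_on UNIV)"

text \<open>
  The operators \<^const>\<open>Delta\<close> annihilate polynomials, but \<^const>\<open>Slow\<close> does not, so on a class modulo
  polynomials it has to be applied to a distinguished representative.  This is the usual one, whose
  low frequencies vanish: \<open>u - lim Slow m u\<close> as \<open>m\<close> tends to minus infinity.  The subtracted limit has
  its Fourier transform supported at the origin, hence is a polynomial, and the result does not
  depend on the representative \<open>u\<close> used; it is also the sum of all the blocks \<open>Delta k u\<close>.
\<close>

definition realization :: "(real^'n::finite \<Rightarrow> real) \<Rightarrow> 'n distr set \<Rightarrow> 'n distr" where
  "realization chi A \<phi> = Lim at_bot (\<lambda>m::int. rep A \<phi> - Slow chi m (rep A) \<phi>)"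

definition realizable :: "(real^'n::finite \<Rightarrow> real) \<Rightarrow> 'n distr set \<Rightarrow> bool" where
  "realizable chi A \<longleftrightarrow> tempered (realization chi A) \<and>
     (\<forall>\<phi>\<in>schwartz. ((\<lambda>m::int. rep A \<phi> - Slow chi m (rep A) \<phi>) \<longlongrightarrow> realization chi A \<phi>) at_bot)"

definition product_class :: "(real^'n::finite \<Rightarrow> real) \<Rightarrow> 'n distr set \<Rightarrow> 'n distr set \<Rightarrow> 'n distr set" where
  "product_class chi A B = poly_class (bony chi (realization chi A) (realization chi B))"

definition product_defined :: "(real^'n::finite \<Rightarrow> real) \<Rightarrow> 'n distr set \<Rightarrow> 'n distr set \<Rightarrow> bool" where
  "product_defined chi A B \<longleftrightarrow> realizable chi A \<and> realizable chi B \<and>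
     bony_converges chi (realization chi A) (realization chi B)"

section \<open>Norms\<close>

definition enn_powr :: "ennreal \<Rightarrow> real \<Rightarrow> ennreal" where
  "enn_powr x r = (if x = \<infinity> then \<infinity> else ennreal (enn2real x powr r))"

definition Lnorm :: "ennreal \<Rightarrow> 'a measure \<Rightarrow> ('a \<Rightarrow> ennreal) \<Rightarrow> ennreal" where
  "Lnorm p M f = (if p = \<infinity> then esssup M f
     else enn_powr (\<integral>\<^sup>+x. enn_powr (f x) (enn2real p) \<partial>M) (1 / enn2real p))"

text \<open>
  The infimum is over almost everywhere equal functions, and it is infinite if the distribution is
  not a function.
\<close>

definition distr_Lnorm :: "ennreal \<Rightarrow> 'n::finite distr \<Rightarrow> ennreal" where
  "distr_Lnorm p u = Inf {Lnorm p lborel (\<lambda>x. ennreal (norm (f x))) | f. represents f u}"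

text \<open>
  Membership in \<open>L\<^sup>\<theta>(0,T;L\<^sup>p)\<close> includes measurability in time, so the norm of a non-measurable
  function is infinite, as for \<^const>\<open>esssup\<close>.  For finite \<open>p\<close>, where \<open>L\<^sup>p\<close> is separable, the weak
  measurability below is the same as strong measurability.
\<close>

definition time_space_norm :: "ennreal \<Rightarrow> real \<Rightarrow> ennreal \<Rightarrow> (real \<Rightarrow> 'n::finite distr) \<Rightarrow> ennreal" where
  "time_space_norm \<theta> T p w =
     (if \<forall>\<phi>\<in>schwartz. (\<lambda>t. w t \<phi>) \<in> borel_measurable (lebesgue_on {0<..<T})
      then Lnorm \<theta> (lebesgue_on {0<..<T}) (\<lambda>t. distr_Lnorm p (w t)) else \<infinity>)"

definition chemin_lerner_norm ::
  "(real^'n::finite \<Rightarrow> real) \<Rightarrow> ennreal \<Rightarrow> real \<Rightarrow> real \<Rightarrow> ennreal \<Rightarrow> ennreal \<Rightarrow> (real \<Rightarrow> 'n distr set) \<Rightarrow> ennreal" where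
  "chemin_lerner_norm chi \<theta> T s p r f =
     Lnorm r (count_space UNIV)
       (\<lambda>j::int. ennreal (2 powr (of_int j * s)) * time_space_norm \<theta> T p (\<lambda>t. Delta chi j (rep (f t))))"

end

theory Submission
  imports Defs "HOL-Probability.Probability"
begin

text \<open>
  For functions whose frequencies have size at most \<open>2\<^sup>k\<close>, Bernstein's
  inequality raises the Lebesgue exponent from \<open>p\<close> to \<open>s\<close> at the price
  \<open>2\<^sup>k\<close> to the power \<open>d/p - d/s\<close>. Together with Hoelder's
  inequality it bounds the \<open>L\<^sup>q\<close> norm of the product of such a function with
  another function by the product of their \<open>L\<^sup>p\<close> norms, at the price
  \<open>2\<^sup>k\<close> to the power \<open>2d/p - d/q\<close>; this needs \<open>q \<le> p
  \<le> 2q\<close>.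

  Fix a block \<open>\<Delta>\<^sub>l (ab)\<close>. A term \<open>S\<^sub>j\<^sub>-\<^sub>1 a
  \<Delta>\<^sub>j b\<close> of the paraproduct has its frequencies in an annulus of size
  \<open>2\<^sup>j\<close>, so only the terms with \<open>\<bar>j - l\<bar> \<le> 5\<close>
  contribute. Expand \<open>S\<^sub>j\<^sub>-\<^sub>1 a\<close> into its blocks of frequency
  \<open>2\<^sup>k\<close>. With the weights of \<open>a\<close> in the space of index \<open>d/p
  - 2\<close> and of \<open>b\<close> in the space of index \<open>d/p\<close>, the power of
  \<open>2\<^sup>k\<close> that is left is \<open>d/p - d/q + 2\<close>. It is positive exactly
  when \<open>1/q < 1/p + 2/d\<close>, and then the sum over \<open>k < j\<close> is geometric. A
  term \<open>\<Delta>\<^sub>k a \<Delta>\<^sub>j b\<close> with \<open>\<bar>k - j\<bar> \<le>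
  1\<close> of the remainder only has frequencies below \<open>8 * 2\<^sup>j\<close>, so all
  \<open>j \<ge> l - 3\<close> contribute. It is estimated in \<open>L\<^sup>r\<close> with
  \<open>r = max 1 (p/2)\<close> by the same product inequality, and Bernstein's inequality at the
  frequency \<open>2\<^sup>l\<close> leads back to \<open>L\<^sup>q\<close>, since \<open>r \<le>
  q\<close>. The power of \<open>2\<^sup>j\<close> that is left is \<open>2 - d/r\<close>. It is
  negative because \<open>p < d\<close> and \<open>3 \<le> d\<close>, and the sum over
  \<open>j\<close> is geometric again. Both parts are of size \<open>2\<^sup>l\<close> to the
  power \<open>2 - d/q\<close>, as claimed. The bound is a sum of products of the norms of two
  blocks, so Minkowski's and Hoelder's inequalities in time can be applied term by term
  (\<open>prod_block_Lnorm\<close>, \<open>Lnorm_prod_bound\<close>).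

  The Chemin-Lerner norms take the supremum over the blocks after the norm in time, hence they do
  not bound a Besov norm of \<open>a t\<close> at a fixed time. They do imply a slightly weaker
  bound of the blocks for almost every \<open>t\<close>, called \<open>good\<close> below
  (\<open>AE_good\<close>). It suffices for the low frequencies to be summable, so that the
  realization exists, and for the three series in Bony's decomposition to converge when they are
  tested (\<open>product_defined_good\<close>): at low frequencies the terms are small in the
  supremum norm, a paraproduct term of high frequency only sees the high frequencies of the test
  function, and a remainder term of high frequency is small in \<open>L\<^sup>r\<close>. The
  result is defined modulo polynomials, which no block can see (\<open>Delta_poly_class\<close>).

  Finally, all norms in time require measurability. The block of a tempered distribution is always
  a continuous function of \<open>x\<close>, obtained by pairing with a translated kernel
  (\<open>blk_tempered\<close>, by way of \<open>tempered_convolution\<close>); so it is jointly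
  measurable in \<open>t\<close> and \<open>x\<close> as soon as the pairings are measurable in
  \<open>t\<close>, and its \<open>L\<^sup>p\<close> norm is measurable in \<open>t\<close>
  (\<open>distr_Lnorm_measurable\<close>).
\<close>

section \<open>Hoelder and Minkowski inequalities for extended nonnegative functions\<close>

lemma enn_powr_ennreal: "0 \<le> x \<Longrightarrow> enn_powr (ennreal x) r = ennreal (x powr r)"
  by (simp add: enn_powr_def)

lemma enn_powr_top [simp]: "enn_powr \<infinity> r = \<infinity>" "enn_powr top r = top"
  by (simp_all add: enn_powr_def)

lemma enn_powr_0 [simp]: "enn_powr 0 r = 0"
  by (simp add: enn_powr_def)

lemma enn_powr_mono: "0 \<le> r \<Longrightarrow> x \<le> y \<Longrightarrow> enn_powr x r \<le> enn_powr y r"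
  by (cases x; cases y) (auto simp: enn_powr_ennreal powr_mono2 top_unique)

lemma enn_powr_eq_0 [simp]: "enn_powr x r = 0 \<longleftrightarrow> x = 0"
  by (cases x) (auto simp: enn_powr_ennreal)

lemma enn_powr_eq_top [simp]: "enn_powr x r = top \<longleftrightarrow> x = top"
  by (cases x) (auto simp: enn_powr_ennreal)

lemma enn_powr_mult: "enn_powr (x * y) r = enn_powr x r * enn_powr y r"
proof (cases "x = top \<or> y = top")
  case True
  then show ?thesis
    by (cases "x = 0 \<or> y = 0") (auto simp: ennreal_mult_top ennreal_top_mult)
next
  case False
  then show ?thesis
    by (cases x; cases y) (auto simp: enn_powr_ennreal powr_mult simp flip: ennreal_mult)
qed

lemma enn_powr_powr: "enn_powr (enn_powr x r) s = enn_powr x (r * s)"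
  by (cases x) (auto simp: enn_powr_ennreal powr_powr)

lemma enn_powr_one [simp]: "enn_powr x 1 = x"
  by (cases x) (auto simp: enn_powr_ennreal)

lemma enn_powr_add: "enn_powr x (r + s) = enn_powr x r * enn_powr x s"
  by (cases x) (auto simp: enn_powr_ennreal powr_add simp flip: ennreal_mult)

lemma enn_powr_measurable [measurable]:
  assumes [measurable]: "f \<in> borel_measurable M"
  shows "(\<lambda>x. enn_powr (f x) r) \<in> borel_measurable M"
proof -
  have [measurable]: "Measurable.pred M (\<lambda>x. f x = \<infinity>)"
    using borel_measurable_eq[of f M "\<lambda>_. \<infinity>"] by (simp add: pred_def)
  show ?thesis
    unfolding enn_powr_def by measurable
qed

lemma nn_integral_count_space_measurable:
  assumes "countable I" "\<And>i. i \<in> I \<Longrightarrow> f i \<in> borel_measurable M"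
  shows "(\<lambda>x. \<integral>\<^sup>+i. f i x \<partial>count_space I) \<in> borel_measurable M"
proof -
  interpret sigma_finite_measure "count_space I"
    using assms(1) by (rule sigma_finite_measure_count_space_countable)
  have "(\<lambda>z. f (snd z) (fst z)) \<in> borel_measurable (M \<Otimes>\<^sub>M count_space I)"
    by (rule measurable_compose_countable'[where I = I and g = snd and f = "\<lambda>i z. f i (fst z)"])
      (use assms in measurable)
  then show ?thesis
    by (intro borel_measurable_nn_integral) (simp add: case_prod_beta)
qed

lemma enn_powr_le_cancel: "0 < r \<Longrightarrow> enn_powr x r \<le> enn_powr y r \<Longrightarrow> x \<le> y"
  using enn_powr_mono[of "1/r" "enn_powr x r" "enn_powr y r"] by (simp add: enn_powr_powr)

lemma enn_powr_young:
  assumes "0 < a" "0 < b" "a + b = 1"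
  shows "enn_powr x a * enn_powr y b \<le> ennreal a * x + ennreal b * y"
proof (cases "x = 0 \<or> y = 0 \<or> x = top \<or> y = top")
  case True
  then show ?thesis using assms by (auto simp: ennreal_mult_top ennreal_top_mult)
next
  case False
  then obtain u v where "x = ennreal u" "y = ennreal v" "0 < u" "0 < v"
    by (cases x; cases y) (auto simp: less_le)
  then show ?thesis
    using Youngs_inequality_0[of a b u v] assms
    by (simp add: enn_powr_ennreal ennreal_leI flip: ennreal_mult ennreal_plus)
qed

lemma Hoelder_nn_integral:
  assumes "0 < a" "0 < b" "a + b = 1"
    and [measurable]: "F \<in> borel_measurable M" "G \<in> borel_measurable M"
  shows "(\<integral>\<^sup>+x. enn_powr (F x) a * enn_powr (G x) b \<partial>M)
    \<le> enn_powr (\<integral>\<^sup>+x. F x \<partial>M) a * enn_powr (\<integral>\<^sup>+x. G x \<partial>M) b"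
proof -
  define X Y where "X = (\<integral>\<^sup>+x. F x \<partial>M)" and "Y = (\<integral>\<^sup>+x. G x \<partial>M)"
  consider "X = 0 \<or> Y = 0" | "X \<noteq> 0" "Y \<noteq> 0" "X = top \<or> Y = top"
    | "X \<noteq> 0" "Y \<noteq> 0" "X \<noteq> top" "Y \<noteq> top" by blast
  then show ?thesis
  proof cases
    case 1
    then have "AE x in M. F x = 0 \<or> G x = 0"
      by (auto simp: X_def Y_def nn_integral_0_iff_AE)
    then have "(\<integral>\<^sup>+x. enn_powr (F x) a * enn_powr (G x) b \<partial>M) = (\<integral>\<^sup>+x. 0 \<partial>M)"
      by (intro nn_integral_cong_AE) auto
    then show ?thesis by simp
  next
    case 2
    then show ?thesis unfolding X_def[symmetric] Y_def[symmetric]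
      by (auto simp: ennreal_mult_top ennreal_top_mult)
  next
    case 3
    then have pos: "0 < enn2real X" "0 < enn2real Y" "X = ennreal (enn2real X)" "Y = ennreal (enn2real Y)"
      by (auto simp: enn2real_positive_iff less_top zero_less_iff_neq_zero)
    define K where "K = enn_powr X a * enn_powr Y b"
    have K: "enn_powr u a * enn_powr v b = K * (enn_powr (u / X) a * enn_powr (v / Y) b)" for u v
    proof -
      have "u = X * (u / X)" "v = Y * (v / Y)"
        using 3 by (simp_all add: ennreal_times_divide ennreal_mult_divide_eq mult.commute[of X] mult.commute[of Y])
      then show ?thesis unfolding K_def
        by (metis (no_types, lifting) enn_powr_mult mult.assoc mult.left_commute)
    qed
    have "(\<integral>\<^sup>+x. enn_powr (F x) a * enn_powr (G x) b \<partial>M)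
        = K * (\<integral>\<^sup>+x. enn_powr (F x / X) a * enn_powr (G x / Y) b \<partial>M)"
      by (subst K) (simp add: nn_integral_cmult)
    also have "\<dots> \<le> K * (\<integral>\<^sup>+x. ennreal a * (F x / X) + ennreal b * (G x / Y) \<partial>M)"
      by (intro mult_left_mono nn_integral_mono enn_powr_young assms) auto
    also have "\<dots> = K * (ennreal a * (X / X) + ennreal b * (Y / Y))"
      by (simp add: nn_integral_add nn_integral_cmult nn_integral_divide X_def Y_def)
    also have "\<dots> = K"
      using 3 assms by (simp add: ennreal_divide_self less_top flip: ennreal_plus)
    finally show ?thesis by (simp add: K_def X_def Y_def)
  qed
qed

text \<open>
  Jensen's inequality for the measure with density \<open>k\<close>, whose total mass is at most \<open>c\<close>. It is used
  for convolutions, for weights and for series.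
\<close>

lemma Jensen_nn_integral:
  assumes "1 \<le> p" "0 < c" and k: "(\<integral>\<^sup>+x. k x \<partial>M) \<le> ennreal c"
    and [measurable]: "k \<in> borel_measurable M" "h \<in> borel_measurable M"
  shows "enn_powr (\<integral>\<^sup>+x. k x * h x \<partial>M) p \<le> ennreal (c powr (p - 1)) * (\<integral>\<^sup>+x. k x * enn_powr (h x) p \<partial>M)"
proof (cases "p = 1")
  case True
  then show ?thesis using assms by simp
next
  case False
  then have p: "1 < p" using assms by simp
  have eq: "k x * h x = enn_powr (k x) (1 - 1 / p) * enn_powr (k x * enn_powr (h x) p) (1 / p)" for x
    using p enn_powr_add[of "k x" "1 - 1/p" "1/p"]
    by (simp add: enn_powr_mult enn_powr_powr mult.assoc[symmetric])
  have "enn_powr (\<integral>\<^sup>+x. k x * h x \<partial>M) p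
      \<le> enn_powr (enn_powr (\<integral>\<^sup>+x. k x \<partial>M) (1 - 1 / p) * enn_powr (\<integral>\<^sup>+x. k x * enn_powr (h x) p \<partial>M) (1 / p)) p"
    using p by (intro enn_powr_mono) (auto simp: eq intro!: Hoelder_nn_integral)
  also have "\<dots> = enn_powr (\<integral>\<^sup>+x. k x \<partial>M) (p - 1) * (\<integral>\<^sup>+x. k x * enn_powr (h x) p \<partial>M)"
    using p by (simp add: enn_powr_mult enn_powr_powr left_diff_distrib)
  also have "\<dots> \<le> ennreal (c powr (p - 1)) * (\<integral>\<^sup>+x. k x * enn_powr (h x) p \<partial>M)"
    using k p assms(2) enn_powr_mono[OF _ k, of "p - 1"] by (intro mult_right_mono) (auto simp: enn_powr_ennreal)
  finally show ?thesis .
qed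

lemma Lnorm_real:
  "0 < p \<Longrightarrow> Lnorm (ennreal p) M f = enn_powr (\<integral>\<^sup>+x. enn_powr (f x) p \<partial>M) (1 / p)"
  by (simp add: Lnorm_def)

lemma exponent_cases:
  fixes \<theta> :: ennreal
  assumes "1 \<le> \<theta>"
  obtains "\<theta> = \<infinity>" | p where "\<theta> = ennreal p" "1 \<le> p"
  using assms by (cases \<theta>) (auto simp: ennreal_ge_1)

lemma Lnorm_mono_AE:
  assumes "1 \<le> \<theta>" "f \<in> borel_measurable M" "AE x in M. f x \<le> g x"
  shows "Lnorm \<theta> M f \<le> Lnorm \<theta> M g"
  using assms(1)
proof (cases rule: exponent_cases)
  case 1
  then show ?thesis using assms by (simp add: Lnorm_def esssup_AE_mono)
next
  case (2 p)
  then show ?thesis using assms(3)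
    by (auto simp: Lnorm_real intro!: enn_powr_mono nn_integral_mono_AE)
qed

lemma Lnorm_cong_AE:
  assumes "1 \<le> \<theta>" "f \<in> borel_measurable M" "g \<in> borel_measurable M" "AE x in M. f x = g x"
  shows "Lnorm \<theta> M f = Lnorm \<theta> M g"
  using assms by (intro antisym Lnorm_mono_AE) auto

lemma Lnorm_cmult_le:
  assumes "1 \<le> \<theta>" and [measurable]: "f \<in> borel_measurable M" and "0 \<le> c"
  shows "Lnorm \<theta> M (\<lambda>x. ennreal c * f x) \<le> ennreal c * Lnorm \<theta> M f"
  using assms(1)
proof (cases rule: exponent_cases)
  case 1
  have "AE x in M. ennreal c * f x \<le> ennreal c * esssup M f"
    using esssup_AE[of f M] by eventually_elim (auto intro: mult_left_mono)
  then show ?thesis using 1 by (simp add: Lnorm_def esssup_I)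
next
  case (2 p)
  then show ?thesis
    by (simp add: Lnorm_real enn_powr_mult nn_integral_cmult enn_powr_powr)
qed

lemma Lnorm_finite_AE:
  assumes "1 \<le> \<theta>" and [measurable]: "f \<in> borel_measurable M" and "Lnorm \<theta> M f < \<infinity>"
  shows "AE x in M. f x < \<infinity>"
  using assms(1)
proof (cases rule: exponent_cases)
  case 1
  then show ?thesis using assms(3) esssup_AE[of f M] by (auto simp: Lnorm_def elim!: eventually_mono)
next
  case (2 p)
  then have "(\<integral>\<^sup>+x. enn_powr (f x) p \<partial>M) \<noteq> \<infinity>"
    using assms(3) by (auto simp: Lnorm_real less_top[symmetric])
  then have "AE x in M. enn_powr (f x) p \<noteq> \<infinity>"
    by (intro nn_integral_PInf_AE) auto
  then show ?thesis by (auto simp: less_top)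
qed

lemma Lnorm_eq_0_AE:
  assumes "1 \<le> p" and [measurable]: "f \<in> borel_measurable M" and "Lnorm (ennreal p) M f = 0"
  shows "AE x in M. f x = 0"
  using assms by (simp add: Lnorm_real nn_integral_0_iff_AE)

text \<open>
  Jensen's inequality for the weighted mean of the normalised functions \<open>f i / N i\<close>
  with the weights \<open>N i\<close>, their norms.
\<close>

lemma Minkowski_Lnorm_real:
  assumes p: "1 \<le> p" and "countable I" and [measurable]: "\<And>i. i \<in> I \<Longrightarrow> f i \<in> borel_measurable M"
  shows "Lnorm (ennreal p) M (\<lambda>x. \<integral>\<^sup>+i. f i x \<partial>count_space I) \<le> (\<integral>\<^sup>+i. Lnorm (ennreal p) M (f i) \<partial>count_space I)"
proof -
  define N where "N i = Lnorm (ennreal p) M (f i)" for i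
  define S where "S = (\<integral>\<^sup>+i. N i \<partial>count_space I)"
  have Nle: "N i \<le> S" if "i \<in> I" for i
    unfolding S_def using nn_integral_ge_point[OF that] .
  have [measurable]: "(\<lambda>x. \<integral>\<^sup>+i. f i x \<partial>count_space I) \<in> borel_measurable M"
    using assms by (intro nn_integral_count_space_measurable) auto
  consider "S = top" | "S = 0" | c where "S = ennreal c" "0 < c"
    by (cases S) (auto simp: less_le)
  then have "Lnorm (ennreal p) M (\<lambda>x. \<integral>\<^sup>+i. f i x \<partial>count_space I) \<le> S"
  proof cases
    case 2
    have "AE x in M. \<forall>i\<in>I. f i x = 0"
      unfolding AE_ball_countable[OF assms(2)] using Nle 2
      by (intro ballI Lnorm_eq_0_AE[OF p] assms(3)) (auto simp: N_def)
    then have "AE x in M. (\<integral>\<^sup>+i. f i x \<partial>count_space I) = 0"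
      by eventually_elim (simp add: nn_integral_0_iff_AE AE_count_space)
    then have "Lnorm (ennreal p) M (\<lambda>x. \<integral>\<^sup>+i. f i x \<partial>count_space I) = Lnorm (ennreal p) M (\<lambda>x. 0)"
      using p by (intro Lnorm_cong_AE) (auto simp: ennreal_ge_1)
    then show ?thesis using p by (simp add: Lnorm_real)
  next
    case (3 c)
    then have fin: "N i \<noteq> top" if "i \<in> I" for i using Nle[OF that] by (auto simp: top_unique)
    define h where "h i x = f i x / N i" for i x
    have [measurable]: "h i \<in> borel_measurable M" if "i \<in> I" for i
      using that unfolding h_def by measurable
    have "AE x in M. \<forall>i\<in>I. N i = 0 \<longrightarrow> f i x = 0"
      unfolding AE_ball_countable[OF assms(2)]
      by (intro ballI AE_impI Lnorm_eq_0_AE[OF p] assms(3)) (auto simp: N_def)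
    then have "AE x in M. enn_powr (\<integral>\<^sup>+i. f i x \<partial>count_space I) p
       \<le> ennreal (c powr (p - 1)) * (\<integral>\<^sup>+i. N i * enn_powr (h i x) p \<partial>count_space I)"
    proof eventually_elim
      case (elim x)
      then have "f i x = N i * h i x" if "i \<in> I" for i
        using that fin[OF that] unfolding h_def
        by (cases "N i = 0") (auto simp: ennreal_times_divide mult.commute[of "N i"]
            simp flip: ennreal_mult_divide_eq)
      then have "(\<integral>\<^sup>+i. f i x \<partial>count_space I) = (\<integral>\<^sup>+i. N i * h i x \<partial>count_space I)"
        by (intro nn_integral_cong) auto
      then show ?case using Jensen_nn_integral[of p c "count_space I" N "\<lambda>i. h i x"] p 3 by (simp add: S_def)
    qed
    then have "(\<integral>\<^sup>+x. enn_powr (\<integral>\<^sup>+i. f i x \<partial>count_space I) p \<partial>M)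
       \<le> (\<integral>\<^sup>+x. ennreal (c powr (p - 1)) * (\<integral>\<^sup>+i. N i * enn_powr (h i x) p \<partial>count_space I) \<partial>M)"
      by (rule nn_integral_mono_AE)
    also have "\<dots> = ennreal (c powr (p - 1)) * (\<integral>\<^sup>+i. N i * (\<integral>\<^sup>+x. enn_powr (h i x) p \<partial>M) \<partial>count_space I)"
    proof -
      have "(\<integral>\<^sup>+x. (\<integral>\<^sup>+i. N i * enn_powr (h i x) p \<partial>count_space I) \<partial>M)
         = (\<integral>\<^sup>+i. (\<integral>\<^sup>+x. N i * enn_powr (h i x) p \<partial>M) \<partial>count_space I)"
        using assms by (intro nn_integral_count_space_nn_integral) auto
      also have "\<dots> = (\<integral>\<^sup>+i. N i * (\<integral>\<^sup>+x. enn_powr (h i x) p \<partial>M) \<partial>count_space I)"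
        by (intro nn_integral_cong nn_integral_cmult) auto
      finally show ?thesis
        using assms by (subst nn_integral_cmult) (auto intro!: nn_integral_count_space_measurable)
    qed
    also have "\<dots> \<le> ennreal (c powr (p - 1)) * (\<integral>\<^sup>+i. N i \<partial>count_space I)"
    proof (intro mult_left_mono nn_integral_mono)
      fix i assume "i \<in> space (count_space I)"
      then have i: "i \<in> I" by simp
      show "N i * (\<integral>\<^sup>+x. enn_powr (h i x) p \<partial>M) \<le> N i"
      proof (cases "N i = 0")
        case False
        have Np: "(\<integral>\<^sup>+x. enn_powr (f i x) p \<partial>M) = enn_powr (N i) p"
          using p by (simp add: N_def Lnorm_real enn_powr_powr)
        have "enn_powr (f i x) p = enn_powr (h i x) p * enn_powr (N i) p" for x
          using False fin[OF i] unfolding h_def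
          by (simp add: ennreal_divide_times ennreal_mult_divide_eq less_top[symmetric] flip: enn_powr_mult)
        then have "(\<integral>\<^sup>+x. enn_powr (f i x) p \<partial>M) = (\<integral>\<^sup>+x. enn_powr (h i x) p \<partial>M) * enn_powr (N i) p"
          using i by (simp add: nn_integral_multc)
        then have "(\<integral>\<^sup>+x. enn_powr (h i x) p \<partial>M) = 1"
          using Np False fin[OF i] by (metis enn_powr_eq_0 enn_powr_eq_top ennreal_divide_self
              ennreal_mult_divide_eq less_top)
        then show ?thesis by simp
      qed simp
    qed simp
    also have "\<dots> = enn_powr S p"
      using 3 p powr_add[of c "p - 1" 1] by (simp add: S_def enn_powr_ennreal flip: ennreal_mult)
    finally show ?thesis
      using enn_powr_mono[of "1/p" _ "enn_powr S p"] p by (simp add: Lnorm_real enn_powr_powr)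
  qed simp
  then show ?thesis by (simp add: S_def N_def)
qed

lemma Minkowski_Lnorm:
  assumes "1 \<le> \<theta>" "countable I" and [measurable]: "\<And>i. i \<in> I \<Longrightarrow> f i \<in> borel_measurable M"
  shows "Lnorm \<theta> M (\<lambda>x. \<integral>\<^sup>+i. f i x \<partial>count_space I) \<le> (\<integral>\<^sup>+i. Lnorm \<theta> M (f i) \<partial>count_space I)"
  using assms(1)
proof (cases rule: exponent_cases)
  case 1
  have "AE x in M. \<forall>i\<in>I. f i x \<le> esssup M (f i)"
    unfolding AE_ball_countable[OF assms(2)] by (auto simp: esssup_AE)
  then have "AE x in M. (\<integral>\<^sup>+i. f i x \<partial>count_space I) \<le> (\<integral>\<^sup>+i. esssup M (f i) \<partial>count_space I)"
    by eventually_elim (auto intro!: nn_integral_mono)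
  then show ?thesis
    using 1 assms by (auto simp: Lnorm_def intro!: esssup_I nn_integral_count_space_measurable)
next
  case (2 p)
  then show ?thesis using Minkowski_Lnorm_real assms by blast
qed

lemma Hoelder_Lnorm_top:
  assumes "1 \<le> \<theta>" and [measurable]: "f \<in> borel_measurable M" "g \<in> borel_measurable M"
  shows "Lnorm \<theta> M (\<lambda>x. f x * g x) \<le> Lnorm \<infinity> M f * Lnorm \<theta> M g"
  using assms(1)
proof (cases rule: exponent_cases)
  case 1
  have "AE x in M. f x * g x \<le> esssup M f * esssup M g"
    using esssup_AE[of f M] esssup_AE[of g M] by eventually_elim (auto intro: mult_mono)
  then show ?thesis using 1 by (simp add: Lnorm_def esssup_I)
next
  case (2 p)
  define F where "F = esssup M f"
  have "AE x in M. f x * g x \<le> F * g x"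
    using esssup_AE[of f M] by eventually_elim (auto intro: mult_right_mono simp: F_def)
  then have "Lnorm \<theta> M (\<lambda>x. f x * g x) \<le> Lnorm \<theta> M (\<lambda>x. F * g x)"
    using assms by (intro Lnorm_mono_AE) auto
  also have "\<dots> = F * Lnorm \<theta> M g"
    using 2 by (simp add: Lnorm_real enn_powr_mult nn_integral_cmult enn_powr_powr)
  finally show ?thesis by (simp add: Lnorm_def F_def)
qed

lemma Hoelder_Lnorm:
  assumes "1 \<le> \<theta>" "1 \<le> \<theta>\<^sub>1" "1 \<le> \<theta>\<^sub>2" and eq: "1 / \<theta> = 1 / \<theta>\<^sub>1 + 1 / \<theta>\<^sub>2"
    and [measurable]: "f \<in> borel_measurable M" "g \<in> borel_measurable M"
  shows "Lnorm \<theta> M (\<lambda>x. f x * g x) \<le> Lnorm \<theta>\<^sub>1 M f * Lnorm \<theta>\<^sub>2 M g"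
proof -
  have inv_inj: "a = b" if "1 / a = 1 / b" for a b :: ennreal
    using that by (metis one_divide_one_divide_ennreal)
  consider "\<theta>\<^sub>1 = \<infinity>" | "\<theta>\<^sub>2 = \<infinity>" | "\<theta>\<^sub>1 \<noteq> \<infinity>" "\<theta>\<^sub>2 \<noteq> \<infinity>" by blast
  then show ?thesis
  proof cases
    case 1
    then have "\<theta> = \<theta>\<^sub>2" using eq by (auto intro: inv_inj)
    then show ?thesis using Hoelder_Lnorm_top[of \<theta> f M g] assms 1 by simp
  next
    case 2
    then have "\<theta> = \<theta>\<^sub>1" using eq by (auto intro: inv_inj)
    then show ?thesis using Hoelder_Lnorm_top[of \<theta> g M f] assms 2 by (simp add: mult.commute)
  next
    case 3
    then obtain p q where pq: "\<theta>\<^sub>1 = ennreal p" "1 \<le> p" "\<theta>\<^sub>2 = ennreal q" "1 \<le> q"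
      using assms by (metis exponent_cases)
    have e: "1 / \<theta> = ennreal (1 / p + 1 / q)"
      using pq unfolding eq by (simp add: divide_ennreal flip: ennreal_1 ennreal_plus)
    have "\<theta> \<noteq> \<infinity>" using e pq by (auto simp: add_pos_pos)
    then obtain r where r: "\<theta> = ennreal r" "1 \<le> r"
      using assms by (metis exponent_cases)
    have "ennreal (1 / r) = ennreal (1 / p + 1 / q)"
      using e r by (simp add: divide_ennreal flip: ennreal_1)
    then have rr: "1 / r = 1 / p + 1 / q" using pq r by (subst (asm) ennreal_inj) auto
    then have ab: "0 < r / p" "0 < r / q" "r / p + r / q = 1"
      using pq r by (auto simp: field_simps)
    have "enn_powr (f x * g x) r = enn_powr (enn_powr (f x) p) (r / p) * enn_powr (enn_powr (g x) q) (r / q)" for x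
      using pq by (simp add: enn_powr_mult enn_powr_powr)
    then have "(\<integral>\<^sup>+x. enn_powr (f x * g x) r \<partial>M)
      \<le> enn_powr (\<integral>\<^sup>+x. enn_powr (f x) p \<partial>M) (r / p) * enn_powr (\<integral>\<^sup>+x. enn_powr (g x) q \<partial>M) (r / q)"
      using Hoelder_nn_integral[OF ab, of "\<lambda>x. enn_powr (f x) p" M "\<lambda>x. enn_powr (g x) q"] by simp
    from enn_powr_mono[OF _ this, of "1 / r"] show ?thesis
      using r pq by (simp add: Lnorm_real enn_powr_mult enn_powr_powr)
  qed
qed

lemma Lnorm_sum:
  assumes "1 \<le> \<theta>" "finite I" and f: "\<And>i. i \<in> I \<Longrightarrow> f i \<in> borel_measurable M"
  shows "Lnorm \<theta> M (\<lambda>x. \<Sum>i\<in>I. f i x) \<le> (\<Sum>i\<in>I. Lnorm \<theta> M (f i))"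
  using Minkowski_Lnorm[OF assms(1) countable_finite[OF assms(2)] f] assms(2)
  by (simp add: nn_integral_count_space_finite)

lemma Lnorm_add:
  assumes \<theta>: "1 \<le> \<theta>" and fg: "f \<in> borel_measurable M" "g \<in> borel_measurable M"
  shows "Lnorm \<theta> M (\<lambda>x. f x + g x) \<le> Lnorm \<theta> M f + Lnorm \<theta> M g"
  using Lnorm_sum[OF \<theta>, of "UNIV :: bool set" "\<lambda>b. if b then f else g" M] fg by (simp add: UNIV_bool add.commute)

text \<open>
  The form in which the dyadic sums are estimated: Minkowski's inequality for terms with
  geometrically decreasing norms.
\<close>

lemma Lnorm_geometric_series:
  assumes \<theta>: "1 \<le> \<theta>" and F: "\<And>m. F m \<in> borel_measurable M" and K: "0 \<le> K" and g: "0 \<le> g" "g < 1"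
    and le: "\<And>m. Lnorm \<theta> M (F m) \<le> ennreal (K * g ^ m) * X"
  shows "Lnorm \<theta> M (\<lambda>t. \<integral>\<^sup>+m. F m t \<partial>count_space UNIV) \<le> ennreal (K / (1 - g)) * X"
proof -
  have "Lnorm \<theta> M (\<lambda>t. \<integral>\<^sup>+m. F m t \<partial>count_space UNIV) \<le> (\<integral>\<^sup>+m. Lnorm \<theta> M (F m) \<partial>count_space UNIV)"
    by (rule Minkowski_Lnorm[OF \<theta> _ F]) auto
  also have "\<dots> \<le> (\<integral>\<^sup>+m. ennreal (K * g ^ m) * X \<partial>count_space UNIV)" by (intro nn_integral_mono le)
  also have "\<dots> = (\<integral>\<^sup>+m. ennreal (K * g ^ m) \<partial>count_space UNIV) * X" by (rule nn_integral_multc) simp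
  also have "(\<integral>\<^sup>+m. ennreal (K * g ^ m) \<partial>count_space UNIV) = ennreal (K / (1 - g))"
  proof -
    have sums: "(\<lambda>m. K * g ^ m) sums (K / (1 - g))" using sums_mult[OF geometric_sums, of g K] g by simp
    then have "(\<Sum>m. ennreal (K * g ^ m)) = ennreal (\<Sum>m. K * g ^ m)"
      using K g by (intro suminf_ennreal2) (auto dest: sums_summable)
    then show ?thesis using sums_unique[OF sums] by (simp add: nn_integral_count_space_nat)
  qed
  finally show ?thesis .
qed

lemma Lnorm_weighted_product:
  assumes \<theta>: "1 \<le> \<theta>" "1 \<le> \<theta>\<^sub>1" "1 \<le> \<theta>\<^sub>2" "1 / \<theta> = 1 / \<theta>\<^sub>1 + 1 / \<theta>\<^sub>2"
    and f: "f \<in> borel_measurable M" "Lnorm \<theta>\<^sub>1 M f \<le> ennreal a * A" and g: "g \<in> borel_measurable M" "Lnorm \<theta>\<^sub>2 M g \<le> ennreal b * B"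
    and c: "0 \<le> a" "0 \<le> b" "0 \<le> c" "c * a * b \<le> K"
  shows "Lnorm \<theta> M (\<lambda>t. ennreal c * (f t * g t)) \<le> ennreal K * (A * B)"
proof -
  have "Lnorm \<theta> M (\<lambda>t. ennreal c * (f t * g t)) \<le> ennreal c * Lnorm \<theta> M (\<lambda>t. f t * g t)"
    using f g c by (intro Lnorm_cmult_le \<theta>) auto
  also have "\<dots> \<le> ennreal c * (Lnorm \<theta>\<^sub>1 M f * Lnorm \<theta>\<^sub>2 M g)"
    by (intro mult_left_mono Hoelder_Lnorm \<theta> f g) auto
  also have "\<dots> \<le> ennreal c * ((ennreal a * A) * (ennreal b * B))" by (intro mult_left_mono mult_mono f g) auto
  also have "\<dots> = ennreal (c * a * b) * (A * B)" using c by (simp add: ennreal_mult mult_ac)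
  also have "\<dots> \<le> ennreal K * (A * B)" using c(4) by (intro mult_right_mono ennreal_leI) auto
  finally show ?thesis .
qed

lemma ennreal_mult_assoc: "0 \<le> a \<Longrightarrow> 0 \<le> b \<Longrightarrow> ennreal a * (ennreal b * X) = ennreal (a * b) * X"
  by (simp add: ennreal_mult mult.assoc)

section \<open>Calculus of Schwartz functions\<close>

lemma has_derivative_partial:
  fixes f :: "real^'n::finite \<Rightarrow> 'b::real_normed_vector"
  assumes "f differentiable (at x)"
  shows "(f has_derivative (\<lambda>h. \<Sum>i\<in>UNIV. (h $ i) *\<^sub>R partial i f x)) (at x)"
proof -
  have D: "(f has_derivative frechet_derivative f (at x)) (at x)"
    using assms frechet_derivative_works by blast
  then have lin: "linear (frechet_derivative f (at x))"
    by (rule has_derivative_linear)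
  have "frechet_derivative f (at x) h = (\<Sum>i\<in>UNIV. (h $ i) *\<^sub>R partial i f x)" for h
  proof -
    have "frechet_derivative f (at x) h = frechet_derivative f (at x) (\<Sum>i\<in>UNIV. (h $ i) *\<^sub>R axis i 1)"
      by (simp add: basis_expansion flip: scalar_mult_eq_scaleR)
    then show ?thesis
      by (simp add: linear_sum[OF lin] linear_scale[OF lin] partial_def)
  qed
  then have "frechet_derivative f (at x) = (\<lambda>h. \<Sum>i\<in>UNIV. (h $ i) *\<^sub>R partial i f x)" by auto
  then show ?thesis using D by simp
qed

lemma partial_eqI:
  "(f has_derivative f') (at x) \<Longrightarrow> partial i f x = f' (axis i 1)"
  unfolding partial_def using frechet_derivative_at by metis

lemma partial_add:
  assumes "f differentiable (at x)" "g differentiable (at x)"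
  shows "partial i (\<lambda>x. f x + g x) x = partial i f x + partial i g x"
  using partial_eqI[OF has_derivative_add[OF has_derivative_partial[OF assms(1)] has_derivative_partial[OF assms(2)]], of i]
  by (simp add: axis_def if_distrib[of "\<lambda>a. a *\<^sub>R _"] sum.delta cong: if_cong)

lemma sum_axis_scaleR: "(\<Sum>j\<in>UNIV. (axis i (1::real) $ j) *\<^sub>R a j) = (a i :: 'b::real_vector)"
  for i :: "'n::finite"
  by (simp add: axis_def if_distrib[of "\<lambda>a. a *\<^sub>R _"] sum.delta cong: if_cong)

lemma partial_mult:
  fixes f g :: "real^'n::finite \<Rightarrow> complex"
  assumes "f differentiable (at x)" "g differentiable (at x)"
  shows "partial i (\<lambda>x. f x * g x) x = partial i f x * g x + f x * partial i g x"
  using partial_eqI[OF has_derivative_mult[OF has_derivative_partial[OF assms(1)] has_derivative_partial[OF assms(2)]], of i]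
  by (simp add: sum_axis_scaleR)

lemma partial_affine:
  fixes f :: "real^'n::finite \<Rightarrow> 'b::real_normed_vector"
  assumes "f differentiable (at (a + c *\<^sub>R x))"
  shows "((\<lambda>x. f (a + c *\<^sub>R x)) has_derivative (\<lambda>h. \<Sum>j\<in>UNIV. (c *\<^sub>R h) $ j *\<^sub>R partial j f (a + c *\<^sub>R x))) (at x)"
    and "partial i (\<lambda>x. f (a + c *\<^sub>R x)) x = c *\<^sub>R partial i f (a + c *\<^sub>R x)"
proof -
  have "((\<lambda>x. a + c *\<^sub>R x) has_derivative (\<lambda>h. c *\<^sub>R h)) (at x)"
    by (auto intro!: derivative_eq_intros)
  from has_derivative_compose[OF this has_derivative_partial[OF assms]]
  show D: "((\<lambda>x. f (a + c *\<^sub>R x)) has_derivative (\<lambda>h. \<Sum>j\<in>UNIV. (c *\<^sub>R h) $ j *\<^sub>R partial j f (a + c *\<^sub>R x))) (at x)" .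
  show "partial i (\<lambda>x. f (a + c *\<^sub>R x)) x = c *\<^sub>R partial i f (a + c *\<^sub>R x)"
    unfolding partial_eqI[OF D, of i] using sum_axis_scaleR[of i "\<lambda>j. c *\<^sub>R partial j f (a + c *\<^sub>R x)"]
    by (simp add: mult.commute[of c])
qed

lemma partials_Nil [simp]: "partials [] f = f"
  by (simp add: partials_def)

lemma partials_Cons: "partials (i # \<alpha>) f = partial i (partials \<alpha> f)"
  by (simp add: partials_def)

lemma partials_snoc: "partials (\<alpha> @ [i]) f = partials \<alpha> (partial i f)"
  by (simp add: partials_def)

lemma schwartz_differentiable: "f \<in> schwartz \<Longrightarrow> f differentiable (at x)"
  unfolding schwartz_def smooth_def by (metis (mono_tags, lifting) mem_Collect_eq partials_Nil)

lemma schwartz_partial: "f \<in> schwartz \<Longrightarrow> partial i f \<in> schwartz"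
  unfolding schwartz_def smooth_def by (auto simp flip: partials_snoc)

lemma schwartz_partials: "f \<in> schwartz \<Longrightarrow> partials \<alpha> f \<in> schwartz"
  by (induction \<alpha>) (auto simp: partials_Cons schwartz_partial)

lemma schwartz_decay: "f \<in> schwartz \<Longrightarrow> \<exists>B. \<forall>x. (1 + norm x) ^ N * norm (f x) \<le> B"
  unfolding schwartz_def mem_Collect_eq by (elim conjE allE[of _ N] allE[of _ "[]"]) simp

text \<open>
  The derivatives of a function only enter the definition of the Schwartz space through the orbit
  under \<^const>\<open>partial\<close>. Hence it is the largest set of differentiable, rapidly decreasing functions
  that is closed under partial derivatives, and membership can be shown by coinduction, without
  any formula for higher derivatives.
\<close>

lemma schwartz_coinduct:
  assumes "f \<in> X"
    and D: "\<And>f x. f \<in> X \<Longrightarrow> f differentiable (at x)"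
    and P: "\<And>f i. f \<in> X \<Longrightarrow> partial i f \<in> X"
    and N: "\<And>f N. f \<in> X \<Longrightarrow> \<exists>B. \<forall>x. (1 + norm x) ^ N * norm (f x) \<le> B"
  shows "f \<in> schwartz"
proof -
  have "partials \<alpha> f \<in> X" for \<alpha>
    by (induction \<alpha>) (auto simp: partials_Cons assms)
  then show ?thesis
    using D N by (auto simp: schwartz_def smooth_def)
qed

text \<open>The functions that act on the Schwartz space by multiplication.\<close>

definition moderate :: "(real^'n::finite \<Rightarrow> complex) set" where
  "moderate = {f. smooth f \<and> (\<forall>\<alpha>. \<exists>B N. \<forall>x. norm (partials \<alpha> f x) \<le> B * (1 + norm x) ^ N)}"

lemma moderate_differentiable: "f \<in> moderate \<Longrightarrow> f differentiable (at x)"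
  unfolding moderate_def smooth_def by (metis (mono_tags, lifting) mem_Collect_eq partials_Nil)

lemma moderate_partial: "f \<in> moderate \<Longrightarrow> partial i f \<in> moderate"
  unfolding moderate_def smooth_def by (auto simp flip: partials_snoc)

lemma moderate_growth:
  assumes "f \<in> moderate"
  shows "\<exists>B N. 0 \<le> B \<and> (\<forall>x. norm (f x) \<le> B * (1 + norm x) ^ N)"
proof -
  from assms have "\<forall>\<alpha>. \<exists>B N. \<forall>x. norm (partials \<alpha> f x) \<le> B * (1 + norm x) ^ N"
    by (simp add: moderate_def)
  then obtain B N where "\<forall>x. norm (partials [] f x) \<le> B * (1 + norm x) ^ N" by blast
  moreover from this have "norm (f 0) \<le> B" by (auto dest: spec[of _ 0])
  then have "0 \<le> B" using norm_ge_zero order_trans by blast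
  ultimately show ?thesis by auto
qed

lemma moderate_coinduct:
  assumes "f \<in> X"
    and D: "\<And>f x. f \<in> X \<Longrightarrow> f differentiable (at x)"
    and P: "\<And>f i. f \<in> X \<Longrightarrow> partial i f \<in> X"
    and N: "\<And>f. f \<in> X \<Longrightarrow> \<exists>B N. \<forall>x. norm (f x) \<le> B * (1 + norm x) ^ N"
  shows "f \<in> moderate"
proof -
  have "partials \<alpha> f \<in> X" for \<alpha>
    by (induction \<alpha>) (auto simp: partials_Cons assms)
  then show ?thesis
    using D N by (auto simp: moderate_def smooth_def)
qed

lemma schwartz_imp_moderate: "f \<in> schwartz \<Longrightarrow> f \<in> moderate"
proof (erule moderate_coinduct)
  fix f :: "real^'n \<Rightarrow> complex" assume "f \<in> schwartz"
  then obtain B where "\<And>x. (1 + norm x) ^ 0 * norm (f x) \<le> B" using schwartz_decay[of f 0] by blast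
  then show "\<exists>B N. \<forall>x. norm (f x) \<le> B * (1 + norm x) ^ N"
    by (intro exI[of _ B] exI[of _ 0]) auto
qed (auto intro: schwartz_differentiable schwartz_partial)

lemma schwartz_continuous [continuous_intros]: "f \<in> schwartz \<Longrightarrow> continuous_on A f"
  by (meson continuous_at_imp_continuous_on differentiable_imp_continuous_within schwartz_differentiable)

lemma moderate_continuous: "f \<in> moderate \<Longrightarrow> continuous_on A f"
  by (meson continuous_at_imp_continuous_on differentiable_imp_continuous_within moderate_differentiable)

lemma schwartz_measurable [measurable]: "f \<in> schwartz \<Longrightarrow> f \<in> borel_measurable borel"
  by (intro borel_measurable_continuous_onI schwartz_continuous)

lemma partial_const: "partial i (\<lambda>x. c) = (\<lambda>x. 0)"
  using partial_eqI[OF has_derivative_const] by auto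

lemma moderate_const [simp]: "(\<lambda>x. c) \<in> moderate"
proof (rule moderate_coinduct[where X = "range (\<lambda>c x. c)"])
  fix f :: "real^'n \<Rightarrow> complex" assume "f \<in> range (\<lambda>c x. c)"
  then obtain c where "f = (\<lambda>x. c)" by blast
  then show "\<exists>B N. \<forall>x. norm (f x) \<le> B * (1 + norm x) ^ N"
    by (intro exI[of _ "norm c"] exI[of _ 0]) auto
qed (auto simp: partial_const)

lemma schwartz_add [intro]:
  assumes "f \<in> schwartz" "g \<in> schwartz"
  shows "(\<lambda>x. f x + g x) \<in> schwartz"
proof (rule schwartz_coinduct[where X = "{\<lambda>x. f x + g x | f g. f \<in> schwartz \<and> g \<in> schwartz}"])
  fix h :: "real^'n \<Rightarrow> complex" and i and N
  assume "h \<in> {\<lambda>x. f x + g x | f g. f \<in> schwartz \<and> g \<in> schwartz}"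
  then obtain f g where h: "h = (\<lambda>x. f x + g x)" and fg: "f \<in> schwartz" "g \<in> schwartz" by blast
  have "partial i h = (\<lambda>x. partial i f x + partial i g x)"
    unfolding h using fg by (intro ext partial_add schwartz_differentiable)
  then show "partial i h \<in> {\<lambda>x. f x + g x | f g. f \<in> schwartz \<and> g \<in> schwartz}"
    using fg schwartz_partial by blast
  show "h differentiable (at x)" for x
    unfolding h using fg by (intro differentiable_add schwartz_differentiable)
  obtain B where B: "\<And>x. (1 + norm x) ^ N * norm (f x) \<le> B" using schwartz_decay[OF fg(1)] by blast
  obtain C where C: "\<And>x. (1 + norm x) ^ N * norm (g x) \<le> C" using schwartz_decay[OF fg(2)] by blast
  have "(1 + norm x) ^ N * norm (h x) \<le> B + C" for x
  proof -
    have "(1 + norm x) ^ N * norm (h x) \<le> (1 + norm x) ^ N * (norm (f x) + norm (g x))"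
      by (intro mult_left_mono) (auto simp: h norm_triangle_ineq)
    also have "\<dots> \<le> B + C" using B[of x] C[of x] by (simp add: distrib_left)
    finally show ?thesis .
  qed
  then show "\<exists>B. \<forall>x. (1 + norm x) ^ N * norm (h x) \<le> B" by blast
qed (use assms in blast)

text \<open>
  Finite sums of products of a moderate and a Schwartz function are stable under derivatives by the
  product rule, so coinduction applies to the smallest such set.
\<close>

inductive_set moderate_schwartz_span :: "(real^'n::finite \<Rightarrow> complex) set" where
  mult: "f \<in> moderate \<Longrightarrow> g \<in> schwartz \<Longrightarrow> (\<lambda>x. f x * g x) \<in> moderate_schwartz_span"
| add: "f \<in> moderate_schwartz_span \<Longrightarrow> g \<in> moderate_schwartz_span \<Longrightarrow> (\<lambda>x. f x + g x) \<in> moderate_schwartz_span"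

lemma moderate_schwartz_span_props:
  "h \<in> moderate_schwartz_span \<Longrightarrow> (\<forall>x. h differentiable (at x)) \<and> (\<forall>i. partial i h \<in> moderate_schwartz_span) \<and>
    (\<forall>N. \<exists>B. \<forall>x. (1 + norm x) ^ N * norm (h x) \<le> B)"
proof (induction rule: moderate_schwartz_span.induct)
  case (mult f g)
  have "partial i (\<lambda>x. f x * g x) = (\<lambda>x. partial i f x * g x + f x * partial i g x)" for i
    using mult by (intro ext partial_mult schwartz_differentiable moderate_differentiable)
  moreover have "\<exists>B. \<forall>x. (1 + norm x) ^ N * norm (f x * g x) \<le> B" for N
  proof -
    obtain A K where A: "0 \<le> A" "\<And>x. norm (f x) \<le> A * (1 + norm x) ^ K" using moderate_growth[OF mult(1)] by blast
    obtain B where B: "\<And>x. (1 + norm x) ^ (N + K) * norm (g x) \<le> B" using schwartz_decay[OF mult(2)] by blast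
    have "(1 + norm x) ^ N * norm (f x * g x) \<le> A * B" for x
    proof -
      have "(1 + norm x) ^ N * norm (f x * g x) \<le> (1 + norm x) ^ N * (A * (1 + norm x) ^ K * norm (g x))"
        unfolding norm_mult by (intro mult_left_mono mult_right_mono A(2)) auto
      also have "\<dots> = A * ((1 + norm x) ^ (N + K) * norm (g x))" by (simp add: power_add)
      also have "\<dots> \<le> A * B" by (intro mult_left_mono A B)
      finally show ?thesis .
    qed
    then show ?thesis by blast
  qed
  moreover have "(\<lambda>x. f x * g x) differentiable (at x)" for x
    using mult by (intro differentiable_mult schwartz_differentiable moderate_differentiable)
  moreover have "(\<lambda>x. partial i f x * g x + f x * partial i g x) \<in> moderate_schwartz_span" for i
    using mult by (intro moderate_schwartz_span.intros moderate_partial schwartz_partial)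
  ultimately show ?case by simp
next
  case (add f g)
  have "partial i (\<lambda>x. f x + g x) = (\<lambda>x. partial i f x + partial i g x)" for i
    using add by (intro ext partial_add) auto
  moreover have "\<exists>B. \<forall>x. (1 + norm x) ^ N * norm (f x + g x) \<le> B" for N
  proof -
    obtain B C where BC: "\<And>x. (1 + norm x) ^ N * norm (f x) \<le> B" "\<And>x. (1 + norm x) ^ N * norm (g x) \<le> C"
      using add.IH by meson
    have "(1 + norm x) ^ N * norm (f x + g x) \<le> B + C" for x
    proof -
      have "(1 + norm x) ^ N * norm (f x + g x) \<le> (1 + norm x) ^ N * (norm (f x) + norm (g x))"
        by (intro mult_left_mono) (auto simp: norm_triangle_ineq)
      also have "\<dots> \<le> B + C" using BC[of x] by (simp add: distrib_left)
      finally show ?thesis .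
    qed
    then show ?thesis by blast
  qed
  ultimately show ?case
    using add by (auto intro!: differentiable_add moderate_schwartz_span.intros)
qed

lemma schwartz_mult_moderate:
  assumes "f \<in> moderate" "g \<in> schwartz"
  shows "(\<lambda>x. f x * g x) \<in> schwartz"
  using moderate_schwartz_span.mult[OF assms]
  by (rule schwartz_coinduct) (use moderate_schwartz_span_props in blast)+

lemma schwartz_mult: "f \<in> schwartz \<Longrightarrow> g \<in> schwartz \<Longrightarrow> (\<lambda>x. f x * g x) \<in> schwartz"
  by (intro schwartz_mult_moderate schwartz_imp_moderate)

lemma schwartz_cmult [intro]: "f \<in> schwartz \<Longrightarrow> (\<lambda>x. c * f x) \<in> schwartz"
  by (intro schwartz_mult_moderate moderate_const)

lemma schwartz_diff [intro]: "f \<in> schwartz \<Longrightarrow> g \<in> schwartz \<Longrightarrow> (\<lambda>x. f x - g x) \<in> schwartz"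
  using schwartz_add[of f "\<lambda>x. -1 * g x"] schwartz_cmult[of g "-1"] by simp

lemma partial_coordinate:
  "partial i (\<lambda>x::real^'n::finite. of_real (x $ j) :: complex) = (\<lambda>x. if i = j then 1 else 0)"
proof
  fix x :: "real^'n"
  have "((\<lambda>x. of_real (x $ j) :: complex) has_derivative (\<lambda>h. of_real (h $ j))) (at x)"
    by (intro bounded_linear_imp_has_derivative bounded_linear_compose[OF bounded_linear_of_real] bounded_linear_vec_nth)
  from partial_eqI[OF this, of i] show "partial i (\<lambda>x. of_real (x $ j) :: complex) x = (if i = j then 1 else 0)"
    by (auto simp: axis_def)
qed

lemma moderate_coordinate: "(\<lambda>x::real^'n::finite. of_real (x $ j)) \<in> moderate"
proof (rule moderate_coinduct[where X = "insert (\<lambda>x. of_real (x $ j)) (range (\<lambda>c x. c))"])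
  fix f :: "real^'n \<Rightarrow> complex" and i x
  assume f: "f \<in> insert (\<lambda>x. of_real (x $ j)) (range (\<lambda>c x. c))"
  show "partial i f \<in> insert (\<lambda>x. of_real (x $ j)) (range (\<lambda>c x. c))"
    using f by (auto simp: partial_const partial_coordinate)
  show "f differentiable (at x)"
    using f bounded_linear_imp_differentiable[OF bounded_linear_compose[OF bounded_linear_of_real bounded_linear_vec_nth]]
    by auto
  show "\<exists>B N. \<forall>x. norm (f x) \<le> B * (1 + norm x) ^ N"
    using f
  proof
    assume "f = (\<lambda>x. of_real (x $ j))"
    then have "norm (f x) \<le> 1 * (1 + norm x) ^ 1" for x
      using component_le_norm_cart[of x j] by simp
    then show ?thesis by blast
  next
    assume "f \<in> range (\<lambda>c x. c)"
    then obtain c where "f = (\<lambda>x. c)" by blast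
    then show ?thesis by (intro exI[of _ "norm c"] exI[of _ 0]) auto
  qed
qed auto

lemma cis_has_derivative:
  "((\<lambda>x. cis (x \<bullet> \<xi>)) has_derivative (\<lambda>h. \<i> * of_real (h \<bullet> \<xi>) * cis (x \<bullet> \<xi>))) (at x)"
proof -
  have "((\<lambda>x. \<i> * of_real (x \<bullet> \<xi>)) has_derivative (\<lambda>h. \<i> * of_real (h \<bullet> \<xi>))) (at x)"
    by (intro has_derivative_mult_right has_derivative_of_real has_derivative_inner_left has_derivative_ident)
  moreover have "(exp has_derivative (*) (exp (\<i> * of_real (x \<bullet> \<xi>)))) (at (\<i> * of_real (x \<bullet> \<xi>)))"
    by (rule DERIV_exp[unfolded has_field_derivative_def])
  ultimately have "((\<lambda>x. exp (\<i> * of_real (x \<bullet> \<xi>))) has_derivative (\<lambda>h. exp (\<i> * of_real (x \<bullet> \<xi>)) * (\<i> * of_real (h \<bullet> \<xi>)))) (at x)"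
    by (rule has_derivative_compose)
  then show ?thesis by (simp add: cis_conv_exp mult.commute mult.left_commute)
qed

lemma moderate_cis: "(\<lambda>x::real^'n::finite. cis (x \<bullet> \<xi>)) \<in> moderate"
proof (rule moderate_coinduct[where X = "range (\<lambda>c x. c * cis (x \<bullet> \<xi>))"])
  show "(\<lambda>x. cis (x \<bullet> \<xi>)) \<in> range (\<lambda>c x. c * cis (x \<bullet> \<xi>))"
    by (intro range_eqI[where x = 1]) auto
  fix f :: "real^'n \<Rightarrow> complex" and i x
  assume "f \<in> range (\<lambda>c x. c * cis (x \<bullet> \<xi>))"
  then obtain c where f: "f = (\<lambda>x. c * cis (x \<bullet> \<xi>))" by blast
  have D: "(f has_derivative (\<lambda>h. c * (\<i> * of_real (h \<bullet> \<xi>) * cis (x \<bullet> \<xi>)))) (at x)" for x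
    unfolding f by (intro has_derivative_mult_right cis_has_derivative)
  then show "f differentiable (at x)" by (auto simp: differentiable_def)
  have "partial i f = (\<lambda>x. (c * \<i> * of_real (axis i 1 \<bullet> \<xi>)) * cis (x \<bullet> \<xi>))"
    using partial_eqI[OF D, of i] by (auto simp: mult.assoc)
  then show "partial i f \<in> range (\<lambda>c x. c * cis (x \<bullet> \<xi>))" by blast
  show "\<exists>B N. \<forall>x. norm (f x) \<le> B * (1 + norm x) ^ N"
    unfolding f by (intro exI[of _ "norm c"] exI[of _ 0]) (auto simp: norm_mult)
qed

lemma schwartz_affine:
  fixes f :: "real^'n::finite \<Rightarrow> complex"
  assumes "f \<in> schwartz" "c \<noteq> 0"
  shows "(\<lambda>x. f (a + c *\<^sub>R x)) \<in> schwartz"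
proof (rule schwartz_coinduct[where X = "{\<lambda>x. d * f (a + c *\<^sub>R x) | d f. f \<in> schwartz}"])
  show "(\<lambda>x. f (a + c *\<^sub>R x)) \<in> {\<lambda>x. d * f (a + c *\<^sub>R x) | d f. f \<in> schwartz}"
    using assms(1) by (auto intro!: exI[of _ 1] exI[of _ f])
  fix h :: "real^'n \<Rightarrow> complex" and i N x
  assume "h \<in> {\<lambda>x. d * f (a + c *\<^sub>R x) | d f. f \<in> schwartz}"
  then obtain d f where h: "h = (\<lambda>x. d * f (a + c *\<^sub>R x))" and f: "f \<in> schwartz" by blast
  note D = has_derivative_mult_right[OF partial_affine(1)[OF schwartz_differentiable[OF f]], of d a c]
  show "h differentiable (at x)" using D by (auto simp: h differentiable_def)
  have "partial i h = (\<lambda>x. (d * of_real c) * partial i f (a + c *\<^sub>R x))"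
  proof
    fix x
    have "partial i h x = d * (\<Sum>j\<in>UNIV. (axis i 1 $ j) *\<^sub>R (c *\<^sub>R partial j f (a + c *\<^sub>R x)))"
      unfolding h partial_eqI[OF D, of i] by (simp add: mult.commute[of c])
    then show "partial i h x = (d * of_real c) * partial i f (a + c *\<^sub>R x)"
      unfolding sum_axis_scaleR by (simp add: scaleR_conv_of_real mult.assoc)
  qed
  then show "partial i h \<in> {\<lambda>x. d * f (a + c *\<^sub>R x) | d f. f \<in> schwartz}"
    using schwartz_partial[OF f, of i] by blast
  obtain B where B: "\<And>x. (1 + norm x) ^ N * norm (f x) \<le> B" using schwartz_decay[OF f] by blast
  define K where "K = 1 + (1 + norm a) / \<bar>c\<bar>"
  have K: "1 + norm x \<le> K * (1 + norm (a + c *\<^sub>R x))" for x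
  proof -
    have "\<bar>c\<bar> * norm x = norm ((a + c *\<^sub>R x) - a)" by simp
    also have "\<dots> \<le> norm (a + c *\<^sub>R x) + norm a" by (rule norm_triangle_ineq4)
    finally have "norm x \<le> (norm (a + c *\<^sub>R x) + norm a) / \<bar>c\<bar>" using assms(2) by (simp add: field_simps)
    also have "\<dots> \<le> (1 + norm a) / \<bar>c\<bar> * (1 + norm (a + c *\<^sub>R x))"
    proof -
      have "norm (a + c *\<^sub>R x) + norm a \<le> (1 + norm a) * (1 + norm (a + c *\<^sub>R x))"
        by (simp add: algebra_simps)
      then show ?thesis using divide_right_mono[of _ _ "\<bar>c\<bar>"] by simp
    qed
    finally have "norm x \<le> (1 + norm a) / \<bar>c\<bar> * (1 + norm (a + c *\<^sub>R x))" .
    moreover have "1 \<le> 1 + norm (a + c *\<^sub>R x)" by simp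
    ultimately show ?thesis
      unfolding K_def distrib_right[of 1] mult_1_left by (intro add_mono)
  qed
  have "K \<ge> 0" by (simp add: K_def)
  have "(1 + norm x) ^ N * norm (h x) \<le> K ^ N * (norm d * B)" for x
  proof -
    have "(1 + norm x) ^ N * norm (h x) \<le> (K * (1 + norm (a + c *\<^sub>R x))) ^ N * norm (h x)"
      by (intro mult_right_mono power_mono K) auto
    also have "\<dots> = K ^ N * (norm d * ((1 + norm (a + c *\<^sub>R x)) ^ N * norm (f (a + c *\<^sub>R x))))"
      by (simp add: h norm_mult power_mult_distrib)
    also have "\<dots> \<le> K ^ N * (norm d * B)"
      using \<open>K \<ge> 0\<close> by (intro mult_left_mono B) auto
    finally show ?thesis .
  qed
  then show "\<exists>B. \<forall>x. (1 + norm x) ^ N * norm (h x) \<le> B" by blast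
qed

lemma schwartz_translate_reflect: "f \<in> schwartz \<Longrightarrow> (\<lambda>y. f (x - y)) \<in> schwartz"
  using schwartz_affine[of f "-1" x] by simp

lemma schwartz_translate: "f \<in> schwartz \<Longrightarrow> (\<lambda>y. f (y - x)) \<in> schwartz"
  using schwartz_affine[of f "1" "-x"] by simp

lemma partial_of_real:
  fixes f :: "real^'n::finite \<Rightarrow> real"
  assumes "f differentiable (at x)"
  shows "((\<lambda>x. of_real (f x) :: complex) has_derivative (\<lambda>h. of_real (\<Sum>j\<in>UNIV. h $ j *\<^sub>R partial j f x))) (at x)"
    and "partial i (\<lambda>x. of_real (f x) :: complex) x = of_real (partial i f x)"
proof -
  show D: "((\<lambda>x. of_real (f x) :: complex) has_derivative (\<lambda>h. of_real (\<Sum>j\<in>UNIV. h $ j *\<^sub>R partial j f x))) (at x)"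
    by (rule has_derivative_of_real[OF has_derivative_partial[OF assms]])
  show "partial i (\<lambda>x. of_real (f x) :: complex) x = of_real (partial i f x)"
    unfolding partial_eqI[OF D, of i] sum_axis_scaleR ..
qed

lemma schwartz_of_real_bump:
  fixes f :: "real^'n::finite \<Rightarrow> real"
  assumes "smooth f" and sub: "closure {x. f x \<noteq> 0} \<subseteq> {x. norm x \<le> R}"
  shows "(\<lambda>x. of_real (f x)) \<in> schwartz"
proof -
  have zero: "partials \<alpha> f x = 0" if "norm x > R" for \<alpha> x
    using that
  proof (induction \<alpha> arbitrary: x)
    case Nil
    then show ?case using sub closure_subset[of "{x. f x \<noteq> 0}"] by force
  next
    case (Cons i \<alpha>)
    have "open {x :: real^'n. norm x > R}"
      by (intro open_Collect_less continuous_intros)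
    then have "(partials \<alpha> f has_derivative (\<lambda>h. 0)) (at x)"
      using Cons by (intro has_derivative_transform_within_open[OF has_derivative_const[of 0]]) auto
    from partial_eqI[OF this] show ?case by (simp add: partials_Cons)
  qed
  have D: "partials \<alpha> f differentiable (at x)" for \<alpha> x
    using assms(1) by (simp add: smooth_def)
  show ?thesis
  proof (rule schwartz_coinduct[where X = "{\<lambda>x. of_real (partials \<alpha> f x) | \<alpha>. True}"])
    show "(\<lambda>x. of_real (f x)) \<in> {\<lambda>x. of_real (partials \<alpha> f x) | \<alpha>. True}"
      by (auto intro!: exI[of _ "[]"])
    fix h :: "real^'n \<Rightarrow> complex" and i N x
    assume "h \<in> {\<lambda>x. of_real (partials \<alpha> f x) | \<alpha>. True}"
    then obtain \<alpha> where h: "h = (\<lambda>x. of_real (partials \<alpha> f x))" by blast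
    show "h differentiable (at x)"
      using partial_of_real(1)[OF D] by (auto simp: h differentiable_def)
    have "partial i h = (\<lambda>x. of_real (partials (i # \<alpha>) f x))"
      using partial_of_real(2)[OF D] by (auto simp: h partials_Cons)
    then show "partial i h \<in> {\<lambda>x. of_real (partials \<alpha> f x) | \<alpha>. True}" by blast
    have "continuous_on (cball 0 R) (\<lambda>x. (1 + norm x) ^ N * norm (h x))"
      using D unfolding h
      by (intro continuous_intros continuous_at_imp_continuous_on ballI differentiable_imp_continuous_within)
    then have "bounded ((\<lambda>x. (1 + norm x) ^ N * norm (h x)) ` cball 0 R)"
      by (intro compact_imp_bounded compact_continuous_image) auto
    then obtain B where B: "\<And>x. x \<in> cball 0 R \<Longrightarrow> norm ((1 + norm x) ^ N * norm (h x)) \<le> B"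
      unfolding bounded_iff by blast
    have "(1 + norm x) ^ N * norm (h x) \<le> max B 0" for x
      using B[of x] zero[where x = x and \<alpha> = \<alpha>] by (cases "norm x \<le> R") (auto simp: h)
    then show "\<exists>B. \<forall>x. (1 + norm x) ^ N * norm (h x) \<le> B" by blast
  qed
qed

section \<open>Integration of rapidly decreasing functions\<close>

lemma lborel_integrable_affine:
  fixes f :: "'a::euclidean_space \<Rightarrow> 'b::{banach, second_countable_topology}"
  assumes f: "integrable lborel f" and c: "c \<noteq> 0"
  shows "integrable lborel (\<lambda>x. f (t + c *\<^sub>R x))"
  using f f[THEN borel_measurable_integrable] unfolding integrable_iff_bounded
  by (subst (asm) (1) lborel_affine[OF c, of t])
    (auto simp: nn_integral_density nn_integral_distr nn_integral_cmult c ennreal_mult_less_top)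

lemma nn_integral_lborel_affine:
  fixes t :: "'a::euclidean_space"
  assumes [measurable]: "f \<in> borel_measurable borel" and c: "c \<noteq> 0"
  shows "(\<integral>\<^sup>+x. f x \<partial>lborel) = ennreal (\<bar>c\<bar> ^ DIM('a)) * (\<integral>\<^sup>+x. f (t + c *\<^sub>R x) \<partial>lborel)"
  by (subst lborel_affine[OF c, of t]) (simp add: nn_integral_density nn_integral_distr nn_integral_cmult)

lemma lborel_integral_affine:
  fixes f :: "'a::euclidean_space \<Rightarrow> 'b::{banach, second_countable_topology}"
  assumes [measurable]: "f \<in> borel_measurable borel" and c: "c \<noteq> 0"
  shows "(\<integral>x. f x \<partial>lborel) = \<bar>c\<bar> ^ DIM('a) *\<^sub>R (\<integral>x. f (t + c *\<^sub>R x) \<partial>lborel)"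
  by (subst lborel_affine[OF c, of t]) (simp add: integral_density integral_distr)

text \<open>
  An integrable function that decreases slower than every Schwartz function. The exponent is
  twice the dimension, so that the weight is below the product of the integrable functions
  \<open>1 / (1 + x\<^sub>i\<^sup>2)\<close> of the single coordinates.
\<close>

definition weight :: "real^'n::finite \<Rightarrow> real" where
  "weight x = 1 / (1 + norm x) ^ (2 * CARD('n))"

lemma weight_pos: "0 < weight x"
  by (auto simp: weight_def intro!: divide_pos_pos zero_less_power add_pos_nonneg)

lemma weight_le_1: "weight x \<le> 1"
  by (simp add: weight_def divide_le_eq)

lemma weight_measurable [measurable]: "weight \<in> borel_measurable borel"
  unfolding weight_def by measurable

lemma weight_integrable: "integrable lborel (weight :: real^'n::finite \<Rightarrow> real)"
proof (rule integrableI_nonneg)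
  have "set_integrable lborel UNIV (\<lambda>x::real. inverse (1 + x^2))"
    using integrable_inverse_1_plus_square by (simp add: einterval_eq_UNIV)
  then have "integrable lborel (\<lambda>x::real. 1 / (1 + x^2))"
    by (simp add: set_integrable_def inverse_eq_divide)
  then have fin: "(\<integral>\<^sup>+x. ennreal (1 / (1 + x^2)) \<partial>(lborel :: real measure)) < top"
    by (simp add: nn_integral_eq_integral)
  have le: "ennreal (weight x) \<le> (\<Prod>b\<in>Basis. ennreal (1 / (1 + (x \<bullet> b)^2)))" for x :: "real^'n"
  proof -
    have 1: "1 + (x \<bullet> b)^2 \<le> (1 + norm x)^2" if "b \<in> Basis" for b :: "real^'n"
      using Basis_le_norm[OF that, of x] abs_le_square_iff[of "x \<bullet> b" "norm x"]
      by (simp add: power2_sum)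
    have "(\<Prod>b\<in>(Basis :: (real^'n) set). 1 + (x \<bullet> b)^2) \<le> (\<Prod>b\<in>(Basis :: (real^'n) set). (1 + norm x)^2)"
      using 1 by (intro prod_mono) (auto simp: add_nonneg_nonneg)
    also have "\<dots> = (1 + norm x) ^ (2 * CARD('n))"
      by (simp add: power_mult)
    finally have "weight x \<le> 1 / (\<Prod>b\<in>(Basis :: (real^'n) set). 1 + (x \<bullet> b)^2)"
      unfolding weight_def by (intro divide_left_mono mult_pos_pos prod_pos) (auto intro!: add_pos_nonneg zero_less_power)
    also have "\<dots> = (\<Prod>b\<in>(Basis :: (real^'n) set). 1 / (1 + (x \<bullet> b)^2))"
      by (simp add: prod_dividef)
    finally show ?thesis by (simp add: prod_ennreal ennreal_leI)
  qed
  have "(\<integral>\<^sup>+x. ennreal (weight x) \<partial>(lborel :: (real^'n) measure))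
      \<le> (\<integral>\<^sup>+x. (\<Prod>b\<in>Basis. ennreal (1 / (1 + (x \<bullet> b)^2))) \<partial>(lborel :: (real^'n) measure))"
    by (intro nn_integral_mono le)
  also have "\<dots> = (\<Prod>b\<in>(Basis :: (real^'n) set). (\<integral>\<^sup>+x. ennreal (1 / (1 + x^2)) \<partial>lborel))"
    by (rule nn_integral_lborel_prod) auto
  also have "\<dots> < top"
    using fin by (simp add: ennreal_prod_eq_top power_less_top_ennreal)
  finally show "(\<integral>\<^sup>+x. ennreal (weight x) \<partial>(lborel :: (real^'n) measure)) < \<infinity>" by simp
qed (auto simp: weight_pos less_imp_le)

lemma integral_weight_pos: "0 < (\<integral>x. weight x \<partial>(lborel :: (real^'n::finite) measure))"
proof -
  have "0 \<le> (\<integral>x. weight x \<partial>(lborel :: (real^'n) measure))"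
    by (intro integral_nonneg_AE) (auto simp: weight_pos less_imp_le)
  moreover have "(\<integral>x. weight x \<partial>(lborel :: (real^'n) measure)) \<noteq> 0"
  proof
    assume "(\<integral>x. weight x \<partial>(lborel :: (real^'n) measure)) = 0"
    then have "AE x in (lborel :: (real^'n) measure). weight x = 0"
      using integral_nonneg_eq_0_iff_AE[OF weight_integrable] by (auto simp: weight_pos less_imp_le)
    then have "AE x in (lborel :: (real^'n) measure). False"
      by eventually_elim (use weight_pos in \<open>metis less_irrefl\<close>)
    then show False
      by (simp add: AE_iff_null null_sets_def)
  qed
  ultimately show ?thesis by simp
qed

lemma schwartz_le_weight:
  fixes f :: "real^'n::finite \<Rightarrow> complex"
  assumes "f \<in> schwartz"
  shows "\<exists>B\<ge>0. \<forall>x. (1 + norm x) ^ N * norm (f x) \<le> B * weight x"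
proof -
  obtain B where B: "\<And>x. (1 + norm x) ^ (N + 2 * CARD('n)) * norm (f x) \<le> B"
    using schwartz_decay[OF assms] by blast
  have "norm (f 0) \<le> B" using B[of 0] by simp
  then have "0 \<le> B" using norm_ge_zero order_trans by blast
  moreover have "(1 + norm x) ^ N * norm (f x) \<le> B * weight x" for x
  proof -
    have "0 < (1 + norm x) ^ (2 * CARD('n))" by (intro zero_less_power add_pos_nonneg) auto
    then show ?thesis using B[of x] by (simp add: weight_def field_simps power_add)
  qed
  ultimately show ?thesis by blast
qed

lemma schwartz_norm_integrable:
  fixes f :: "real^'n::finite \<Rightarrow> complex"
  assumes "f \<in> schwartz"
  shows "integrable lborel (\<lambda>x. (1 + norm x) ^ N * norm (f x))"
proof -
  obtain B where B: "0 \<le> B" "\<And>x. (1 + norm x) ^ N * norm (f x) \<le> B * weight x"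
    using schwartz_le_weight[OF assms] by blast
  show ?thesis
  proof (rule Bochner_Integration.integrable_bound[of _ "\<lambda>x. B * weight x"])
    show "(\<lambda>x. (1 + norm x) ^ N * norm (f x)) \<in> borel_measurable lborel"
      using assms by measurable
  qed (use B weight_integrable weight_pos in \<open>auto simp: abs_mult abs_of_pos[OF weight_pos] intro!: AE_I2\<close>)
qed

lemma schwartz_integrable:
  fixes f :: "real^'n::finite \<Rightarrow> complex"
  assumes "f \<in> schwartz"
  shows "integrable lborel f"
  using schwartz_norm_integrable[OF assms, of 0] assms by (auto simp: integrable_norm_iff)

section \<open>The Fourier transform on the Schwartz space\<close>

lemma one_plus_norm_le: "1 + norm x \<le> (1 + norm (x + y)) * (1 + norm y)"
  for x y :: "'a::real_normed_vector"
proof -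
  have "norm x \<le> norm (x + y) + norm y" using norm_triangle_ineq4[of "x + y" y] by simp
  then have "norm x + 0 \<le> (norm (x + y) + norm y) + norm (x + y) * norm y" by (rule add_mono) simp
  then show ?thesis by (simp add: algebra_simps)
qed

lemma norm_integral_le:
  fixes f :: "'a \<Rightarrow> 'b::{banach, second_countable_topology}"
  assumes "integrable M g" "\<And>x. norm (f x) \<le> g x"
  shows "norm (\<integral>x. f x \<partial>M) \<le> (\<integral>x. g x \<partial>M)"
  using assms by (intro order_trans[OF integral_norm_bound] integral_mono') (auto intro: order_trans[OF norm_ge_zero])

text \<open>
  The mean value theorem on the segment from \<open>x\<close> to \<open>x + y\<close>, on which
  the weight changes at most by the factor \<open>(1 + norm y)\<^sup>N\<close>.
\<close>

lemma schwartz_increment: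
  fixes f :: "real^'n::finite \<Rightarrow> complex"
  assumes f: "f \<in> schwartz" and B: "\<And>j z. (1 + norm z) ^ N * norm (partial j f z) \<le> B"
  shows "(1 + norm x) ^ N * norm (f (x + y) - f x) \<le> real CARD('n) * B * norm y * (1 + norm y) ^ N"
proof -
  let ?c = "real CARD('n) * (B * (1 + norm y) ^ N / (1 + norm x) ^ N)"
  have px: "0 < (1 + norm x) ^ N" for x :: "real^'n" by (intro zero_less_power add_pos_nonneg) auto
  have "norm (f (x + y) - f x) \<le> ?c * norm ((x + y) - x)"
  proof (rule differentiable_bound)
    show "convex (closed_segment x (x + y))" by simp
    show "(f has_derivative (\<lambda>h. \<Sum>i\<in>UNIV. (h $ i) *\<^sub>R partial i f z)) (at z within closed_segment x (x + y))" for z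
      using has_derivative_partial[OF schwartz_differentiable[OF f]] by (rule has_derivative_at_withinI)
    show "x + y \<in> closed_segment x (x + y)" "x \<in> closed_segment x (x + y)" by auto
    fix z assume "z \<in> closed_segment x (x + y)"
    then obtain s where s: "0 \<le> s" "s \<le> 1" "z = x + s *\<^sub>R y"
      by (auto simp: closed_segment_def algebra_simps)
    have "1 + norm x \<le> (1 + norm z) * (1 + norm (s *\<^sub>R y))"
      unfolding s(3) by (rule one_plus_norm_le)
    also have "\<dots> \<le> (1 + norm z) * (1 + norm y)"
      using s by (intro mult_left_mono) (auto intro: mult_left_le_one_le)
    finally have xz: "(1 + norm x) ^ N \<le> (1 + norm z) ^ N * (1 + norm y) ^ N"
      by (metis add_nonneg_nonneg norm_ge_zero power_mono power_mult_distrib zero_le_one)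
    have P: "norm (partial j f z) \<le> B * (1 + norm y) ^ N / (1 + norm x) ^ N" for j
    proof -
      have "(1 + norm x) ^ N * norm (partial j f z) \<le> (1 + norm z) ^ N * (1 + norm y) ^ N * norm (partial j f z)"
        by (intro mult_right_mono xz) auto
      also have "\<dots> = (1 + norm y) ^ N * ((1 + norm z) ^ N * norm (partial j f z))" by simp
      also have "\<dots> \<le> (1 + norm y) ^ N * B" by (intro mult_left_mono B) auto
      finally show ?thesis using px[of x] by (simp add: field_simps)
    qed
    show "onorm (\<lambda>h. \<Sum>i\<in>UNIV. (h $ i) *\<^sub>R partial i f z) \<le> ?c"
    proof (rule onorm_le)
      fix h :: "real^'n"
      have "norm (\<Sum>i\<in>UNIV. (h $ i) *\<^sub>R partial i f z) \<le> (\<Sum>i\<in>(UNIV::'n set). norm h * (B * (1 + norm y) ^ N / (1 + norm x) ^ N))"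
        by (intro order_trans[OF norm_sum] sum_mono, unfold norm_scaleR real_norm_def)
          (intro mult_mono P component_le_norm_cart norm_ge_zero)
      then show "norm (\<Sum>i\<in>UNIV. (h $ i) *\<^sub>R partial i f z) \<le> ?c * norm h" by (simp add: mult_ac)
    qed
  qed
  then show ?thesis using px[of x] by (simp add: field_simps)
qed

lemma schwartz_partial_bound:
  fixes f :: "real^'n::finite \<Rightarrow> complex"
  assumes "f \<in> schwartz"
  shows "\<exists>B\<ge>0. \<forall>j z. (1 + norm z) ^ N * norm (partial j f z) \<le> B"
proof -
  have "\<forall>j. \<exists>B. \<forall>z. (1 + norm z) ^ N * norm (partial j f z) \<le> B"
    using schwartz_decay[OF schwartz_partial[OF assms]] by blast
  then obtain B where B: "\<And>j z. (1 + norm z) ^ N * norm (partial j f z) \<le> B j" by metis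
  have "(1 + norm z) ^ N * norm (partial j f z) \<le> Max (range B)" for j z
    using B[of z j] by (intro order_trans[OF B]) auto
  moreover from this have "(0::real) \<le> Max (range B)"
    by (rule order_trans[rotated]) auto
  ultimately show ?thesis by blast
qed

text \<open>
  The integral of a difference quotient vanishes by translation invariance, and the difference
  quotients are dominated.
\<close>

lemma integral_partial_schwartz:
  fixes f :: "real^'n::finite \<Rightarrow> complex"
  assumes f: "f \<in> schwartz"
  shows "(\<integral>x. partial j f x \<partial>lborel) = 0"
proof -
  define h where "h k = inverse (real (Suc k))" for k
  have h: "0 < h k" "h k \<le> 1" for k by (auto simp: h_def inverse_le_1_iff)
  define D where "D k x = (f (x + h k *\<^sub>R axis j 1) - f x) /\<^sub>R h k" for k x
  obtain B where B: "0 \<le> B" "\<And>j z. (1 + norm z) ^ (2 * CARD('n)) * norm (partial j f z) \<le> B"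
    using schwartz_partial_bound[OF f] by blast
  have ft: "(\<lambda>x. f (x + a)) \<in> schwartz" for a using schwartz_translate[OF f, of "-a"] by simp
  have "(\<lambda>k. \<integral>x. D k x \<partial>lborel) \<longlonglongrightarrow> (\<integral>x. partial j f x \<partial>lborel)"
  proof (rule integral_dominated_convergence[where w = "\<lambda>x. (real CARD('n) * B * 2 ^ (2 * CARD('n))) * weight x"])
    show "(\<lambda>x. partial j f x) \<in> borel_measurable lborel"
      using schwartz_partial[OF f] by measurable
    show "D k \<in> borel_measurable lborel" for k
      unfolding D_def using f ft by measurable
    show "AE x in lborel. (\<lambda>k. D k x) \<longlonglongrightarrow> partial j f x"
    proof (rule AE_I2)
      fix x
      have "((\<lambda>t. f (x + t *\<^sub>R axis j 1)) has_vector_derivative partial j f x) (at 0)"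
      proof -
        have "((\<lambda>t. x + t *\<^sub>R axis j 1) has_derivative (\<lambda>t. t *\<^sub>R axis j 1)) (at (0::real))"
          by (auto intro!: derivative_eq_intros)
        moreover have "(f has_derivative (\<lambda>h. \<Sum>i\<in>UNIV. (h $ i) *\<^sub>R partial i f x)) (at (x + 0 *\<^sub>R axis j 1))"
          using has_derivative_partial[OF schwartz_differentiable[OF f]] by simp
        ultimately have "((\<lambda>t. f (x + t *\<^sub>R axis j 1)) has_derivative (\<lambda>t. \<Sum>i\<in>UNIV. ((t *\<^sub>R axis j 1) $ i) *\<^sub>R partial i f x)) (at 0)"
          by (rule has_derivative_compose)
        moreover have "(\<Sum>i\<in>UNIV. ((t *\<^sub>R axis j 1) $ i) *\<^sub>R partial i f x) = t *\<^sub>R partial j f x" for t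
          using sum_axis_scaleR[of j "\<lambda>i. t *\<^sub>R partial i f x"] by (simp add: mult_ac)
        ultimately show ?thesis by (simp add: has_vector_derivative_def)
      qed
      then have "((\<lambda>t. norm (f (x + t *\<^sub>R axis j 1) - f x - t *\<^sub>R partial j f x) / norm t) \<longlongrightarrow> 0) (at 0)"
        unfolding has_vector_derivative_def has_derivative_at by simp
      moreover have "norm (f (x + t *\<^sub>R axis j 1) - f x - t *\<^sub>R partial j f x) / norm t
          = norm ((f (x + t *\<^sub>R axis j 1) - f x) /\<^sub>R t - partial j f x)" if "t \<noteq> 0" for t
      proof -
        have "(f (x + t *\<^sub>R axis j 1) - f x) /\<^sub>R t - partial j f x
            = (f (x + t *\<^sub>R axis j 1) - f x - t *\<^sub>R partial j f x) /\<^sub>R t"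
          using that by (simp add: scaleR_diff_right)
        then show ?thesis by (simp add: divide_inverse mult.commute)
      qed
      ultimately have "((\<lambda>t. norm ((f (x + t *\<^sub>R axis j 1) - f x) /\<^sub>R t - partial j f x)) \<longlongrightarrow> 0) (at 0)"
        by (rule Lim_transform_eventually[OF _ eventually_at_ball'[OF zero_less_one, THEN eventually_mono]]) auto
      then have "((\<lambda>t. (f (x + t *\<^sub>R axis j 1) - f x) /\<^sub>R t) \<longlongrightarrow> partial j f x) (at 0)"
        by (simp add: tendsto_norm_zero_iff LIM_zero_iff)
      moreover have "filterlim h (at 0) sequentially"
        unfolding h_def filterlim_at using LIMSEQ_inverse_real_of_nat by auto
      ultimately show "(\<lambda>k. D k x) \<longlonglongrightarrow> partial j f x"
        unfolding D_def by (rule filterlim_compose)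
    qed
    show "AE x in lborel. norm (D k x) \<le> (real CARD('n) * B * 2 ^ (2 * CARD('n))) * weight x" for k
    proof (rule AE_I2)
      fix x :: "real^'n"
      let ?y = "h k *\<^sub>R axis j 1 :: real^'n"
      have y: "norm ?y = h k" using h[of k] by simp
      have "(1 + norm x) ^ (2 * CARD('n)) * norm (f (x + ?y) - f x)
          \<le> real CARD('n) * B * norm ?y * (1 + norm ?y) ^ (2 * CARD('n))"
        by (rule schwartz_increment[OF f B(2)])
      also have "\<dots> \<le> real CARD('n) * B * h k * 2 ^ (2 * CARD('n))"
        unfolding y using h[of k] B(1) by (intro mult_left_mono power_mono) auto
      finally have "(1 + norm x) ^ (2 * CARD('n)) * norm (f (x + ?y) - f x) / h k \<le> real CARD('n) * B * 2 ^ (2 * CARD('n))"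
        using h[of k] by (simp add: pos_divide_le_eq mult_ac)
      then have "(1 + norm x) ^ (2 * CARD('n)) * norm (D k x) \<le> real CARD('n) * B * 2 ^ (2 * CARD('n))"
        using h[of k] by (simp add: D_def divide_inverse mult_ac)
      moreover have "0 < (1 + norm x) ^ (2 * CARD('n))" by (intro zero_less_power add_pos_nonneg) auto
      ultimately show "norm (D k x) \<le> (real CARD('n) * B * 2 ^ (2 * CARD('n))) * weight x"
        by (simp add: weight_def field_simps)
    qed
    show "integrable lborel (\<lambda>x::real^'n. (real CARD('n) * B * 2 ^ (2 * CARD('n))) * weight x)"
      by (intro integrable_mult_right weight_integrable)
  qed
  moreover have "(\<integral>x. D k x \<partial>lborel) = 0" for k
  proof -
    have "(\<integral>x. f (x + h k *\<^sub>R axis j 1) \<partial>lborel) = (\<integral>x. f x \<partial>lborel)"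
      using lborel_integral_affine[of f 1 "h k *\<^sub>R axis j 1"] f by (simp add: add.commute)
    then show ?thesis
      unfolding D_def using schwartz_integrable[OF f] schwartz_integrable[OF ft] by simp
  qed
  ultimately show ?thesis by (simp add: LIMSEQ_const_iff)
qed

lemma schwartz_cis_mult: "f \<in> schwartz \<Longrightarrow> (\<lambda>x. cis (x \<bullet> \<xi>) * f x) \<in> schwartz"
  by (intro schwartz_mult_moderate moderate_cis)

lemma schwartz_cis_mult_minus: "f \<in> schwartz \<Longrightarrow> (\<lambda>x. cis (- (x \<bullet> \<xi>)) * f x) \<in> schwartz"
  using schwartz_cis_mult[of f "- \<xi>"] by simp

lemma schwartz_coordinate_mult: "f \<in> schwartz \<Longrightarrow> (\<lambda>x. c * of_real (x $ j) * f x) \<in> schwartz"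
  using schwartz_cmult[OF schwartz_mult_moderate[OF moderate_coordinate[of j]], of f c] by (simp add: mult.assoc)

lemma norm_fourier_le:
  assumes "f \<in> schwartz"
  shows "norm (fourier f \<xi>) \<le> (\<integral>x. norm (f x) \<partial>lborel)"
  unfolding fourier_def
  using integral_norm_bound[of lborel "\<lambda>x. cis (- (x \<bullet> \<xi>)) * f x"] by (simp add: norm_mult)

lemma inv_fourier_eq: "inv_fourier g x = fourier g (- x) / of_real ((2 * pi) ^ CARD('n))"
  for g :: "real^'n::finite \<Rightarrow> complex"
  by (simp add: inv_fourier_def fourier_def inner_commute)

lemma fourier_has_derivative:
  fixes f :: "real^'n::finite \<Rightarrow> complex"
  assumes f: "f \<in> schwartz"
  shows "(fourier f has_derivative (\<lambda>h. \<Sum>j\<in>UNIV. (h $ j) *\<^sub>R fourier (\<lambda>x. - \<i> * of_real (x $ j) * f x) \<xi>)) (at \<xi>)"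
proof (rule has_derivativeI_sandwich[of 1])
  define c where "c = (\<integral>x. (1 + norm x) ^ 2 * norm (f x) \<partial>lborel)"
  show "((\<lambda>\<eta>. c * norm (\<eta> - \<xi>)) \<longlongrightarrow> 0) (at \<xi>)"
    by (auto intro!: tendsto_eq_intros)
  show "bounded_linear (\<lambda>h. \<Sum>j\<in>UNIV. (h $ j) *\<^sub>R fourier (\<lambda>x. - \<i> * of_real (x $ j) * f x) \<xi>)"
    by (intro bounded_linear_sum bounded_linear_scaleR_const bounded_linear_vec_nth)
  fix \<eta> assume "\<eta> \<noteq> \<xi>"
  let ?h = "\<eta> - \<xi>"
  let ?r = "\<lambda>x. cis (- (x \<bullet> \<eta>)) * f x - cis (- (x \<bullet> \<xi>)) * f x
      - (\<Sum>j\<in>UNIV. (?h $ j) *\<^sub>R (cis (- (x \<bullet> \<xi>)) * (- \<i> * of_real (x $ j) * f x)))"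
  have r: "?r x = cis (- (x \<bullet> \<xi>)) * (cis (- (x \<bullet> ?h)) - 1 + \<i> * of_real (x \<bullet> ?h)) * f x" for x
  proof -
    have "(\<Sum>j\<in>UNIV. (?h $ j) *\<^sub>R (cis (- (x \<bullet> \<xi>)) * (- \<i> * of_real (x $ j) * f x)))
       = - (cis (- (x \<bullet> \<xi>)) * \<i> * f x * of_real (\<Sum>j\<in>UNIV. x $ j * ?h $ j))"
      by (simp add: sum_distrib_left sum_negf[symmetric] scaleR_conv_of_real mult_ac)
    also have "(\<Sum>j\<in>UNIV. x $ j * ?h $ j) = x \<bullet> ?h" by (simp add: inner_vec_def)
    finally have *: "(\<Sum>j\<in>UNIV. (?h $ j) *\<^sub>R (cis (- (x \<bullet> \<xi>)) * (- \<i> * of_real (x $ j) * f x)))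
       = - (cis (- (x \<bullet> \<xi>)) * \<i> * f x * of_real (x \<bullet> ?h))" .
    have "cis (- (x \<bullet> \<eta>)) = cis (- (x \<bullet> \<xi>)) * cis (- (x \<bullet> ?h))"
      by (simp add: cis_mult inner_diff_right)
    then show ?thesis unfolding * by (simp add: algebra_simps)
  qed
  have bound: "norm (?r x) \<le> (norm ?h)^2 * ((1 + norm x) ^ 2 * norm (f x))" for x
  proof -
    have "norm (cis (- (x \<bullet> ?h)) - 1 + \<i> * of_real (x \<bullet> ?h)) \<le> \<bar>x \<bullet> ?h\<bar> ^ 2 / 2"
      using iexp_approx1[of "- (x \<bullet> ?h)" 1] by (simp add: cis_conv_exp algebra_simps numeral_2_eq_2)
    also have "\<dots> \<le> (norm x * norm ?h) ^ 2 / 1"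
      using Cauchy_Schwarz_ineq2[of x ?h] by (intro frac_le power_mono) auto
    also have "\<dots> \<le> (norm ?h)^2 * (1 + norm x)^2"
      by (simp add: power_mult_distrib mult.commute[of "(norm ?h)\<^sup>2"] mult_right_mono power_mono)
    finally show ?thesis unfolding r norm_mult by (simp add: mult_right_mono mult.assoc[symmetric])
  qed
  have i1: "integrable lborel (\<lambda>x. cis (- (x \<bullet> \<eta>)) * f x)" for \<eta>
    by (intro schwartz_integrable schwartz_cis_mult_minus f)
  have i2: "integrable lborel (\<lambda>x. cis (- (x \<bullet> \<xi>)) * (- \<i> * of_real (x $ j) * f x))" for j
    by (intro schwartz_integrable schwartz_cis_mult_minus schwartz_coordinate_mult f)
  have "fourier f \<eta> - fourier f \<xi> - (\<Sum>j\<in>UNIV. (?h $ j) *\<^sub>R fourier (\<lambda>x. - \<i> * of_real (x $ j) * f x) \<xi>) = (\<integral>x. ?r x \<partial>lborel)"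
    unfolding fourier_def using i1 i2 by (simp add: Bochner_Integration.integral_diff Bochner_Integration.integral_sum del: vector_minus_component)
  also have "norm \<dots> \<le> (\<integral>x. (norm ?h)^2 * ((1 + norm x) ^ 2 * norm (f x)) \<partial>lborel)"
    by (intro norm_integral_le integrable_mult_right schwartz_norm_integrable f bound)
  also have "\<dots> = c * (norm ?h)^2" by (simp add: c_def)
  finally show "norm (fourier f \<eta> - fourier f \<xi> - (\<Sum>j\<in>UNIV. ((\<eta> - \<xi>) $ j) *\<^sub>R fourier (\<lambda>x. - \<i> * of_real (x $ j) * f x) \<xi>)) / norm (\<eta> - \<xi>)
      \<le> c * norm (\<eta> - \<xi>)"
    using \<open>\<eta> \<noteq> \<xi>\<close> by (simp add: field_simps power2_eq_square)
qed simp

lemma partial_fourier: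
  "f \<in> schwartz \<Longrightarrow> partial j (fourier f) = fourier (\<lambda>x. - \<i> * of_real (x $ j) * f x)"
  using partial_eqI[OF fourier_has_derivative, of f j] by (auto simp: sum_axis_scaleR)

lemma fourier_partial:
  fixes f :: "real^'n::finite \<Rightarrow> complex"
  assumes f: "f \<in> schwartz"
  shows "fourier (partial j f) \<xi> = \<i> * of_real (\<xi> $ j) * fourier f \<xi>"
proof -
  have D: "((\<lambda>x. cis (- (x \<bullet> \<xi>))) has_derivative (\<lambda>h. - \<i> * of_real (h \<bullet> \<xi>) * cis (- (x \<bullet> \<xi>)))) (at x)" for x
    using cis_has_derivative[of "- \<xi>" x] by simp
  then have d: "(\<lambda>x. cis (- (x \<bullet> \<xi>))) differentiable (at x)" for x by (auto simp: differentiable_def)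
  have "partial j (\<lambda>x. cis (- (x \<bullet> \<xi>)) * f x)
      = (\<lambda>x. (- \<i> * of_real (\<xi> $ j)) * (cis (- (x \<bullet> \<xi>)) * f x) + cis (- (x \<bullet> \<xi>)) * partial j f x)"
    using partial_mult[OF d schwartz_differentiable[OF f]] partial_eqI[OF D, of j]
    by (auto simp: fun_eq_iff inner_axis' mult_ac)
  from integral_partial_schwartz[OF schwartz_cis_mult_minus[OF f], of j \<xi>, unfolded this]
  have "(- \<i> * of_real (\<xi> $ j)) * fourier f \<xi> + fourier (partial j f) \<xi> = 0"
    unfolding fourier_def
    using schwartz_integrable[OF schwartz_cis_mult_minus[OF f]] schwartz_integrable[OF schwartz_cis_mult_minus[OF schwartz_partial[OF f]]]
    by (subst (asm) Bochner_Integration.integral_add) auto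
  then show ?thesis by (simp add: add_eq_0_iff2)
qed

text \<open>
  A derivative of a Fourier transform is the Fourier transform of another Schwartz function, so
  by coinduction only the decay matters. Multiplication by \<open>\<xi>\<^sub>j\<close> is a
  derivative of \<open>f\<close>, which gives the decay by induction on the power.
\<close>

lemma fourier_schwartz:
  fixes f :: "real^'n::finite \<Rightarrow> complex"
  assumes "f \<in> schwartz"
  shows "fourier f \<in> schwartz"
proof (rule schwartz_coinduct[where X = "fourier ` schwartz"])
  show "fourier f \<in> fourier ` schwartz" using assms by blast
  have decay: "\<exists>B. \<forall>\<xi>. (1 + (\<Sum>j\<in>UNIV. \<bar>\<xi> $ j\<bar>)) ^ N * norm (fourier g \<xi>) \<le> B"
    if "g \<in> schwartz" for N and g :: "real^'n \<Rightarrow> complex"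
    using that
  proof (induction N arbitrary: g)
    case 0
    then show ?case using norm_fourier_le by auto
  next
    case (Suc N)
    from Suc.IH[OF Suc.prems] obtain B where
      B: "\<And>\<xi>. (1 + (\<Sum>j\<in>UNIV. \<bar>\<xi> $ j\<bar>)) ^ N * norm (fourier g \<xi>) \<le> B" by blast
    have "\<forall>j. \<exists>B. \<forall>\<xi>. (1 + (\<Sum>j\<in>UNIV. \<bar>\<xi> $ j\<bar>)) ^ N * norm (fourier (partial j g) \<xi>) \<le> B"
      using Suc.IH[OF schwartz_partial[OF Suc.prems]] by blast
    then obtain C where
      C: "\<And>j \<xi>. (1 + (\<Sum>j\<in>UNIV. \<bar>\<xi> $ j\<bar>)) ^ N * norm (fourier (partial j g) \<xi>) \<le> C j" by metis
    have "(1 + (\<Sum>j\<in>UNIV. \<bar>\<xi> $ j\<bar>)) ^ Suc N * norm (fourier g \<xi>) \<le> B + (\<Sum>j\<in>UNIV. C j)" for \<xi>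
    proof -
      have "(1 + (\<Sum>j\<in>UNIV. \<bar>\<xi> $ j\<bar>)) ^ Suc N * norm (fourier g \<xi>)
        = (1 + (\<Sum>j\<in>UNIV. \<bar>\<xi> $ j\<bar>)) ^ N * norm (fourier g \<xi>)
          + (\<Sum>j\<in>UNIV. (1 + (\<Sum>j\<in>UNIV. \<bar>\<xi> $ j\<bar>)) ^ N * norm (fourier (partial j g) \<xi>))"
        by (simp add: fourier_partial[OF Suc.prems] norm_mult distrib_left distrib_right sum_distrib_left sum_distrib_right mult_ac)
      also have "\<dots> \<le> B + (\<Sum>j\<in>UNIV. C j)" by (intro add_mono sum_mono B C)
      finally show ?thesis .
    qed
    then show ?case by blast
  qed
  fix h :: "real^'n \<Rightarrow> complex" and i N x
  assume "h \<in> fourier ` schwartz"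
  then obtain g where h: "h = fourier g" and g: "g \<in> schwartz" by blast
  show "h differentiable (at x)" unfolding h using fourier_has_derivative[OF g] by (auto simp: differentiable_def)
  show "partial i h \<in> fourier ` schwartz"
    unfolding h partial_fourier[OF g] using schwartz_coordinate_mult[OF g] by blast
  obtain B where B: "\<And>\<xi>. (1 + (\<Sum>j\<in>UNIV. \<bar>\<xi> $ j\<bar>)) ^ N * norm (fourier g \<xi>) \<le> B"
    using decay[OF g] by blast
  have "(1 + norm \<xi>) ^ N * norm (h \<xi>) \<le> B" for \<xi>
    using norm_le_l1_cart[of \<xi>] unfolding h
    by (intro order_trans[OF _ B[of \<xi>]] mult_right_mono power_mono) auto
  then show "\<exists>B. \<forall>\<xi>. (1 + norm \<xi>) ^ N * norm (h \<xi>) \<le> B" by blast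
qed

lemma inv_fourier_schwartz:
  fixes f :: "real^'n::finite \<Rightarrow> complex"
  assumes "f \<in> schwartz"
  shows "inv_fourier f \<in> schwartz"
  using schwartz_cmult[OF schwartz_affine[OF fourier_schwartz[OF assms], of "-1" 0], of "1 / of_real ((2 * pi) ^ CARD('n))"]
  by (simp add: inv_fourier_eq[abs_def])

section \<open>Fourier inversion and multipliers acting on test functions\<close>

lemma borel_measurable_cis [measurable]:
  assumes [measurable]: "f \<in> borel_measurable M"
  shows "(\<lambda>x. cis (f x)) \<in> borel_measurable M"
  unfolding cis_conv_exp by measurable

lemma integrable_mult_pair:
  fixes f :: "'a::euclidean_space \<Rightarrow> complex" and g :: "'b::euclidean_space \<Rightarrow> complex"
  assumes f: "integrable lborel f" and g: "integrable lborel g"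
  shows "integrable (lborel \<Otimes>\<^sub>M lborel) (\<lambda>(x, y). f x * g y)"
proof -
  have [measurable]: "f \<in> borel_measurable borel" "g \<in> borel_measurable borel"
    using f g by (auto dest: borel_measurable_integrable)
  show ?thesis
  proof (rule lborel_pair.Fubini_integrable)
    show "integrable lborel (\<lambda>x. \<integral>y. norm (case (x, y) of (x, y) \<Rightarrow> f x * g y) \<partial>lborel)"
      using f by (simp add: norm_mult)
    show "AE x in lborel. integrable lborel (\<lambda>y. case (x, y) of (x, y) \<Rightarrow> f x * g y)"
      using g by simp
  qed measurable
qed

lemma fourier_exchange:
  fixes f g :: "real^'n::finite \<Rightarrow> complex"
  assumes f: "integrable lborel f" and g: "integrable lborel g"
  shows "(\<integral>\<xi>. fourier f \<xi> * g \<xi> \<partial>lborel) = (\<integral>x. f x * fourier g x \<partial>lborel)"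
proof -
  have [measurable]: "f \<in> borel_measurable borel" "g \<in> borel_measurable borel"
    using f g by (auto dest: borel_measurable_integrable)
  have int: "integrable (lborel \<Otimes>\<^sub>M lborel) (\<lambda>(x, \<xi>). cis (- (x \<bullet> \<xi>)) * (f x * g \<xi>))"
    by (rule Bochner_Integration.integrable_bound[OF integrable_mult_pair[OF f g]])
      (auto simp: norm_mult cis_conv_exp)
  have "(\<integral>\<xi>. fourier f \<xi> * g \<xi> \<partial>lborel) = (\<integral>\<xi>. (\<integral>x. cis (- (x \<bullet> \<xi>)) * (f x * g \<xi>) \<partial>lborel) \<partial>lborel)"
    unfolding fourier_def by (simp flip: mult.assoc)
  also have "\<dots> = (\<integral>x. (\<integral>\<xi>. cis (- (x \<bullet> \<xi>)) * (f x * g \<xi>) \<partial>lborel) \<partial>lborel)"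
    by (rule lborel_pair.Fubini_integral[OF int])
  also have "\<dots> = (\<integral>x. f x * fourier g x \<partial>lborel)"
    unfolding fourier_def by (simp add: inner_commute mult.left_commute)
  finally show ?thesis .
qed

lemma fourier_scale:
  fixes f :: "real^'n::finite \<Rightarrow> complex"
  assumes [measurable]: "f \<in> borel_measurable borel" and c: "0 < c"
  shows "fourier (\<lambda>x. f (c *\<^sub>R x)) \<xi> = fourier f (\<xi> /\<^sub>R c) / of_real (c ^ CARD('n))"
proof -
  have "fourier f (\<xi> /\<^sub>R c) = c ^ CARD('n) *\<^sub>R (\<integral>x. cis (- ((c *\<^sub>R x) \<bullet> (\<xi> /\<^sub>R c))) * f (c *\<^sub>R x) \<partial>lborel)"
    unfolding fourier_def
    using lborel_integral_affine[of "\<lambda>x. cis (- (x \<bullet> (\<xi> /\<^sub>R c))) * f x" c 0] c by simp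
  also have "\<dots> = c ^ CARD('n) *\<^sub>R fourier (\<lambda>x. f (c *\<^sub>R x)) \<xi>"
  proof -
    have "(c *\<^sub>R x) \<bullet> (\<xi> /\<^sub>R c) = x \<bullet> \<xi>" for x using c by simp
    then show ?thesis by (simp only: fourier_def)
  qed
  finally show ?thesis using c by (simp add: scaleR_conv_of_real)
qed

lemma fourier_translate:
  fixes f :: "real^'n::finite \<Rightarrow> complex"
  assumes [measurable]: "f \<in> borel_measurable borel"
  shows "fourier (\<lambda>x. f (a + x)) \<xi> = cis (a \<bullet> \<xi>) * fourier f \<xi>"
proof -
  have "fourier f \<xi> = (\<integral>x. cis (- ((a + x) \<bullet> \<xi>)) * f (a + x) \<partial>lborel)"
    unfolding fourier_def
    using lborel_integral_affine[of "\<lambda>x. cis (- (x \<bullet> \<xi>)) * f x" 1 a] by simp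
  also have "\<dots> = cis (- (a \<bullet> \<xi>)) * fourier (\<lambda>x. f (a + x)) \<xi>"
  proof -
    have "cis (- ((a + x) \<bullet> \<xi>)) * f (a + x) = cis (- (a \<bullet> \<xi>)) * (cis (- (x \<bullet> \<xi>)) * f (a + x))" for x
      by (simp add: inner_add_left cis_mult flip: mult.assoc)
    then show ?thesis by (simp only: fourier_def integral_mult_right_zero)
  qed
  finally show ?thesis by (simp add: cis_mult flip: mult.assoc)
qed

lemma fourier_modulate: "fourier (\<lambda>x. cis (- (x \<bullet> a)) * f x) \<xi> = fourier f (\<xi> + a)"
proof -
  have "cis (- (x \<bullet> \<xi>)) * (cis (- (x \<bullet> a)) * f x) = cis (- (x \<bullet> (\<xi> + a))) * f x" for x
    by (simp add: inner_add_right cis_mult flip: mult.assoc)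
  then show ?thesis by (simp only: fourier_def)
qed

lemma integral_reflect:
  fixes f :: "real^'n::finite \<Rightarrow> complex"
  assumes "f \<in> borel_measurable borel"
  shows "(\<integral>x. f (a - x) \<partial>lborel) = (\<integral>x. f x \<partial>lborel)"
  using lborel_integral_affine[OF assms, of "-1" a] by simp

lemma lborel_integral_prod:
  fixes f :: "'a::euclidean_space \<Rightarrow> real \<Rightarrow> complex"
  assumes f: "\<And>b. b \<in> Basis \<Longrightarrow> integrable lborel (f b)"
  shows "(\<integral>x. (\<Prod>b\<in>Basis. f b (x \<bullet> b)) \<partial>lborel) = (\<Prod>b\<in>Basis. \<integral>t. f b t \<partial>lborel)" (is ?eq)
    and "integrable lborel (\<lambda>x. \<Prod>b\<in>Basis. f b (x \<bullet> b))" (is ?int)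
proof -
  interpret product_sigma_finite "\<lambda>_::'a. lborel :: real measure" ..
  have [measurable]: "\<And>b. b \<in> Basis \<Longrightarrow> f b \<in> borel_measurable borel"
    using f by (auto dest: borel_measurable_integrable)
  have "(\<integral>x. (\<Prod>b\<in>Basis. f b (x \<bullet> b)) \<partial>lborel)
      = (\<integral>x. (\<Prod>b\<in>Basis. f b (x b)) \<partial>(\<Pi>\<^sub>M b\<in>(Basis::'a set). lborel))"
    by (subst lborel_eq, subst integral_distr) (auto intro!: prod.cong Bochner_Integration.integral_cong)
  then show ?eq using product_integral_prod[of Basis f] f by simp
  have "integrable (\<Pi>\<^sub>M b\<in>(Basis::'a set). lborel) (\<lambda>x. \<Prod>b\<in>Basis. f b (x b))"
    using f by (intro product_integrable_prod) auto
  then show ?int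
    by (subst lborel_eq, subst integrable_distr_eq) (auto cong: prod.cong)
qed

text \<open>
  The standard normal density as a product over the coordinates, so that its Fourier transform
  follows from the one-dimensional characteristic function.
\<close>

definition gauss :: "real^'n::finite \<Rightarrow> complex" where
  "gauss x = (\<Prod>b\<in>Basis. of_real (std_normal_density (x \<bullet> b)))"

lemma gauss_integrable: "integrable lborel (gauss :: real^'n::finite \<Rightarrow> complex)"
  unfolding gauss_def by (intro lborel_integral_prod(2) integrable_of_real integrable_normal_density) auto

lemma integral_gauss: "(\<integral>x. gauss x \<partial>(lborel :: (real^'n::finite) measure)) = 1"
  unfolding gauss_def by (subst lborel_integral_prod(1)) auto

lemma gauss_0: "gauss (0 :: real^'n::finite) = 1 / of_real (sqrt (2 * pi) ^ CARD('n))"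
  by (simp add: gauss_def std_normal_density_def power_one_over)

lemma gauss_le: "norm (gauss (x :: real^'n::finite)) \<le> norm (gauss (0 :: real^'n))"
  unfolding gauss_def prod_norm[symmetric]
  by (intro prod_mono) (auto simp: std_normal_density_def norm_mult norm_divide divide_right_mono)

lemma gauss_continuous: "continuous_on A gauss"
  unfolding gauss_def std_normal_density_def by (intro continuous_intros) auto

lemma fourier_std_normal:
  "(\<integral>x. cis (- (x * t)) * of_real (std_normal_density x) \<partial>lborel) = of_real (exp (- t\<^sup>2 / 2))"
proof -
  have "char std_normal_distribution (- t) = of_real (exp (- (- t)\<^sup>2 / 2))"
    by (simp add: char_std_normal_distribution)
  then have "(\<integral>x. std_normal_density x *\<^sub>R iexp (- t * x) \<partial>lborel) = of_real (exp (- t\<^sup>2 / 2))"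
    unfolding char_def by (subst (asm) integral_density) auto
  then show ?thesis
    by (simp add: cis_conv_exp scaleR_conv_of_real mult.commute)
qed

lemma fourier_gauss:
  "fourier gauss (\<xi> :: real^'n::finite) = of_real (sqrt (2 * pi) ^ CARD('n)) * gauss \<xi>"
proof -
  have "cis (- (x \<bullet> \<xi>)) = (\<Prod>b\<in>Basis. cis (- ((x \<bullet> b) * (\<xi> \<bullet> b))))" for x :: "real^'n"
    by (simp add: cis_conv_exp euclidean_inner[of x \<xi>] sum_negf[symmetric] sum_distrib_left exp_sum)
  then have "fourier gauss \<xi> = (\<integral>x. (\<Prod>b\<in>Basis. cis (- ((x \<bullet> b) * (\<xi> \<bullet> b))) * of_real (std_normal_density (x \<bullet> b))) \<partial>lborel)"
    unfolding fourier_def gauss_def by (simp add: prod.distrib)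
  also have "\<dots> = (\<Prod>b\<in>Basis. of_real (exp (- (\<xi> \<bullet> b)\<^sup>2 / 2)))"
  proof (subst lborel_integral_prod(1))
    show "integrable lborel (\<lambda>t. cis (- (t * (\<xi> \<bullet> b))) * of_real (std_normal_density t))" for b
      by (rule Bochner_Integration.integrable_bound[OF integrable_normal_density[of 1 0]])
        (auto simp: norm_mult cis_conv_exp)
  qed (simp add: fourier_std_normal)
  also have "\<dots> = (\<Prod>b\<in>(Basis::(real^'n) set). of_real (sqrt (2 * pi)) * of_real (std_normal_density (\<xi> \<bullet> b)))"
    by (intro prod.cong) (auto simp: std_normal_density_def)
  also have "\<dots> = of_real (sqrt (2 * pi) ^ CARD('n)) * gauss \<xi>"
    by (simp add: prod.distrib gauss_def)
  finally show ?thesis .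
qed

text \<open>
  Both sides below are \<open>c f(0)\<close> with a constant \<open>c\<close> that does not depend on \<open>f\<close>: moving the Fourier
  transform from \<open>f(\<epsilon> x)\<close> to a Gaussian and letting \<open>\<epsilon>\<close> tend to 0 identifies it.
\<close>

lemma integral_fourier:
  fixes f :: "real^'n::finite \<Rightarrow> complex"
  assumes f: "f \<in> schwartz"
  shows "(\<integral>\<xi>. fourier f \<xi> \<partial>lborel) = of_real ((2 * pi) ^ CARD('n)) * f 0"
proof -
  let ?G = "gauss :: real^'n \<Rightarrow> complex"
  define \<epsilon> where "\<epsilon> k = inverse (real (Suc k))" for k
  have \<epsilon>: "0 < \<epsilon> k" for k by (simp add: \<epsilon>_def)
  have lim: "\<epsilon> \<longlonglongrightarrow> 0" unfolding \<epsilon>_def by (rule LIMSEQ_inverse_real_of_nat)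
  have [measurable]: "?G \<in> borel_measurable borel" by (intro borel_measurable_continuous_onI gauss_continuous)
  note [measurable] = schwartz_measurable[OF f] schwartz_measurable[OF fourier_schwartz[OF f]]
  obtain B where B: "\<And>x. norm (f x) \<le> B" using schwartz_decay[OF f, of 0] by auto
  have eq: "(\<integral>\<xi>. fourier f \<xi> * ?G (\<epsilon> k *\<^sub>R \<xi>) \<partial>lborel) = (\<integral>x. f (\<epsilon> k *\<^sub>R x) * fourier ?G x \<partial>lborel)" for k
  proof -
    have fk: "(\<lambda>x. f (\<epsilon> k *\<^sub>R x)) \<in> schwartz"
      using schwartz_affine[OF f, of "\<epsilon> k" 0] \<epsilon>[of k] by simp
    have "(\<integral>x. f (\<epsilon> k *\<^sub>R x) * fourier ?G x \<partial>lborel) = (\<integral>\<xi>. fourier f (\<xi> /\<^sub>R \<epsilon> k) / of_real (\<epsilon> k ^ CARD('n)) * ?G \<xi> \<partial>lborel)"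
      using fourier_exchange[OF schwartz_integrable[OF fk] gauss_integrable] fourier_scale[of f "\<epsilon> k"] \<epsilon>[of k]
      by simp
    also have "\<dots> = \<epsilon> k ^ CARD('n) *\<^sub>R (\<integral>\<xi>. fourier f \<xi> / of_real (\<epsilon> k ^ CARD('n)) * ?G (\<epsilon> k *\<^sub>R \<xi>) \<partial>lborel)"
      using lborel_integral_affine[of "\<lambda>\<xi>. fourier f (\<xi> /\<^sub>R \<epsilon> k) / of_real (\<epsilon> k ^ CARD('n)) * ?G \<xi>" "\<epsilon> k" 0] \<epsilon>[of k]
      by simp
    also have "\<dots> = (\<integral>\<xi>. fourier f \<xi> * ?G (\<epsilon> k *\<^sub>R \<xi>) \<partial>lborel)"
      using \<epsilon>[of k] by (simp add: scaleR_conv_of_real)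
    finally show ?thesis ..
  qed
  have "(\<lambda>k. \<integral>\<xi>. fourier f \<xi> * ?G (\<epsilon> k *\<^sub>R \<xi>) \<partial>lborel) \<longlonglongrightarrow> (\<integral>\<xi>. fourier f \<xi> * ?G 0 \<partial>lborel)"
  proof (rule integral_dominated_convergence[where w = "\<lambda>\<xi>. norm (fourier f \<xi>) * norm (?G 0)"])
    show "integrable lborel (\<lambda>\<xi>. norm (fourier f \<xi>) * norm (?G 0))"
      using schwartz_integrable[OF fourier_schwartz[OF f]] by (intro integrable_mult_left integrable_norm)
    have "(\<lambda>k. fourier f \<xi> * ?G (\<epsilon> k *\<^sub>R \<xi>)) \<longlonglongrightarrow> fourier f \<xi> * ?G (0 *\<^sub>R \<xi>)" for \<xi>
      by (intro tendsto_mult tendsto_const continuous_on_tendsto_compose[OF gauss_continuous[of UNIV]] tendsto_scaleR lim) auto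
    then show "AE \<xi> in lborel. (\<lambda>k. fourier f \<xi> * ?G (\<epsilon> k *\<^sub>R \<xi>)) \<longlonglongrightarrow> fourier f \<xi> * ?G 0" by simp
  qed (auto simp: norm_mult gauss_le mult_left_mono)
  moreover have "(\<lambda>k. \<integral>x. f (\<epsilon> k *\<^sub>R x) * fourier ?G x \<partial>lborel) \<longlonglongrightarrow> (\<integral>x. f 0 * fourier ?G x \<partial>lborel)"
  proof (rule integral_dominated_convergence[where w = "\<lambda>x. B * (norm (of_real (sqrt (2 * pi) ^ CARD('n)) :: complex) * norm (?G x))"])
    show "integrable lborel (\<lambda>x. B * (norm (of_real (sqrt (2 * pi) ^ CARD('n)) :: complex) * norm (?G x)))"
      using gauss_integrable by (intro integrable_mult_right integrable_norm)
    have "(\<lambda>k. f (\<epsilon> k *\<^sub>R x) * fourier ?G x) \<longlonglongrightarrow> f (0 *\<^sub>R x) * fourier ?G x" for x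
      by (intro tendsto_mult tendsto_const continuous_on_tendsto_compose[OF schwartz_continuous[OF f, of UNIV]] tendsto_scaleR lim) auto
    then show "AE x in lborel. (\<lambda>k. f (\<epsilon> k *\<^sub>R x) * fourier ?G x) \<longlonglongrightarrow> f 0 * fourier ?G x" by simp
    show "AE x in lborel. norm (f (\<epsilon> k *\<^sub>R x) * fourier ?G x) \<le> B * (norm (of_real (sqrt (2 * pi) ^ CARD('n)) :: complex) * norm (?G x))" for k
      unfolding fourier_gauss norm_mult by (intro AE_I2 mult_right_mono B) auto
  qed (auto simp: fourier_gauss[abs_def])
  ultimately have "(\<integral>\<xi>. fourier f \<xi> * ?G 0 \<partial>lborel) = (\<integral>x. f 0 * fourier ?G x \<partial>lborel)"
    unfolding eq by (rule LIMSEQ_unique)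
  then have "(\<integral>\<xi>. fourier f \<xi> \<partial>lborel) * ?G 0 = f 0 * of_real (sqrt (2 * pi) ^ CARD('n))"
    by (simp add: fourier_gauss integral_gauss)
  moreover define c where "c = (of_real (sqrt (2 * pi) ^ CARD('n)) :: complex)"
  moreover have "c \<noteq> 0" by (simp add: c_def)
  ultimately have "(\<integral>\<xi>. fourier f \<xi> \<partial>lborel) = f 0 * (c * c)"
    unfolding gauss_0 by (simp add: divide_eq_eq mult.assoc)
  also have "c * c = of_real ((sqrt (2 * pi) * sqrt (2 * pi)) ^ CARD('n))"
    unfolding c_def power_mult_distrib of_real_mult ..
  also have "sqrt (2 * pi) * sqrt (2 * pi) = 2 * pi"
    by simp
  finally show ?thesis by (simp only: mult.commute)
qed

lemma inv_fourier_fourier: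
  fixes f :: "real^'n::finite \<Rightarrow> complex"
  assumes f: "f \<in> schwartz"
  shows "inv_fourier (fourier f) = f"
proof
  fix x
  have "(\<lambda>y. f (x + y)) \<in> schwartz" using schwartz_affine[OF f, of 1 x] by simp
  from integral_fourier[OF this] show "inv_fourier (fourier f) x = f x"
    by (simp add: inv_fourier_def fourier_translate schwartz_measurable[OF f])
qed

lemma fourier_inv_fourier:
  fixes f :: "real^'n::finite \<Rightarrow> complex"
  assumes f: "f \<in> schwartz"
  shows "fourier (inv_fourier f) = f"
proof
  fix x
  note [measurable] = schwartz_measurable[OF fourier_schwartz[OF f]]
  have "fourier (inv_fourier f) x = fourier (\<lambda>y. fourier f (- y) / of_real ((2 * pi) ^ CARD('n))) x"
    by (simp only: inv_fourier_eq[abs_def])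
  also have "\<dots> = (\<integral>y. cis (- (y \<bullet> x)) * fourier f (- y) \<partial>lborel) / of_real ((2 * pi) ^ CARD('n))"
    by (simp add: fourier_def[of "\<lambda>y. fourier f (- y) / _"])
  also have "(\<integral>y. cis (- (y \<bullet> x)) * fourier f (- y) \<partial>lborel) = (\<integral>y. cis (y \<bullet> x) * fourier f y \<partial>lborel)"
    using integral_reflect[of "\<lambda>y. cis (y \<bullet> x) * fourier f y" 0] by simp
  also have "(\<integral>y. cis (y \<bullet> x) * fourier f y \<partial>lborel) / of_real ((2 * pi) ^ CARD('n)) = inv_fourier (fourier f) x"
    by (simp add: inv_fourier_def inner_commute)
  finally show "fourier (inv_fourier f) x = f x"
    by (simp only: inv_fourier_fourier[OF f])
qed

text \<open>The operator \<open>m(D)\<close> as it acts on test functions: by definition it is the transpose of \<^const>\<open>multiplier\<close>.\<close>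

definition test_multiplier :: "(real^'n::finite \<Rightarrow> complex) \<Rightarrow> (real^'n \<Rightarrow> complex) \<Rightarrow> real^'n \<Rightarrow> complex" where
  "test_multiplier m \<phi> = fourier (\<lambda>\<xi>. m \<xi> * inv_fourier \<phi> \<xi>)"

lemma multiplier_eq: "multiplier m u \<phi> = u (test_multiplier (\<lambda>\<xi>. of_real (m \<xi>)) \<phi>)"
  by (simp add: multiplier_def test_multiplier_def)

lemma mult_inv_fourier_schwartz:
  "m \<in> schwartz \<Longrightarrow> \<phi> \<in> schwartz \<Longrightarrow> (\<lambda>\<xi>. m \<xi> * inv_fourier \<phi> \<xi>) \<in> schwartz"
  by (intro schwartz_mult inv_fourier_schwartz)

lemma test_multiplier_schwartz: "m \<in> schwartz \<Longrightarrow> \<phi> \<in> schwartz \<Longrightarrow> test_multiplier m \<phi> \<in> schwartz"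
  unfolding test_multiplier_def by (intro fourier_schwartz mult_inv_fourier_schwartz)

lemma inv_fourier_test_multiplier:
  "m \<in> schwartz \<Longrightarrow> \<phi> \<in> schwartz \<Longrightarrow> inv_fourier (test_multiplier m \<phi>) = (\<lambda>\<xi>. m \<xi> * inv_fourier \<phi> \<xi>)"
  unfolding test_multiplier_def by (intro inv_fourier_fourier mult_inv_fourier_schwartz)

lemma test_multiplier_compose:
  assumes "m\<^sub>1 \<in> schwartz" "m\<^sub>2 \<in> schwartz" "\<phi> \<in> schwartz"
  shows "test_multiplier m\<^sub>1 (test_multiplier m\<^sub>2 \<phi>) = test_multiplier (\<lambda>\<xi>. m\<^sub>1 \<xi> * m\<^sub>2 \<xi>) \<phi>"
  unfolding test_multiplier_def[of m\<^sub>1] inv_fourier_test_multiplier[OF assms(2,3)]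
  by (simp add: test_multiplier_def mult.assoc)

lemma test_multiplier_zero:
  assumes "m \<in> schwartz" "\<phi> \<in> schwartz" "\<And>\<xi>. m \<xi> * inv_fourier \<phi> \<xi> = 0"
  shows "test_multiplier m \<phi> = (\<lambda>x. 0)"
  by (auto simp: test_multiplier_def assms(3) fourier_def)

lemma inv_fourier_partial:
  fixes f :: "real^'n::finite \<Rightarrow> complex"
  assumes f: "f \<in> schwartz"
  shows "inv_fourier (partial j f) \<xi> = - \<i> * of_real (\<xi> $ j) * inv_fourier f \<xi>"
  by (simp add: inv_fourier_eq fourier_partial[OF f])

lemma partial_test_multiplier:
  fixes m \<phi> :: "real^'n::finite \<Rightarrow> complex"
  assumes "m \<in> schwartz" "\<phi> \<in> schwartz"
  shows "partial j (test_multiplier m \<phi>) = test_multiplier m (partial j \<phi>)"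
  unfolding test_multiplier_def partial_fourier[OF mult_inv_fourier_schwartz[OF assms]] inv_fourier_partial[OF assms(2)]
  by (simp add: mult_ac)

lemma partials_test_multiplier:
  fixes m \<phi> :: "real^'n::finite \<Rightarrow> complex"
  assumes "m \<in> schwartz" "\<phi> \<in> schwartz"
  shows "partials \<alpha> (test_multiplier m \<phi>) = test_multiplier m (partials \<alpha> \<phi>)"
  by (induction \<alpha>) (auto simp: partials_Cons partial_test_multiplier assms schwartz_partials)

text \<open>
  The kernel is reflected, since this is the transpose of the operator that acts on
  distributions.
\<close>

lemma test_multiplier_eq_convolution:
  fixes m \<phi> :: "real^'n::finite \<Rightarrow> complex"
  assumes m: "m \<in> schwartz" and \<phi>: "\<phi> \<in> schwartz"
  shows "test_multiplier m \<phi> x = (\<integral>y. inv_fourier m (y - x) * \<phi> y \<partial>lborel)"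
proof -
  let ?c = "of_real ((2 * pi) ^ CARD('n)) :: complex"
  have r: "(\<lambda>y. \<phi> (- y)) \<in> schwartz" using schwartz_translate_reflect[OF \<phi>, of 0] by simp
  note [measurable] = schwartz_measurable[OF \<phi>] schwartz_measurable[OF fourier_schwartz[OF m]]
  have inv: "inv_fourier \<phi> \<xi> = fourier (\<lambda>y. \<phi> (- y)) \<xi> / ?c" for \<xi>
    using integral_reflect[of "\<lambda>y. cis (- (y \<bullet> \<xi>)) * \<phi> (- y)" 0] schwartz_measurable[OF schwartz_cis_mult_minus[OF r]]
    by (simp add: inv_fourier_def fourier_def inner_commute)
  have "test_multiplier m \<phi> x = (\<integral>\<xi>. fourier (\<lambda>y. \<phi> (- y)) \<xi> * (cis (- (\<xi> \<bullet> x)) * m \<xi>) \<partial>lborel) / ?c"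
    by (simp add: test_multiplier_def fourier_def[of _ x] inv mult_ac)
  also have "\<dots> = (\<integral>y. \<phi> (- y) * fourier m (y + x) \<partial>lborel) / ?c"
    using fourier_exchange[OF schwartz_integrable[OF r] schwartz_integrable[OF schwartz_cis_mult_minus[OF m, of x]]]
    by (simp add: fourier_modulate)
  also have "(\<integral>y. \<phi> (- y) * fourier m (y + x) \<partial>lborel) = (\<integral>y. \<phi> y * fourier m (- y + x) \<partial>lborel)"
    using integral_reflect[of "\<lambda>y. \<phi> y * fourier m (- y + x)" 0] by simp
  finally show ?thesis
    by (simp add: inv_fourier_eq mult_ac)
qed

section \<open>Convolution with Schwartz kernels\<close>

lemma weight_shift: "weight (x - y) \<le> (1 + norm x) ^ (2 * CARD('n)) * weight y" for x y :: "real^'n::finite"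
proof -
  have "1 + norm y \<le> (1 + norm (y + - x)) * (1 + norm (- x))" by (rule one_plus_norm_le)
  then have "(1 + norm y) ^ (2 * CARD('n)) \<le> ((1 + norm (x - y)) * (1 + norm x)) ^ (2 * CARD('n))"
    by (intro power_mono) (auto simp: norm_minus_commute)
  then have "(1 + norm y) ^ (2 * CARD('n)) \<le> (1 + norm (x - y)) ^ (2 * CARD('n)) * (1 + norm x) ^ (2 * CARD('n))"
    unfolding power_mult_distrib .
  moreover have "0 < (1 + norm z) ^ (2 * CARD('n))" for z :: "real^'n" by (intro zero_less_power add_pos_nonneg) auto
  ultimately show ?thesis
    by (simp add: weight_def field_simps)
qed

text \<open>
  A class of functions that can be integrated against every Schwartz function; it contains the
  bounded functions and all Lebesgue spaces.
\<close>

definition tame :: "(real^'n::finite \<Rightarrow> complex) \<Rightarrow> bool" where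
  "tame h \<longleftrightarrow> h \<in> borel_measurable borel \<and> integrable lborel (\<lambda>x. weight x * norm (h x))"

lemma tame_measurable [measurable_dest]: "tame h \<Longrightarrow> h \<in> borel_measurable borel"
  by (simp add: tame_def)

lemma bounded_tame:
  fixes h :: "real^'n::finite \<Rightarrow> complex"
  assumes [measurable]: "h \<in> borel_measurable borel" and "\<And>x. norm (h x) \<le> B"
  shows "tame h"
proof -
  have "integrable lborel (\<lambda>x. weight x * norm (h x))"
  proof (rule Bochner_Integration.integrable_bound[of _ "\<lambda>x. weight x * B"])
    show "integrable lborel (\<lambda>x. weight x * B)" by (intro integrable_mult_left weight_integrable)
    show "AE x in lborel. norm (weight x * norm (h x)) \<le> norm (weight x * B)"
      using assms(2) by (intro AE_I2) (auto simp: abs_mult intro!: mult_left_mono order_trans[OF assms(2) abs_ge_self])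
  qed measurable
  then show ?thesis by (simp add: tame_def)
qed

lemma tame_mult_integrable:
  fixes h :: "real^'n::finite \<Rightarrow> complex"
  assumes h: "tame h" and \<phi>: "\<phi> \<in> schwartz"
  shows "integrable lborel (\<lambda>x. h x * \<phi> x)"
proof -
  note [measurable] = tame_measurable[OF h] schwartz_measurable[OF \<phi>]
  obtain B where B: "\<And>x. (1 + norm x) ^ 0 * norm (\<phi> x) \<le> B * weight x" using schwartz_le_weight[OF \<phi>] by blast
  show ?thesis
  proof (rule Bochner_Integration.integrable_bound[of _ "\<lambda>x. B * (weight x * norm (h x))"])
    show "integrable lborel (\<lambda>x. B * (weight x * norm (h x)))"
      using h by (intro integrable_mult_right) (simp add: tame_def)
    have "norm (h x * \<phi> x) \<le> norm (h x) * (B * weight x)" for x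
      using B[of x] by (simp add: norm_mult mult_left_mono)
    then show "AE x in lborel. norm (h x * \<phi> x) \<le> norm (B * (weight x * norm (h x)))"
      by (intro AE_I2 order_trans[OF _ abs_ge_self[of "B * _", folded real_norm_def]]) (auto simp: mult_ac)
  qed measurable
qed

lemma tame_mult_le:
  fixes h :: "real^'n::finite \<Rightarrow> complex"
  assumes h: "tame h" and B: "\<And>x. norm (\<phi> x) \<le> B * weight x"
  shows "norm (\<integral>x. h x * \<phi> x \<partial>lborel) \<le> B * (\<integral>x. weight x * norm (h x) \<partial>lborel)"
proof -
  have "norm (\<integral>x. h x * \<phi> x \<partial>lborel) \<le> (\<integral>x. B * (weight x * norm (h x)) \<partial>lborel)"
  proof (rule norm_integral_le)
    show "integrable lborel (\<lambda>x. B * (weight x * norm (h x)))"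
      using h by (intro integrable_mult_right) (simp add: tame_def)
    show "norm (h x * \<phi> x) \<le> B * (weight x * norm (h x))" for x
      using mult_right_mono[OF B[of x], of "norm (h x)"] by (simp add: norm_mult mult_ac)
  qed
  then show ?thesis by simp
qed

text \<open>
  Jensen's inequality for the finite measure with density \<^const>\<open>weight\<close>.
\<close>

lemma Lp_weight:
  fixes h :: "real^'n::finite \<Rightarrow> complex"
  assumes p: "1 \<le> p" and [measurable]: "h \<in> borel_measurable borel"
  shows "(\<integral>\<^sup>+x. weight x * norm (h x) \<partial>lborel)
    \<le> ennreal ((\<integral>x. weight x \<partial>(lborel :: (real^'n) measure)) powr (1 - 1 / p)) * Lnorm (ennreal p) lborel (\<lambda>x. norm (h x))"
proof -
  define c where "c = (\<integral>x. weight x \<partial>(lborel :: (real^'n) measure))"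
  have c: "0 < c" unfolding c_def by (rule integral_weight_pos)
  have "(\<integral>\<^sup>+x. ennreal (weight x) \<partial>(lborel :: (real^'n) measure)) \<le> ennreal c"
    unfolding c_def using weight_integrable by (subst nn_integral_eq_integral) (auto simp: weight_pos less_imp_le)
  from Jensen_nn_integral[OF p c this, of "\<lambda>x. norm (h x)"]
  have "enn_powr (\<integral>\<^sup>+x. weight x * ennreal (norm (h x)) \<partial>lborel) p
     \<le> ennreal (c powr (p - 1)) * (\<integral>\<^sup>+x. weight x * enn_powr (norm (h x)) p \<partial>lborel)" by simp
  also have "\<dots> \<le> ennreal (c powr (p - 1)) * (\<integral>\<^sup>+x. enn_powr (norm (h x)) p \<partial>lborel)"
  proof (intro mult_left_mono nn_integral_mono)
    show "ennreal (weight x) * enn_powr (norm (h x)) p \<le> enn_powr (norm (h x)) p" for x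
      using mult_right_mono[of "ennreal (weight x)" 1 "enn_powr (norm (h x)) p"] weight_le_1[of x] by simp
  qed simp
  finally have "enn_powr (enn_powr (\<integral>\<^sup>+x. weight x * ennreal (norm (h x)) \<partial>lborel) p) (1 / p)
     \<le> enn_powr (ennreal (c powr (p - 1)) * (\<integral>\<^sup>+x. enn_powr (norm (h x)) p \<partial>lborel)) (1 / p)"
    using p by (intro enn_powr_mono) auto
  moreover have "(p - 1) / p = 1 - 1 / p" using p by (simp add: field_simps)
  ultimately show ?thesis
    using p by (simp add: enn_powr_powr enn_powr_mult Lnorm_real enn_powr_ennreal powr_powr c_def
        ennreal_mult weight_pos less_imp_le)
qed

lemma Lp_tame:
  fixes h :: "real^'n::finite \<Rightarrow> complex"
  assumes p: "1 \<le> p" and [measurable]: "h \<in> borel_measurable borel" and "Lnorm (ennreal p) lborel (\<lambda>x. norm (h x)) < \<infinity>"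
  shows "tame h"
proof -
  have "(\<integral>\<^sup>+x. weight x * norm (h x) \<partial>lborel) < \<infinity>"
    using assms(3) by (intro order_le_less_trans[OF Lp_weight[OF p]] ) (auto simp: ennreal_mult_less_top)
  then have "integrable lborel (\<lambda>x. weight x * norm (h x))"
    by (intro integrableI_nonneg) (auto simp: weight_pos less_imp_le)
  then show ?thesis by (simp add: tame_def)
qed

definition conv :: "(real^'n::finite \<Rightarrow> complex) \<Rightarrow> (real^'n \<Rightarrow> complex) \<Rightarrow> real^'n \<Rightarrow> complex" where
  "conv K h x = (\<integral>y. K (x - y) * h y \<partial>lborel)"

lemma conv_integrable:
  assumes "tame h" "K \<in> schwartz"
  shows "integrable lborel (\<lambda>y. K (x - y) * h y)"
  using tame_mult_integrable[OF assms(1) schwartz_translate_reflect[OF assms(2), of x]] by (simp add: mult.commute)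

lemma conv_kernel_le:
  fixes K :: "real^'n::finite \<Rightarrow> complex"
  assumes "\<And>x. norm (K x) \<le> B * weight x" "0 \<le> B"
  shows "norm (K (x - y)) \<le> (B * (1 + norm x) ^ (2 * CARD('n))) * weight y"
proof -
  have "norm (K (x - y)) \<le> B * weight (x - y)" by (rule assms)
  also have "\<dots> \<le> B * ((1 + norm x) ^ (2 * CARD('n)) * weight y)" by (intro mult_left_mono weight_shift assms)
  finally show ?thesis by simp
qed

lemma schwartz_le_weight0:
  "K \<in> schwartz \<Longrightarrow> \<exists>B\<ge>0. \<forall>x. norm (K x) \<le> B * weight x"
  using schwartz_le_weight[of K 0] by simp

lemma conv_growth:
  fixes K :: "real^'n::finite \<Rightarrow> complex"
  assumes h: "tame h" and K: "\<And>x. norm (K x) \<le> B * weight x" "0 \<le> B"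
  shows "norm (conv K h x) \<le> (B * (\<integral>y. weight y * norm (h y) \<partial>lborel)) * (1 + norm x) ^ (2 * CARD('n))"
  using tame_mult_le[OF h conv_kernel_le[OF K, of x]] unfolding conv_def by (simp add: mult_ac)

text \<open>
  A second order Taylor estimate for the kernel shows that the derivative can be taken under the
  integral.
\<close>

lemma schwartz_taylor:
  fixes K :: "real^'n::finite \<Rightarrow> complex"
  assumes K: "K \<in> schwartz"
  shows "\<exists>B\<ge>0. \<forall>a v. norm (K (a + v) - K a - (\<Sum>j\<in>UNIV. (v $ j) *\<^sub>R partial j K a))
    \<le> B * norm v ^ 2 * (1 + norm v) ^ (2 * CARD('n)) * weight a"
proof -
  let ?N = "2 * CARD('n)"
  have "\<forall>i. \<exists>B\<ge>0. \<forall>j z. (1 + norm z) ^ ?N * norm (partial j (partial i K) z) \<le> B"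
    using schwartz_partial_bound[OF schwartz_partial[OF K]] by blast
  then obtain B where B: "\<And>i. 0 \<le> B i" "\<And>i j z. (1 + norm z) ^ ?N * norm (partial j (partial i K) z) \<le> B i" by metis
  define C where "C = (\<Sum>i\<in>UNIV. real CARD('n) * B i)"
  have C: "0 \<le> C" unfolding C_def using B(1) by (intro sum_nonneg) auto
  have px: "0 < (1 + norm x) ^ ?N" for x :: "real^'n" by (intro zero_less_power add_pos_nonneg) auto
  have "norm (K (a + v) - K a - (\<Sum>j\<in>UNIV. (v $ j) *\<^sub>R partial j K a))
    \<le> C * norm v ^ 2 * (1 + norm v) ^ ?N * weight a" for a v
  proof -
    let ?D = "\<lambda>z h. \<Sum>j\<in>UNIV. (h $ j) *\<^sub>R partial j K z"
    have "norm (K (a + v) - K a - ?D a ((a + v) - a))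
        \<le> norm ((a + v) - a) * (C * norm v * (1 + norm v) ^ ?N * weight a)"
    proof (rule differentiable_bound_linearization)
      show "a \<in> closed_segment a (a + v)" by simp
      show "\<And>t. t \<in> {0..1} \<Longrightarrow> a + t *\<^sub>R (a + v - a) \<in> closed_segment a (a + v)"
        by (auto simp: closed_segment_def algebra_simps)
      show "\<And>z. z \<in> closed_segment a (a + v) \<Longrightarrow> (K has_derivative ?D z) (at z within closed_segment a (a + v))"
        using has_derivative_partial[OF schwartz_differentiable[OF K]] by (rule has_derivative_at_withinI)
      fix z assume "z \<in> closed_segment a (a + v)"
      then obtain s where s: "0 \<le> s" "s \<le> 1" "z = a + s *\<^sub>R v"
        by (auto simp: closed_segment_def algebra_simps)
      have sv: "norm (s *\<^sub>R v) \<le> norm v" using s by (simp add: mult_left_le_one_le)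
      have P: "norm (partial i K z - partial i K a) \<le> real CARD('n) * B i * norm v * (1 + norm v) ^ ?N * weight a" for i
      proof -
        have "(1 + norm a) ^ ?N * norm (partial i K z - partial i K a)
            \<le> real CARD('n) * B i * norm (s *\<^sub>R v) * (1 + norm (s *\<^sub>R v)) ^ ?N"
          unfolding s(3) by (rule schwartz_increment[OF schwartz_partial[OF K] B(2)])
        also have "\<dots> \<le> real CARD('n) * B i * norm v * (1 + norm v) ^ ?N"
          using sv B(1) by (intro mult_mono power_mono) auto
        finally show ?thesis using px[of a] by (simp add: weight_def field_simps)
      qed
      show "onorm (?D z - ?D a) \<le> C * norm v * (1 + norm v) ^ ?N * weight a"
        unfolding fun_diff_def
      proof (rule onorm_le)
        fix h :: "real^'n"
        have "?D z h - ?D a h = (\<Sum>j\<in>UNIV. (h $ j) *\<^sub>R (partial j K z - partial j K a))"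
          by (simp add: scaleR_diff_right sum_subtractf)
        also have "norm \<dots> \<le> (\<Sum>j\<in>UNIV. norm h * (real CARD('n) * B j * norm v * (1 + norm v) ^ ?N * weight a))"
          by (intro order_trans[OF norm_sum] sum_mono, unfold norm_scaleR real_norm_def)
            (intro mult_mono P component_le_norm_cart norm_ge_zero)
        also have "\<dots> = C * norm v * (1 + norm v) ^ ?N * weight a * norm h"
          by (simp add: C_def sum_distrib_left sum_distrib_right mult_ac)
        finally show "norm (?D z h - ?D a h) \<le> C * norm v * (1 + norm v) ^ ?N * weight a * norm h" .
      qed
    qed
    then show ?thesis by (simp add: power2_eq_square mult_ac)
  qed
  then show ?thesis using C by blast
qed

lemma conv_has_derivative:
  fixes K :: "real^'n::finite \<Rightarrow> complex"
  assumes h: "tame h" and K: "K \<in> schwartz"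
  shows "(conv K h has_derivative (\<lambda>v. \<Sum>j\<in>UNIV. (v $ j) *\<^sub>R conv (partial j K) h x)) (at x)"
proof -
  let ?N = "2 * CARD('n)"
  obtain B where B: "0 \<le> B" "\<And>a v. norm (K (a + v) - K a - (\<Sum>j\<in>UNIV. (v $ j) *\<^sub>R partial j K a))
    \<le> B * norm v ^ 2 * (1 + norm v) ^ ?N * weight a" using schwartz_taylor[OF K] by blast
  define c where "c = B * (1 + norm x) ^ ?N * (\<integral>y. weight y * norm (h y) \<partial>lborel)"
  show ?thesis
  proof (rule has_derivativeI_sandwich[of 1])
    show "((\<lambda>z. c * norm (z - x) * (1 + norm (z - x)) ^ ?N) \<longlongrightarrow> 0) (at x)"
      by (auto intro!: tendsto_eq_intros)
    show "bounded_linear (\<lambda>v. \<Sum>j\<in>UNIV. (v $ j) *\<^sub>R conv (partial j K) h x)"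
      by (intro bounded_linear_sum bounded_linear_scaleR_const bounded_linear_vec_nth)
    fix z assume "z \<noteq> x"
    let ?v = "z - x"
    let ?R = "\<lambda>y. K ((x - y) + ?v) - K (x - y) - (\<Sum>j\<in>UNIV. (?v $ j) *\<^sub>R partial j K (x - y))"
    have i1: "integrable lborel (\<lambda>y. K (z - y) * h y)" for z by (rule conv_integrable[OF h K])
    have i2: "integrable lborel (\<lambda>y. (?v $ j) *\<^sub>R (partial j K (x - y) * h y))" for j
      by (intro integrable_scaleR_right conv_integrable[OF h schwartz_partial[OF K]])
    have "conv K h z - conv K h x - (\<Sum>j\<in>UNIV. (?v $ j) *\<^sub>R conv (partial j K) h x)
        = (\<integral>y. K (z - y) * h y - K (x - y) * h y - (\<Sum>j\<in>UNIV. (?v $ j) *\<^sub>R (partial j K (x - y) * h y)) \<partial>lborel)"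
      unfolding conv_def using i1 i2
      by (simp add: Bochner_Integration.integral_diff Bochner_Integration.integral_sum del: vector_minus_component)
    also have "\<dots> = (\<integral>y. h y * ?R y \<partial>lborel)"
      by (intro Bochner_Integration.integral_cong) (auto simp: algebra_simps sum_distrib_left)
    also have "norm \<dots> \<le> (B * norm ?v ^ 2 * (1 + norm ?v) ^ ?N * (1 + norm x) ^ ?N) * (\<integral>y. weight y * norm (h y) \<partial>lborel)"
    proof (rule tame_mult_le[OF h])
      fix y
      have "norm (?R y) \<le> B * norm ?v ^ 2 * (1 + norm ?v) ^ ?N * weight (x - y)" by (rule B(2))
      also have "\<dots> \<le> B * norm ?v ^ 2 * (1 + norm ?v) ^ ?N * ((1 + norm x) ^ ?N * weight y)"
        using B(1) by (intro mult_left_mono weight_shift) auto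
      finally show "norm (?R y) \<le> B * norm ?v ^ 2 * (1 + norm ?v) ^ ?N * (1 + norm x) ^ ?N * weight y"
        by (simp add: mult_ac)
    qed
    also have "\<dots> = (c * norm ?v * (1 + norm ?v) ^ ?N) * norm ?v"
      by (simp add: c_def power2_eq_square mult_ac)
    finally show "norm (conv K h z - conv K h x - (\<Sum>j\<in>UNIV. ((z - x) $ j) *\<^sub>R conv (partial j K) h x)) / norm (z - x)
      \<le> c * norm (z - x) * (1 + norm (z - x)) ^ ?N"
      using \<open>z \<noteq> x\<close> by (simp add: pos_divide_le_eq)
  qed simp
qed

lemma conv_moderate:
  fixes K :: "real^'n::finite \<Rightarrow> complex"
  assumes h: "tame h" and K: "K \<in> schwartz"
  shows "conv K h \<in> moderate"
proof (rule moderate_coinduct[where X = "{conv K h | K. K \<in> schwartz}"])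
  show "conv K h \<in> {conv K h | K. K \<in> schwartz}" using K by blast
  fix f :: "real^'n \<Rightarrow> complex" and i x
  assume "f \<in> {conv K h | K. K \<in> schwartz}"
  then obtain K where f: "f = conv K h" and K: "K \<in> schwartz" by blast
  show "f differentiable (at x)"
    using conv_has_derivative[OF h K] unfolding f by (auto simp: differentiable_def)
  have "partial i f = conv (partial i K) h"
    using partial_eqI[OF conv_has_derivative[OF h K], of i] by (auto simp: f sum_axis_scaleR)
  then show "partial i f \<in> {conv K h | K. K \<in> schwartz}" using schwartz_partial[OF K] by blast
  obtain B where "\<And>x. norm (K x) \<le> B * weight x" "0 \<le> B" using schwartz_le_weight0[OF K] by blast
  from conv_growth[OF h this] show "\<exists>B N. \<forall>x. norm (f x) \<le> B * (1 + norm x) ^ N"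
    unfolding f by blast
qed

lemma conv_continuous: "tame h \<Longrightarrow> K \<in> schwartz \<Longrightarrow> continuous_on A (conv K h)"
  by (intro moderate_continuous conv_moderate)

text \<open>
  Fubini's theorem: the kernel of this convolution is the reflection of the one in
  \<open>test_multiplier_eq_convolution\<close>.
\<close>

lemma conv_duality:
  fixes m :: "real^'n::finite \<Rightarrow> complex"
  assumes h: "tame h" and m: "m \<in> schwartz" and \<phi>: "\<phi> \<in> schwartz"
  shows "integrable lborel (\<lambda>x. conv (inv_fourier m) h x * \<phi> x)"
    and "(\<integral>x. conv (inv_fourier m) h x * \<phi> x \<partial>lborel) = (\<integral>y. h y * test_multiplier m \<phi> y \<partial>lborel)"
proof -
  let ?K = "inv_fourier m"
  have K: "?K \<in> schwartz" by (rule inv_fourier_schwartz[OF m])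
  obtain B where B: "\<And>x. norm (?K x) \<le> B * weight x" "0 \<le> B" using schwartz_le_weight0[OF K] by blast
  note [measurable] = tame_measurable[OF h] schwartz_measurable[OF \<phi>] schwartz_measurable[OF K]
  have "integrable lborel (\<lambda>x. of_real ((1 + norm x) ^ (2 * CARD('n)) * norm (\<phi> x)) :: complex)"
    by (intro integrable_of_real schwartz_norm_integrable \<phi>)
  moreover have "integrable lborel (\<lambda>y. of_real (B * (weight y * norm (h y))) :: complex)"
    using h by (intro integrable_of_real integrable_mult_right) (simp add: tame_def)
  ultimately have "integrable (lborel \<Otimes>\<^sub>M lborel) (\<lambda>(x, y). of_real ((1 + norm x) ^ (2 * CARD('n)) * norm (\<phi> x))
      * (of_real (B * (weight y * norm (h y))) :: complex))"
    by (rule integrable_mult_pair)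
  then have int: "integrable (lborel \<Otimes>\<^sub>M lborel) (\<lambda>(x, y). ?K (x - y) * h y * \<phi> x)"
  proof (rule Bochner_Integration.integrable_bound)
    have "norm (?K (x - y) * h y * \<phi> x) \<le> ((1 + norm x) ^ (2 * CARD('n)) * norm (\<phi> x)) * (B * (weight y * norm (h y)))" for x y
      using mult_right_mono[OF conv_kernel_le[OF B, of x y], of "norm (h y) * norm (\<phi> x)"]
      by (simp add: norm_mult mult_ac)
    then show "AE z in lborel \<Otimes>\<^sub>M lborel. norm (case z of (x, y) \<Rightarrow> ?K (x - y) * h y * \<phi> x)
      \<le> norm (case z of (x, y) \<Rightarrow> of_real ((1 + norm x) ^ (2 * CARD('n)) * norm (\<phi> x)) * (of_real (B * (weight y * norm (h y))) :: complex))"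
      using B(2) weight_pos by (intro AE_I2) (auto simp: norm_mult abs_mult abs_of_pos[OF weight_pos] simp flip: of_real_mult)
  qed measurable
  have "(\<lambda>x. \<integral>y. ?K (x - y) * h y * \<phi> x \<partial>lborel) = (\<lambda>x. conv ?K h x * \<phi> x)"
    by (simp add: conv_def)
  then show "integrable lborel (\<lambda>x. conv ?K h x * \<phi> x)"
    using lborel_pair.integrable_fst'[OF int] by simp
  have "(\<integral>x. conv ?K h x * \<phi> x \<partial>lborel) = (\<integral>x. (\<integral>y. ?K (x - y) * h y * \<phi> x \<partial>lborel) \<partial>lborel)"
    by (simp add: conv_def)
  also have "\<dots> = (\<integral>y. (\<integral>x. ?K (x - y) * h y * \<phi> x \<partial>lborel) \<partial>lborel)"
    by (rule lborel_pair.Fubini_integral[OF int, symmetric])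
  also have "\<dots> = (\<integral>y. h y * test_multiplier m \<phi> y \<partial>lborel)"
  proof -
    have "?K (x - y) * h y * \<phi> x = h y * (?K (x - y) * \<phi> x)" for x y by simp
    then show ?thesis by (simp only: test_multiplier_eq_convolution[OF m \<phi>] integral_mult_right_zero)
  qed
  finally show "(\<integral>x. conv ?K h x * \<phi> x \<partial>lborel) = (\<integral>y. h y * test_multiplier m \<phi> y \<partial>lborel)" .
qed

section \<open>Bernstein and product inequalities\<close>

lemma norm_conv_le: "ennreal (norm (conv K h x)) \<le> (\<integral>\<^sup>+y. ennreal (norm (K (x - y))) * ennreal (norm (h y)) \<partial>lborel)"
proof (cases "integrable lborel (\<lambda>y. K (x - y) * h y)")
  case True
  then show ?thesis
    using integral_norm_bound_ennreal[OF True] by (simp add: conv_def norm_mult ennreal_mult)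
next
  case False
  then show ?thesis by (simp add: conv_def not_integrable_integral_eq)
qed

text \<open>
  The kernel \<open>k\<close> has mass at most \<open>c\<close> and height at most \<open>c L\<close>. For a kernel of frequency \<open>2\<^sup>j\<close> in
  dimension \<open>n\<close>, \<open>L\<close> is \<open>2\<^sup>j\<^sup>n\<close>.
\<close>

lemma Bernstein_sup:
  fixes k h :: "real^'n::finite \<Rightarrow> ennreal"
  assumes r: "1 \<le> r" and c: "0 < c" and L: "0 < L"
    and k: "(\<integral>\<^sup>+x. k x \<partial>lborel) \<le> ennreal c" "\<And>x. k x \<le> ennreal (c * L)"
    and [measurable]: "k \<in> borel_measurable borel" "h \<in> borel_measurable borel"
  shows "(\<integral>\<^sup>+y. k (x - y) * h y \<partial>lborel) \<le> ennreal (c * L powr (1 / r)) * Lnorm (ennreal r) lborel h"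
proof -
  have refl: "(\<integral>\<^sup>+y. k (x - y) \<partial>lborel) = (\<integral>\<^sup>+y. k y \<partial>lborel)"
    using nn_integral_lborel_affine[of k "-1" x] by simp
  have "enn_powr (\<integral>\<^sup>+y. k (x - y) * h y \<partial>lborel) r \<le> ennreal (c powr (r - 1)) * (\<integral>\<^sup>+y. k (x - y) * enn_powr (h y) r \<partial>lborel)"
    using r c k(1) by (intro Jensen_nn_integral) (auto simp: refl)
  also have "\<dots> \<le> ennreal (c powr (r - 1)) * (\<integral>\<^sup>+y. ennreal (c * L) * enn_powr (h y) r \<partial>lborel)"
    using k(2) by (intro mult_left_mono nn_integral_mono mult_right_mono) auto
  also have "\<dots> = ennreal (c powr (r - 1) * (c * L)) * (\<integral>\<^sup>+y. enn_powr (h y) r \<partial>lborel)"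
    using c L by (simp add: nn_integral_cmult ennreal_mult mult.assoc)
  also have "c powr (r - 1) * (c * L) = (c * L powr (1 / r)) powr r"
    using c L r powr_add[of c "r - 1" 1] by (simp add: powr_mult powr_powr)
  also have "ennreal \<dots> * (\<integral>\<^sup>+y. enn_powr (h y) r \<partial>lborel) = enn_powr (ennreal (c * L powr (1 / r)) * Lnorm (ennreal r) lborel h) r"
    using r c L by (simp add: Lnorm_real enn_powr_mult enn_powr_powr enn_powr_ennreal)
  finally show ?thesis by (rule enn_powr_le_cancel[rotated]) (use r in simp)
qed

text \<open>
  Young's inequality with \<open>L\<^sup>1\<close> kernels: Jensen's inequality for the kernel
  at each \<open>x\<close>, then Fubini.
\<close>

lemma Young_Lp:
  fixes k h :: "real^'n::finite \<Rightarrow> ennreal"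
  assumes r: "1 \<le> r" and c: "0 < c"
    and k: "(\<integral>\<^sup>+x. k x \<partial>lborel) \<le> ennreal c"
    and [measurable]: "k \<in> borel_measurable borel" "h \<in> borel_measurable borel"
  shows "(\<integral>\<^sup>+x. enn_powr (\<integral>\<^sup>+y. k (x - y) * h y \<partial>lborel) r \<partial>lborel) \<le> ennreal (c powr r) * (\<integral>\<^sup>+y. enn_powr (h y) r \<partial>lborel)"
proof -
  have refl: "(\<integral>\<^sup>+y. k (x - y) \<partial>lborel) = (\<integral>\<^sup>+y. k y \<partial>lborel)" for x
    using nn_integral_lborel_affine[of k "-1" x] by simp
  have trans: "(\<integral>\<^sup>+x. k (x - y) \<partial>lborel) = (\<integral>\<^sup>+y. k y \<partial>lborel)" for y
    using nn_integral_lborel_affine[of k "1" "-y"] by simp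
  have "(\<integral>\<^sup>+x. enn_powr (\<integral>\<^sup>+y. k (x - y) * h y \<partial>lborel) r \<partial>lborel)
     \<le> (\<integral>\<^sup>+x. ennreal (c powr (r - 1)) * (\<integral>\<^sup>+y. k (x - y) * enn_powr (h y) r \<partial>lborel) \<partial>lborel)"
    using r c k(1) by (intro nn_integral_mono Jensen_nn_integral) (auto simp: refl)
  also have "\<dots> = ennreal (c powr (r - 1)) * (\<integral>\<^sup>+x. (\<integral>\<^sup>+y. k (x - y) * enn_powr (h y) r \<partial>lborel) \<partial>lborel)"
    by (rule nn_integral_cmult) measurable
  also have "(\<integral>\<^sup>+x. (\<integral>\<^sup>+y. k (x - y) * enn_powr (h y) r \<partial>lborel) \<partial>lborel)
      = (\<integral>\<^sup>+y. (\<integral>\<^sup>+x. k (x - y) * enn_powr (h y) r \<partial>lborel) \<partial>lborel)"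
    by (rule lborel_pair.Fubini') measurable
  also have "\<dots> = (\<integral>\<^sup>+x. k x \<partial>lborel) * (\<integral>\<^sup>+y. enn_powr (h y) r \<partial>lborel)"
    by (simp add: nn_integral_multc trans nn_integral_cmult)
  also have "ennreal (c powr (r - 1)) * ((\<integral>\<^sup>+x. k x \<partial>lborel) * (\<integral>\<^sup>+y. enn_powr (h y) r \<partial>lborel))
      \<le> ennreal (c powr (r - 1)) * (ennreal c * (\<integral>\<^sup>+y. enn_powr (h y) r \<partial>lborel))"
    by (intro mult_left_mono mult_right_mono k) auto
  also have "\<dots> = ennreal (c powr r) * (\<integral>\<^sup>+y. enn_powr (h y) r \<partial>lborel)"
    using c powr_add[of c "r - 1" 1] by (simp add: mult.assoc[symmetric] flip: ennreal_mult)
  finally show ?thesis .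
qed

text \<open>
  The convolution belongs to \<open>L\<^sup>r\<close> by \<open>Young_Lp\<close> and is bounded
  by \<open>Bernstein_sup\<close>; \<open>L\<^sup>q\<close> lies in between.
\<close>

lemma Bernstein:
  fixes k h :: "real^'n::finite \<Rightarrow> ennreal"
  assumes r: "1 \<le> r" "r \<le> q" and c: "0 < c" and L: "0 < L"
    and k: "(\<integral>\<^sup>+x. k x \<partial>lborel) \<le> ennreal c" "\<And>x. k x \<le> ennreal (c * L)"
    and [measurable]: "k \<in> borel_measurable borel" "h \<in> borel_measurable borel"
  shows "Lnorm (ennreal q) lborel (\<lambda>x. \<integral>\<^sup>+y. k (x - y) * h y \<partial>lborel)
    \<le> ennreal (c * L powr (1 / r - 1 / q)) * Lnorm (ennreal r) lborel h"
proof -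
  define N where "N = Lnorm (ennreal r) lborel h"
  let ?g = "\<lambda>x. \<integral>\<^sup>+y. k (x - y) * h y \<partial>lborel"
  have Np: "(\<integral>\<^sup>+y. enn_powr (h y) r \<partial>lborel) = enn_powr N r"
    using r by (simp add: N_def Lnorm_real enn_powr_powr)
  have "(\<integral>\<^sup>+x. enn_powr (?g x) q \<partial>lborel)
     \<le> (\<integral>\<^sup>+x. enn_powr (ennreal (c * L powr (1 / r)) * N) (q - r) * enn_powr (?g x) r \<partial>lborel)"
  proof (rule nn_integral_mono)
    fix x
    have "enn_powr (?g x) q = enn_powr (?g x) (q - r) * enn_powr (?g x) r"
      using enn_powr_add[of "?g x" "q - r" r] by simp
    also have "\<dots> \<le> enn_powr (ennreal (c * L powr (1 / r)) * N) (q - r) * enn_powr (?g x) r"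
      unfolding N_def using r assms by (intro mult_right_mono enn_powr_mono Bernstein_sup) auto
    finally show "enn_powr (?g x) q \<le> enn_powr (ennreal (c * L powr (1 / r)) * N) (q - r) * enn_powr (?g x) r" .
  qed
  also have "\<dots> = enn_powr (ennreal (c * L powr (1 / r)) * N) (q - r) * (\<integral>\<^sup>+x. enn_powr (?g x) r \<partial>lborel)"
    by (rule nn_integral_cmult) measurable
  also have "\<dots> \<le> enn_powr (ennreal (c * L powr (1 / r)) * N) (q - r) * (ennreal (c powr r) * enn_powr N r)"
    unfolding Np[symmetric] using assms by (intro mult_left_mono Young_Lp) auto
  also have "\<dots> = ennreal ((c * L powr (1 / r)) powr (q - r) * c powr r) * enn_powr N q"
  proof -
    define c' where "c' = c * L powr (1 / r)"
    then have "0 < c'" using c L by simp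
    then show ?thesis unfolding c'_def[symmetric]
      using enn_powr_add[of N "q - r" r] c by (simp add: enn_powr_mult enn_powr_ennreal ennreal_mult mult_ac)
  qed
  also have "(c * L powr (1 / r)) powr (q - r) * c powr r = (c * L powr (1 / r - 1 / q)) powr q"
  proof -
    have "(1 / r) * (q - r) = (1 / r - 1 / q) * q" using r by (simp add: field_simps)
    moreover have "c powr (q - r) * c powr r = c powr q" by (simp flip: powr_add)
    ultimately show ?thesis using c L by (simp add: powr_mult powr_powr)
  qed
  also have "ennreal \<dots> * enn_powr N q = enn_powr (ennreal (c * L powr (1 / r - 1 / q)) * N) q"
    using c L by (simp add: enn_powr_mult enn_powr_ennreal)
  finally have "(\<integral>\<^sup>+x. enn_powr (?g x) q \<partial>lborel) \<le> enn_powr (ennreal (c * L powr (1 / r - 1 / q)) * N) q" .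
  from enn_powr_mono[OF _ this, of "1 / q"] show ?thesis
    using r by (simp add: Lnorm_real enn_powr_powr N_def)
qed

text \<open>
  Hoelder's inequality with exponents \<open>p\<close> and \<open>s\<close>, where \<open>1/r = 1/p + 1/s\<close>, followed by an
  interpolation of \<open>L\<^sup>s\<close> between \<open>L\<^sup>p\<close> and the bounded functions, on which \<open>g\<close> is controlled by its
  \<open>L\<^sup>p\<close> norm. The assumptions on \<open>r\<close> say that \<open>s \<ge> p\<close>.
\<close>

lemma product_Lnorm:
  assumes r: "0 < r" "r \<le> p" "p \<le> 2 * r" and c: "1 \<le> c" and L: "0 < L"
    and g: "\<And>x. g x \<le> ennreal (c * L powr (1 / p)) * Lnorm (ennreal p) M g"
    and [measurable]: "f \<in> borel_measurable M" "g \<in> borel_measurable M"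
  shows "Lnorm (ennreal r) M (\<lambda>x. f x * g x)
    \<le> ennreal (c * L powr (2 / p - 1 / r)) * (Lnorm (ennreal p) M f * Lnorm (ennreal p) M g)"
proof -
  define N where "N = Lnorm (ennreal p) M g"
  define \<theta> where "\<theta> = p / r - 1"
  have \<theta>: "0 \<le> \<theta>" "\<theta> \<le> 1" "\<theta> * r = p - r" using r by (auto simp: \<theta>_def field_simps)
  have G: "enn_powr (g x) ((1 - \<theta>) * r) \<le> enn_powr (ennreal (c * L powr (1 / p)) * N) ((1 - \<theta>) * r)" for x
    unfolding N_def using \<theta> r by (intro enn_powr_mono g) auto
  have NN: "(\<integral>\<^sup>+x. enn_powr (g x) p \<partial>M) = enn_powr N p" and FF: "(\<integral>\<^sup>+x. enn_powr (f x) p \<partial>M) = enn_powr (Lnorm (ennreal p) M f) p"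
    using r by (auto simp: N_def Lnorm_real enn_powr_powr)
  define X where "X = ennreal (c * L powr (1 / p)) * N"
  have "(\<integral>\<^sup>+x. enn_powr (f x * g x) r \<partial>M) \<le> enn_powr X ((1 - \<theta>) * r) * (enn_powr (Lnorm (ennreal p) M f) r * enn_powr N (\<theta> * r))"
    if "r < p"
  proof -
    have "(\<integral>\<^sup>+x. enn_powr (f x * g x) r \<partial>M)
      \<le> (\<integral>\<^sup>+x. enn_powr X ((1 - \<theta>) * r) * (enn_powr (f x) r * enn_powr (g x) (\<theta> * r)) \<partial>M)"
    proof (rule nn_integral_mono)
      fix x
      have "enn_powr (g x) r = enn_powr (g x) ((1 - \<theta>) * r) * enn_powr (g x) (\<theta> * r)"
        using enn_powr_add[of "g x" "(1 - \<theta>) * r" "\<theta> * r"] by (simp add: algebra_simps)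
      then show "enn_powr (f x * g x) r \<le> enn_powr X ((1 - \<theta>) * r) * (enn_powr (f x) r * enn_powr (g x) (\<theta> * r))"
        using mult_right_mono[OF G[of x], of "enn_powr (f x) r * enn_powr (g x) (\<theta> * r)"]
        by (simp add: enn_powr_mult X_def mult_ac)
    qed
    also have "\<dots> = enn_powr X ((1 - \<theta>) * r) * (\<integral>\<^sup>+x. enn_powr (f x) r * enn_powr (g x) (\<theta> * r) \<partial>M)"
      by (rule nn_integral_cmult) measurable
    also have "(\<integral>\<^sup>+x. enn_powr (f x) r * enn_powr (g x) (\<theta> * r) \<partial>M) \<le> enn_powr (Lnorm (ennreal p) M f) r * enn_powr N (\<theta> * r)"
    proof -
      have ab: "0 < r / p" "0 < 1 - r / p" "r / p + (1 - r / p) = 1" using that r by auto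
      have "p * (1 - r / p) = p - r" using r by (simp add: algebra_simps)
      then have e: "p * (1 - r / p) = \<theta> * r" using \<theta> by simp
      show ?thesis
        using Hoelder_nn_integral[OF ab, of "\<lambda>x. enn_powr (f x) p" M "\<lambda>x. enn_powr (g x) p"] r
        unfolding NN FF by (simp add: enn_powr_powr e)
    qed
    finally show ?thesis by (simp add: mult_left_mono)
  qed
  moreover have "(\<integral>\<^sup>+x. enn_powr (f x * g x) r \<partial>M) \<le> enn_powr X ((1 - \<theta>) * r) * enn_powr (Lnorm (ennreal p) M f) r"
    if "r = p"
  proof -
    have "(\<integral>\<^sup>+x. enn_powr (f x * g x) r \<partial>M) \<le> (\<integral>\<^sup>+x. enn_powr X r * enn_powr (f x) r \<partial>M)"
      unfolding enn_powr_mult X_def N_def using r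
    proof (intro nn_integral_mono)
      fix x
      have "enn_powr (g x) r \<le> enn_powr X r"
        unfolding X_def N_def using r by (intro enn_powr_mono g) auto
      from mult_left_mono[OF this, of "enn_powr (f x) r"]
      show "enn_powr (f x) r * enn_powr (g x) r \<le> enn_powr (ennreal (c * L powr (1 / p))) r * enn_powr (Lnorm (ennreal p) M g) r * enn_powr (f x) r"
        by (simp add: X_def N_def enn_powr_mult mult_ac)
    qed
    then show ?thesis
      using that r FF by (simp add: nn_integral_cmult \<theta>_def)
  qed
  moreover have "enn_powr X ((1 - \<theta>) * r) * (enn_powr (Lnorm (ennreal p) M f) r * enn_powr N (\<theta> * r)) =
      ennreal ((c * L powr (1 / p)) powr ((1 - \<theta>) * r)) * enn_powr (Lnorm (ennreal p) M f * N) r"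
    using enn_powr_add[of N "(1 - \<theta>) * r" "\<theta> * r"] c L
    by (simp add: X_def enn_powr_mult enn_powr_ennreal algebra_simps)
  moreover have "enn_powr X ((1 - \<theta>) * r) * enn_powr (Lnorm (ennreal p) M f) r =
      ennreal ((c * L powr (1 / p)) powr ((1 - \<theta>) * r)) * enn_powr (Lnorm (ennreal p) M f * N) r" if "r = p"
    using that r c L by (simp add: X_def enn_powr_mult enn_powr_ennreal \<theta>_def mult_ac)
  ultimately have "(\<integral>\<^sup>+x. enn_powr (f x * g x) r \<partial>M)
     \<le> ennreal ((c * L powr (1 / p)) powr ((1 - \<theta>) * r)) * enn_powr (Lnorm (ennreal p) M f * N) r"
    using r by (cases "r = p") auto
  also have "(c * L powr (1 / p)) powr ((1 - \<theta>) * r) \<le> (c * L powr (2 / p - 1 / r)) powr r"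
  proof -
    have e: "(1 - \<theta>) * r / p = (2 / p - 1 / r) * r" using r by (simp add: \<theta>_def field_simps)
    have "(c * L powr (1 / p)) powr ((1 - \<theta>) * r) = c powr ((1 - \<theta>) * r) * L powr ((2 / p - 1 / r) * r)"
      using c L e by (simp add: powr_mult powr_powr)
    also have "\<dots> \<le> c powr r * L powr ((2 / p - 1 / r) * r)"
      using c \<theta> r by (intro mult_right_mono powr_mono) (auto simp: mult_left_le_one_le algebra_simps)
    also have "\<dots> = (c * L powr (2 / p - 1 / r)) powr r"
      using c L by (simp add: powr_mult powr_powr)
    finally show ?thesis .
  qed
  finally have "(\<integral>\<^sup>+x. enn_powr (f x * g x) r \<partial>M) \<le> enn_powr (ennreal (c * L powr (2 / p - 1 / r)) * (Lnorm (ennreal p) M f * N)) r"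
    using c L by (simp add: enn_powr_mult[of "ennreal _"] enn_powr_ennreal ennreal_leI mult_right_mono)
  from enn_powr_mono[OF _ this, of "1 / r"] show ?thesis
    using r by (simp add: Lnorm_real enn_powr_powr N_def)
qed

section \<open>Seminorms and tempered functionals\<close>

lemma tempered_add:
  assumes "tempered u" "\<phi> \<in> schwartz" "\<psi> \<in> schwartz"
  shows "u (\<lambda>x. \<phi> x + \<psi> x) = u \<phi> + u \<psi>"
proof -
  have "\<forall>\<phi>\<in>schwartz. \<forall>\<psi>\<in>schwartz. u (\<lambda>x. \<phi> x + \<psi> x) = u \<phi> + u \<psi>"
    using assms(1) unfolding tempered_def by (elim conjE)
  from this[rule_format, OF assms(2,3)] show ?thesis .
qed

lemma tempered_cmult:
  assumes "tempered u" "\<phi> \<in> schwartz"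
  shows "u (\<lambda>x. c * \<phi> x) = c * u \<phi>"
proof -
  have "\<forall>c. \<forall>\<phi>\<in>schwartz. u (\<lambda>x. c * \<phi> x) = c * u \<phi>"
    using assms(1) unfolding tempered_def by (elim conjE)
  from this[rule_format, OF assms(2)] show ?thesis .
qed

lemma schwartz_zero: "(\<lambda>x. 0) \<in> (schwartz :: (real^'n::finite \<Rightarrow> complex) set)"
  by (rule schwartz_coinduct[where X = "{\<lambda>x. 0}"]) (auto simp: partial_const)

lemma tempered_zero: "tempered u \<Longrightarrow> u (\<lambda>x. 0) = 0"
  using tempered_cmult[OF _ schwartz_zero, of u 0] by simp

definition seminorm_le :: "nat \<Rightarrow> (real^'n::finite \<Rightarrow> complex) \<Rightarrow> real \<Rightarrow> bool" where
  "seminorm_le N \<phi> B \<longleftrightarrow> (\<forall>\<alpha> x. length \<alpha> \<le> N \<longrightarrow> (1 + norm x) ^ N * norm (partials \<alpha> \<phi> x) \<le> B)"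

lemma tempered_iff: "tempered u \<longleftrightarrow>
     (\<forall>\<phi>\<in>schwartz. \<forall>\<psi>\<in>schwartz. u (\<lambda>x. \<phi> x + \<psi> x) = u \<phi> + u \<psi>) \<and>
     (\<forall>c. \<forall>\<phi>\<in>schwartz. u (\<lambda>x. c * \<phi> x) = c * u \<phi>) \<and>
     (\<exists>C N. \<forall>\<phi>\<in>schwartz. \<forall>B. seminorm_le N \<phi> B \<longrightarrow> norm (u \<phi>) \<le> C * B)"
  unfolding tempered_def seminorm_le_def ..

lemma seminorm_le_mono: "seminorm_le N \<phi> B \<Longrightarrow> M \<le> N \<Longrightarrow> seminorm_le M \<phi> B"
  unfolding seminorm_le_def
proof (intro allI impI)
  fix \<alpha> :: "'a list" and x
  assume *: "\<forall>\<alpha> x. length \<alpha> \<le> N \<longrightarrow> (1 + norm x) ^ N * norm (partials \<alpha> \<phi> x) \<le> B" and le: "M \<le> N" "length \<alpha> \<le> M"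
  have "(1 + norm x) ^ M * norm (partials \<alpha> \<phi> x) \<le> (1 + norm x) ^ N * norm (partials \<alpha> \<phi> x)"
    using le by (intro mult_right_mono power_increasing) auto
  also have "\<dots> \<le> B" using * le by auto
  finally show "(1 + norm x) ^ M * norm (partials \<alpha> \<phi> x) \<le> B" .
qed

lemma seminorm_exists:
  fixes \<phi> :: "real^'n::finite \<Rightarrow> complex"
  assumes \<phi>: "\<phi> \<in> schwartz"
  shows "\<exists>B. seminorm_le N \<phi> B"
proof -
  let ?A = "{\<alpha> :: 'n list. length \<alpha> \<le> N}"
  have fin: "finite ?A" using finite_lists_length_le[of "UNIV :: 'n set" N] by simp
  have "\<forall>\<alpha>. \<exists>B. \<forall>x. (1 + norm x) ^ N * norm (partials \<alpha> \<phi> x) \<le> B"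
    using schwartz_decay[OF schwartz_partials[OF \<phi>]] by blast
  then obtain B where B: "\<And>\<alpha> x. (1 + norm x) ^ N * norm (partials \<alpha> \<phi> x) \<le> B \<alpha>" by metis
  have "seminorm_le N \<phi> (Max (B ` ?A))"
    unfolding seminorm_le_def using fin by (intro allI impI order_trans[OF B] Max_ge) auto
  then show ?thesis by blast
qed

lemma seminorm_weight:
  fixes \<phi> :: "real^'n::finite \<Rightarrow> complex"
  assumes "seminorm_le (2 * CARD('n)) \<phi> B"
  shows "norm (\<phi> x) \<le> B * weight x"
proof -
  have "(1 + norm x) ^ (2 * CARD('n)) * norm (\<phi> x) \<le> B"
    using assms unfolding seminorm_le_def by (auto dest: spec[of _ "[]"])
  moreover have "0 < (1 + norm x) ^ (2 * CARD('n))" by (intro zero_less_power add_pos_nonneg) auto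
  ultimately show ?thesis by (simp add: weight_def field_simps)
qed

lemma seminorm_partial:
  fixes \<phi> :: "real^'n::finite \<Rightarrow> complex"
  assumes "seminorm_le (2 * CARD('n)) \<phi> B"
  shows "(1 + norm x) ^ (2 * CARD('n)) * norm (partial j \<phi> x) \<le> B"
proof -
  have "length [j] \<le> 2 * CARD('n)" using zero_less_card_finite[where 'a = 'n] by simp
  then have "(1 + norm x) ^ (2 * CARD('n)) * norm (partials [j] \<phi> x) \<le> B"
    using assms unfolding seminorm_le_def by blast
  then show ?thesis by (simp add: partials_Cons)
qed

lemma seminorm_nonneg:
  fixes \<phi> :: "real^'n::finite \<Rightarrow> complex"
  assumes "seminorm_le (2 * CARD('n)) \<phi> B"
  shows "0 \<le> B"
  using seminorm_weight[OF assms, of 0] norm_ge_zero[of "\<phi> 0"] weight_pos[of "0 :: real^'n"]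
  by (metis less_eq_real_def mult_less_0_iff not_less order_trans)

lemma tempered_bound:
  "tempered u \<Longrightarrow> \<exists>C N. \<forall>\<phi>\<in>schwartz. \<forall>B. seminorm_le N \<phi> B \<longrightarrow> norm (u \<phi>) \<le> C * B"
  unfolding tempered_iff by (elim conjE)

lemma tempered_sum:
  assumes u: "tempered u" and v: "tempered v"
  shows "tempered (\<lambda>\<phi>. u \<phi> + v \<phi>)"
proof -
  obtain C\<^sub>1 N\<^sub>1 where C1: "\<And>\<phi> B. \<phi> \<in> schwartz \<Longrightarrow> seminorm_le N\<^sub>1 \<phi> B \<Longrightarrow> norm (u \<phi>) \<le> C\<^sub>1 * B"
    using tempered_bound[OF u] by blast
  obtain C\<^sub>2 N\<^sub>2 where C2: "\<And>\<phi> B. \<phi> \<in> schwartz \<Longrightarrow> seminorm_le N\<^sub>2 \<phi> B \<Longrightarrow> norm (v \<phi>) \<le> C\<^sub>2 * B"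
    using tempered_bound[OF v] by blast
  have "norm (u \<phi> + v \<phi>) \<le> (C\<^sub>1 + C\<^sub>2) * B" if "\<phi> \<in> schwartz" "seminorm_le (max N\<^sub>1 N\<^sub>2) \<phi> B" for \<phi> B
    unfolding distrib_right
    using that by (intro order_trans[OF norm_triangle_ineq] add_mono C1 C2) (auto intro: seminorm_le_mono)
  then show ?thesis
    unfolding tempered_iff by (auto simp: tempered_add[OF u] tempered_add[OF v] tempered_cmult[OF u] tempered_cmult[OF v] distrib_left)
qed

lemma tempered_scale:
  assumes u: "tempered u"
  shows "tempered (\<lambda>\<phi>. c * u \<phi>)"
proof -
  obtain C N where C: "\<And>\<phi> B. \<phi> \<in> schwartz \<Longrightarrow> seminorm_le N \<phi> B \<Longrightarrow> norm (u \<phi>) \<le> C * B"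
    using tempered_bound[OF u] by blast
  have "norm (c * u \<phi>) \<le> (norm c * C) * B" if "\<phi> \<in> schwartz" "seminorm_le N \<phi> B" for \<phi> B
    using mult_left_mono[OF C[OF that], of "norm c"] by (simp add: norm_mult mult.assoc)
  then show ?thesis
    unfolding tempered_iff by (auto simp: tempered_add[OF u] tempered_cmult[OF u] distrib_left)
qed

lemma tempered_cong:
  assumes "tempered u" "\<And>\<phi>. \<phi> \<in> schwartz \<Longrightarrow> u \<phi> = v \<phi>"
  shows "tempered v"
  using assms(1) unfolding tempered_iff by (simp add: assms(2) schwartz_add schwartz_cmult cong: ball_cong)

lemma tempered_tame:
  fixes f :: "real^'n::finite \<Rightarrow> complex"
  assumes f: "tame f"
  shows "tempered (\<lambda>\<phi>. \<integral>x. f x * \<phi> x \<partial>lborel)"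
proof -
  have "norm (\<integral>x. f x * \<phi> x \<partial>lborel) \<le> (\<integral>x. weight x * norm (f x) \<partial>lborel) * B"
    if "\<phi> \<in> schwartz" "seminorm_le (2 * CARD('n)) \<phi> B" for \<phi> B
    using tame_mult_le[OF f seminorm_weight[OF that(2)]] by (simp add: mult.commute)
  then show ?thesis
    unfolding tempered_iff
    by (auto simp: distrib_left tame_mult_integrable[OF f] mult.left_commute)
qed

lemma test_multiplier_linear:
  fixes m \<phi> \<psi> :: "real^'n::finite \<Rightarrow> complex"
  assumes m: "m \<in> schwartz" and \<phi>: "\<phi> \<in> schwartz" and \<psi>: "\<psi> \<in> schwartz"
  shows "test_multiplier m (\<lambda>x. \<phi> x + \<psi> x) = (\<lambda>x. test_multiplier m \<phi> x + test_multiplier m \<psi> x)"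
    and "test_multiplier m (\<lambda>x. c * \<phi> x) = (\<lambda>x. c * test_multiplier m \<phi> x)"
proof -
  have int: "integrable lborel (\<lambda>y. inv_fourier m (y - x) * \<phi> y)" if "\<phi> \<in> schwartz" for x and \<phi> :: "real^'n \<Rightarrow> complex"
    using schwartz_integrable[OF schwartz_mult[OF schwartz_translate[OF inv_fourier_schwartz[OF m]] that]] .
  show "test_multiplier m (\<lambda>x. \<phi> x + \<psi> x) = (\<lambda>x. test_multiplier m \<phi> x + test_multiplier m \<psi> x)"
    using int[OF \<phi>] int[OF \<psi>]
    by (auto simp: test_multiplier_eq_convolution[OF m] \<phi> \<psi> schwartz_add distrib_left)
  show "test_multiplier m (\<lambda>x. c * \<phi> x) = (\<lambda>x. c * test_multiplier m \<phi> x)"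
    by (auto simp: test_multiplier_eq_convolution[OF m] \<phi> schwartz_cmult mult.left_commute[of _ c])
qed

text \<open>Derivatives commute with multipliers, so one weighted estimate controls all seminorms.\<close>

lemma tempered_test_multiplier:
  fixes m :: "real^'n::finite \<Rightarrow> complex"
  assumes u: "tempered u" and m: "m \<in> schwartz"
  shows "tempered (\<lambda>\<phi>. u (test_multiplier m \<phi>))"
proof -
  obtain C N where C: "\<And>\<phi> B. \<phi> \<in> schwartz \<Longrightarrow> seminorm_le N \<phi> B \<Longrightarrow> norm (u \<phi>) \<le> C * B"
    using tempered_bound[OF u] by blast
  let ?K = "inv_fourier m"
  have K: "?K \<in> schwartz" by (rule inv_fourier_schwartz[OF m])
  note [measurable] = schwartz_measurable[OF K]
  define c where "c = (\<integral>z. (1 + norm z) ^ N * norm (?K z) \<partial>lborel)"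
  have "norm (u (test_multiplier m \<phi>)) \<le> (C * c) * B" if \<phi>: "\<phi> \<in> schwartz" and B: "seminorm_le N \<phi> B" for \<phi> B
  proof -
    have "seminorm_le N (test_multiplier m \<phi>) (c * B)"
      unfolding seminorm_le_def
    proof (intro allI impI)
      fix \<alpha> :: "'n list" and x :: "real^'n" assume len: "length \<alpha> \<le> N"
      let ?\<psi> = "partials \<alpha> \<phi>"
      have \<psi>: "?\<psi> \<in> schwartz" by (rule schwartz_partials[OF \<phi>])
      have px: "0 < (1 + norm x) ^ N" for x :: "real^'n" by (intro zero_less_power add_pos_nonneg) auto
      have le: "norm (?K (y - x) * ?\<psi> y) \<le> (1 + norm (y - x)) ^ N * norm (?K (y - x)) * (B / (1 + norm x) ^ N)" for y
      proof -
        have "1 + norm x \<le> (1 + norm (x + (y - x))) * (1 + norm (y - x))" by (rule one_plus_norm_le)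
        then have "(1 + norm x) ^ N \<le> (1 + norm y) ^ N * (1 + norm (y - x)) ^ N"
          unfolding power_mult_distrib[symmetric] by (intro power_mono) auto
        then have "(1 + norm x) ^ N * norm (?\<psi> y) \<le> (1 + norm y) ^ N * (1 + norm (y - x)) ^ N * norm (?\<psi> y)"
          by (rule mult_right_mono) simp
        also have "\<dots> = (1 + norm (y - x)) ^ N * ((1 + norm y) ^ N * norm (?\<psi> y))" by simp
        also have "\<dots> \<le> (1 + norm (y - x)) ^ N * B"
          using B len by (intro mult_left_mono) (auto simp: seminorm_le_def)
        finally have "norm (?\<psi> y) \<le> (1 + norm (y - x)) ^ N * B / (1 + norm x) ^ N"
          using px[of x] by (simp add: field_simps)
        from mult_left_mono[OF this, of "norm (?K (y - x))"] show ?thesis by (simp add: norm_mult mult_ac)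
      qed
      have int: "integrable lborel (\<lambda>y. (1 + norm (y - x)) ^ N * norm (?K (y - x)))"
        using lborel_integrable_affine[OF schwartz_norm_integrable[OF K, of N], of 1 "-x"] by simp
      have "norm (test_multiplier m ?\<psi> x) \<le> (\<integral>y. (1 + norm (y - x)) ^ N * norm (?K (y - x)) * (B / (1 + norm x) ^ N) \<partial>lborel)"
        unfolding test_multiplier_eq_convolution[OF m \<psi>] by (intro norm_integral_le integrable_mult_left int le)
      also have "\<dots> = c * B / (1 + norm x) ^ N"
        using lborel_integral_affine[of "\<lambda>z. (1 + norm z) ^ N * norm (?K z)" 1 "-x"] by (simp add: c_def)
      finally show "(1 + norm x) ^ N * norm (partials \<alpha> (test_multiplier m \<phi>) x) \<le> c * B"
        unfolding partials_test_multiplier[OF m \<phi>] using px[of x] by (simp add: field_simps)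
    qed
    from C[OF test_multiplier_schwartz[OF m \<phi>] this] show ?thesis by (simp add: mult.assoc)
  qed
  then show ?thesis
    unfolding tempered_iff
    by (auto simp: test_multiplier_linear[OF m] tempered_add[OF u] tempered_cmult[OF u] test_multiplier_schwartz[OF m])
qed

text \<open>
  The order of the seminorm is the one that controls the integral against
  \<^const>\<open>weight\<close>; all the series below are estimated with it.
\<close>

lemma tempered_infsum:
  fixes T :: "int \<Rightarrow> 'n::finite distr"
  assumes T: "\<And>j. tempered (T j)"
    and le: "\<And>j \<phi> B. \<phi> \<in> schwartz \<Longrightarrow> seminorm_le (2 * CARD('n)) \<phi> B \<Longrightarrow> norm (T j \<phi>) \<le> c j * B"
    and c: "c summable_on UNIV"
  shows "\<phi> \<in> schwartz \<Longrightarrow> (\<lambda>j. T j \<phi>) summable_on UNIV" and "tempered (\<lambda>\<phi>. \<Sum>\<^sub>\<infinity>j. T j \<phi>)"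
proof -
  have abs: "(\<lambda>j. norm (T j \<phi>)) summable_on UNIV" if \<phi>: "\<phi> \<in> schwartz" for \<phi>
  proof -
    obtain B where B: "seminorm_le (2 * CARD('n)) \<phi> B" using seminorm_exists[OF \<phi>] by blast
    have "(\<lambda>j. c j * B) summable_on UNIV" by (intro summable_on_cmult_left c)
    then show ?thesis by (rule summable_on_comparison_test) (use le[OF \<phi> B] in auto)
  qed
  then show sm: "\<phi> \<in> schwartz \<Longrightarrow> (\<lambda>j. T j \<phi>) summable_on UNIV" for \<phi>
    by (rule abs_summable_summable)
  have "norm (\<Sum>\<^sub>\<infinity>j. T j \<phi>) \<le> infsum c UNIV * B" if \<phi>: "\<phi> \<in> schwartz" and B: "seminorm_le (2 * CARD('n)) \<phi> B" for \<phi> B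
  proof -
    have "norm (\<Sum>\<^sub>\<infinity>j. T j \<phi>) \<le> (\<Sum>\<^sub>\<infinity>j. norm (T j \<phi>))" by (rule norm_infsum_bound) (rule abs[OF \<phi>])
    also have "\<dots> \<le> (\<Sum>\<^sub>\<infinity>j. c j * B)" by (intro infsum_mono abs[OF \<phi>] summable_on_cmult_left c le \<phi> B)
    also have "\<dots> = infsum c UNIV * B" by (rule infsum_cmult_left) (use c in auto)
    finally show ?thesis .
  qed
  then show "tempered (\<lambda>\<phi>. \<Sum>\<^sub>\<infinity>j. T j \<phi>)"
    unfolding tempered_iff
    by (auto simp: tempered_add[OF T] tempered_cmult[OF T] infsum_add sm infsum_cmult_right)
qed

section \<open>Convolution of a tempered distribution with a Schwartz function\<close>

lemma partials_translate:
  fixes k :: "real^'n::finite \<Rightarrow> complex"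
  assumes "k \<in> schwartz"
  shows "partials \<alpha> (\<lambda>y. k (y - x)) = (\<lambda>y. partials \<alpha> k (y - x))"
proof (induction \<alpha>)
  case (Cons i \<alpha>)
  show ?case
    unfolding partials_Cons Cons
    using partial_affine(2)[of "partials \<alpha> k" "-x" 1, OF schwartz_differentiable[OF schwartz_partials[OF assms]]]
    by (auto simp: fun_eq_iff)
qed simp

lemma partials_conv:
  fixes k h :: "real^'n::finite \<Rightarrow> complex"
  assumes "k \<in> schwartz" "tame h"
  shows "partials \<alpha> (conv k h) = conv (partials \<alpha> k) h"
proof (induction \<alpha>)
  case (Cons i \<alpha>)
  show ?case
    unfolding partials_Cons Cons
    using partial_eqI[OF conv_has_derivative[OF assms(2) schwartz_partials[OF assms(1)]], of i \<alpha>]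
    by (auto simp: sum_axis_scaleR)
qed simp

lemma partials_linear:
  fixes f g :: "real^'n::finite \<Rightarrow> complex"
  assumes "f \<in> schwartz" "g \<in> schwartz"
  shows "partials \<alpha> (\<lambda>x. f x + g x) = (\<lambda>x. partials \<alpha> f x + partials \<alpha> g x)"
    and "partials \<alpha> (\<lambda>x. c * f x) = (\<lambda>x. c * partials \<alpha> f x)"
proof -
  have D: "partials \<alpha> f differentiable (at x)" "partials \<alpha> g differentiable (at x)" for \<alpha> x
    using assms by (auto intro: schwartz_differentiable schwartz_partials)
  show "partials \<alpha> (\<lambda>x. f x + g x) = (\<lambda>x. partials \<alpha> f x + partials \<alpha> g x)"
  proof (induction \<alpha>)
    case (Cons i \<alpha>)
    show ?case unfolding partials_Cons Cons by (intro ext partial_add D)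
  qed simp
  show "partials \<alpha> (\<lambda>x. c * f x) = (\<lambda>x. c * partials \<alpha> f x)"
  proof (induction \<alpha>)
    case (Cons i \<alpha>)
    show ?case
      unfolding partials_Cons Cons
      using partial_eqI[OF has_derivative_mult_right[OF has_derivative_partial[OF D(1)]], of i c]
      by (auto simp: sum_axis_scaleR)
  qed simp
qed

lemma schwartz_sum:
  assumes "finite I" "\<And>i. i \<in> I \<Longrightarrow> f i \<in> schwartz"
  shows "(\<lambda>x. \<Sum>i\<in>I. f i x) \<in> (schwartz :: (real^'n::finite \<Rightarrow> complex) set)"
  using assms
proof (induction I)
  case empty
  show ?case by (simp add: schwartz_zero)
next
  case (insert i I)
  then show ?case by (simp add: schwartz_add)
qed

lemma partials_sum:
  fixes f :: "'i \<Rightarrow> real^'n::finite \<Rightarrow> complex"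
  assumes "finite I" "\<And>i. i \<in> I \<Longrightarrow> f i \<in> schwartz"
  shows "partials \<alpha> (\<lambda>x. \<Sum>i\<in>I. f i x) = (\<lambda>x. \<Sum>i\<in>I. partials \<alpha> (f i) x)"
  using assms
proof (induction I)
  case empty
  from partials_linear(2)[OF schwartz_zero schwartz_zero, of \<alpha> 0] show ?case by simp
next
  case (insert i I)
  then show ?case by (simp add: partials_linear(1) schwartz_sum)
qed

lemma tempered_finite_sum:
  assumes u: "tempered u" and "finite I" "\<And>i. i \<in> I \<Longrightarrow> f i \<in> schwartz"
  shows "u (\<lambda>x. \<Sum>i\<in>I. c i * f i x) = (\<Sum>i\<in>I. c i * u (f i))"
  using assms(2,3)
proof (induction I)
  case empty
  show ?case using tempered_zero[OF u] by simp
next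
  case (insert i I)
  then show ?case
    using tempered_add[OF u schwartz_cmult[of "f i" "c i"] schwartz_sum[of I "\<lambda>i x. c i * f i x"]]
    by (simp add: tempered_cmult[OF u] schwartz_cmult)
qed

text \<open>
  On each piece of the division the integrand differs from its value at the tag by at most
  \<open>e\<close>.
\<close>

lemma riemann_sum_error:
  fixes f :: "real^'n::finite \<Rightarrow> complex"
  assumes f: "continuous_on (cbox a b) f" and p: "p tagged_division_of (cbox a b)" "(\<lambda>x. ball x \<delta>) fine p"
    and e: "\<And>x x'. x \<in> cbox a b \<Longrightarrow> x' \<in> cbox a b \<Longrightarrow> dist x x' < \<delta> \<Longrightarrow> norm (f x - f x') \<le> e"
  shows "norm (integral (cbox a b) f - (\<Sum>(x, Q)\<in>p. of_real (measure lborel Q) * f x)) \<le> e * measure lborel (cbox a b)"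
proof -
  have int: "f integrable_on cbox a b" using f by (rule integrable_continuous)
  have "integral (cbox a b) f = (\<Sum>(x, Q)\<in>p. integral Q f)"
    by (rule integral_combine_tagged_division_topdown[OF int p(1)])
  then have "integral (cbox a b) f - (\<Sum>(x, Q)\<in>p. of_real (measure lborel Q) * f x)
      = (\<Sum>(x, Q)\<in>p. integral Q f - of_real (measure lborel Q) * f x)"
    by (simp add: sum_subtractf case_prod_beta)
  also have "norm \<dots> \<le> (\<Sum>(x, Q)\<in>p. e * measure lborel Q)"
  proof (rule order_trans[OF norm_sum], rule sum_mono, clarify)
    fix x Q assume xQ: "(x, Q) \<in> p"
    then obtain c d where Q: "Q = cbox c d" using p(1) by blast
    have sub: "Q \<subseteq> cbox a b" "x \<in> Q" using p(1) xQ by blast+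
    have "Q \<subseteq> ball x \<delta>" using p(2) xQ unfolding fine_def by blast
    then have le: "norm (f y - f x) \<le> e" if "y \<in> cbox c d" for y
      using that sub Q by (intro e) (auto simp: dist_commute)
    have intQ: "f integrable_on cbox c d" using Henstock_Kurzweil_Integration.integrable_subinterval[OF int] sub Q by blast
    have e0: "0 \<le> e" using le[of x] sub Q by simp
    have "norm (integral (cbox c d) (\<lambda>y. f y - f x)) \<le> e * measure lborel (cbox c d)"
      using e0 le by (intro has_integral_bound[OF _ integrable_integral] Henstock_Kurzweil_Integration.integrable_diff intQ integrable_const) auto
    moreover have "integral (cbox c d) (\<lambda>y. f y - f x) = integral (cbox c d) f - of_real (measure lborel (cbox c d)) * f x"
      using intQ by (subst Henstock_Kurzweil_Integration.integral_diff) (auto simp: scaleR_conv_of_real)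
    ultimately show "norm (integral Q f - of_real (measure lborel Q) * f x) \<le> e * measure lborel Q"
      by (simp add: Q)
  qed
  also have "\<dots> = e * measure lborel (cbox a b)"
    using additive_content_tagged_division[OF p(1)] by (simp add: case_prod_beta sum_distrib_left[symmetric])
  finally show ?thesis .
qed

text \<open>
  A translation by \<open>x\<close> changes the weight at most by the factor \<open>(1 + norm
  x)\<^sup>N\<close>, and an increment is controlled by the derivatives of the next order.
\<close>

lemma translate_seminorm:
  fixes k :: "real^'n::finite \<Rightarrow> complex"
  assumes k: "k \<in> schwartz"
  shows "\<exists>B\<ge>0. \<forall>\<alpha> x y. length \<alpha> \<le> N \<longrightarrow> (1 + norm y) ^ N * norm (partials \<alpha> k (y - x)) \<le> B * (1 + norm x) ^ N"
    and "\<exists>L\<ge>0. \<forall>\<alpha> x x' y. length \<alpha> \<le> N \<longrightarrow> (1 + norm y) ^ N * norm (partials \<alpha> k (y - x') - partials \<alpha> k (y - x))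
      \<le> L * norm (x - x') * (1 + norm (x - x')) ^ N * (1 + norm x) ^ N"
proof -
  have px: "(1 + norm y) ^ N \<le> (1 + norm (y - x)) ^ N * (1 + norm x) ^ N" for x y :: "real^'n"
    using one_plus_norm_le[of y "-x"] unfolding power_mult_distrib[symmetric] by (intro power_mono) auto
  have shift: "(1 + norm y) ^ N * c \<le> D * (1 + norm x) ^ N" if "(1 + norm (y - x)) ^ N * c \<le> D" "0 \<le> c" for x y :: "real^'n" and c D
  proof -
    have "(1 + norm y) ^ N * c \<le> ((1 + norm (y - x)) ^ N * (1 + norm x) ^ N) * c" using px that(2) by (rule mult_right_mono)
    also have "\<dots> = ((1 + norm (y - x)) ^ N * c) * (1 + norm x) ^ N" by simp
    also have "\<dots> \<le> D * (1 + norm x) ^ N" using that(1) by (rule mult_right_mono) simp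
    finally show ?thesis .
  qed
  obtain B where B: "seminorm_le N k B" using seminorm_exists[OF k] by blast
  then have B1: "(1 + norm y) ^ N * norm (partials \<alpha> k y) \<le> B" if "length \<alpha> \<le> N" for \<alpha> y
    using that unfolding seminorm_le_def by blast
  have "0 \<le> B" using order_trans[OF norm_ge_zero[of "k 0"], of B] B1[of "[]" 0] by (simp add: partials_Nil)
  then show "\<exists>B\<ge>0. \<forall>\<alpha> x y. length \<alpha> \<le> N \<longrightarrow> (1 + norm y) ^ N * norm (partials \<alpha> k (y - x)) \<le> B * (1 + norm x) ^ N"
    using shift[OF B1] by (intro exI[of _ B]) auto
  have "\<forall>\<alpha>. \<exists>B\<ge>0. \<forall>j z. (1 + norm z) ^ N * norm (partial j (partials \<alpha> k) z) \<le> B"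
    using schwartz_partial_bound[OF schwartz_partials[OF k]] by blast
  then obtain B' where B': "\<And>\<alpha>. 0 \<le> B' \<alpha>" "\<And>\<alpha> j z. (1 + norm z) ^ N * norm (partial j (partials \<alpha> k) z) \<le> B' \<alpha>" by metis
  define L where "L = (\<Sum>\<alpha> | length \<alpha> \<le> N. real CARD('n) * B' \<alpha>)"
  have fin: "finite {\<alpha> :: 'n list. length \<alpha> \<le> N}" using finite_lists_length_le[of "UNIV :: 'n set" N] by simp
  have inc: "(1 + norm (y - x)) ^ N * norm (partials \<alpha> k (y - x') - partials \<alpha> k (y - x)) \<le> L * norm (x - x') * (1 + norm (x - x')) ^ N"
    if len: "length \<alpha> \<le> N" for \<alpha> :: "'n list" and x x' y
  proof -
    have "(1 + norm (y - x)) ^ N * norm (partials \<alpha> k ((y - x) + (x - x')) - partials \<alpha> k (y - x))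
        \<le> real CARD('n) * B' \<alpha> * norm (x - x') * (1 + norm (x - x')) ^ N"
      by (rule schwartz_increment[OF schwartz_partials[OF k] B'(2)])
    also have "\<dots> \<le> L * norm (x - x') * (1 + norm (x - x')) ^ N"
      unfolding L_def using B'(1) len fin by (intro mult_right_mono member_le_sum) auto
    finally show ?thesis by simp
  qed
  have "0 \<le> L" unfolding L_def using B'(1) by (intro sum_nonneg mult_nonneg_nonneg) auto
  then show "\<exists>L\<ge>0. \<forall>\<alpha> x x' y. length \<alpha> \<le> N \<longrightarrow> (1 + norm y) ^ N * norm (partials \<alpha> k (y - x') - partials \<alpha> k (y - x))
      \<le> L * norm (x - x') * (1 + norm (x - x')) ^ N * (1 + norm x) ^ N"
    using shift[OF inc] by (intro exI[of _ L]) auto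
qed

lemma tempered_translate:
  fixes k :: "real^'n::finite \<Rightarrow> complex"
  assumes u: "tempered u" and k: "k \<in> schwartz"
  shows "\<exists>C N. 0 \<le> C \<and> (\<forall>x. norm (u (\<lambda>y. k (y - x))) \<le> C * (1 + norm x) ^ N)"
    and "continuous_on UNIV (\<lambda>x. u (\<lambda>y. k (y - x)))"
proof -
  obtain C N where C: "\<And>\<phi> B. \<phi> \<in> schwartz \<Longrightarrow> seminorm_le N \<phi> B \<Longrightarrow> norm (u \<phi>) \<le> C * B"
    using tempered_bound[OF u] by blast
  have kx: "(\<lambda>y. k (y - x)) \<in> schwartz" for x by (rule schwartz_translate[OF k])
  obtain B where B: "0 \<le> B" "\<And>\<alpha> x y. length \<alpha> \<le> N \<Longrightarrow> (1 + norm y) ^ N * norm (partials \<alpha> k (y - x)) \<le> B * (1 + norm x) ^ N"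
    using translate_seminorm(1)[OF k, of N] by blast
  obtain L where L: "\<And>\<alpha> x x' y. length \<alpha> \<le> N \<Longrightarrow> (1 + norm y) ^ N * norm (partials \<alpha> k (y - x') - partials \<alpha> k (y - x))
      \<le> L * norm (x - x') * (1 + norm (x - x')) ^ N * (1 + norm x) ^ N"
    using translate_seminorm(2)[OF k, of N] by blast
  have bound: "norm (u (\<lambda>y. k (y - x))) \<le> (C * B) * (1 + norm x) ^ N" for x
    using C[OF kx, of x "B * (1 + norm x) ^ N"] B(2) by (simp add: seminorm_le_def partials_translate[OF k] mult.assoc)
  have "0 \<le> C * B" using order_trans[OF norm_ge_zero[of "u k"], of "C * B"] bound[of 0] by simp
  then show "\<exists>C N. 0 \<le> C \<and> (\<forall>x. norm (u (\<lambda>y. k (y - x))) \<le> C * (1 + norm x) ^ N)" using bound by blast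
  have le: "norm (u (\<lambda>y. k (y - x')) - u (\<lambda>y. k (y - x))) \<le> C * (L * norm (x - x') * (1 + norm (x - x')) ^ N * (1 + norm x) ^ N)" for x x'
  proof -
    have "seminorm_le N (\<lambda>y. k (y - x') + (-1) * k (y - x)) (L * norm (x - x') * (1 + norm (x - x')) ^ N * (1 + norm x) ^ N)"
      unfolding seminorm_le_def partials_linear(1)[OF kx schwartz_cmult[OF kx]] partials_linear(2)[OF kx kx[of 0]] partials_translate[OF k]
      using L by simp
    from C[OF schwartz_add[OF kx schwartz_cmult[OF kx]] this] show ?thesis
      using tempered_add[OF u kx schwartz_cmult[OF kx], of x' "-1" x] tempered_cmult[OF u kx, of "-1" x] by simp
  qed
  show "continuous_on UNIV (\<lambda>x. u (\<lambda>y. k (y - x)))"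
    unfolding continuous_on_eq_continuous_at[OF open_UNIV] isCont_def
  proof (intro ballI)
    fix x :: "real^'n"
    have "((\<lambda>x'. C * (L * norm (x - x') * (1 + norm (x - x')) ^ N * (1 + norm x) ^ N)) \<longlongrightarrow> 0) (at x)"
      by (auto intro!: tendsto_eq_intros)
    then have "((\<lambda>x'. u (\<lambda>y. k (y - x')) - u (\<lambda>y. k (y - x))) \<longlongrightarrow> 0) (at x)"
      by (rule Lim_null_comparison[rotated]) (simp add: le)
    then show "((\<lambda>x'. u (\<lambda>y. k (y - x'))) \<longlongrightarrow> u (\<lambda>y. k (y - x))) (at x)"
      by (simp add: LIM_zero_iff)
  qed
qed

lemma tail_small:
  fixes f :: "real^'n::finite \<Rightarrow> real"
  assumes f: "integrable lborel f" "\<And>x. 0 \<le> f x" and "0 < e"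
  shows "\<exists>a b. (\<integral>x. indicator (- cbox a b) x * f x \<partial>lborel) < e"
proof -
  define A where "A k = cbox (- (\<chi> i. real k)) (\<chi> i. real k :: real^'n)" for k :: nat
  have "(\<lambda>k. \<integral>x. indicator (- A k) x * f x \<partial>lborel) \<longlonglongrightarrow> (\<integral>x. 0 \<partial>(lborel :: (real^'n) measure))"
  proof (rule integral_dominated_convergence[where w = f])
    show "AE x in lborel. (\<lambda>k. indicator (- A k) x * f x) \<longlonglongrightarrow> 0"
    proof (rule AE_I2)
      fix x :: "real^'n"
      obtain K :: nat where K: "norm x \<le> real K" using real_arch_simple by blast
      have "x \<in> A k" if "k \<ge> K" for k
      proof -
        have "\<bar>x $ i\<bar> \<le> real k" for i using component_le_norm_cart[of x i] K that by linarith
        then show ?thesis unfolding A_def mem_box_cart by (auto simp: abs_le_iff minus_le_iff)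
      qed
      then have "eventually (\<lambda>k. indicator (- A k) x * f x = 0) sequentially"
        unfolding eventually_sequentially by (intro exI[of _ K]) auto
      then show "(\<lambda>k. indicator (- A k) x * f x) \<longlonglongrightarrow> 0" by (rule tendsto_eventually)
    qed
    show "AE x in lborel. norm (indicator (- A k) x * f x) \<le> f x" for k
      using f(2) by (auto simp: indicator_def)
    show "(\<lambda>x. indicator (- A k) x * f x) \<in> borel_measurable lborel" for k
      using f(1) by (auto simp: A_def)
  qed (use f in auto)
  then have "eventually (\<lambda>k. (\<integral>x. indicator (- A k) x * f x \<partial>lborel) < e) sequentially"
    using assms(3) by (intro order_tendstoD(2)) auto
  then show ?thesis unfolding A_def eventually_sequentially by blast
qed

text \<open>
  A continuous functional may be moved under the integral sign, because the integral is a limit of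
  Riemann sums in every Schwartz seminorm.
\<close>

lemma tempered_convolution:
  fixes k \<phi> :: "real^'n::finite \<Rightarrow> complex"
  assumes u: "tempered u" and k: "k \<in> schwartz" and \<phi>: "\<phi> \<in> schwartz" and ck: "conv k \<phi> \<in> schwartz"
  shows "integrable lborel (\<lambda>x. u (\<lambda>y. k (y - x)) * \<phi> x)"
    and "u (conv k \<phi>) = (\<integral>x. u (\<lambda>y. k (y - x)) * \<phi> x \<partial>lborel)"
proof -
  let ?g = "\<lambda>x. u (\<lambda>y. k (y - x))"
  obtain C N where C: "\<And>\<phi> B. \<phi> \<in> schwartz \<Longrightarrow> seminorm_le N \<phi> B \<Longrightarrow> norm (u \<phi>) \<le> C * B"
    using tempered_bound[OF u] by blast
  obtain G M where G: "0 \<le> G" "\<And>x. norm (?g x) \<le> G * (1 + norm x) ^ M" using tempered_translate(1)[OF u k] by blast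
  have gc: "continuous_on UNIV ?g" by (rule tempered_translate(2)[OF u k])
  have kx: "(\<lambda>y. k (y - x)) \<in> schwartz" for x by (rule schwartz_translate[OF k])
  note [measurable] = borel_measurable_continuous_onI[OF gc] schwartz_measurable[OF \<phi>]
  have g\<phi>c: "continuous_on A (\<lambda>x. ?g x * \<phi> x)" for A
    by (intro continuous_on_mult continuous_on_subset[OF gc] schwartz_continuous \<phi>) auto
  let ?w = "\<lambda>x. (1 + norm x) ^ (M + N) * norm (\<phi> x)"
  have pw: "(1 + norm x) ^ M \<le> (1 + norm x) ^ (M + N)" "(1 + norm x) ^ N \<le> (1 + norm x) ^ (M + N)" for x :: "real^'n"
    by (intro power_increasing; simp)+
  have gle: "norm (?g x * \<phi> x) \<le> G * ?w x" for x
  proof -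
    have "norm (?g x) \<le> G * (1 + norm x) ^ (M + N)" using G pw(1)[of x] by (meson mult_left_mono order_trans)
    from mult_right_mono[OF this, of "norm (\<phi> x)"] show ?thesis by (simp add: norm_mult mult.assoc)
  qed
  have iw: "integrable lborel ?w" by (rule schwartz_norm_integrable[OF \<phi>])
  show ig: "integrable lborel (\<lambda>x. ?g x * \<phi> x)"
    by (rule Bochner_Integration.integrable_bound[OF integrable_mult_right[OF iw, of G]]) (use gle G(1) in \<open>auto simp: abs_mult\<close>)
  have t\<phi>: "tame \<phi>"
  proof -
    obtain B where "\<And>x. norm (\<phi> x) \<le> B" using schwartz_decay[OF \<phi>, of 0] unfolding power_0 mult_1 by blast
    then show ?thesis by (intro bounded_tame) auto
  qed
  obtain B where B0: "0 \<le> B" and B: "\<And>\<alpha> x y. length \<alpha> \<le> N \<Longrightarrow> (1 + norm y) ^ N * norm (partials \<alpha> k (y - x)) \<le> B * (1 + norm x) ^ N"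
    using translate_seminorm(1)[OF k, of N] by blast
  obtain L where L0: "0 \<le> L" and L: "\<And>\<alpha> x x' y. length \<alpha> \<le> N \<Longrightarrow> (1 + norm y) ^ N * norm (partials \<alpha> k (y - x') - partials \<alpha> k (y - x))
      \<le> L * norm (x - x') * (1 + norm (x - x')) ^ N * (1 + norm x) ^ N"
    using translate_seminorm(2)[OF k, of N] by blast
  have "norm (u (conv k \<phi>) - (\<integral>x. ?g x * \<phi> x \<partial>lborel)) \<le> e" if e: "0 < e" for e :: real
  proof -
    \<comment> \<open>The error is at most \<open>\<bar>C\<bar> (B + 1) e'\<close> in the functional and \<open>(G + 1) e'\<close> in the integral.\<close>
    define c where "c = \<bar>C\<bar> * (B + 1) + G + 1"
    have c: "0 < c" unfolding c_def using B0 G(1) by (intro add_nonneg_pos add_nonneg_nonneg mult_nonneg_nonneg) auto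
    define e' where "e' = e / c"
    have e': "0 < e'" using e c by (simp add: e'_def)
    obtain a b where tail: "(\<integral>x. indicator (- cbox a b) x * ?w x \<partial>lborel) < e'"
      using tail_small[OF iw _ e'] by auto
    let ?Q = "cbox a b"
    have tail': "norm ((\<integral>x. f x \<partial>lborel) - integral ?Q f) \<le> K * e'"
      if f: "continuous_on UNIV f" "\<And>x. norm (f x) \<le> K * ?w x" and K: "0 \<le> K" for f :: "real^'n \<Rightarrow> complex" and K
    proof -
      have [measurable]: "f \<in> borel_measurable borel" using f(1) by (rule borel_measurable_continuous_onI)
      have fi: "integrable lborel f"
        by (rule Bochner_Integration.integrable_bound[OF integrable_mult_right[OF iw, of K]]) (use f(2) K in \<open>auto simp: abs_mult\<close>)
      have si: "set_integrable lborel ?Q f" "set_integrable lborel (- ?Q) f"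
        using fi unfolding set_integrable_def by (auto intro!: integrable_mult_indicator)
      have "(\<integral>x. f x \<partial>lborel) = (\<integral>x. (indicator ?Q x *\<^sub>R f x + indicator (- ?Q) x *\<^sub>R f x) \<partial>lborel)"
        by (intro Bochner_Integration.integral_cong) (auto simp: indicator_def)
      also have "\<dots> = integral ?Q f + (\<integral>x. indicator (- ?Q) x *\<^sub>R f x \<partial>lborel)"
        using si set_borel_integral_eq_integral(2)[OF si(1)] unfolding set_integrable_def set_lebesgue_integral_def by simp
      finally have "norm ((\<integral>x. f x \<partial>lborel) - integral ?Q f) = norm (\<integral>x. indicator (- ?Q) x *\<^sub>R f x \<partial>lborel)" by simp
      also have "\<dots> \<le> (\<integral>x. K * (indicator (- ?Q) x * ?w x) \<partial>lborel)"
      proof (rule Bochner_Integration.integral_norm_bound_integral)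
        show "integrable lborel (\<lambda>x. indicator (- ?Q) x *\<^sub>R f x)" using si(2) unfolding set_integrable_def .
        show "integrable lborel (\<lambda>x. K * (indicator (- ?Q) x * ?w x))"
          using integrable_mult_indicator[OF _ iw, of "- ?Q"] by (intro integrable_mult_right) simp
        show "norm (indicator (- ?Q) x *\<^sub>R f x) \<le> K * (indicator (- ?Q) x * ?w x)" for x
          using f(2)[of x] by (auto simp: indicator_def)
      qed
      also have "\<dots> \<le> K * e'" using tail K by (simp add: mult_left_mono)
      finally show ?thesis .
    qed
    \<comment> \<open>Inside the box, \<open>\<delta>\<close> is chosen so that both integrands vary by at most \<open>2 \<epsilon>\<close> on its scale.\<close>
    define W where "W = measure lborel ?Q"
    have W: "0 \<le> W" by (simp add: W_def)
    define \<epsilon> where "\<epsilon> = e' / (2 * (W + 1))"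
    have \<epsilon>: "0 < \<epsilon>" "(2 * \<epsilon>) * W \<le> e'" using e' W by (auto simp: \<epsilon>_def field_simps)
    have cQ: "compact ?Q" by (rule compact_cbox)
    obtain R where R: "0 \<le> R" "\<And>x. x \<in> ?Q \<Longrightarrow> (1 + norm x) ^ N \<le> R"
    proof -
      have "bounded ((\<lambda>x. (1 + norm x) ^ N) ` ?Q)"
        by (intro compact_imp_bounded compact_continuous_image cQ continuous_intros)
      then obtain R where "\<forall>x\<in>?Q. norm ((1 + norm x) ^ N) \<le> R" unfolding bounded_iff by auto
      then show ?thesis by (intro that[of "max R 0"]) (auto intro: order_trans abs_ge_self)
    qed
    obtain \<Phi> where \<Phi>: "\<And>x. norm (\<phi> x) \<le> \<Phi>" using schwartz_decay[OF \<phi>, of 0] unfolding power_0 mult_1 by blast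
    have \<Phi>0: "0 \<le> \<Phi>" using \<Phi>[of 0] norm_ge_zero order_trans by blast
    obtain \<delta>1 where \<delta>1: "0 < \<delta>1" "\<And>x x'. x \<in> ?Q \<Longrightarrow> x' \<in> ?Q \<Longrightarrow> dist x' x < \<delta>1 \<Longrightarrow> dist (?g x' * \<phi> x') (?g x * \<phi> x) < \<epsilon>"
      using compact_uniformly_continuous[OF g\<phi>c cQ] \<epsilon>(1) unfolding uniformly_continuous_on_def by metis
    have BR: "0 < \<epsilon> / (B * R + 1)" using B0 R(1) \<epsilon>(1) by (intro divide_pos_pos add_nonneg_pos) auto
    have "uniformly_continuous_on ?Q \<phi>" by (intro compact_uniformly_continuous schwartz_continuous \<phi> cQ)
    then obtain \<delta>2 where \<delta>2: "0 < \<delta>2" "\<And>x x'. x \<in> ?Q \<Longrightarrow> x' \<in> ?Q \<Longrightarrow> dist x' x < \<delta>2 \<Longrightarrow> dist (\<phi> x') (\<phi> x) < \<epsilon> / (B * R + 1)"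
      using BR unfolding uniformly_continuous_on_def by metis
    define \<delta>3 where "\<delta>3 = \<epsilon> / (L * 2 ^ N * R * \<Phi> + 1)"
    have \<delta>3: "0 < \<delta>3" "L * \<delta>3 * 2 ^ N * R * \<Phi> \<le> \<epsilon>"
    proof -
      have "0 \<le> L * 2 ^ N * R * \<Phi>" using L0 R(1) \<Phi>0 by simp
      then show "0 < \<delta>3" "L * \<delta>3 * 2 ^ N * R * \<Phi> \<le> \<epsilon>" using \<epsilon>(1) by (auto simp: \<delta>3_def field_simps)
    qed
    define \<delta> where "\<delta> = min (min \<delta>1 \<delta>2) (min \<delta>3 1)"
    have \<delta>: "0 < \<delta>" "\<delta> \<le> \<delta>1" "\<delta> \<le> \<delta>2" "\<delta> \<le> \<delta>3" "\<delta> \<le> 1" using \<delta>1(1) \<delta>2(1) \<delta>3(1) by (auto simp: \<delta>_def)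
    obtain p where p: "p tagged_division_of ?Q" "(\<lambda>x. ball x \<delta>) fine p"
      using fine_division_exists[OF gauge_ball[OF \<delta>(1)]] by blast
    have finp: "finite p" using p(1) by blast
    have split: "(\<Sum>z\<in>p. f z) = (\<Sum>(x, Q)\<in>p. f (x, Q))" for f :: "_ \<Rightarrow> complex" by (simp add: case_prod_beta)
    \<comment> \<open>The Riemann sum of the convolution is a finite combination of translates of \<open>k\<close>.\<close>
    define S where "S y = (\<Sum>z\<in>p. (of_real (measure lborel (snd z)) * \<phi> (fst z)) * k (y - fst z))" for y
    have Ss: "S \<in> schwartz" unfolding S_def[abs_def] by (intro schwartz_sum finp schwartz_cmult kx)
    have PS: "partials \<alpha> S y = (\<Sum>(x, Q)\<in>p. of_real (measure lborel Q) * (partials \<alpha> k (y - x) * \<phi> x))" for \<alpha> y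
      unfolding S_def[abs_def] partials_sum[OF finp schwartz_cmult[OF kx]] partials_linear(2)[OF kx kx[of 0]] partials_translate[OF k]
      by (simp add: case_prod_beta mult_ac)
    have uS: "u S = (\<Sum>(x, Q)\<in>p. of_real (measure lborel Q) * (?g x * \<phi> x))"
      unfolding S_def[abs_def] tempered_finite_sum[OF u finp kx] by (simp add: case_prod_beta mult_ac)
    have "seminorm_le N (\<lambda>y. conv k \<phi> y + (-1) * S y) ((B + 1) * e')"
      unfolding seminorm_le_def partials_linear(1)[OF ck schwartz_cmult[OF Ss]] partials_linear(2)[OF Ss Ss] partials_conv[OF k t\<phi>]
    proof (intro allI impI)
      fix \<alpha> :: "'n list" and y assume len: "length \<alpha> \<le> N"
      define h where "h x = of_real ((1 + norm y) ^ N) * (partials \<alpha> k (y - x) * \<phi> x)" for x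
      have nN: "norm (complex_of_real ((1 + norm y) ^ N)) = (1 + norm y) ^ N" by (simp only: norm_of_real abs_of_nonneg zero_le_power add_nonneg_nonneg norm_ge_zero zero_le_one)
      have hc: "continuous_on A h" for A
        unfolding h_def
        by (intro continuous_on_mult continuous_on_const schwartz_continuous[OF \<phi>]
            schwartz_continuous[OF schwartz_translate_reflect[OF schwartz_partials[OF k]]])
      have hle: "norm (h x) \<le> B * ?w x" for x
      proof -
        have "norm (h x) = ((1 + norm y) ^ N * norm (partials \<alpha> k (y - x))) * norm (\<phi> x)" by (simp add: h_def norm_mult nN del: of_real_power of_real_add)
        also have "\<dots> \<le> (B * (1 + norm x) ^ N) * norm (\<phi> x)" using B[OF len] by (rule mult_right_mono) simp
        also have "\<dots> \<le> (B * (1 + norm x) ^ (M + N)) * norm (\<phi> x)" using pw(2) B0 by (intro mult_right_mono mult_left_mono) auto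
        finally show ?thesis by (simp add: mult.assoc)
      qed
      have hmod: "norm (h x - h x') \<le> 2 * \<epsilon>" if x: "x \<in> ?Q" "x' \<in> ?Q" "dist x x' < \<delta>" for x x'
      proof -
        have "norm (h x - h x') = norm (of_real ((1 + norm y) ^ N) * (partials \<alpha> k (y - x') - partials \<alpha> k (y - x)) * \<phi> x
            + of_real ((1 + norm y) ^ N) * partials \<alpha> k (y - x') * (\<phi> x' - \<phi> x))"
          unfolding h_def by (subst norm_minus_commute) (simp add: algebra_simps)
        also have "\<dots> \<le> ((1 + norm y) ^ N * norm (partials \<alpha> k (y - x') - partials \<alpha> k (y - x))) * norm (\<phi> x)
            + ((1 + norm y) ^ N * norm (partials \<alpha> k (y - x'))) * norm (\<phi> x' - \<phi> x)"
          by (rule order_trans[OF norm_triangle_ineq]) (simp add: norm_mult nN del: of_real_power of_real_add)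
        also have "\<dots> \<le> (L * \<delta>3 * 2 ^ N * R) * \<Phi> + (B * R) * (\<epsilon> / (B * R + 1))"
        proof (rule add_mono[OF mult_mono mult_mono])
          have n: "norm (x - x') \<le> \<delta>3" "(1 + norm (x - x')) ^ N \<le> 2 ^ N"
            using x(3) \<delta> by (auto simp: dist_norm intro!: power_mono)
          have "L * norm (x - x') * (1 + norm (x - x')) ^ N * (1 + norm x) ^ N \<le> L * \<delta>3 * 2 ^ N * R"
            using n R(2)[OF x(1)] L0 \<delta>3(1) by (intro mult_mono mult_nonneg_nonneg) auto
          then show "(1 + norm y) ^ N * norm (partials \<alpha> k (y - x') - partials \<alpha> k (y - x)) \<le> L * \<delta>3 * 2 ^ N * R"
            using L[OF len, of y x' x] by linarith
          show "(1 + norm y) ^ N * norm (partials \<alpha> k (y - x')) \<le> B * R"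
            using B[OF len, of y x'] mult_left_mono[OF R(2)[OF x(2)] B0] by linarith
          show "norm (\<phi> x' - \<phi> x) \<le> \<epsilon> / (B * R + 1)"
            using \<delta>2(2)[OF x(1,2)] x(3) \<delta>(3) by (simp add: dist_commute dist_norm less_imp_le)
        qed (use \<Phi> L0 B0 R(1) \<delta>3(1) in auto)
        also have "(B * R) * (\<epsilon> / (B * R + 1)) \<le> \<epsilon>"
        proof -
          have "0 \<le> B * R" using B0 R(1) by simp
          then show ?thesis using \<epsilon>(1) by (simp add: field_simps)
        qed
        finally show ?thesis using \<delta>3(2) by linarith
      qed
      have t1: "norm ((\<integral>x. h x \<partial>lborel) - integral ?Q h) \<le> B * e'" by (rule tail'[OF hc hle B0])
      have t2: "norm (integral ?Q h - (\<Sum>(x, Q)\<in>p. of_real (measure lborel Q) * h x)) \<le> (2 * \<epsilon>) * W"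
        unfolding W_def by (rule riemann_sum_error[OF hc p hmod])
      have "of_real ((1 + norm y) ^ N) * (conv (partials \<alpha> k) \<phi> y + - 1 * partials \<alpha> S y)
          = (\<integral>x. h x \<partial>lborel) - (\<Sum>(x, Q)\<in>p. of_real (measure lborel Q) * h x)"
      proof -
        have "(\<integral>x. h x \<partial>lborel) = of_real ((1 + norm y) ^ N) * conv (partials \<alpha> k) \<phi> y"
          unfolding conv_def h_def by (rule integral_mult_right_zero)
        moreover have "(\<Sum>(x, Q)\<in>p. of_real (measure lborel Q) * h x) = of_real ((1 + norm y) ^ N) * partials \<alpha> S y"
          unfolding PS h_def sum_distrib_left case_prod_beta by (intro sum.cong refl) (simp only: mult_ac)
        ultimately show ?thesis by (simp only: right_diff_distrib mult_minus1 diff_conv_add_uminus[symmetric])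
      qed
      then have "(1 + norm y) ^ N * norm (conv (partials \<alpha> k) \<phi> y + - 1 * partials \<alpha> S y)
          = norm ((\<integral>x. h x \<partial>lborel) - (\<Sum>(x, Q)\<in>p. of_real (measure lborel Q) * h x))"
        using nN by (metis norm_mult)
      also have "\<dots> \<le> B * e' + (2 * \<epsilon>) * W"
        using t1 t2 norm_triangle_ineq[of "(\<integral>x. h x \<partial>lborel) - integral ?Q h" "integral ?Q h - (\<Sum>(x, Q)\<in>p. of_real (measure lborel Q) * h x)"] by simp
      also have "\<dots> \<le> (B + 1) * e'" using \<epsilon>(2) by (simp add: algebra_simps)
      finally show "(1 + norm y) ^ N * norm (conv (partials \<alpha> k) \<phi> y + - 1 * partials \<alpha> S y) \<le> (B + 1) * e'" .
    qed
    from C[OF schwartz_add[OF ck schwartz_cmult[OF Ss]] this]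
    have 1: "norm (u (conv k \<phi>) - u S) \<le> C * ((B + 1) * e')"
      using tempered_add[OF u ck schwartz_cmult[OF Ss], of "-1"] tempered_cmult[OF u Ss, of "-1"] by simp
    have "norm (integral ?Q (\<lambda>x. ?g x * \<phi> x) - u S) \<le> (2 * \<epsilon>) * W"
      unfolding uS W_def
    proof (rule riemann_sum_error[OF g\<phi>c p])
      fix x x' assume "x \<in> ?Q" "x' \<in> ?Q" "dist x x' < \<delta>"
      then show "norm (?g x * \<phi> x - ?g x' * \<phi> x') \<le> 2 * \<epsilon>"
        using \<delta>1(2)[of x' x] \<delta>(2) \<epsilon>(1) by (simp add: dist_norm)
    qed
    moreover have "norm ((\<integral>x. ?g x * \<phi> x \<partial>lborel) - integral ?Q (\<lambda>x. ?g x * \<phi> x)) \<le> G * e'"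
      by (rule tail'[OF g\<phi>c gle G(1)])
    ultimately have 2: "norm ((\<integral>x. ?g x * \<phi> x \<partial>lborel) - u S) \<le> G * e' + e'"
      using norm_triangle_ineq[of "(\<integral>x. ?g x * \<phi> x \<partial>lborel) - integral ?Q (\<lambda>x. ?g x * \<phi> x)" "integral ?Q (\<lambda>x. ?g x * \<phi> x) - u S"] \<epsilon>(2) by simp
    have "C * ((B + 1) * e') \<le> \<bar>C\<bar> * ((B + 1) * e')" using B0 e' by (intro mult_right_mono) auto
    then have "norm (u (conv k \<phi>) - (\<integral>x. ?g x * \<phi> x \<partial>lborel)) \<le> \<bar>C\<bar> * ((B + 1) * e') + (G * e' + e')"
      using 1 2 norm_triangle_ineq4[of "u (conv k \<phi>) - u S" "(\<integral>x. ?g x * \<phi> x \<partial>lborel) - u S"] by simp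
    also have "\<dots> = c * e'" by (simp add: c_def algebra_simps)
    also have "\<dots> = e" using c by (simp add: e'_def)
    finally show ?thesis .
  qed
  then have "norm (u (conv k \<phi>) - (\<integral>x. ?g x * \<phi> x \<partial>lborel)) \<le> 0" by (rule field_le_epsilon[of _ 0, simplified])
  then show "u (conv k \<phi>) = (\<integral>x. ?g x * \<phi> x \<partial>lborel)" by simp
qed

section \<open>Series and limits indexed by the integers\<close>

lemma powr_abs_summable_on:
  assumes "0 < a"
  shows "(\<lambda>j::int. 2 powr (- a * real_of_int \<bar>j\<bar>)) summable_on UNIV"
proof -
  let ?f = "\<lambda>j::int. 2 powr (- a * real_of_int \<bar>j\<bar>)"
  have "2 powr (- a) < 2 powr (0 :: real)" using assms by (intro powr_less_mono) auto
  then have "summable (\<lambda>m. (2 powr (- a) :: real) ^ m)" by (intro summable_geometric) auto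
  then have s: "(\<lambda>m::nat. 2 powr (- a * real m)) summable_on UNIV"
    by (subst summable_on_UNIV_nonneg_real_iff) (auto simp: powr_realpow[symmetric] powr_powr)
  have "?f summable_on (range int)"
    using s by (subst summable_on_reindex) (auto simp: o_def)
  moreover have "?f summable_on (range (\<lambda>m. - int m))"
    using s by (subst summable_on_reindex) (auto simp: o_def inj_def)
  ultimately have "?f summable_on (range int \<union> range (\<lambda>m. - int m))"
    by (rule summable_on_union)
  moreover have "range int \<union> range (\<lambda>m. - int m) = UNIV"
    by (metis (no_types, lifting) UNIV_eq_I Un_iff int_cases2 rangeI)
  ultimately show ?thesis by simp
qed

lemma norm_suminf_le_nn_integral:
  fixes f :: "nat \<Rightarrow> 'a::{banach}"
  assumes "summable (\<lambda>m. norm (f m))"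
  shows "ennreal (norm (\<Sum>m. f m)) \<le> (\<integral>\<^sup>+m. ennreal (norm (f m)) \<partial>count_space UNIV)"
proof -
  have "ennreal (norm (\<Sum>m. f m)) \<le> ennreal (\<Sum>m. norm (f m))"
    by (intro ennreal_leI summable_norm assms)
  also have "\<dots> = (\<Sum>m. ennreal (norm (f m)))"
    using assms by (subst suminf_ennreal2) auto
  also have "\<dots> = (\<integral>\<^sup>+m. ennreal (norm (f m)) \<partial>count_space UNIV)"
    by (simp add: nn_integral_count_space_nat)
  finally show ?thesis .
qed

lemma has_sum_int_tail:
  fixes g :: "int \<Rightarrow> 'a::{topological_comm_monoid_add, t2_space}"
  assumes "g summable_on UNIV" "\<And>j. j < j\<^sub>0 \<Longrightarrow> g j = 0"
  shows "(\<lambda>m. g (j\<^sub>0 + int m)) sums infsum g UNIV"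
proof -
  have "(g has_sum infsum g UNIV) UNIV" using assms(1) by (rule has_sum_infsum)
  then have "(g has_sum infsum g UNIV) {j\<^sub>0..}"
    by (rule has_sum_cong_neutral[THEN iffD1, rotated -1]) (use assms(2) in auto)
  moreover have "{j\<^sub>0..} = range (\<lambda>m. j\<^sub>0 + int m)"
  proof
    show "{j\<^sub>0..} \<subseteq> range (\<lambda>m. j\<^sub>0 + int m)"
    proof
      fix i assume "i \<in> {j\<^sub>0..}"
      then have "i = j\<^sub>0 + int (nat (i - j\<^sub>0))" by simp
      then show "i \<in> range (\<lambda>m. j\<^sub>0 + int m)" by (rule range_eqI)
    qed
  qed auto
  ultimately have "((\<lambda>m. g (j\<^sub>0 + int m)) has_sum infsum g UNIV) UNIV"
    by (simp add: has_sum_reindex inj_def o_def)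
  then show ?thesis by (rule has_sum_imp_sums)
qed

lemma tendsto_at_bot_int:
  fixes g :: "int \<Rightarrow> 'a::topological_space"
  assumes "(\<lambda>m. g (j - int m)) \<longlonglongrightarrow> L"
  shows "(g \<longlongrightarrow> L) at_bot"
proof (rule topological_tendstoI)
  fix S assume "open S" "L \<in> S"
  with assms obtain N where N: "\<And>m. m \<ge> N \<Longrightarrow> g (j - int m) \<in> S"
    unfolding tendsto_def eventually_sequentially by blast
  have "g i \<in> S" if "i \<le> j - int N" for i
    using N[of "nat (j - i)"] that by simp
  then show "eventually (\<lambda>i. g i \<in> S) at_bot"
    unfolding eventually_at_bot_linorder by blast
qed

text \<open>The Weierstrass test for the continuity, dominated convergence for the pairing.\<close>

lemma dominated_series:
  fixes f :: "nat \<Rightarrow> real^'n::finite \<Rightarrow> complex"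
  assumes f: "\<And>m. continuous_on UNIV (f m)" "\<And>m x. norm (f m x) \<le> c m" and c: "summable c"
  shows "continuous_on UNIV (\<lambda>x. \<Sum>m. f m x)"
    and "summable (\<lambda>m. norm (f m x))"
    and "norm (\<Sum>m. f m x) \<le> suminf c"
    and "\<phi> \<in> schwartz \<Longrightarrow> (\<lambda>m. \<integral>x. f m x * \<phi> x \<partial>lborel) sums (\<integral>x. (\<Sum>m. f m x) * \<phi> x \<partial>lborel)"
proof -
  show abs: "summable (\<lambda>m. norm (f m x))" for x
    by (rule summable_comparison_test'[OF c, of 0]) (use f in auto)
  have "uniform_limit UNIV (\<lambda>n x. \<Sum>m<n. f m x) (\<lambda>x. \<Sum>m. f m x) sequentially"
    by (rule Weierstrass_m_test[OF f(2) c])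
  then show "continuous_on UNIV (\<lambda>x. \<Sum>m. f m x)"
    by (rule uniform_limit_theorem[rotated]) (auto intro!: always_eventually continuous_on_sum f)
  show "norm (\<Sum>m. f m x) \<le> suminf c" for x
    using summable_norm[OF abs] suminf_le[OF f(2) abs c] by (rule order_trans)
  assume \<phi>: "\<phi> \<in> schwartz"
  have [measurable]: "f m \<in> borel_measurable borel" for m by (intro borel_measurable_continuous_onI f)
  have "(\<lambda>m. \<integral>x. f m x * \<phi> x \<partial>lborel) sums (\<integral>x. (\<Sum>m. f m x * \<phi> x) \<partial>lborel)"
  proof (rule sums_integral)
    show "integrable lborel (\<lambda>x. f m x * \<phi> x)" for m
      by (intro tame_mult_integrable \<phi> bounded_tame[of _ "c m"] f) measurable
    show "AE x in lborel. summable (\<lambda>m. norm (f m x * \<phi> x))"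
      unfolding norm_mult by (intro AE_I2 summable_mult2 abs)
    show "summable (\<lambda>m. \<integral>x. norm (f m x * \<phi> x) \<partial>lborel)"
    proof (rule summable_comparison_test'[of _ 0])
      show "summable (\<lambda>m. c m * (\<integral>x. norm (\<phi> x) \<partial>lborel))" by (intro summable_mult2 c)
      fix m
      have "0 \<le> c m" using f(2)[of m 0] norm_ge_zero order_trans by blast
      then have "(\<integral>x. norm (f m x * \<phi> x) \<partial>lborel) \<le> (\<integral>x. c m * norm (\<phi> x) \<partial>lborel)"
        using schwartz_integrable[OF \<phi>] unfolding norm_mult
        by (intro integral_mono' integrable_mult_right integrable_norm mult_right_mono f) auto
      then show "norm (\<integral>x. norm (f m x * \<phi> x) \<partial>lborel) \<le> c m * (\<integral>x. norm (\<phi> x) \<partial>lborel)" by simp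
    qed
  qed
  moreover have "(\<Sum>m. f m x * \<phi> x) = (\<Sum>m. f m x) * \<phi> x" for x
    by (rule suminf_mult2[symmetric, OF summable_norm_cancel[OF abs]])
  ultimately show "(\<lambda>m. \<integral>x. f m x * \<phi> x \<partial>lborel) sums (\<integral>x. (\<Sum>m. f m x) * \<phi> x \<partial>lborel)" by simp
qed

section \<open>Classes modulo polynomials\<close>

lemma rep_poly_class:
  assumes u: "tempered (u :: 'n::finite distr)"
  shows "(u, rep (poly_class u)) \<in> poly_equiv"
proof -
  have "(u, u) \<in> poly_equiv"
    unfolding poly_equiv_def using u by (auto intro!: exI[of _ "\<lambda>x. 0"])
  then have "u \<in> poly_class u" by (simp add: poly_class_def)
  then have "rep (poly_class u) \<in> poly_class u"
    unfolding rep_def by (rule someI[where P = "\<lambda>v. v \<in> poly_class u"])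
  then show ?thesis by (simp add: poly_class_def)
qed

lemma tempered_rep_poly_class: "tempered u \<Longrightarrow> tempered (rep (poly_class u))"
  using rep_poly_class unfolding poly_equiv_def by blast

lemma tempered_rep: "A \<in> S0' \<Longrightarrow> tempered (rep A)"
  unfolding S0'_def by (erule quotientE) (simp flip: poly_class_def add: tempered_rep_poly_class)

lemma tempered_0: "tempered (\<lambda>\<phi>. 0)"
  unfolding tempered_def by (auto intro!: exI[of _ 0])

text \<open>
  On the Fourier side, multiplication by a polynomial is a differential operator, which
  preserves this space. The integral of a Fourier transform is a multiple of the value at 0.
\<close>

definition null_near_0 :: "(real^'n::finite \<Rightarrow> complex) set" where
  "null_near_0 = {g \<in> schwartz. \<exists>e>0. \<forall>\<xi>. norm \<xi> < e \<longrightarrow> g \<xi> = 0}"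

lemma null_near_0_add: "f \<in> null_near_0 \<Longrightarrow> g \<in> null_near_0 \<Longrightarrow> (\<lambda>x. f x + g x) \<in> null_near_0"
proof -
  assume "f \<in> null_near_0" "g \<in> null_near_0"
  then obtain d e where "d > 0" "e > 0" "\<And>\<xi>. norm \<xi> < d \<Longrightarrow> f \<xi> = 0" "\<And>\<xi>. norm \<xi> < e \<Longrightarrow> g \<xi> = 0"
    "f \<in> schwartz" "g \<in> schwartz"
    unfolding null_near_0_def by blast
  then show ?thesis
    unfolding null_near_0_def by (auto intro!: schwartz_add exI[of _ "min d e"])
qed

lemma null_near_0_cmult: "g \<in> null_near_0 \<Longrightarrow> (\<lambda>x. c * g x) \<in> null_near_0"
  unfolding null_near_0_def by (auto intro!: schwartz_cmult)

lemma null_near_0_partial: "g \<in> null_near_0 \<Longrightarrow> partial j g \<in> null_near_0"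
proof -
  assume "g \<in> null_near_0"
  then obtain e where e: "e > 0" "\<And>\<xi>. norm \<xi> < e \<Longrightarrow> g \<xi> = 0" and g: "g \<in> schwartz"
    unfolding null_near_0_def by blast
  have "partial j g \<xi> = 0" if "norm \<xi> < e" for \<xi>
  proof -
    have "(g has_derivative (\<lambda>h. 0)) (at \<xi>)"
      by (rule has_derivative_transform_within_open[OF has_derivative_const[of 0], of "ball 0 e"]) (use that e in auto)
    from partial_eqI[OF this] show ?thesis by simp
  qed
  then show ?thesis unfolding null_near_0_def using e schwartz_partial[OF g] by blast
qed

lemma fourier_add:
  assumes "f \<in> schwartz" "g \<in> schwartz"
  shows "fourier (\<lambda>x. f x + g x) \<xi> = fourier f \<xi> + fourier g \<xi>"
  using schwartz_integrable[OF schwartz_cis_mult_minus[OF assms(1)]] schwartz_integrable[OF schwartz_cis_mult_minus[OF assms(2)]]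
  by (simp add: fourier_def distrib_left)

lemma fourier_cmult: "fourier (\<lambda>x. c * f x) \<xi> = c * fourier f \<xi>"
proof -
  have "cis (- (x \<bullet> \<xi>)) * (c * f x) = c * (cis (- (x \<bullet> \<xi>)) * f x)" for x by simp
  then show ?thesis by (simp only: fourier_def integral_mult_right_zero)
qed

lemma polynomial_mult_fourier:
  fixes Q :: "real^'n::finite \<Rightarrow> real"
  assumes "real_polynomial_function Q" "g \<in> null_near_0"
  shows "\<exists>g'\<in>null_near_0. \<forall>x. of_real (Q x) * fourier g x = fourier g' x"
  using assms
proof (induction arbitrary: g rule: real_polynomial_function.induct)
  case (linear Q)
  have lin: "linear Q" using linear bounded_linear.linear by blast
  have g: "g \<in> schwartz" using linear by (simp add: null_near_0_def)
  have step: "\<exists>g'\<in>null_near_0. \<forall>x. (\<Sum>j\<in>J. of_real (x $ j * Q (axis j 1))) * fourier g x = fourier g' x" if "finite J" for J :: "'n set"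
    using that
  proof (induction J)
    case empty
    have "(\<lambda>x. 0 * g x) \<in> null_near_0" by (rule null_near_0_cmult) (rule linear)
    then show ?case by (intro bexI[of _ "\<lambda>x. 0 * g x"]) (auto simp: fourier_def)
  next
    case (insert i J)
    then obtain g' where g': "g' \<in> null_near_0" "\<And>x. (\<Sum>j\<in>J. of_real (x $ j * Q (axis j 1))) * fourier g x = fourier g' x" by blast
    let ?h = "\<lambda>x. (- \<i> * of_real (Q (axis i 1))) * partial i g x"
    have h: "?h \<in> null_near_0" by (intro null_near_0_cmult null_near_0_partial linear)
    have "fourier ?h x = of_real (x $ i * Q (axis i 1)) * fourier g x" for x
      unfolding fourier_cmult fourier_partial[OF g] by (simp add: complex_eq_iff algebra_simps)
    moreover have "?h \<in> schwartz" "g' \<in> schwartz" using h g'(1) unfolding null_near_0_def by blast+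
    ultimately have "fourier (\<lambda>x. ?h x + g' x) x = of_real (x $ i * Q (axis i 1)) * fourier g x + fourier g' x" for x
      by (simp only: fourier_add)
    then show ?case
      using insert g'(2)[symmetric] null_near_0_add[OF h g'(1)]
      by (intro bexI[of _ "\<lambda>x. ?h x + g' x"]) (auto simp: distrib_right)
  qed
  have "Q x = (\<Sum>j\<in>UNIV. x $ j * Q (axis j 1))" for x
  proof -
    have "Q x = Q (\<Sum>j\<in>UNIV. (x $ j) *\<^sub>R axis j 1)" by (simp add: basis_expansion flip: scalar_mult_eq_scaleR)
    then show ?thesis by (simp add: linear_sum[OF lin] linear_scale[OF lin])
  qed
  then have eq: "of_real (Q x) = (\<Sum>j\<in>UNIV. of_real (x $ j * Q (axis j 1)) :: complex)" for x
    by (metis of_real_sum)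
  show ?case unfolding eq by (rule step) simp
next
  case (const c)
  then show ?case by (intro bexI[of _ "\<lambda>x. of_real c * g x"] null_near_0_cmult) (auto simp: fourier_cmult)
next
  case (add P Q)
  obtain g' where g': "g' \<in> null_near_0" "\<And>x. of_real (P x) * fourier g x = fourier g' x" using add by blast
  obtain g'' where g'': "g'' \<in> null_near_0" "\<And>x. of_real (Q x) * fourier g x = fourier g'' x" using add by blast
  have "fourier (\<lambda>x. g' x + g'' x) x = of_real (P x + Q x) * fourier g x" for x
    using g' g'' by (subst fourier_add) (auto simp: null_near_0_def distrib_right)
  then show ?case using null_near_0_add[OF g'(1) g''(1)] by (intro bexI[of _ "\<lambda>x. g' x + g'' x"]) auto
next
  case (mult P Q)
  obtain g' where g': "g' \<in> null_near_0" "\<And>x. of_real (Q x) * fourier g x = fourier g' x" using mult by blast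
  obtain g'' where g'': "g'' \<in> null_near_0" "\<And>x. of_real (P x) * fourier g' x = fourier g'' x" using mult g'(1) by blast
  show ?case using g''(1) g''(2) g'(2) by (intro bexI[of _ g'']) (auto simp: mult.assoc)
qed

lemma polynomial_fourier_integral:
  fixes P :: "real^'n::finite \<Rightarrow> complex"
  assumes P: "polynomial_function P" and g: "g \<in> null_near_0"
  shows "(\<integral>x. P x * fourier g x \<partial>lborel) = 0"
proof -
  have "real_polynomial_function (Re \<circ> P)" "real_polynomial_function (Im \<circ> P)"
    using P bounded_linear_Re bounded_linear_Im unfolding polynomial_function_def by auto
  then obtain g\<^sub>1 g\<^sub>2 where g1: "g\<^sub>1 \<in> null_near_0" "\<And>x. of_real (Re (P x)) * fourier g x = fourier g\<^sub>1 x"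
    and g2: "g\<^sub>2 \<in> null_near_0" "\<And>x. of_real (Im (P x)) * fourier g x = fourier g\<^sub>2 x"
    using polynomial_mult_fourier[OF _ g] unfolding o_def by metis
  have "P x * fourier g x = fourier g\<^sub>1 x + \<i> * fourier g\<^sub>2 x" for x
    unfolding g1(2)[symmetric] g2(2)[symmetric] by (subst complex_eq[of "P x"]) (simp add: distrib_right mult.assoc)
  moreover have int: "integrable lborel (fourier g\<^sub>1)" "integrable lborel (fourier g\<^sub>2)"
    using g1(1) g2(1) by (auto simp: null_near_0_def intro!: schwartz_integrable fourier_schwartz)
  moreover have "(\<integral>x. fourier g\<^sub>1 x \<partial>lborel) = 0" "(\<integral>x. fourier g\<^sub>2 x \<partial>lborel) = 0"
    using g1(1) g2(1) by (auto simp: null_near_0_def integral_fourier)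
  ultimately show ?thesis by simp
qed

section \<open>Littlewood-Paley blocks\<close>

text \<open>The factor by which the dilation by \<open>2\<^sup>j\<close> multiplies volumes in dimension \<open>n\<close>.\<close>

definition dyadic_vol :: "nat \<Rightarrow> int \<Rightarrow> real" where
  "dyadic_vol n j = 2 powr (real_of_int j * real n)"

lemma dyadic_vol_pos [simp]: "0 < dyadic_vol n j" "0 \<le> dyadic_vol n j" "dyadic_vol n j \<noteq> 0"
  by (simp_all add: dyadic_vol_def)

lemma dyadic_vol_eq: "dyadic_vol n j = (2 powi j) ^ n"
  by (simp add: dyadic_vol_def powr_powr[symmetric] powr_real_of_int' powr_realpow)

locale lp =
  fixes chi :: "real^'n::finite \<Rightarrow> real"
  assumes LP: "littlewood_paley chi"
begin

lemma chi_schwartz: "(\<lambda>\<xi>. complex_of_real (chi \<xi>)) \<in> schwartz"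
  using LP by (intro schwartz_of_real_bump[where R = "4/3"]) (auto simp: littlewood_paley_def)

lemma chi_range: "0 \<le> chi \<xi>" "chi \<xi> \<le> 1"
proof -
  have "chi \<xi> \<in> {0..1}" using LP unfolding littlewood_paley_def by blast
  then show "0 \<le> chi \<xi>" "chi \<xi> \<le> 1" by auto
qed

lemma chi_continuous: "continuous_on A chi"
proof -
  have "continuous_on A (\<lambda>\<xi>. Re (complex_of_real (chi \<xi>)))"
    by (intro continuous_intros chi_schwartz)
  then show ?thesis by simp
qed

lemma chi_measurable [measurable]: "chi \<in> borel_measurable borel"
  by (intro borel_measurable_continuous_onI chi_continuous)

lemma chi_far: "4 / 3 < norm \<xi> \<Longrightarrow> chi \<xi> = 0"
  using LP closure_subset[of "{\<xi>. chi \<xi> \<noteq> 0}"] by (force simp: littlewood_paley_def)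

lemma annulus_supp: "annulus_fun chi \<xi> \<noteq> 0 \<Longrightarrow> 3 / 4 \<le> norm \<xi> \<and> norm \<xi> \<le> 8 / 3"
  using LP closure_subset[of "{\<xi>. annulus_fun chi \<xi> \<noteq> 0}"] by (force simp: littlewood_paley_def)

text \<open>
  For \<open>\<bar>\<xi>\<bar> < 3/4\<close> the annulus function vanishes at
  \<open>\<xi>\<close> and at all \<open>2\<^sup>-\<^sup>m \<xi>\<close>, so \<open>chi \<xi> =
  chi (2\<^sup>-\<^sup>m \<xi>)\<close>, which tends to \<open>chi 0\<close>.
\<close>

lemma chi_near_eq: "norm \<xi> < 3 / 4 \<Longrightarrow> chi \<xi> = chi 0"
proof -
  assume \<xi>: "norm \<xi> < 3 / 4"
  have "chi ((1 / 2) ^ k *\<^sub>R \<xi>) = chi \<xi>" for k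
  proof (induction k)
    case (Suc k)
    have "(1 / 2) ^ k * norm \<xi> \<le> norm \<xi>" by (intro mult_left_le_one_le) (auto simp: power_le_one)
    then have "norm ((1 / 2) ^ k *\<^sub>R \<xi>) < 3 / 4" using \<xi> by simp
    then have "annulus_fun chi ((1 / 2) ^ k *\<^sub>R \<xi>) = 0" using annulus_supp[of "(1 / 2) ^ k *\<^sub>R \<xi>"] by force
    then show ?case using Suc by (simp add: annulus_fun_def)
  qed simp
  moreover have "(\<lambda>k. chi ((1 / 2) ^ k *\<^sub>R \<xi>)) \<longlonglongrightarrow> chi (0 *\<^sub>R \<xi>)"
    by (intro continuous_on_tendsto_compose[OF chi_continuous[of UNIV]] tendsto_scaleR tendsto_const LIMSEQ_realpow_zero) auto
  ultimately show ?thesis by (simp add: LIMSEQ_const_iff)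
qed

text \<open>On the unit sphere only two terms of the partition of unity do not vanish.\<close>

lemma chi_0: "chi 0 = 1"
proof -
  define \<xi> where "\<xi> = (axis undefined 1 :: real^'n)"
  have \<xi>: "norm \<xi> = 1" by (simp add: \<xi>_def)
  let ?f = "\<lambda>j::int. annulus_fun chi ((2 powi (-j)) *\<^sub>R \<xi>)"
  have zero: "?f j = 0" if "j \<notin> {-1, 0}" for j
  proof (rule ccontr)
    assume "?f j \<noteq> 0"
    then have b: "3 / 4 \<le> (2 powi (-j) :: real)" "2 powi (-j) \<le> (8 / 3 :: real)"
      using annulus_supp[of "(2 powi (-j)) *\<^sub>R \<xi>"] \<xi> by auto
    consider "j \<ge> 1" | "j \<le> -2" using \<open>j \<notin> {-1, 0}\<close> by force
    then show False
    proof cases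
      case 1
      then have "2 powi (-j) \<le> (2 powi (-1) :: real)" by (intro power_int_increasing) auto
      then show False using b by (simp add: power_int_minus)
    next
      case 2
      then have "(2 powi 2 :: real) \<le> 2 powi (-j)" by (intro power_int_increasing) auto
      then show False using b by simp
    qed
  qed
  have "\<xi> \<noteq> 0" using \<xi> by auto
  then have "(?f has_sum 1) UNIV" using LP unfolding littlewood_paley_def by blast
  then have "(?f has_sum 1) {-1, 0}"
    by (rule has_sum_cong_neutral[THEN iffD1, rotated -1]) (use zero in auto)
  moreover have "(?f has_sum sum ?f {-1, 0}) {-1, 0}" by (rule has_sum_finite) simp
  ultimately have "sum ?f {-1, 0} = 1" using has_sum_unique by blast
  then have "annulus_fun chi (2 *\<^sub>R \<xi>) + annulus_fun chi \<xi> = 1" by simp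
  then have "chi ((1 / 2) *\<^sub>R \<xi>) = 1"
    using chi_far[of "2 *\<^sub>R \<xi>"] \<xi> by (simp add: annulus_fun_def)
  then show ?thesis using chi_near_eq[of "(1 / 2) *\<^sub>R \<xi>"] \<xi> by simp
qed

lemma chi_near: "norm \<xi> < 3 / 4 \<Longrightarrow> chi \<xi> = 1"
  using chi_near_eq chi_0 by simp

subsection \<open>Approximation of the identity and uniqueness of representing functions\<close>

lemma integral_chi_pos: "0 < (\<integral>x. chi x \<partial>lborel)"
proof -
  have int: "integrable lborel chi" using integrable_Re[OF schwartz_integrable[OF chi_schwartz]] by simp
  have "(\<integral>x. indicator (ball 0 (3/4)) x \<partial>(lborel :: (real^'n) measure)) \<le> (\<integral>x. chi x \<partial>lborel)"
  proof (rule integral_mono[OF _ int])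
    show "integrable lborel (indicator (ball 0 (3/4)) :: real^'n \<Rightarrow> real)"
      by (intro integrable_real_indicator) (auto simp: emeasure_ball)
  qed (auto simp: indicator_def chi_range chi_near)
  moreover have "(\<integral>x. indicator (ball 0 (3/4)) x \<partial>(lborel :: (real^'n) measure)) = measure lborel (ball (0 :: real^'n) (3/4))"
    by simp
  moreover have "0 < measure lborel (ball (0 :: real^'n) (3/4))"
    by (simp add: measure_def emeasure_ball unit_ball_vol_pos)
  ultimately show ?thesis by linarith
qed

text \<open>
  The function \<open>chi\<close> itself, scaled to integral 1, serves as an approximate
  identity: it is nonnegative, smooth and compactly supported, and equal to 1 near the origin.
\<close>

definition mollifier :: "nat \<Rightarrow> real^'n \<Rightarrow> complex" where
  "mollifier k x = of_real (real (Suc k) ^ CARD('n) / (\<integral>x. chi x \<partial>lborel)) * of_real (chi (real (Suc k) *\<^sub>R x))"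

lemma mollifier_schwartz: "mollifier k \<in> schwartz"
  unfolding mollifier_def using schwartz_affine[OF chi_schwartz, of "real (Suc k)" 0]
  by (intro schwartz_cmult) simp

lemma mollifier_test_schwartz: "(\<lambda>y. mollifier k (x - y)) \<in> schwartz"
  by (intro schwartz_translate_reflect mollifier_schwartz)

lemma mollifier_tendsto:
  assumes f: "continuous_on UNIV f"
  shows "(\<lambda>k. \<integral>y. mollifier k (x - y) * f y \<partial>lborel) \<longlonglongrightarrow> f x"
proof -
  define c where "c = (\<integral>x. chi x \<partial>lborel)"
  have c: "0 < c" unfolding c_def by (rule integral_chi_pos)
  have [measurable]: "f \<in> borel_measurable borel" by (intro borel_measurable_continuous_onI f)
  note [measurable] = schwartz_measurable[OF mollifier_schwartz]
  have eq: "(\<integral>y. mollifier k (x - y) * f y \<partial>lborel) = (\<integral>z. of_real (chi z / c) * f (x + (- 1 / real (Suc k)) *\<^sub>R z) \<partial>lborel)" for k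
  proof -
    let ?s = "real (Suc k)"
    have "mollifier k (x - (x + (- 1 / ?s) *\<^sub>R z)) = of_real (?s ^ CARD('n)) * of_real (chi z / c)" for z
      by (simp add: mollifier_def c_def del: of_nat_Suc)
    then have "(\<integral>y. mollifier k (x - y) * f y \<partial>lborel)
      = \<bar>- 1 / ?s\<bar> ^ CARD('n) *\<^sub>R (\<integral>z. of_real (?s ^ CARD('n)) * (of_real (chi z / c) * f (x + (- 1 / ?s) *\<^sub>R z)) \<partial>lborel)"
      using lborel_integral_affine[of "\<lambda>y. mollifier k (x - y) * f y" "- 1 / ?s" x]
      by (simp del: of_nat_Suc of_real_divide of_real_power add: mult.assoc)
    then show ?thesis
      by (simp del: of_nat_Suc add: scaleR_conv_of_real power_divide)
  qed
  obtain M where M: "\<And>y. y \<in> cball x (4/3) \<Longrightarrow> norm (f y) \<le> M"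
    using compact_imp_bounded[OF compact_continuous_image[OF continuous_on_subset[OF f subset_UNIV] compact_cball, of x "4/3"]]
    unfolding bounded_iff by blast
  have "(\<lambda>k. \<integral>z. of_real (chi z / c) * f (x + (- 1 / real (Suc k)) *\<^sub>R z) \<partial>lborel) \<longlonglongrightarrow> (\<integral>z. of_real (chi z / c) * f x \<partial>lborel)"
  proof (rule integral_dominated_convergence[where w = "\<lambda>z. chi z / c * M"])
    show "integrable lborel (\<lambda>z. chi z / c * M)"
      using integrable_Re[OF schwartz_integrable[OF chi_schwartz]] by (intro integrable_mult_left integrable_divide_zero) simp
    have "(\<lambda>k. of_real (chi z / c) * f (x + (- 1 / real (Suc k)) *\<^sub>R z)) \<longlonglongrightarrow> of_real (chi z / c) * f (x + 0 *\<^sub>R z)" for z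
    proof (intro tendsto_mult tendsto_const continuous_on_tendsto_compose[OF f] tendsto_add tendsto_scaleR)
      have "(\<lambda>k. - inverse (real (Suc k))) \<longlonglongrightarrow> - 0" by (intro tendsto_minus LIMSEQ_inverse_real_of_nat)
      then show "(\<lambda>k. - 1 / real (Suc k)) \<longlonglongrightarrow> 0" by (simp add: inverse_eq_divide)
    qed auto
    then show "AE z in lborel. (\<lambda>k. of_real (chi z / c) * f (x + (- 1 / real (Suc k)) *\<^sub>R z)) \<longlonglongrightarrow> of_real (chi z / c) * f x"
      by simp
    show "AE z in lborel. norm (of_real (chi z / c) * f (x + (- 1 / real (Suc k)) *\<^sub>R z)) \<le> chi z / c * M" for k
    proof (rule AE_I2)
      fix z
      show "norm (of_real (chi z / c) * f (x + (- 1 / real (Suc k)) *\<^sub>R z)) \<le> chi z / c * M"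
      proof (cases "norm z \<le> 4 / 3")
        case True
        have "norm z / real (Suc k) \<le> norm z / 1" by (intro divide_left_mono) auto
        then have "norm z / real (Suc k) \<le> 4 / 3" using True by linarith
        moreover have "dist x (x + (- 1 / real (Suc k)) *\<^sub>R z) = norm z / real (Suc k)" by (simp add: dist_norm)
        ultimately have "x + (- 1 / real (Suc k)) *\<^sub>R z \<in> cball x (4/3)" by (simp only: mem_cball)
        then have "norm (f (x + (- 1 / real (Suc k)) *\<^sub>R z)) \<le> M" by (rule M)
        moreover have "norm (of_real (chi z / c) * a) = chi z / c * norm a" for a :: complex
          using c chi_range[of z] by (simp add: norm_mult norm_divide)
        moreover have "0 \<le> chi z / c" using c chi_range[of z] by simp
        ultimately show ?thesis by (simp only: mult_left_mono)
      next
        case False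
        then show ?thesis using chi_far[of z] by simp
      qed
    qed
  qed measurable
  moreover have "(\<integral>z. of_real (chi z / c) * f x \<partial>lborel) = f x"
    using c integral_complex_of_real[of lborel "\<lambda>z. chi z / c"] by (simp add: c_def[symmetric] del: of_real_divide)
  ultimately show ?thesis unfolding eq by simp
qed

lemma represents_unique:
  fixes f g :: "real^'n \<Rightarrow> complex"
  assumes "continuous_on UNIV f" "continuous_on UNIV g" "represents f u" "represents g u"
  shows "f = g"
proof
  fix x
  have "(\<integral>y. mollifier k (x - y) * f y \<partial>lborel) = u (\<lambda>y. mollifier k (x - y))" for k
    using assms(3) mollifier_test_schwartz by (simp add: represents_def mult.commute)
  moreover have "(\<integral>y. mollifier k (x - y) * g y \<partial>lborel) = u (\<lambda>y. mollifier k (x - y))" for k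
    using assms(4) mollifier_test_schwartz by (simp add: represents_def mult.commute)
  ultimately show "f x = g x"
    using mollifier_tendsto[OF assms(1), of x] mollifier_tendsto[OF assms(2), of x] LIMSEQ_unique by simp
qed

lemma fun_of_eq:
  fixes f :: "real^'n \<Rightarrow> complex"
  assumes "continuous_on UNIV f" "represents f u"
  shows "fun_of u = f"
proof -
  have "continuous_on UNIV (fun_of u) \<and> represents (fun_of u) u"
    unfolding fun_of_def by (rule someI[where x = f]) (use assms in blast)
  then show ?thesis using represents_unique assms by blast
qed

lemma integral_norm_mollifier: "(\<integral>\<^sup>+x. norm (mollifier k x) \<partial>lborel) = 1"
proof -
  define c where "c = (\<integral>x. chi x \<partial>lborel)"
  have c: "0 < c" unfolding c_def by (rule integral_chi_pos)
  let ?s = "real (Suc k)"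
  have int: "integrable lborel chi" using integrable_Re[OF schwartz_integrable[OF chi_schwartz]] by simp
  have "(\<integral>\<^sup>+x. ennreal (chi x) \<partial>lborel) = ennreal c"
    unfolding c_def using int by (intro nn_integral_eq_integral) (auto simp: chi_range)
  then have *: "ennreal c = ennreal (?s ^ CARD('n)) * (\<integral>\<^sup>+x. ennreal (chi (?s *\<^sub>R x)) \<partial>lborel)"
    using nn_integral_lborel_affine[of "\<lambda>x. ennreal (chi x)" ?s 0] by (simp del: of_nat_Suc)
  have "norm (mollifier k x) = ?s ^ CARD('n) / c * chi (?s *\<^sub>R x)" for x
    using c chi_range[of "?s *\<^sub>R x"] by (simp add: mollifier_def c_def[symmetric] norm_mult norm_divide norm_power del: of_nat_Suc)
  then have "ennreal (norm (mollifier k x)) = ennreal (?s ^ CARD('n) / c) * ennreal (chi (?s *\<^sub>R x))" for x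
    using c chi_range by (simp add: ennreal_mult[symmetric] del: of_nat_Suc)
  then have "(\<integral>\<^sup>+x. norm (mollifier k x) \<partial>lborel) = (\<integral>\<^sup>+x. ennreal (?s ^ CARD('n) / c) * ennreal (chi (?s *\<^sub>R x)) \<partial>lborel)"
    by (simp only:)
  also have "\<dots> = ennreal (1 / c) * (ennreal (?s ^ CARD('n)) * (\<integral>\<^sup>+x. ennreal (chi (?s *\<^sub>R x)) \<partial>lborel))"
    using c by (subst nn_integral_cmult) (auto simp: mult.assoc[symmetric] simp flip: ennreal_mult)
  also have "\<dots> = 1" unfolding *[symmetric] using c by (simp flip: ennreal_mult)
  finally show ?thesis .
qed

text \<open>
  If \<open>h\<close> and the continuous function \<open>f\<close> represent the same distribution, mollification turns \<open>h\<close>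
  into functions of at most the same norm that converge to \<open>f\<close>; so the infimum is attained at \<open>f\<close>.
\<close>

lemma distr_Lnorm_eq:
  fixes f :: "real^'n \<Rightarrow> complex"
  assumes q: "1 \<le> q" and f: "continuous_on UNIV f" "represents f u"
  shows "distr_Lnorm (ennreal q) u = Lnorm (ennreal q) lborel (\<lambda>x. ennreal (norm (f x)))"
proof (rule antisym)
  show "distr_Lnorm (ennreal q) u \<le> Lnorm (ennreal q) lborel (\<lambda>x. ennreal (norm (f x)))"
    unfolding distr_Lnorm_def using f by (intro Inf_lower) blast
  show "Lnorm (ennreal q) lborel (\<lambda>x. ennreal (norm (f x))) \<le> distr_Lnorm (ennreal q) u"
    unfolding distr_Lnorm_def
  proof (rule Inf_greatest, safe)
    fix h assume h: "represents h u"
    then have [measurable]: "h \<in> borel_measurable borel" by (simp add: represents_def)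
    note [measurable] = schwartz_measurable[OF mollifier_schwartz]
    let ?N = "\<integral>\<^sup>+y. enn_powr (norm (h y)) q \<partial>lborel"
    have "(\<integral>y. f y * mollifier k (x - y) \<partial>lborel) = (\<integral>y. h y * mollifier k (x - y) \<partial>lborel)" for k x
      using f(2) h mollifier_test_schwartz[of k x] unfolding represents_def by metis
    then have "(\<integral>y. mollifier k (x - y) * f y \<partial>lborel) = conv (mollifier k) h x" for k x
      by (simp add: conv_def mult.commute)
    then have lim: "(\<lambda>k. conv (mollifier k) h x) \<longlonglongrightarrow> f x" for x
      using mollifier_tendsto[OF f(1), of x] by simp
    have le: "(\<integral>\<^sup>+x. enn_powr (\<integral>\<^sup>+y. norm (mollifier k (x - y)) * ennreal (norm (h y)) \<partial>lborel) q \<partial>lborel) \<le> ?N" for k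
      using Young_Lp[OF q zero_less_one, of "\<lambda>x. norm (mollifier k x)" "\<lambda>y. norm (h y)"]
      by (simp add: integral_norm_mollifier)
    have "(\<integral>\<^sup>+x. enn_powr (norm (f x)) q \<partial>lborel) \<le> (\<integral>\<^sup>+x. liminf (\<lambda>k. enn_powr (\<integral>\<^sup>+y. norm (mollifier k (x - y)) * ennreal (norm (h y)) \<partial>lborel) q) \<partial>lborel)"
    proof (rule nn_integral_mono)
      fix x
      have "(\<lambda>k. norm (conv (mollifier k) h x) powr q) \<longlonglongrightarrow> norm (f x) powr q"
        using q by (intro tendsto_powr' tendsto_norm lim tendsto_const) auto
      then have "(\<lambda>k. enn_powr (norm (conv (mollifier k) h x)) q) \<longlonglongrightarrow> enn_powr (norm (f x)) q"
        by (simp add: enn_powr_ennreal)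
      then have "enn_powr (norm (f x)) q = liminf (\<lambda>k. enn_powr (norm (conv (mollifier k) h x)) q)"
        by (simp add: lim_imp_Liminf)
      also have "\<dots> \<le> liminf (\<lambda>k. enn_powr (\<integral>\<^sup>+y. norm (mollifier k (x - y)) * ennreal (norm (h y)) \<partial>lborel) q)"
        using q by (intro Liminf_mono always_eventually allI enn_powr_mono norm_conv_le) auto
      finally show "enn_powr (norm (f x)) q \<le> liminf (\<lambda>k. enn_powr (\<integral>\<^sup>+y. norm (mollifier k (x - y)) * ennreal (norm (h y)) \<partial>lborel) q)" .
    qed
    also have "\<dots> \<le> liminf (\<lambda>k. \<integral>\<^sup>+x. enn_powr (\<integral>\<^sup>+y. norm (mollifier k (x - y)) * ennreal (norm (h y)) \<partial>lborel) q \<partial>lborel)"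
      by (intro nn_integral_liminf) measurable
    also have "\<dots> \<le> liminf (\<lambda>k::nat. ?N)" by (intro Liminf_mono always_eventually allI le)
    also have "\<dots> = ?N" by (simp add: Liminf_const)
    finally show "Lnorm (ennreal q) lborel (\<lambda>x. ennreal (norm (f x))) \<le> Lnorm (ennreal q) lborel (\<lambda>x. ennreal (norm (h x)))"
      using q by (simp add: Lnorm_real enn_powr_mono)
  qed
qed

subsection \<open>Dyadic multipliers and their kernels\<close>

definition dil :: "int \<Rightarrow> real^'n \<Rightarrow> complex" where
  "dil j \<xi> = of_real (chi ((2 powi (-j)) *\<^sub>R \<xi>))"

definition ann :: "int \<Rightarrow> real^'n \<Rightarrow> complex" where
  "ann j \<xi> = dil (j + 1) \<xi> - dil j \<xi>"

text \<open>A dyadic multiplier that equals 1 on the support of \<open>ann j\<close>.\<close>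

definition fat_ann :: "int \<Rightarrow> real^'n \<Rightarrow> complex" where
  "fat_ann j \<xi> = dil (j + 2) \<xi> - dil (j - 1) \<xi>"

lemma dil_schwartz: "dil j \<in> schwartz"
  using schwartz_affine[OF chi_schwartz, of "2 powi (-j)" 0] by (simp add: dil_def[abs_def])

lemma ann_schwartz: "ann j \<in> schwartz"
  unfolding ann_def[abs_def] by (intro schwartz_diff dil_schwartz)

lemma fat_ann_schwartz: "fat_ann j \<in> schwartz"
  unfolding fat_ann_def[abs_def] by (intro schwartz_diff dil_schwartz)

lemma Slow_eq: "Slow chi j u \<phi> = u (test_multiplier (dil j) \<phi>)"
  by (simp add: Slow_def multiplier_eq dil_def[abs_def])

lemma Delta_eq: "Delta chi j u \<phi> = u (test_multiplier (ann j) \<phi>)"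
proof -
  have "(\<lambda>\<xi>. complex_of_real (annulus_fun chi ((2 powi (-j)) *\<^sub>R \<xi>))) = ann j"
    by (auto simp: ann_def dil_def annulus_fun_def power_int_diff power_int_minus field_simps power_int_add)
  then show ?thesis by (simp add: Delta_def multiplier_eq)
qed

lemma dil_far: "4 / 3 * 2 powi j < norm \<xi> \<Longrightarrow> dil j \<xi> = 0"
  unfolding dil_def by (subst chi_far) (auto simp: power_int_minus field_simps)

lemma dil_near: "norm \<xi> < 3 / 4 * 2 powi j \<Longrightarrow> dil j \<xi> = 1"
  unfolding dil_def by (subst chi_near) (auto simp: power_int_minus field_simps)

lemma ann_supp: "ann j \<xi> \<noteq> 0 \<Longrightarrow> 3 / 4 * 2 powi j \<le> norm \<xi> \<and> norm \<xi> \<le> 8 / 3 * 2 powi j"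
proof -
  assume *: "ann j \<xi> \<noteq> 0"
  define P where "P = (2 powi j :: real)"
  have P: "0 < P" "2 powi (j + 1) = 2 * P" by (simp_all add: P_def power_int_add)
  have "\<not> norm \<xi> < 3 / 4 * P"
    using * P dil_near[of \<xi> j] dil_near[of \<xi> "j + 1"] unfolding P_def[symmetric] P(2) by (auto simp: ann_def)
  moreover have "\<not> 8 / 3 * P < norm \<xi>"
    using * P dil_far[of j \<xi>] dil_far[of "j + 1" \<xi>] unfolding P_def[symmetric] P(2) by (auto simp: ann_def)
  ultimately show ?thesis by (simp add: P_def)
qed

lemma fat_ann_mult: "fat_ann j \<xi> * ann j \<xi> = ann j \<xi>"
proof (cases "ann j \<xi> = 0")
  case False
  define P where "P = (2 powi j :: real)"
  have P: "0 < P" "2 powi (j + 2) = 4 * P" "2 powi (j - 1) = P / 2"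
    by (simp_all add: P_def power_int_add power_int_diff)
  have "3 / 4 * P \<le> norm \<xi>" "norm \<xi> \<le> 8 / 3 * P" using ann_supp[OF False] by (simp_all add: P_def)
  then have "norm \<xi> < 3 / 4 * (4 * P)" "4 / 3 * (P / 2) < norm \<xi>" using P(1) by linarith+
  then have "dil (j + 2) \<xi> = 1" "dil (j - 1) \<xi> = 0"
    using dil_near[of \<xi> "j + 2"] dil_far[of "j - 1" \<xi>] unfolding P by auto
  then show ?thesis by (simp add: fat_ann_def)
qed simp

lemma inv_fourier_dil: "inv_fourier (dil j) x = of_real (dyadic_vol CARD('n) j) * inv_fourier (dil 0) ((2 powi j) *\<^sub>R x)"
proof -
  note [measurable] = schwartz_measurable[OF dil_schwartz]
  have "dil j = (\<lambda>\<xi>. dil 0 ((2 powi (-j)) *\<^sub>R \<xi>))" by (simp add: dil_def fun_eq_iff)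
  then have "fourier (dil j) (- x) = fourier (dil 0) (- x /\<^sub>R 2 powi (-j)) / of_real ((2 powi (-j)) ^ CARD('n))"
    using fourier_scale[of "dil 0" "2 powi (-j)" "- x"] by simp
  then show ?thesis
    unfolding inv_fourier_eq dyadic_vol_eq by (simp add: power_int_minus power_inverse divide_inverse)
qed

lemma inv_fourier_diff:
  assumes "f \<in> schwartz" "g \<in> schwartz"
  shows "inv_fourier (\<lambda>x. f x - g x) x = inv_fourier f x - inv_fourier (g :: real^'n \<Rightarrow> complex) x"
  using schwartz_integrable[OF schwartz_cis_mult[OF assms(1)]] schwartz_integrable[OF schwartz_cis_mult[OF assms(2)]]
  by (simp add: inv_fourier_def inner_commute[of x] right_diff_distrib diff_divide_distrib)

text \<open>
  The bounds of mass and height that Bernstein's inequality uses at the frequency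
  \<open>2\<^sup>j\<close>.
\<close>

definition dyadic_kernel_bound :: "real \<Rightarrow> int \<Rightarrow> (real^'n \<Rightarrow> complex) \<Rightarrow> bool" where
  "dyadic_kernel_bound c j K \<longleftrightarrow> (\<integral>\<^sup>+x. norm (K x) \<partial>lborel) \<le> ennreal c \<and> (\<forall>x. norm (K x) \<le> c * dyadic_vol CARD('n) j)"

lemma dil_kernel_bound: "\<exists>c\<ge>1. \<forall>j. dyadic_kernel_bound c j (inv_fourier (dil j))"
proof -
  let ?E = "inv_fourier (dil 0)"
  have E: "?E \<in> schwartz" by (intro inv_fourier_schwartz dil_schwartz)
  obtain B where B: "\<And>x. norm (?E x) \<le> B"
    using schwartz_decay[OF E, of 0] unfolding power_0 mult_1 by blast
  define c where "c = max 1 (max B (\<integral>x. norm (?E x) \<partial>lborel))"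
  have "dyadic_kernel_bound c j (inv_fourier (dil j))" for j
    unfolding dyadic_kernel_bound_def
  proof safe
    note [measurable] = schwartz_measurable[OF E]
    have "(\<integral>\<^sup>+x. norm (inv_fourier (dil j) x) \<partial>lborel) = (\<integral>\<^sup>+x. ennreal (dyadic_vol CARD('n) j) * ennreal (norm (?E ((2 powi j) *\<^sub>R x))) \<partial>lborel)"
      by (simp add: inv_fourier_dil[of j] norm_mult ennreal_mult)
    also have "\<dots> = (\<integral>\<^sup>+x. norm (?E x) \<partial>lborel)"
      using nn_integral_lborel_affine[of "\<lambda>x. ennreal (norm (?E x))" "2 powi j" 0]
      by (simp add: nn_integral_cmult dyadic_vol_eq)
    also have "\<dots> = ennreal (\<integral>x. norm (?E x) \<partial>lborel)"
      using schwartz_integrable[OF E] by (intro nn_integral_eq_integral) auto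
    finally show "(\<integral>\<^sup>+x. norm (inv_fourier (dil j) x) \<partial>lborel) \<le> ennreal c"
      by (simp add: c_def ennreal_leI)
    show "norm (inv_fourier (dil j) x) \<le> c * dyadic_vol CARD('n) j" for x
      using B[of "(2 powi j) *\<^sub>R x"] by (simp add: inv_fourier_dil[of j] norm_mult c_def mult.commute mult_left_mono)
  qed
  moreover have "1 \<le> c" by (simp add: c_def)
  ultimately show ?thesis by blast
qed

text \<open>
  Each multiplier is a dilate of \<open>chi\<close> or the difference of two dilates, by a
  bounded number of octaves.
\<close>

lemma dyadic_kernel_bounds:
  "\<exists>c\<ge>1. \<forall>j. dyadic_kernel_bound c j (inv_fourier (dil j)) \<and> dyadic_kernel_bound c j (inv_fourier (ann j))
    \<and> dyadic_kernel_bound c j (inv_fourier (fat_ann j))"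
proof -
  obtain c where c: "1 \<le> c" "\<And>j. dyadic_kernel_bound c j (inv_fourier (dil j))" using dil_kernel_bound by blast
  have sub: "dyadic_kernel_bound (2 * 4 ^ CARD('n) * c) j (inv_fourier (\<lambda>\<xi>. dil k \<xi> - dil l \<xi>))"
    if "k \<le> j + 2" "l \<le> j + 2" for j k l
    unfolding dyadic_kernel_bound_def
  proof safe
    note [measurable] = schwartz_measurable[OF inv_fourier_schwartz[OF dil_schwartz]]
    let ?K = "\<lambda>x. inv_fourier (dil k) x - inv_fourier (dil l) x"
    have eq: "inv_fourier (\<lambda>\<xi>. dil k \<xi> - dil l \<xi>) x = ?K x" for x by (intro inv_fourier_diff dil_schwartz)
    have "(\<integral>\<^sup>+x. norm (?K x) \<partial>lborel) \<le> (\<integral>\<^sup>+x. ennreal (norm (inv_fourier (dil k) x)) + ennreal (norm (inv_fourier (dil l) x)) \<partial>lborel)"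
      by (intro nn_integral_mono) (auto simp: norm_triangle_ineq4 ennreal_leI simp flip: ennreal_plus)
    also have "\<dots> \<le> ennreal c + ennreal c"
      using c(2)[of k] c(2)[of l] by (subst nn_integral_add) (auto simp: dyadic_kernel_bound_def intro: add_mono)
    also have "\<dots> \<le> ennreal (2 * 4 ^ CARD('n) * c)"
      using c(1) by (simp add: ennreal_leI flip: ennreal_plus)
    finally show "(\<integral>\<^sup>+x. norm (inv_fourier (\<lambda>\<xi>. dil k \<xi> - dil l \<xi>) x) \<partial>lborel) \<le> ennreal (2 * 4 ^ CARD('n) * c)"
      by (simp add: eq)
    have vol: "dyadic_vol CARD('n) i \<le> 4 ^ CARD('n) * dyadic_vol CARD('n) j" if "i \<le> j + 2" for i
    proof -
      have "dyadic_vol CARD('n) i \<le> dyadic_vol CARD('n) (j + 2)" using that unfolding dyadic_vol_def by (intro powr_mono mult_right_mono) auto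
      also have "\<dots> = 4 ^ CARD('n) * dyadic_vol CARD('n) j"
        unfolding dyadic_vol_eq by (simp add: power_int_add power_mult_distrib mult.commute)
      finally show ?thesis .
    qed
    fix x
    have "norm (?K x) \<le> c * dyadic_vol CARD('n) k + c * dyadic_vol CARD('n) l"
      using c(2) by (intro order_trans[OF norm_triangle_ineq4] add_mono) (auto simp: dyadic_kernel_bound_def)
    also have "\<dots> \<le> c * (4 ^ CARD('n) * dyadic_vol CARD('n) j) + c * (4 ^ CARD('n) * dyadic_vol CARD('n) j)"
      using c(1) that by (intro add_mono mult_left_mono vol) auto
    finally show "norm (inv_fourier (\<lambda>\<xi>. dil k \<xi> - dil l \<xi>) x) \<le> 2 * 4 ^ CARD('n) * c * dyadic_vol CARD('n) j"
      by (simp add: eq mult_ac)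
  qed
  have big: "c \<le> 2 * 4 ^ CARD('n) * c"
  proof -
    have "1 \<le> (4::real) ^ CARD('n)" by (rule one_le_power) simp
    then have "1 \<le> (2::real) * 4 ^ CARD('n)" by linarith
    then have "1 * c \<le> (2 * 4 ^ CARD('n)) * c" using c(1) by (intro mult_right_mono) auto
    then show ?thesis by (simp only: mult_1)
  qed
  have "dyadic_kernel_bound (2 * 4 ^ CARD('n) * c) j (inv_fourier (dil j))" for j
    using c(2)[of j] big unfolding dyadic_kernel_bound_def
    by (auto intro: order_trans[OF _ ennreal_leI] order_trans[OF _ mult_right_mono])
  moreover have "dyadic_kernel_bound (2 * 4 ^ CARD('n) * c) j (inv_fourier (ann j))" for j
    using sub[of "j + 1" j j] by (simp add: ann_def[abs_def])
  moreover have "dyadic_kernel_bound (2 * 4 ^ CARD('n) * c) j (inv_fourier (fat_ann j))" for j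
    using sub[of "j + 2" j "j - 1"] by (simp add: fat_ann_def[abs_def])
  ultimately show ?thesis using big c(1) by (meson order_trans)
qed

text \<open>
  A constant for all these kernels, chosen once so that the constants in the estimates below
  stay explicit and visibly do not depend on the distributions.
\<close>

definition kc :: real where
  "kc = (SOME c. 1 \<le> c \<and> (\<forall>j. dyadic_kernel_bound c j (inv_fourier (dil j)) \<and> dyadic_kernel_bound c j (inv_fourier (ann j))
    \<and> dyadic_kernel_bound c j (inv_fourier (fat_ann j))))"

lemma kc: "1 \<le> kc" "dyadic_kernel_bound kc j (inv_fourier (dil j))" "dyadic_kernel_bound kc j (inv_fourier (ann j))"
  "dyadic_kernel_bound kc j (inv_fourier (fat_ann j))"
  using someI_ex[OF dyadic_kernel_bounds, folded kc_def] by auto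

lemma dyadic_Bernstein:
  assumes K: "dyadic_kernel_bound kc j K" "K \<in> schwartz" and r: "1 \<le> r" "r \<le> q" and [measurable]: "h \<in> borel_measurable borel"
  shows "Lnorm (ennreal q) lborel (\<lambda>x. norm (conv K h x))
      \<le> ennreal (kc * dyadic_vol CARD('n) j powr (1 / r - 1 / q)) * Lnorm (ennreal r) lborel (\<lambda>x. norm (h x))"
    and "ennreal (norm (conv K h x)) \<le> ennreal (kc * dyadic_vol CARD('n) j powr (1 / r)) * Lnorm (ennreal r) lborel (\<lambda>x. norm (h x))"
proof -
  note [measurable] = schwartz_measurable[OF K(2)]
  have kc0: "0 < kc" using kc(1) by simp
  have k: "(\<integral>\<^sup>+x. norm (K x) \<partial>lborel) \<le> ennreal kc" "ennreal (norm (K x)) \<le> ennreal (kc * dyadic_vol CARD('n) j)" for x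
    using K(1) by (auto simp: dyadic_kernel_bound_def ennreal_leI)
  let ?g = "\<lambda>x. \<integral>\<^sup>+y. ennreal (norm (K (x - y))) * ennreal (norm (h y)) \<partial>lborel"
  have "Lnorm (ennreal q) lborel (\<lambda>x. norm (conv K h x)) \<le> Lnorm (ennreal q) lborel ?g"
    using r unfolding Lnorm_real[OF order_less_le_trans[OF zero_less_one order_trans[OF r]]]
    by (intro enn_powr_mono nn_integral_mono norm_conv_le) auto
  also have "\<dots> \<le> ennreal (kc * dyadic_vol CARD('n) j powr (1 / r - 1 / q)) * Lnorm (ennreal r) lborel (\<lambda>x. norm (h x))"
    using r kc0 k by (intro Bernstein) auto
  finally show "Lnorm (ennreal q) lborel (\<lambda>x. norm (conv K h x))
      \<le> ennreal (kc * dyadic_vol CARD('n) j powr (1 / r - 1 / q)) * Lnorm (ennreal r) lborel (\<lambda>x. norm (h x))" .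
  have "ennreal (norm (conv K h x)) \<le> ?g x" by (rule norm_conv_le)
  also have "\<dots> \<le> ennreal (kc * dyadic_vol CARD('n) j powr (1 / r)) * Lnorm (ennreal r) lborel (\<lambda>x. norm (h x))"
    using r kc0 k by (intro Bernstein_sup) auto
  finally show "ennreal (norm (conv K h x)) \<le> ennreal (kc * dyadic_vol CARD('n) j powr (1 / r)) * Lnorm (ennreal r) lborel (\<lambda>x. norm (h x))" .
qed

section \<open>Blocks of a distribution and their spectrum\<close>

definition blk :: "'n distr \<Rightarrow> int \<Rightarrow> real^'n \<Rightarrow> complex" where
  "blk u k = fun_of (Delta chi k u)"

lemma kernel_schwartz:
  "inv_fourier (dil j) \<in> schwartz" "inv_fourier (ann j) \<in> schwartz" "inv_fourier (fat_ann j) \<in> schwartz"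
  by (intro inv_fourier_schwartz dil_schwartz ann_schwartz fat_ann_schwartz)+

text \<open>
  Because \<open>fat_ann k\<close> equals 1 where \<open>ann k\<close> does not vanish.
\<close>

lemma represents_conv_fat_ann:
  assumes h: "tame h" "represents h (Delta chi k u)"
  shows "represents (conv (inv_fourier (fat_ann k)) h) (Delta chi k u)"
proof -
  have [measurable]: "conv (inv_fourier (fat_ann k)) h \<in> borel_measurable borel"
    by (intro borel_measurable_continuous_onI conv_continuous h kernel_schwartz)
  have "Delta chi k u \<phi> = (\<integral>x. conv (inv_fourier (fat_ann k)) h x * \<phi> x \<partial>lborel)" if \<phi>: "\<phi> \<in> schwartz" for \<phi>
  proof -
    have "(\<integral>x. conv (inv_fourier (fat_ann k)) h x * \<phi> x \<partial>lborel) = (\<integral>y. h y * test_multiplier (fat_ann k) \<phi> y \<partial>lborel)"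
      by (intro conv_duality h fat_ann_schwartz \<phi>)
    also have "\<dots> = Delta chi k u (test_multiplier (fat_ann k) \<phi>)"
      using h(2) test_multiplier_schwartz[OF fat_ann_schwartz \<phi>] by (simp add: represents_def)
    also have "\<dots> = Delta chi k u \<phi>"
      by (simp add: Delta_eq test_multiplier_compose[OF ann_schwartz fat_ann_schwartz \<phi>] mult.commute[of "ann k _"] fat_ann_mult)
    finally show ?thesis ..
  qed
  then show ?thesis
    unfolding represents_def using conv_duality(1)[OF h(1) fat_ann_schwartz] by auto
qed

text \<open>
  A block that belongs to \<open>L\<^sup>p\<close> is reproduced by the convolution with the kernel of a slightly larger
  annulus, hence is smooth and bounded, with Bernstein's estimate.
\<close>

lemma blk_props:
  assumes p: "1 \<le> p" and fin: "distr_Lnorm (ennreal p) (Delta chi k u) < \<infinity>"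
  shows blk_represents: "represents (blk u k) (Delta chi k u)"
    and blk_moderate: "blk u k \<in> moderate"
    and blk_Lnorm: "Lnorm (ennreal p) lborel (\<lambda>x. ennreal (norm (blk u k x))) = distr_Lnorm (ennreal p) (Delta chi k u)"
    and blk_sup: "ennreal (norm (blk u k x)) \<le> ennreal (kc * dyadic_vol CARD('n) k powr (1 / p)) * distr_Lnorm (ennreal p) (Delta chi k u)"
proof -
  obtain h where h: "represents h (Delta chi k u)" "Lnorm (ennreal p) lborel (\<lambda>x. ennreal (norm (h x))) < \<infinity>"
    using fin unfolding distr_Lnorm_def Inf_less_iff by blast
  then have th: "tame h" using p by (intro Lp_tame[where p = p]) (auto simp: represents_def)
  let ?f = "conv (inv_fourier (fat_ann k)) h"
  have cont: "continuous_on UNIV ?f" by (intro conv_continuous th kernel_schwartz)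
  have rep: "represents ?f (Delta chi k u)" by (rule represents_conv_fat_ann[OF th h(1)])
  have eq: "blk u k = ?f" unfolding blk_def by (rule fun_of_eq[OF cont rep])
  show rep': "represents (blk u k) (Delta chi k u)" unfolding eq by (rule rep)
  show "blk u k \<in> moderate" unfolding eq by (intro conv_moderate th kernel_schwartz)
  have cont': "continuous_on UNIV (blk u k)" unfolding eq by (rule cont)
  show L: "Lnorm (ennreal p) lborel (\<lambda>x. ennreal (norm (blk u k x))) = distr_Lnorm (ennreal p) (Delta chi k u)"
    by (rule distr_Lnorm_eq[OF p cont' rep', symmetric])
  have [measurable]: "blk u k \<in> borel_measurable borel" using rep' by (simp add: represents_def)
  have t: "tame (blk u k)" using p fin L by (intro Lp_tame[where p = p]) auto
  have rep2: "represents (conv (inv_fourier (fat_ann k)) (blk u k)) (Delta chi k u)"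
    by (rule represents_conv_fat_ann[OF t rep'])
  have r: "blk u k = conv (inv_fourier (fat_ann k)) (blk u k)"
    by (rule represents_unique[OF cont' conv_continuous[OF t kernel_schwartz(3)] rep' rep2])
  show "ennreal (norm (blk u k x)) \<le> ennreal (kc * dyadic_vol CARD('n) k powr (1 / p)) * distr_Lnorm (ennreal p) (Delta chi k u)"
    using dyadic_Bernstein(2)[where K = "inv_fourier (fat_ann k)" and h = "blk u k" and j = k and x = x and r = p and q = p]
      kc(4) kernel_schwartz(3) p unfolding r[symmetric] L by simp
qed

text \<open>
  The Fourier transform of \<open>f\<close> is supported in \<open>A\<close>, expressed by
  duality. It is tested on functions with a Fourier transform vanishing on \<open>A\<close> and
  not necessarily near \<open>A\<close>; this is a stronger property, which the blocks have, and
  which passes to products by a pointwise argument.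
\<close>

definition spectrum_in :: "(real^'n) set \<Rightarrow> (real^'n \<Rightarrow> complex) \<Rightarrow> bool" where
  "spectrum_in A f \<longleftrightarrow> (\<forall>\<psi>\<in>schwartz. (\<forall>\<xi>\<in>A. inv_fourier \<psi> \<xi> = 0) \<longrightarrow> (\<integral>x. f x * \<psi> x \<partial>lborel) = 0)"

lemma spectrum_blk:
  assumes "tempered u" "represents f (Delta chi k u)"
  shows "spectrum_in {\<xi>. 3 / 4 * 2 powi k \<le> norm \<xi> \<and> norm \<xi> \<le> 8 / 3 * 2 powi k} f"
  unfolding spectrum_in_def
proof (intro ballI impI)
  fix \<psi> :: "real^'n \<Rightarrow> complex"
  assume \<psi>: "\<psi> \<in> schwartz" and z: "\<forall>\<xi>\<in>{\<xi>. 3 / 4 * 2 powi k \<le> norm \<xi> \<and> norm \<xi> \<le> 8 / 3 * 2 powi k}. inv_fourier \<psi> \<xi> = 0"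
  have "ann k \<xi> * inv_fourier \<psi> \<xi> = 0" for \<xi>
    using ann_supp[of k \<xi>] z by auto
  then have "test_multiplier (ann k) \<psi> = (\<lambda>x. 0)"
    by (intro test_multiplier_zero ann_schwartz \<psi>)
  then have "Delta chi k u \<psi> = 0" by (simp add: Delta_eq tempered_zero[OF assms(1)])
  then show "(\<integral>x. f x * \<psi> x \<partial>lborel) = 0" using assms(2) \<psi> by (simp add: represents_def)
qed

text \<open>
  The spectrum of a product is contained in the sum of the spectra: the frequency \<open>\<xi>\<close> of \<open>g \<psi>\<close> is
  the pairing of \<open>g\<close> with \<open>\<psi>\<close> modulated by \<open>\<xi>\<close>.
\<close>

lemma spectrum_mult:
  assumes f: "spectrum_in A f" and g: "spectrum_in B g" and gm: "g \<in> moderate"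
    and sub: "\<And>a b. a \<in> A \<Longrightarrow> b \<in> B \<Longrightarrow> a + b \<in> C"
  shows "spectrum_in C (\<lambda>x. f x * g x)"
  unfolding spectrum_in_def
proof (intro ballI impI)
  fix \<psi> :: "real^'n \<Rightarrow> complex" assume \<psi>: "\<psi> \<in> schwartz" and z: "\<forall>\<xi>\<in>C. inv_fourier \<psi> \<xi> = 0"
  have "inv_fourier (\<lambda>x. g x * \<psi> x) \<xi> = 0" if "\<xi> \<in> A" for \<xi>
  proof -
    have m: "(\<lambda>x. cis (x \<bullet> \<xi>) * \<psi> x) \<in> schwartz" by (rule schwartz_cis_mult[OF \<psi>])
    have "inv_fourier (\<lambda>x. cis (x \<bullet> \<xi>) * \<psi> x) \<eta> = inv_fourier \<psi> (\<xi> + \<eta>)" for \<eta>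
    proof -
      have "cis (\<eta> \<bullet> x) * (cis (x \<bullet> \<xi>) * \<psi> x) = cis ((\<xi> + \<eta>) \<bullet> x) * \<psi> x" for x
        by (simp add: inner_add_left inner_add_right cis_mult inner_commute add.commute flip: mult.assoc)
      then show ?thesis by (simp only: inv_fourier_def)
    qed
    then have "(\<integral>x. g x * (cis (x \<bullet> \<xi>) * \<psi> x) \<partial>lborel) = 0"
      using g m sub[OF that] z unfolding spectrum_in_def by simp
    then show ?thesis by (simp add: inv_fourier_def inner_commute mult.left_commute)
  qed
  then have "(\<integral>x. f x * (g x * \<psi> x) \<partial>lborel) = 0"
    using f schwartz_mult_moderate[OF gm \<psi>] unfolding spectrum_in_def by blast
  then show "(\<integral>x. f x * g x * \<psi> x \<partial>lborel) = 0" by (simp add: mult.assoc)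
qed

lemma spectrum_test_multiplier:
  assumes "spectrum_in A f" "m \<in> schwartz" "\<phi> \<in> schwartz" "\<And>\<xi>. \<xi> \<in> A \<Longrightarrow> m \<xi> = 0"
  shows "(\<integral>x. f x * test_multiplier m \<phi> x \<partial>lborel) = 0"
  using assms test_multiplier_schwartz[OF assms(2,3)] inv_fourier_test_multiplier[OF assms(2,3)]
  unfolding spectrum_in_def by simp

section \<open>Distributions with a summable low frequency part\<close>

text \<open>
  The exponent \<open>1/4\<close> is a small positive number. The bound is weaker than a bound of both norms in
  the theorem, but it is what survives at almost every fixed time, since in the Chemin-Lerner
  norms the supremum over the blocks is taken after the integration in time.
\<close>

definition good :: "real \<Rightarrow> 'n distr \<Rightarrow> bool" where
  "good p u \<longleftrightarrow> tempered u \<and> (\<exists>M\<ge>0. \<forall>k. distr_Lnorm (ennreal p) (Delta chi k u)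
      \<le> ennreal (M * 2 powr (real_of_int k * (1 / 4 - real CARD('n) / p))))"

lemma good_finite: "good p u \<Longrightarrow> distr_Lnorm (ennreal p) (Delta chi k u) < \<infinity>"
  unfolding good_def by (metis ennreal_less_top infinity_ennreal_def order_le_less_trans)

lemma good_sup:
  assumes p: "1 \<le> p" and u: "good p u"
  shows "\<exists>M\<ge>0. \<forall>k x. norm (blk u k x) \<le> M * 2 powr (real_of_int k / 4)"
proof -
  obtain M where M: "0 \<le> M" "\<And>k. distr_Lnorm (ennreal p) (Delta chi k u)
      \<le> ennreal (M * 2 powr (real_of_int k * (1 / 4 - real CARD('n) / p)))"
    using u unfolding good_def by blast
  have "norm (blk u k x) \<le> (kc * M) * 2 powr (real_of_int k / 4)" for k x
  proof -
    have "ennreal (norm (blk u k x)) \<le> ennreal (kc * dyadic_vol CARD('n) k powr (1 / p)) * distr_Lnorm (ennreal p) (Delta chi k u)"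
      by (rule blk_sup[OF p good_finite[OF u]])
    also have "\<dots> \<le> ennreal (kc * dyadic_vol CARD('n) k powr (1 / p)) * ennreal (M * 2 powr (real_of_int k * (1 / 4 - real CARD('n) / p)))"
      by (intro mult_left_mono M) auto
    also have "\<dots> = ennreal ((kc * M) * (dyadic_vol CARD('n) k powr (1 / p) * 2 powr (real_of_int k * (1 / 4 - real CARD('n) / p))))"
      using kc(1) M(1) by (simp add: mult_ac flip: ennreal_mult)
    also have "dyadic_vol CARD('n) k powr (1 / p) * 2 powr (real_of_int k * (1 / 4 - real CARD('n) / p)) = 2 powr (real_of_int k / 4)"
      by (simp add: dyadic_vol_def powr_powr right_diff_distrib flip: powr_add)
    finally show ?thesis using kc(1) M(1) by simp
  qed
  moreover have "0 \<le> kc * M" using kc(1) M(1) by simp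
  ultimately show ?thesis by blast
qed

lemma blk_continuous: "1 \<le> p \<Longrightarrow> good p u \<Longrightarrow> continuous_on A (blk u k)"
  by (intro moderate_continuous blk_moderate good_finite)

lemma blk_measurable: "1 \<le> p \<Longrightarrow> good p u \<Longrightarrow> blk u k \<in> borel_measurable borel"
  by (intro borel_measurable_continuous_onI blk_continuous)

text \<open>
  The sum of all blocks of frequency below \<open>2\<^sup>j\<close>. It represents \<open>Slow
  chi j\<close> of the realization.
\<close>

definition low :: "'n distr \<Rightarrow> int \<Rightarrow> real^'n \<Rightarrow> complex" where
  "low u j x = (\<Sum>m. blk u (j - 1 - int m) x)"

lemma powr_quarter_step: "2 powr (real_of_int (j - int m) / 4) = 2 powr (real_of_int j / 4) * (2 powr (- 1 / 4)) ^ m"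
  by (simp add: powr_realpow[symmetric] powr_powr flip: powr_add) (simp add: field_simps)

lemma geometric_quarter: "summable (\<lambda>m. (2 powr (- 1 / 4) :: real) ^ m)"
proof (rule summable_geometric)
  have "2 powr (- 1 / 4) < 2 powr (0 :: real)" by (intro powr_less_mono) auto
  then show "norm (2 powr (- 1 / 4) :: real) < 1" by simp
qed

lemma low_props:
  assumes p: "1 \<le> p" and u: "good p u"
  shows low_continuous: "continuous_on UNIV (low u j)"
    and low_abs_summable: "summable (\<lambda>m. norm (blk u (j - 1 - int m) x))"
    and low_bound: "\<exists>M\<ge>0. \<forall>j x. norm (low u j x) \<le> M * 2 powr (real_of_int j / 4)"
    and low_integral: "\<phi> \<in> schwartz \<Longrightarrow> (\<lambda>m. \<integral>x. blk u (j - 1 - int m) x * \<phi> x \<partial>lborel) sums (\<integral>x. low u j x * \<phi> x \<partial>lborel)"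
proof -
  obtain M where M: "0 \<le> M" "\<And>k x. norm (blk u k x) \<le> M * 2 powr (real_of_int k / 4)"
    using good_sup[OF p u] by blast
  let ?q = "2 powr (- 1 / 4) :: real"
  let ?c = "\<lambda>j m. M * 2 powr (real_of_int (j - 1) / 4) * ?q ^ m"
  have "?q < 2 powr 0" by (intro powr_less_mono) auto
  then have q: "0 < ?q" "?q < 1" by simp_all
  have le: "norm (blk u (j - 1 - int m) x) \<le> ?c j m" for j m x
    using M(2)[of "j - 1 - int m" x] unfolding powr_quarter_step by (simp add: mult.assoc)
  have sm: "summable (?c j)" for j by (intro summable_mult geometric_quarter)
  note ser = dominated_series[of "\<lambda>m. blk u (j - 1 - int m)" "?c j" for j, OF blk_continuous[OF p u] le sm, folded low_def]
  show "summable (\<lambda>m. norm (blk u (j - 1 - int m) x))" "continuous_on UNIV (low u j)" by (rule ser)+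
  show "\<phi> \<in> schwartz \<Longrightarrow> (\<lambda>m. \<integral>x. blk u (j - 1 - int m) x * \<phi> x \<partial>lborel) sums (\<integral>x. low u j x * \<phi> x \<partial>lborel)" by (rule ser)
  have "norm (low u j x) \<le> (M / (1 - ?q)) * 2 powr (real_of_int j / 4)" for j x
  proof -
    have "norm (low u j x) \<le> suminf (?c j)" by (rule ser)
    also have "\<dots> = M * 2 powr (real_of_int (j - 1) / 4) * (1 / (1 - ?q))"
      using q by (subst suminf_mult[OF geometric_quarter]) (simp add: suminf_geometric)
    also have "\<dots> = (M / (1 - ?q)) * 2 powr (real_of_int (j - 1) / 4)" by simp
    also have "\<dots> \<le> (M / (1 - ?q)) * 2 powr (real_of_int j / 4)"
      using M(1) q by (intro mult_left_mono powr_mono) auto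
    finally show ?thesis .
  qed
  moreover have "0 \<le> M / (1 - ?q)" using M(1) q by simp
  ultimately show "\<exists>M\<ge>0. \<forall>j x. norm (low u j x) \<le> M * 2 powr (real_of_int j / 4)" by blast
qed

lemma low_measurable: "1 \<le> p \<Longrightarrow> good p u \<Longrightarrow> low u j \<in> borel_measurable borel"
  by (intro borel_measurable_continuous_onI low_continuous)

lemma low_tame: "1 \<le> p \<Longrightarrow> good p u \<Longrightarrow> tame (low u j)"
  using low_bound[of p u] by (metis bounded_tame low_measurable)

lemma spectrum_low:
  assumes p: "1 \<le> p" and u: "good p u"
  shows "spectrum_in {\<xi>. norm \<xi> \<le> 4 / 3 * 2 powi j} (low u j)"
  unfolding spectrum_in_def
proof (intro ballI impI)
  fix \<psi> :: "real^'n \<Rightarrow> complex" assume \<psi>: "\<psi> \<in> schwartz" and z: "\<forall>\<xi>\<in>{\<xi>. norm \<xi> \<le> 4 / 3 * 2 powi j}. inv_fourier \<psi> \<xi> = 0"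
  have "(\<integral>x. blk u (j - 1 - int m) x * \<psi> x \<partial>lborel) = 0" for m
  proof -
    have "(2::real) powi (j - 1 - int m) \<le> 2 powi (j - 1)" by (intro power_int_increasing) auto
    then have "8 / 3 * 2 powi (j - 1 - int m) \<le> (4 / 3 * 2 powi j :: real)" by (simp add: power_int_diff)
    then have "\<forall>\<xi>\<in>{\<xi>. 3 / 4 * 2 powi (j - 1 - int m) \<le> norm \<xi> \<and> norm \<xi> \<le> 8 / 3 * 2 powi (j - 1 - int m)}. inv_fourier \<psi> \<xi> = 0"
      using z by auto
    moreover have "tempered u" using u by (simp add: good_def)
    ultimately show ?thesis
      using spectrum_blk[OF _ blk_represents[OF p good_finite[OF u]]] \<psi> unfolding spectrum_in_def by blast
  qed
  then show "(\<integral>x. low u j x * \<psi> x \<partial>lborel) = 0"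
    using low_integral[OF p u \<psi>, of j] sums_unique2[OF _ sums_zero] by simp
qed

lemma test_multiplier_add:
  assumes m: "m\<^sub>1 \<in> schwartz" "m\<^sub>2 \<in> schwartz" and \<phi>: "\<phi> \<in> schwartz"
  shows "test_multiplier (\<lambda>\<xi>. m\<^sub>1 \<xi> + m\<^sub>2 \<xi>) \<phi> = (\<lambda>x. test_multiplier m\<^sub>1 \<phi> x + test_multiplier m\<^sub>2 (\<phi> :: real^'n \<Rightarrow> complex) x)"
proof
  fix x
  have "integrable lborel (\<lambda>\<xi>. cis (- (\<xi> \<bullet> x)) * (m \<xi> * inv_fourier \<phi> \<xi>))" if "m \<in> schwartz" for m
    by (intro schwartz_integrable schwartz_cis_mult_minus mult_inv_fourier_schwartz that \<phi>)
  from this[OF m(1)] this[OF m(2)]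
  show "test_multiplier (\<lambda>\<xi>. m\<^sub>1 \<xi> + m\<^sub>2 \<xi>) \<phi> x = test_multiplier m\<^sub>1 \<phi> x + test_multiplier m\<^sub>2 \<phi> x"
    by (simp add: test_multiplier_def fourier_def distrib_right distrib_left)
qed

lemma Slow_step:
  assumes "tempered u" "\<phi> \<in> schwartz"
  shows "Slow chi (j + 1) u \<phi> = Slow chi j u \<phi> + Delta chi j u \<phi>"
proof -
  have "dil (j + 1) = (\<lambda>\<xi>. dil j \<xi> + ann j \<xi>)" by (simp add: ann_def)
  then show ?thesis
    using assms by (simp add: Slow_eq Delta_eq test_multiplier_add dil_schwartz ann_schwartz tempered_add test_multiplier_schwartz)
qed

text \<open>
  By telescoping, \<open>Slow chi m u\<close> is \<open>Slow chi j u\<close> minus the blocks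
  between \<open>m\<close> and \<open>j\<close>.
\<close>

lemma Slow_limit:
  assumes p: "1 \<le> p" and u: "good p u" and \<phi>: "\<phi> \<in> schwartz"
  shows "((\<lambda>m. Slow chi m u \<phi>) \<longlongrightarrow> Slow chi j u \<phi> - (\<integral>x. low u j x * \<phi> x \<partial>lborel)) at_bot"
proof (rule tendsto_at_bot_int[of _ j])
  have tu: "tempered u" using u by (simp add: good_def)
  have "Slow chi (j - int M) u \<phi> = Slow chi j u \<phi> - (\<Sum>m<M. \<integral>x. blk u (j - 1 - int m) x * \<phi> x \<partial>lborel)" for M
  proof (induction M)
    case (Suc M)
    have "Slow chi (j - int M) u \<phi> = Slow chi (j - int (Suc M)) u \<phi> + Delta chi (j - 1 - int M) u \<phi>"
      using Slow_step[OF tu \<phi>, of "j - 1 - int M"] by (simp add: algebra_simps)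
    moreover have "Delta chi (j - 1 - int M) u \<phi> = (\<integral>x. blk u (j - 1 - int M) x * \<phi> x \<partial>lborel)"
      using blk_represents[OF p good_finite[OF u]] \<phi> by (simp add: represents_def)
    ultimately have "Slow chi (j - int (Suc M)) u \<phi>
        = Slow chi j u \<phi> - (\<Sum>m<M. \<integral>x. blk u (j - 1 - int m) x * \<phi> x \<partial>lborel) - (\<integral>x. blk u (j - 1 - int M) x * \<phi> x \<partial>lborel)"
      using Suc by (metis add_diff_cancel_right')
    then show ?case by (simp only: sum.lessThan_Suc diff_diff_eq)
  qed simp
  then show "(\<lambda>M. Slow chi (j - int M) u \<phi>) \<longlonglongrightarrow> Slow chi j u \<phi> - (\<integral>x. low u j x * \<phi> x \<partial>lborel)"
    using low_integral[OF p u \<phi>, of j] unfolding sums_def by (auto intro!: tendsto_intros)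
qed

lemma realization_limit:
  assumes p: "1 \<le> p" and u: "good p (rep A)" and \<phi>: "\<phi> \<in> schwartz"
  shows "((\<lambda>m. rep A \<phi> - Slow chi m (rep A) \<phi>) \<longlongrightarrow> realization chi A \<phi>) at_bot"
    and "realization chi A \<phi> = rep A \<phi> - Slow chi j (rep A) \<phi> + (\<integral>x. low (rep A) j x * \<phi> x \<partial>lborel)"
proof -
  have l: "((\<lambda>m. rep A \<phi> - Slow chi m (rep A) \<phi>) \<longlongrightarrow> rep A \<phi> - (Slow chi j (rep A) \<phi> - (\<integral>x. low (rep A) j x * \<phi> x \<partial>lborel))) at_bot" for j
    by (intro tendsto_diff tendsto_const Slow_limit[OF p u \<phi>])
  have eq: "realization chi A \<phi> = rep A \<phi> - (Slow chi j (rep A) \<phi> - (\<integral>x. low (rep A) j x * \<phi> x \<partial>lborel))" for j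
    unfolding realization_def by (rule tendsto_Lim[OF trivial_limit_at_bot_linorder l])
  show "((\<lambda>m. rep A \<phi> - Slow chi m (rep A) \<phi>) \<longlongrightarrow> realization chi A \<phi>) at_bot"
    using l[of j] unfolding eq[of j, symmetric] .
  show "realization chi A \<phi> = rep A \<phi> - Slow chi j (rep A) \<phi> + (\<integral>x. low (rep A) j x * \<phi> x \<partial>lborel)"
    unfolding eq[of j] by (simp only: diff_diff_eq2 diff_add_eq)
qed

lemma dil_mult_ann: "m < k \<Longrightarrow> dil m \<xi> * ann k \<xi> = 0"
proof (cases "ann k \<xi> = 0")
  case False
  assume "m < k"
  then have "(2::real) powi m \<le> 2 powi (k - 1)" by (intro power_int_increasing) auto
  then have "(2::real) powi m \<le> 2 powi k / 2" by (simp add: power_int_diff)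
  moreover have "0 < (2::real) powi k" by simp
  ultimately have "4 / 3 * 2 powi m < norm \<xi>" using ann_supp[OF False] by linarith
  then show ?thesis by (simp add: dil_far)
qed simp

lemma dil_mult_dil: "m < k \<Longrightarrow> dil m \<xi> * dil k \<xi> = dil m \<xi>"
proof (cases "dil m \<xi> = 0")
  case False
  assume "m < k"
  then have "(2::real) powi m \<le> 2 powi (k - 1)" by (intro power_int_increasing) auto
  then have "(2::real) powi m \<le> 2 powi k / 2" by (simp add: power_int_diff)
  moreover have "norm \<xi> \<le> 4 / 3 * 2 powi m" using False dil_far by force
  moreover have "0 < (2::real) powi k" by simp
  ultimately have "norm \<xi> < 3 / 4 * 2 powi k" by linarith
  then show ?thesis by (simp add: dil_near)
qed simp

text \<open>
  A low frequency cut-off far below \<open>2\<^sup>k\<close> is invisible to the block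
  \<open>k\<close>.
\<close>

lemma Delta_realization:
  assumes p: "1 \<le> p" and u: "good p (rep A)" and \<phi>: "\<phi> \<in> schwartz"
  shows "Delta chi k (realization chi A) \<phi> = Delta chi k (rep A) \<phi>"
proof -
  let ?\<psi> = "test_multiplier (ann k) \<phi>"
  have tu: "tempered (rep A)" using u by (simp add: good_def)
  have "Slow chi m (rep A) ?\<psi> = 0" if "m < k" for m
  proof -
    have "test_multiplier (dil m) ?\<psi> = test_multiplier (\<lambda>\<xi>. dil m \<xi> * ann k \<xi>) \<phi>"
      by (rule test_multiplier_compose[OF dil_schwartz ann_schwartz \<phi>])
    also have "\<dots> = (\<lambda>x. 0)"
      unfolding dil_mult_ann[OF that] by (simp add: test_multiplier_def fourier_def[abs_def])
    finally show ?thesis by (simp add: Slow_eq tempered_zero[OF tu])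
  qed
  then have "eventually (\<lambda>m. rep A ?\<psi> - Slow chi m (rep A) ?\<psi> = rep A ?\<psi>) at_bot"
    unfolding eventually_at_bot_linorder by (intro exI[of _ "k - 1"]) simp
  moreover have "((\<lambda>m. rep A ?\<psi> - Slow chi m (rep A) ?\<psi>) \<longlongrightarrow> realization chi A ?\<psi>) at_bot"
    by (intro realization_limit(1)[OF p u] test_multiplier_schwartz ann_schwartz \<phi>)
  ultimately have "((\<lambda>m::int. rep A ?\<psi>) \<longlongrightarrow> realization chi A ?\<psi>) at_bot"
    by (rule Lim_transform_eventually[rotated])
  then have "realization chi A ?\<psi> = rep A ?\<psi>"
    using tendsto_unique[OF trivial_limit_at_bot_linorder _ tendsto_const] by blast
  then show ?thesis by (simp add: Delta_eq)
qed

text \<open>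
  Subtracting the limit of the low frequency cut-offs leaves exactly the sum of the blocks below
  \<open>2\<^sup>j\<close>.
\<close>

lemma Slow_realization:
  assumes p: "1 \<le> p" and u: "good p (rep A)" and \<phi>: "\<phi> \<in> schwartz"
  shows "Slow chi j (realization chi A) \<phi> = (\<integral>x. low (rep A) j x * \<phi> x \<partial>lborel)"
proof -
  let ?\<psi> = "test_multiplier (dil j) \<phi>"
  have "rep A ?\<psi> - Slow chi m (rep A) ?\<psi> = Slow chi j (rep A) \<phi> - Slow chi m (rep A) \<phi>" if "m < j" for m
    using that by (simp add: Slow_eq test_multiplier_compose dil_schwartz \<phi> dil_mult_dil)
  then have ev: "eventually (\<lambda>m. rep A ?\<psi> - Slow chi m (rep A) ?\<psi> = Slow chi j (rep A) \<phi> - Slow chi m (rep A) \<phi>) at_bot"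
    unfolding eventually_at_bot_linorder by (intro exI[of _ "j - 1"]) simp
  have "((\<lambda>m. rep A ?\<psi> - Slow chi m (rep A) ?\<psi>) \<longlongrightarrow> realization chi A ?\<psi>) at_bot"
    by (intro realization_limit(1)[OF p u] test_multiplier_schwartz dil_schwartz \<phi>)
  then have "((\<lambda>m. Slow chi j (rep A) \<phi> - Slow chi m (rep A) \<phi>) \<longlongrightarrow> realization chi A ?\<psi>) at_bot"
    by (rule Lim_transform_eventually[OF _ ev])
  moreover have "((\<lambda>m. Slow chi j (rep A) \<phi> - Slow chi m (rep A) \<phi>) \<longlongrightarrow> Slow chi j (rep A) \<phi> - (Slow chi j (rep A) \<phi> - (\<integral>x. low (rep A) j x * \<phi> x \<partial>lborel))) at_bot"
    by (intro tendsto_diff tendsto_const Slow_limit[OF p u \<phi>])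
  ultimately have "realization chi A ?\<psi> = Slow chi j (rep A) \<phi> - (Slow chi j (rep A) \<phi> - (\<integral>x. low (rep A) j x * \<phi> x \<partial>lborel))"
    by (rule tendsto_unique[OF trivial_limit_at_bot_linorder])
  then show ?thesis by (simp add: Slow_eq)
qed

lemma fun_of_Delta_realization:
  assumes p: "1 \<le> p" and u: "good p (rep A)"
  shows "fun_of (Delta chi k (realization chi A)) = blk (rep A) k"
proof (rule fun_of_eq)
  show "continuous_on UNIV (blk (rep A) k)" by (rule blk_continuous[OF p u])
  show "represents (blk (rep A) k) (Delta chi k (realization chi A))"
    using blk_represents[OF p good_finite[OF u]] Delta_realization[OF p u] by (simp add: represents_def)
qed

lemma fun_of_Slow_realization:
  assumes p: "1 \<le> p" and u: "good p (rep A)"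
  shows "fun_of (Slow chi j (realization chi A)) = low (rep A) j"
proof (rule fun_of_eq)
  show "continuous_on UNIV (low (rep A) j)" by (rule low_continuous[OF p u])
  show "represents (low (rep A) j) (Slow chi j (realization chi A))"
    using Slow_realization[OF p u] low_measurable[OF p u] tame_mult_integrable[OF low_tame[OF p u]]
    by (simp add: represents_def)
qed

lemma realizable_good:
  assumes p: "1 \<le> p" and u: "good p (rep A)"
  shows "realizable chi A" "tempered (realization chi A)"
proof -
  have tu: "tempered (rep A)" using u by (simp add: good_def)
  have "tempered (\<lambda>\<phi>. (rep A \<phi> + (-1) * rep A (test_multiplier (dil 0) \<phi>)) + (\<integral>x. low (rep A) 0 x * \<phi> x \<partial>lborel))"
    by (intro tempered_sum tempered_scale tu tempered_test_multiplier dil_schwartz tempered_tame low_tame[OF p u])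
  then show t: "tempered (realization chi A)"
    by (rule tempered_cong) (simp add: realization_limit(2)[OF p u, of _ 0] Slow_eq)
  then show "realizable chi A"
    unfolding realizable_def using realization_limit(1)[OF p u] by blast
qed

text \<open>
  A change of variables moves the scale from the kernel to the increment of
  \<open>\<phi>\<close>.
\<close>

lemma test_multiplier_dil:
  assumes \<phi>: "\<phi> \<in> schwartz"
  shows "test_multiplier (dil J) \<phi> x = (\<integral>w. inv_fourier (dil 0) w * \<phi> (x + (2 powi (- J)) *\<^sub>R w) \<partial>lborel)"
proof -
  let ?s = "2 powi (- J) :: real"
  note [measurable] = schwartz_measurable[OF \<phi>] schwartz_measurable[OF kernel_schwartz(1)]
  have "inv_fourier (dil J) (?s *\<^sub>R w) = of_real (dyadic_vol CARD('n) J) * inv_fourier (dil 0) w" for w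
    by (simp add: inv_fourier_dil[of J] power_int_minus)
  then have "test_multiplier (dil J) \<phi> x
      = \<bar>?s\<bar> ^ CARD('n) *\<^sub>R (\<integral>w. of_real (dyadic_vol CARD('n) J) * (inv_fourier (dil 0) w * \<phi> (x + ?s *\<^sub>R w)) \<partial>lborel)"
    unfolding test_multiplier_eq_convolution[OF dil_schwartz \<phi>]
    using lborel_integral_affine[of "\<lambda>y. inv_fourier (dil J) (y - x) * \<phi> y" ?s x] by (simp add: mult.assoc)
  also have "\<dots> = (\<bar>?s\<bar> ^ CARD('n) * dyadic_vol CARD('n) J) *\<^sub>R (\<integral>w. inv_fourier (dil 0) w * \<phi> (x + ?s *\<^sub>R w) \<partial>lborel)"
    by (simp add: scaleR_conv_of_real)
  also have "\<bar>?s\<bar> ^ CARD('n) * dyadic_vol CARD('n) J = 1"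
    by (simp add: dyadic_vol_eq power_int_minus power_inverse)
  finally show ?thesis by simp
qed

text \<open>Removing the low frequencies of a test function gains a derivative, because the kernel has integral 1.\<close>

lemma one_minus_Slow:
  "\<exists>C\<ge>0. \<forall>J\<ge>0. \<forall>\<phi>\<in>schwartz. \<forall>B. seminorm_le (2 * CARD('n)) \<phi> B \<longrightarrow>
     (\<forall>x. norm (\<phi> x - test_multiplier (dil J) \<phi> x) \<le> C * 2 powi (- J) * B * weight x)"
proof -
  let ?E = "inv_fourier (dil 0)" and ?N = "2 * CARD('n)"
  have E: "?E \<in> schwartz" by (rule kernel_schwartz)
  define c where "c = (\<integral>w. (1 + norm w) ^ Suc ?N * norm (?E w) \<partial>lborel)"
  have c: "0 \<le> c" unfolding c_def by (intro integral_nonneg_AE AE_I2) auto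
  have "norm (\<phi> x - test_multiplier (dil J) \<phi> x) \<le> (real CARD('n) * c) * 2 powi (- J) * B * weight x"
    if J: "0 \<le> J" and \<phi>: "\<phi> \<in> schwartz" and B: "seminorm_le ?N \<phi> B" for J \<phi> B x
  proof -
    let ?s = "2 powi (- J) :: real"
    have s: "0 < ?s" "?s \<le> 1" using J power_int_increasing[of "- J" 0 "2::real"] by auto
    have one: "(\<integral>w. ?E w \<partial>lborel) = 1"
      using fun_cong[OF fourier_inv_fourier[OF dil_schwartz[of 0]], of 0] by (simp add: fourier_def dil_near)
    have \<phi>x: "(\<lambda>w. \<phi> (x + ?s *\<^sub>R w)) \<in> schwartz" using schwartz_affine[OF \<phi>, of ?s x] s by simp
    have "\<phi> x = (\<integral>w. ?E w * \<phi> x \<partial>lborel)" by (simp add: one)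
    then have "\<phi> x - test_multiplier (dil J) \<phi> x = (\<integral>w. ?E w * \<phi> x - ?E w * \<phi> (x + ?s *\<^sub>R w) \<partial>lborel)"
      unfolding test_multiplier_dil[OF \<phi>]
      using schwartz_integrable[OF E] schwartz_integrable[OF schwartz_mult[OF E \<phi>x]]
      by (subst Bochner_Integration.integral_diff) auto
    also have "norm \<dots> \<le> (\<integral>w. (real CARD('n) * B * ?s * weight x) * ((1 + norm w) ^ Suc ?N * norm (?E w)) \<partial>lborel)"
    proof (rule norm_integral_le)
      show "integrable lborel (\<lambda>w. (real CARD('n) * B * ?s * weight x) * ((1 + norm w) ^ Suc ?N * norm (?E w)))"
        by (intro integrable_mult_right schwartz_norm_integrable E)
      fix w :: "real^'n"
      have px: "0 < (1 + norm x) ^ ?N" by (intro zero_less_power add_pos_nonneg) auto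
      have B0: "0 \<le> B" by (rule seminorm_nonneg[OF B])
      have sw: "norm (?s *\<^sub>R w) = ?s * norm w" using s by simp
      have "(1 + norm x) ^ ?N * norm (\<phi> (x + ?s *\<^sub>R w) - \<phi> x) \<le> real CARD('n) * B * norm (?s *\<^sub>R w) * (1 + norm (?s *\<^sub>R w)) ^ ?N"
        by (rule schwartz_increment[OF \<phi> seminorm_partial[OF B]])
      also have "\<dots> \<le> real CARD('n) * B * (?s * (1 + norm w)) * (1 + norm w) ^ ?N"
        unfolding sw using s B0 by (intro mult_mono power_mono) (auto intro: mult_left_le_one_le simp: mult_left_le_one_le)
      also have "\<dots> = real CARD('n) * B * ?s * (1 + norm w) ^ Suc ?N" by simp
      finally have "norm (\<phi> (x + ?s *\<^sub>R w) - \<phi> x) \<le> (real CARD('n) * B * ?s * (1 + norm w) ^ Suc ?N) * weight x"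
        using px by (simp add: weight_def pos_le_divide_eq mult.commute)
      then have "norm (?E w) * norm (\<phi> (x + ?s *\<^sub>R w) - \<phi> x) \<le> norm (?E w) * ((real CARD('n) * B * ?s * (1 + norm w) ^ Suc ?N) * weight x)"
        by (rule mult_left_mono) simp
      then show "norm (?E w * \<phi> x - ?E w * \<phi> (x + ?s *\<^sub>R w)) \<le> (real CARD('n) * B * ?s * weight x) * ((1 + norm w) ^ Suc ?N * norm (?E w))"
        unfolding right_diff_distrib[symmetric] norm_mult norm_minus_commute[of "\<phi> x"] by (simp only: mult_ac)
    qed
    also have "\<dots> = (real CARD('n) * c) * ?s * B * weight x"
      unfolding c_def integral_mult_right_zero by (simp only: mult_ac)
    finally show ?thesis .
  qed
  moreover have "0 \<le> real CARD('n) * c" using c by simp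
  ultimately show ?thesis by blast
qed

section \<open>Convergence of Bony's decomposition\<close>

definition para :: "'n distr \<Rightarrow> 'n distr \<Rightarrow> int \<Rightarrow> real^'n \<Rightarrow> complex" where
  "para u v j x = low u (j - 1) x * blk v j x"

definition rem :: "'n distr \<Rightarrow> 'n distr \<Rightarrow> int \<Rightarrow> real^'n \<Rightarrow> complex" where
  "rem u v j x = (\<Sum>k | \<bar>k - j\<bar> \<le> 1. blk u k x) * blk v j x"

lemma near_eq: "{k :: int. \<bar>k - j\<bar> \<le> 1} = {j - 1, j, j + 1}"
  by auto

text \<open>
  The low frequency factor lives below \<open>2/3 * 2\<^sup>j\<close> and the block between
  \<open>3/4 * 2\<^sup>j\<close> and \<open>8/3 * 2\<^sup>j\<close>.
\<close>

lemma spectrum_para: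
  assumes p: "1 \<le> p" and u: "good p u" and v: "good p v"
  shows "spectrum_in {\<xi>. 1 / 12 * 2 powi j \<le> norm \<xi> \<and> norm \<xi> \<le> 10 / 3 * 2 powi j} (para u v j)"
  unfolding para_def
proof (rule spectrum_mult[OF spectrum_low[OF p u] spectrum_blk[OF _ blk_represents[OF p good_finite[OF v]]] blk_moderate[OF p good_finite[OF v]]])
  show "tempered v" using v by (simp add: good_def)
  fix a b :: "real^'n" assume a: "a \<in> {\<xi>. norm \<xi> \<le> 4 / 3 * 2 powi (j - 1)}"
    and b: "b \<in> {\<xi>. 3 / 4 * 2 powi j \<le> norm \<xi> \<and> norm \<xi> \<le> 8 / 3 * 2 powi j}"
  have "norm a \<le> 2 / 3 * 2 powi j" using a by (simp add: power_int_diff)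
  moreover have "norm b - norm a \<le> norm (a + b)" using norm_diff_ineq[of b a] by (simp add: add.commute)
  moreover have "norm (a + b) \<le> norm a + norm b" by (rule norm_triangle_ineq)
  ultimately show "a + b \<in> {\<xi>. 1 / 12 * 2 powi j \<le> norm \<xi> \<and> norm \<xi> \<le> 10 / 3 * 2 powi j}"
    using b by auto
qed

lemma para_sup:
  assumes p: "1 \<le> p" and u: "good p u" and v: "good p v"
  shows "\<exists>D\<ge>0. \<forall>j x. norm (para u v j x) \<le> D * 2 powr (real_of_int j / 2)"
proof -
  obtain M where M: "0 \<le> M" "\<And>j x. norm (low u j x) \<le> M * 2 powr (real_of_int j / 4)" using low_bound[OF p u] by blast
  obtain M' where M': "0 \<le> M'" "\<And>k x. norm (blk v k x) \<le> M' * 2 powr (real_of_int k / 4)" using good_sup[OF p v] by blast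
  have "norm (para u v j x) \<le> (M * M') * 2 powr (real_of_int j / 2)" for j x
  proof -
    have "norm (low u (j - 1) x) \<le> M * 2 powr (real_of_int (j - 1) / 4)" by (rule M)
    also have "\<dots> \<le> M * 2 powr (real_of_int j / 4)" using M(1) by (intro mult_left_mono powr_mono) auto
    finally have "norm (para u v j x) \<le> (M * 2 powr (real_of_int j / 4)) * (M' * 2 powr (real_of_int j / 4))"
      unfolding para_def norm_mult using M'(1) by (intro mult_mono M') (auto simp: M(1))
    also have "\<dots> = (M * M') * (2 powr (real_of_int j / 4) * 2 powr (real_of_int j / 4))" by simp
    also have "2 powr (real_of_int j / 4) * 2 powr (real_of_int j / 4) = 2 powr (real_of_int j / 2)" by (simp flip: powr_add)
    finally show ?thesis .
  qed
  then show ?thesis using M(1) M'(1) by (intro exI[of _ "M * M'"]) auto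
qed

lemma rem_sup:
  assumes p: "1 \<le> p" and u: "good p u" and v: "good p v"
  shows "\<exists>D\<ge>0. \<forall>j x. norm (rem u v j x) \<le> D * 2 powr (real_of_int j / 2)"
proof -
  obtain M where M: "0 \<le> M" "\<And>j x. norm (blk u j x) \<le> M * 2 powr (real_of_int j / 4)" using good_sup[OF p u] by blast
  obtain M' where M': "0 \<le> M'" "\<And>k x. norm (blk v k x) \<le> M' * 2 powr (real_of_int k / 4)" using good_sup[OF p v] by blast
  have "norm (rem u v j x) \<le> (6 * M * M') * 2 powr (real_of_int j / 2)" for j x
  proof -
    have "norm (\<Sum>k | \<bar>k - j\<bar> \<le> 1. blk u k x) \<le> (\<Sum>k | \<bar>k - j\<bar> \<le> 1. M * (2 * 2 powr (real_of_int j / 4)))"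
    proof (intro order_trans[OF norm_sum] sum_mono)
      fix k assume "k \<in> {k. \<bar>k - j\<bar> \<le> 1}"
      then have "real_of_int k / 4 \<le> 1 + real_of_int j / 4" by auto
      then have "2 powr (real_of_int k / 4) \<le> 2 powr (1 + real_of_int j / 4)" by (intro powr_mono) auto
      also have "\<dots> = 2 * 2 powr (real_of_int j / 4)" by (simp add: powr_add)
      finally show "norm (blk u k x) \<le> M * (2 * 2 powr (real_of_int j / 4))"
        using M by (intro order_trans[OF M(2)] mult_left_mono) auto
    qed
    also have "\<dots> = 6 * M * 2 powr (real_of_int j / 4)" by (simp add: near_eq)
    finally have "norm (rem u v j x) \<le> (6 * M * 2 powr (real_of_int j / 4)) * (M' * 2 powr (real_of_int j / 4))"
      unfolding rem_def norm_mult using M'(1) M(1) by (intro mult_mono M') auto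
    also have "\<dots> = (6 * M * M') * (2 powr (real_of_int j / 4) * 2 powr (real_of_int j / 4))" by simp
    also have "2 powr (real_of_int j / 4) * 2 powr (real_of_int j / 4) = 2 powr (real_of_int j / 2)" by (simp flip: powr_add)
    finally show ?thesis .
  qed
  then show ?thesis using M(1) M'(1) by (intro exI[of _ "6 * M * M'"]) auto
qed

lemma para_continuous: "1 \<le> p \<Longrightarrow> good p u \<Longrightarrow> good p v \<Longrightarrow> continuous_on UNIV (para u v j)"
  unfolding para_def by (intro continuous_intros low_continuous blk_continuous)

lemma rem_continuous: "1 \<le> p \<Longrightarrow> good p u \<Longrightarrow> good p v \<Longrightarrow> continuous_on UNIV (rem u v j)"
  unfolding rem_def by (intro continuous_intros blk_continuous)

lemma para_tame: "1 \<le> p \<Longrightarrow> good p u \<Longrightarrow> good p v \<Longrightarrow> tame (para u v j)"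
  using para_sup[of p u v] para_continuous[of p u v j] by (metis bounded_tame borel_measurable_continuous_onI)

lemma rem_tame: "1 \<le> p \<Longrightarrow> good p u \<Longrightarrow> good p v \<Longrightarrow> tame (rem u v j)"
  using rem_sup[of p u v] rem_continuous[of p u v j] by (metis bounded_tame borel_measurable_continuous_onI)

lemma sup_test_le:
  fixes f :: "real^'n \<Rightarrow> complex"
  assumes f: "f \<in> borel_measurable borel" "\<And>x. norm (f x) \<le> D" and \<phi>: "\<And>x. norm (\<phi> x) \<le> B * weight x" and B: "0 \<le> B"
  shows "norm (\<integral>x. f x * \<phi> x \<partial>lborel) \<le> D * (\<integral>x. weight x \<partial>(lborel :: (real^'n) measure)) * B"
proof -
  have "norm (\<integral>x. f x * \<phi> x \<partial>lborel) \<le> (\<integral>x. D * (B * weight x) \<partial>(lborel :: (real^'n) measure))"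
  proof (rule norm_integral_le)
    have "0 \<le> D" using f(2)[of 0] norm_ge_zero order_trans by blast
    then show "norm (f x * \<phi> x) \<le> D * (B * weight x)" for x
      unfolding norm_mult by (intro mult_mono f \<phi>) auto
  qed (intro integrable_mult_right weight_integrable)
  then show ?thesis by (simp add: mult_ac)
qed

text \<open>
  At low frequencies the supremum bound suffices. At high frequencies the term is orthogonal to
  the low frequencies of \<open>\<phi>\<close>, and \<open>\<phi> - test_multiplier (dil (j -
  5)) \<phi>\<close> is of size \<open>2\<^sup>-\<^sup>j\<close>, which beats the growth
  \<open>2\<^sup>j\<^sup>/\<^sup>2\<close> of the term.
\<close>

lemma para_test:
  assumes p: "1 \<le> p" and u: "good p u" and v: "good p v"
  shows "\<exists>D\<ge>0. \<forall>j. \<forall>\<phi>\<in>schwartz. \<forall>B. seminorm_le (2 * CARD('n)) \<phi> B \<longrightarrow>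
    norm (\<integral>x. para u v j x * \<phi> x \<partial>lborel) \<le> (D * 2 powr (- (1 / 2) * real_of_int \<bar>j\<bar>)) * B"
proof -
  obtain D where D: "0 \<le> D" "\<And>j x. norm (para u v j x) \<le> D * 2 powr (real_of_int j / 2)" using para_sup[OF p u v] by blast
  obtain C where C: "0 \<le> C" "\<And>J \<phi> B x. 0 \<le> J \<Longrightarrow> \<phi> \<in> schwartz \<Longrightarrow> seminorm_le (2 * CARD('n)) \<phi> B \<Longrightarrow>
     norm (\<phi> x - test_multiplier (dil J) \<phi> x) \<le> C * 2 powi (- J) * B * weight x" using one_minus_Slow by blast
  define W where "W = (\<integral>x. weight x \<partial>(lborel :: (real^'n) measure))"
  have W: "0 < W" unfolding W_def by (rule integral_weight_pos)
  have meas: "para u v j \<in> borel_measurable borel" for j by (intro borel_measurable_continuous_onI para_continuous[OF p u v])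
  have "norm (\<integral>x. para u v j x * \<phi> x \<partial>lborel) \<le> (32 * D * W * (1 + C)) * 2 powr (- (1 / 2) * real_of_int \<bar>j\<bar>) * B"
    if \<phi>: "\<phi> \<in> schwartz" and B: "seminorm_le (2 * CARD('n)) \<phi> B" for j \<phi> B
  proof (cases "j < 5")
    case True
    have B0: "0 \<le> B" by (rule seminorm_nonneg[OF B])
    have "norm (\<integral>x. para u v j x * \<phi> x \<partial>lborel) \<le> D * 2 powr (real_of_int j / 2) * W * B"
      unfolding W_def by (rule sup_test_le[OF meas D(2) seminorm_weight[OF B] B0])
    also have "2 powr (real_of_int j / 2) \<le> 2 powr (5 + - (1 / 2) * real_of_int \<bar>j\<bar>)"
      using True by (intro powr_mono) auto
    also have "\<dots> = 32 * 2 powr (- (1 / 2) * real_of_int \<bar>j\<bar>)" unfolding powr_add by simp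
    finally have "norm (\<integral>x. para u v j x * \<phi> x \<partial>lborel) \<le> (32 * D * W) * 2 powr (- (1 / 2) * real_of_int \<bar>j\<bar>) * B"
      using D(1) W B0 by (simp add: mult_left_mono mult_right_mono mult_ac)
    also have "\<dots> \<le> (32 * D * W * (1 + C)) * 2 powr (- (1 / 2) * real_of_int \<bar>j\<bar>) * B"
    proof (intro mult_right_mono B0 powr_ge_zero)
      have "32 * D * W * 1 \<le> 32 * D * W * (1 + C)" using D(1) W C(1) by (intro mult_left_mono) auto
      then show "32 * D * W \<le> 32 * D * W * (1 + C)" by simp
    qed
    finally show ?thesis .
  next
    case False
    have B0: "0 \<le> B" by (rule seminorm_nonneg[OF B])
    have S: "test_multiplier (dil (j - 5)) \<phi> \<in> schwartz" by (intro test_multiplier_schwartz dil_schwartz \<phi>)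
    have "(\<integral>x. para u v j x * test_multiplier (dil (j - 5)) \<phi> x \<partial>lborel) = 0"
    proof (rule spectrum_test_multiplier[OF spectrum_para[OF p u v] dil_schwartz \<phi>])
      fix \<xi> :: "real^'n" assume "\<xi> \<in> {\<xi>. 1 / 12 * 2 powi j \<le> norm \<xi> \<and> norm \<xi> \<le> 10 / 3 * 2 powi j}"
      then have "1 / 12 * 2 powi j \<le> norm \<xi>" by simp
      moreover have "(2::real) powi (j - 5) = 2 powi j / 32" by (simp add: power_int_diff)
      moreover have "0 < (2::real) powi j" by simp
      ultimately have "4 / 3 * 2 powi (j - 5) < norm \<xi>" by linarith
      then show "dil (j - 5) \<xi> = 0" by (rule dil_far)
    qed
    then have "(\<integral>x. para u v j x * \<phi> x \<partial>lborel) = (\<integral>x. para u v j x * (\<phi> x - test_multiplier (dil (j - 5)) \<phi> x) \<partial>lborel)"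
      using tame_mult_integrable[OF para_tame[OF p u v] \<phi>] tame_mult_integrable[OF para_tame[OF p u v] S]
      by (simp add: right_diff_distrib)
    also have "norm \<dots> \<le> D * 2 powr (real_of_int j / 2) * W * (C * 2 powi (- (j - 5)) * B)"
      unfolding W_def using False B0 C(1) by (intro sup_test_le[OF meas D(2) C(2)[OF _ \<phi> B]]) auto
    also have "2 powi (- (j - 5)) = 32 * (2 powr (- real_of_int j) :: real)"
      using powr_real_of_int'[of 2 "- j"] by (simp add: power_int_diff power_int_minus field_simps)
    also have "D * 2 powr (real_of_int j / 2) * W * (C * (32 * 2 powr (- real_of_int j)) * B)
        = (32 * D * W * C) * (2 powr (real_of_int j / 2) * 2 powr (- real_of_int j)) * B" by (simp only: mult_ac)
    also have "2 powr (real_of_int j / 2) * 2 powr (- real_of_int j) = 2 powr (- (1 / 2) * real_of_int \<bar>j\<bar>)"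
      using False by (simp flip: powr_add)
    also have "(32 * D * W * C) * 2 powr (- (1 / 2) * real_of_int \<bar>j\<bar>) * B \<le> (32 * D * W * (1 + C)) * 2 powr (- (1 / 2) * real_of_int \<bar>j\<bar>) * B"
      using D(1) W B0 C(1) by (intro mult_right_mono mult_left_mono) auto
    finally show ?thesis .
  qed
  moreover have "0 \<le> 32 * D * W * (1 + C)" using D(1) W C(1) by simp
  ultimately show ?thesis by blast
qed

text \<open>
  The symbol \<open>ann l\<close> vanishes near the origin, so a block does not depend on the
  representative.
\<close>

lemma Delta_poly_class:
  assumes u: "tempered u" and \<phi>: "\<phi> \<in> schwartz"
  shows "Delta chi l (rep (poly_class u)) \<phi> = Delta chi l u \<phi>"
proof -
  have "(u, rep (poly_class u)) \<in> poly_equiv" by (rule rep_poly_class[OF u])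
  then have "\<exists>P::real^'n \<Rightarrow> complex. polynomial_function P \<and>
      (\<forall>\<phi>\<in>schwartz. u \<phi> - rep (poly_class u) \<phi> = (\<integral>x. P x * \<phi> x \<partial>lborel))"
    unfolding poly_equiv_def mem_Collect_eq split_conv by (elim conjE)
  then obtain P :: "real^'n \<Rightarrow> complex" where P: "polynomial_function P"
    "\<forall>\<phi>\<in>schwartz. u \<phi> - rep (poly_class u) \<phi> = (\<integral>x. P x * \<phi> x \<partial>lborel)" by (elim exE conjE)
  have "(\<lambda>\<xi>. ann l \<xi> * inv_fourier \<phi> \<xi>) \<in> null_near_0"
    unfolding null_near_0_def
  proof (intro CollectI conjI exI[of _ "3 / 4 * 2 powi l"] allI impI)
    show "(\<lambda>\<xi>. ann l \<xi> * inv_fourier \<phi> \<xi>) \<in> schwartz" by (intro mult_inv_fourier_schwartz ann_schwartz \<phi>)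
    show "ann l \<xi> * inv_fourier \<phi> \<xi> = 0" if "norm \<xi> < 3 / 4 * 2 powi l" for \<xi>
      using ann_supp[of l \<xi>] that by force
  qed simp
  then have "(\<integral>x. P x * test_multiplier (ann l) \<phi> x \<partial>lborel) = 0"
    unfolding test_multiplier_def by (rule polynomial_fourier_integral[OF P(1)])
  then show ?thesis
    using P(2)[rule_format, OF test_multiplier_schwartz[OF ann_schwartz[of l] \<phi>]] by (simp add: Delta_eq)
qed

section \<open>Lebesgue norms of the pieces of the product\<close>

abbreviation bnorm :: "real \<Rightarrow> 'n distr \<Rightarrow> int \<Rightarrow> ennreal" where
  "bnorm p u k \<equiv> distr_Lnorm (ennreal p) (Delta chi k u)"

text \<open>
  Hoelder's inequality, with Bernstein's inequality for the factor of frequency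
  \<open>2\<^sup>k\<close>.
\<close>

lemma blk_product:
  assumes p: "1 \<le> p" and r: "0 < r" "r \<le> p" "p \<le> 2 * r" and u: "good p u" and v: "good p v"
  shows "Lnorm (ennreal r) lborel (\<lambda>x. ennreal (norm (blk v j x)) * ennreal (norm (blk u k x)))
    \<le> ennreal (kc * dyadic_vol CARD('n) k powr (2 / p - 1 / r)) * (bnorm p v j * bnorm p u k)"
proof -
  note [measurable] = blk_measurable[OF p u] blk_measurable[OF p v]
  note L = blk_Lnorm[OF p good_finite[OF u], of k] blk_Lnorm[OF p good_finite[OF v], of j]
  show ?thesis
    using product_Lnorm[where f = "\<lambda>x. ennreal (norm (blk v j x))" and g = "\<lambda>x. ennreal (norm (blk u k x))"
        and M = lborel and L = "dyadic_vol CARD('n) k" and c = kc, OF r kc(1)]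
      blk_sup[OF p good_finite[OF u], where k = k] unfolding L by simp
qed

lemma rem_Lnorm:
  assumes p: "1 \<le> p" and r: "1 \<le> r" "r \<le> p" "p \<le> 2 * r" and u: "good p u" and v: "good p v"
  shows "Lnorm (ennreal r) lborel (\<lambda>x. ennreal (norm (rem u v j x)))
    \<le> (\<Sum>k | \<bar>k - j\<bar> \<le> 1. ennreal (kc * dyadic_vol CARD('n) j powr (2 / p - 1 / r)) * (bnorm p u k * bnorm p v j))"
proof -
  note [measurable] = blk_measurable[OF p u] blk_measurable[OF p v]
  have r': "1 \<le> ennreal r" using r by (simp add: ennreal_ge_1)
  have fin: "finite {k. \<bar>k - j\<bar> \<le> 1}" by (simp add: near_eq)
  have [measurable]: "rem u v j \<in> borel_measurable borel" by (intro borel_measurable_continuous_onI rem_continuous[OF p u v])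
  have "ennreal (norm (rem u v j x)) \<le> (\<Sum>k | \<bar>k - j\<bar> \<le> 1. ennreal (norm (blk u k x)) * ennreal (norm (blk v j x)))" for x
  proof -
    have "norm (rem u v j x) \<le> (\<Sum>k | \<bar>k - j\<bar> \<le> 1. norm (blk u k x)) * norm (blk v j x)"
      unfolding rem_def norm_mult by (intro mult_right_mono norm_sum) auto
    then have "ennreal (norm (rem u v j x)) \<le> ennreal (\<Sum>k | \<bar>k - j\<bar> \<le> 1. norm (blk u k x) * norm (blk v j x))"
      by (simp add: ennreal_leI sum_distrib_right)
    also have "\<dots> = (\<Sum>k | \<bar>k - j\<bar> \<le> 1. ennreal (norm (blk u k x)) * ennreal (norm (blk v j x)))"
      by (subst sum_ennreal[symmetric]) (auto simp: ennreal_mult)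
    finally show ?thesis .
  qed
  then have "Lnorm (ennreal r) lborel (\<lambda>x. ennreal (norm (rem u v j x)))
    \<le> Lnorm (ennreal r) lborel (\<lambda>x. \<Sum>k | \<bar>k - j\<bar> \<le> 1. ennreal (norm (blk u k x)) * ennreal (norm (blk v j x)))"
    by (intro Lnorm_mono_AE r' AE_I2) auto
  also have "\<dots> \<le> (\<Sum>k | \<bar>k - j\<bar> \<le> 1. Lnorm (ennreal r) lborel (\<lambda>x. ennreal (norm (blk u k x)) * ennreal (norm (blk v j x))))"
    by (intro Lnorm_sum r' fin) auto
  also have "\<dots> \<le> (\<Sum>k | \<bar>k - j\<bar> \<le> 1. ennreal (kc * dyadic_vol CARD('n) j powr (2 / p - 1 / r)) * (bnorm p u k * bnorm p v j))"
    using r by (intro sum_mono blk_product[OF p _ _ _ v u]) auto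
  finally show ?thesis .
qed

lemma para_Lnorm:
  assumes p: "1 \<le> p" and q: "1 \<le> q" "q \<le> p" "p \<le> 2 * q" and u: "good p u" and v: "good p v"
  shows "Lnorm (ennreal q) lborel (\<lambda>x. ennreal (norm (para u v j x)))
    \<le> (\<integral>\<^sup>+m. ennreal (kc * dyadic_vol CARD('n) (j - 2 - int m) powr (2 / p - 1 / q)) * (bnorm p u (j - 2 - int m) * bnorm p v j) \<partial>count_space UNIV)"
proof -
  note [measurable] = blk_measurable[OF p u] blk_measurable[OF p v]
  have q': "1 \<le> ennreal q" using q by (simp add: ennreal_ge_1)
  have [measurable]: "para u v j \<in> borel_measurable borel" by (intro borel_measurable_continuous_onI para_continuous[OF p u v])
  have le: "ennreal (norm (para u v j x)) \<le> (\<integral>\<^sup>+m. ennreal (norm (blk v j x)) * ennreal (norm (blk u (j - 2 - int m) x)) \<partial>count_space UNIV)" for x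
  proof -
    have "ennreal (norm (low u (j - 1) x)) \<le> (\<integral>\<^sup>+m. ennreal (norm (blk u (j - 1 - 1 - int m) x)) \<partial>count_space UNIV)"
      unfolding low_def by (rule norm_suminf_le_nn_integral[OF low_abs_summable[OF p u]])
    from mult_left_mono[OF this, of "ennreal (norm (blk v j x))"] show ?thesis
      by (simp add: para_def norm_mult ennreal_mult nn_integral_cmult mult.commute)
  qed
  then have "Lnorm (ennreal q) lborel (\<lambda>x. ennreal (norm (para u v j x)))
    \<le> Lnorm (ennreal q) lborel (\<lambda>x. \<integral>\<^sup>+m. ennreal (norm (blk v j x)) * ennreal (norm (blk u (j - 2 - int m) x)) \<partial>count_space UNIV)"
    by (intro Lnorm_mono_AE q' AE_I2) auto
  also have "\<dots> \<le> (\<integral>\<^sup>+m. Lnorm (ennreal q) lborel (\<lambda>x. ennreal (norm (blk v j x)) * ennreal (norm (blk u (j - 2 - int m) x))) \<partial>count_space UNIV)"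
    by (intro Minkowski_Lnorm q') auto
  also have "\<dots> \<le> (\<integral>\<^sup>+m. ennreal (kc * dyadic_vol CARD('n) (j - 2 - int m) powr (2 / p - 1 / q)) * (bnorm p v j * bnorm p u (j - 2 - int m)) \<partial>count_space UNIV)"
    using q by (intro nn_integral_mono blk_product[OF p _ _ _ u v]) auto
  finally show ?thesis by (simp add: mult.commute)
qed

text \<open>
  The bounds in \<open>good\<close> and Hoelder's inequality give the power \<open>2 * (1/4 -
  n/p) + n * (2/p - 1/r) = 1/2 - n/r\<close> of \<open>2\<^sup>j\<close>, where \<open>n\<close>
  is the dimension, and \<open>r \<le> n\<close>.
\<close>

lemma rem_decay:
  assumes p: "1 \<le> p" and r: "1 \<le> r" "r \<le> p" "p \<le> 2 * r" "r \<le> real CARD('n)" and u: "good p u" and v: "good p v"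
  shows "\<exists>D\<ge>0. \<forall>j\<ge>0. Lnorm (ennreal r) lborel (\<lambda>x. ennreal (norm (rem u v j x))) \<le> ennreal (D * 2 powr (- (1 / 2) * real_of_int \<bar>j\<bar>))"
proof -
  let ?n = "real CARD('n)"
  let ?s = "1 / 4 - ?n / p"
  obtain M where M: "0 \<le> M" "\<And>k. bnorm p u k \<le> ennreal (M * 2 powr (real_of_int k * ?s))"
    using u unfolding good_def by blast
  obtain M' where M': "0 \<le> M'" "\<And>k. bnorm p v k \<le> ennreal (M' * 2 powr (real_of_int k * ?s))"
    using v unfolding good_def by blast
  have kc0: "0 < kc" using kc(1) by simp
  have "Lnorm (ennreal r) lborel (\<lambda>x. ennreal (norm (rem u v j x))) \<le> ennreal ((3 * kc * M * M' * 2 powr \<bar>?s\<bar>) * 2 powr (- (1 / 2) * real_of_int \<bar>j\<bar>))"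
    if j: "0 \<le> j" for j
  proof -
    let ?x = "real_of_int j"
    let ?t = "kc * dyadic_vol CARD('n) j powr (2 / p - 1 / r) * (M * (2 powr \<bar>?s\<bar> * 2 powr (?x * ?s)) * (M' * 2 powr (?x * ?s)))"
    have "Lnorm (ennreal r) lborel (\<lambda>x. ennreal (norm (rem u v j x)))
        \<le> (\<Sum>k | \<bar>k - j\<bar> \<le> 1. ennreal (kc * dyadic_vol CARD('n) j powr (2 / p - 1 / r)) * (bnorm p u k * bnorm p v j))"
      by (rule rem_Lnorm[OF p r(1-3) u v])
    also have "\<dots> \<le> (\<Sum>k | \<bar>k - j\<bar> \<le> 1. ennreal ?t)"
    proof (rule sum_mono)
      fix k assume "k \<in> {k. \<bar>k - j\<bar> \<le> 1}"
      then have "\<bar>real_of_int k - ?x\<bar> \<le> 1" by auto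
      then have "\<bar>(real_of_int k - ?x) * ?s\<bar> \<le> 1 * \<bar>?s\<bar>" unfolding abs_mult by (intro mult_right_mono) auto
      then have "real_of_int k * ?s \<le> \<bar>?s\<bar> + ?x * ?s" by (simp add: left_diff_distrib)
      then have "2 powr (real_of_int k * ?s) \<le> 2 powr (\<bar>?s\<bar> + ?x * ?s)" by (intro powr_mono) auto
      then have "M * 2 powr (real_of_int k * ?s) \<le> M * (2 powr \<bar>?s\<bar> * 2 powr (?x * ?s))"
        unfolding powr_add using M(1) by (rule mult_left_mono)
      then have "bnorm p u k \<le> ennreal (M * (2 powr \<bar>?s\<bar> * 2 powr (?x * ?s)))"
        using M(2)[of k] by (meson ennreal_leI order_trans)
      then have "ennreal (kc * dyadic_vol CARD('n) j powr (2 / p - 1 / r)) * (bnorm p u k * bnorm p v j)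
        \<le> ennreal (kc * dyadic_vol CARD('n) j powr (2 / p - 1 / r)) * (ennreal (M * (2 powr \<bar>?s\<bar> * 2 powr (?x * ?s))) * ennreal (M' * 2 powr (?x * ?s)))"
        by (intro mult_left_mono mult_mono M') auto
      also have "\<dots> = ennreal ?t" using M(1) M'(1) kc0 by (simp flip: ennreal_mult)
      finally show "ennreal (kc * dyadic_vol CARD('n) j powr (2 / p - 1 / r)) * (bnorm p u k * bnorm p v j) \<le> ennreal ?t" .
    qed
    also have "\<dots> = ennreal (3 * ?t)" using M(1) M'(1) kc0 by (simp add: near_eq ennreal_mult)
    also have "\<dots> \<le> ennreal ((3 * kc * M * M' * 2 powr \<bar>?s\<bar>) * 2 powr (- (1 / 2) * real_of_int \<bar>j\<bar>))"
    proof (rule ennreal_leI)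
      have "dyadic_vol CARD('n) j powr (2 / p - 1 / r) * (2 powr (?x * ?s) * 2 powr (?x * ?s)) = 2 powr (?x * (1 / 2 - ?n / r))"
        by (simp add: dyadic_vol_def powr_powr algebra_simps flip: powr_add)
      moreover have "2 powr (?x * (1 / 2 - ?n / r)) \<le> 2 powr (- (1 / 2) * real_of_int \<bar>j\<bar>)"
      proof (intro powr_mono)
        have "1 \<le> ?n / r" using r by simp
        then have "?x * (1 / 2 - ?n / r) \<le> ?x * (- (1 / 2))" using j by (intro mult_left_mono) auto
        then show "?x * (1 / 2 - ?n / r) \<le> - (1 / 2) * real_of_int \<bar>j\<bar>" using j by simp
      qed simp
      ultimately have "(3 * kc * M * M' * 2 powr \<bar>?s\<bar>) * (dyadic_vol CARD('n) j powr (2 / p - 1 / r) * (2 powr (?x * ?s) * 2 powr (?x * ?s)))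
          \<le> (3 * kc * M * M' * 2 powr \<bar>?s\<bar>) * 2 powr (- (1 / 2) * real_of_int \<bar>j\<bar>)"
        using M(1) M'(1) kc0 by (intro mult_left_mono) auto
      then show "3 * ?t \<le> (3 * kc * M * M' * 2 powr \<bar>?s\<bar>) * 2 powr (- (1 / 2) * real_of_int \<bar>j\<bar>)"
        by (simp only: mult_ac)
    qed
    finally show ?thesis .
  qed
  moreover have "0 \<le> 3 * kc * M * M' * 2 powr \<bar>?s\<bar>" using M(1) M'(1) kc0 by simp
  ultimately show ?thesis by blast
qed

text \<open>
  The frequencies of a remainder term fill a ball, so nothing can be gained from
  \<open>\<phi>\<close> at high frequencies; the decay in \<open>L\<^sup>r\<close> replaces it.
\<close>

lemma rem_test:
  assumes p: "1 \<le> p" and r: "1 \<le> r" "r \<le> p" "p \<le> 2 * r" "r \<le> real CARD('n)" and u: "good p u" and v: "good p v"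
  shows "\<exists>D\<ge>0. \<forall>j. \<forall>\<phi>\<in>schwartz. \<forall>B. seminorm_le (2 * CARD('n)) \<phi> B \<longrightarrow>
    norm (\<integral>x. rem u v j x * \<phi> x \<partial>lborel) \<le> (D * 2 powr (- (1 / 2) * real_of_int \<bar>j\<bar>)) * B"
proof -
  obtain D where D: "0 \<le> D" "\<And>j x. norm (rem u v j x) \<le> D * 2 powr (real_of_int j / 2)" using rem_sup[OF p u v] by blast
  obtain E where E: "0 \<le> E" "\<And>j. 0 \<le> j \<Longrightarrow> Lnorm (ennreal r) lborel (\<lambda>x. ennreal (norm (rem u v j x))) \<le> ennreal (E * 2 powr (- (1 / 2) * real_of_int \<bar>j\<bar>))"
    using rem_decay[OF p r u v] by blast
  define W where "W = (\<integral>x. weight x \<partial>(lborel :: (real^'n) measure))"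
  have W: "0 < W" unfolding W_def by (rule integral_weight_pos)
  have meas: "rem u v j \<in> borel_measurable borel" for j by (intro borel_measurable_continuous_onI rem_continuous[OF p u v])
  have "norm (\<integral>x. rem u v j x * \<phi> x \<partial>lborel) \<le> ((D * W + W powr (1 - 1 / r) * E) * 2 powr (- (1 / 2) * real_of_int \<bar>j\<bar>)) * B"
    if \<phi>: "\<phi> \<in> schwartz" and B: "seminorm_le (2 * CARD('n)) \<phi> B" for j \<phi> B
  proof (cases "j < 0")
    case True
    have B0: "0 \<le> B" by (rule seminorm_nonneg[OF B])
    have "norm (\<integral>x. rem u v j x * \<phi> x \<partial>lborel) \<le> D * 2 powr (real_of_int j / 2) * W * B"
      unfolding W_def by (rule sup_test_le[OF meas D(2) seminorm_weight[OF B] B0])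
    also have "\<dots> = ((D * W) * 2 powr (- (1 / 2) * real_of_int \<bar>j\<bar>)) * B" using True by simp
    also have "\<dots> \<le> ((D * W + W powr (1 - 1 / r) * E) * 2 powr (- (1 / 2) * real_of_int \<bar>j\<bar>)) * B"
      using D(1) W B0 E(1) by (intro mult_right_mono) auto
    finally show ?thesis .
  next
    case False
    have B0: "0 \<le> B" by (rule seminorm_nonneg[OF B])
    have t: "tame (rem u v j)" by (rule rem_tame[OF p u v])
    have "ennreal (\<integral>x. weight x * norm (rem u v j x) \<partial>lborel) = (\<integral>\<^sup>+x. weight x * norm (rem u v j x) \<partial>lborel)"
      using t by (intro nn_integral_eq_integral[symmetric]) (auto simp: tame_def less_imp_le[OF weight_pos])
    also have "\<dots> \<le> ennreal (W powr (1 - 1 / r)) * Lnorm (ennreal r) lborel (\<lambda>x. ennreal (norm (rem u v j x)))"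
      unfolding W_def by (rule Lp_weight[OF r(1) meas])
    also have "\<dots> \<le> ennreal (W powr (1 - 1 / r)) * ennreal (E * 2 powr (- (1 / 2) * real_of_int \<bar>j\<bar>))"
      using False by (intro mult_left_mono E) auto
    also have "\<dots> = ennreal ((W powr (1 - 1 / r) * E) * 2 powr (- (1 / 2) * real_of_int \<bar>j\<bar>))"
      using E(1) by (simp add: mult.assoc flip: ennreal_mult)
    finally have "(\<integral>x. weight x * norm (rem u v j x) \<partial>lborel) \<le> (W powr (1 - 1 / r) * E) * 2 powr (- (1 / 2) * real_of_int \<bar>j\<bar>)"
      using E(1) by (subst (asm) ennreal_le_iff) auto
    also have "\<dots> \<le> (D * W + W powr (1 - 1 / r) * E) * 2 powr (- (1 / 2) * real_of_int \<bar>j\<bar>)"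
      using D(1) W by (intro mult_right_mono) auto
    finally have "B * (\<integral>x. weight x * norm (rem u v j x) \<partial>lborel) \<le> B * ((D * W + W powr (1 - 1 / r) * E) * 2 powr (- (1 / 2) * real_of_int \<bar>j\<bar>))"
      using B0 by (rule mult_left_mono)
    then show ?thesis
      using tame_mult_le[OF t seminorm_weight[OF B]] by (simp add: mult.commute)
  qed
  moreover have "0 \<le> D * W + W powr (1 - 1 / r) * E" using D(1) W E(1) by simp
  ultimately show ?thesis by blast
qed

text \<open>
  By \<open>tempered_infsum\<close>, since the tested terms are bounded by \<open>2\<close> to
  the power \<open>- \<bar>j\<bar> / 2\<close>.
\<close>

lemma series_converge:
  assumes p: "1 \<le> p" and r: "1 \<le> r" "r \<le> p" "p \<le> 2 * r" "r \<le> real CARD('n)" and u: "good p u" and v: "good p v"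
  shows para_summable: "\<phi> \<in> schwartz \<Longrightarrow> (\<lambda>j. \<integral>x. para u v j x * \<phi> x \<partial>lborel) summable_on UNIV"
    and para_tempered: "tempered (\<lambda>\<phi>. \<Sum>\<^sub>\<infinity>j. \<integral>x. para u v j x * \<phi> x \<partial>lborel)"
    and rem_summable: "\<phi> \<in> schwartz \<Longrightarrow> (\<lambda>j. \<integral>x. rem u v j x * \<phi> x \<partial>lborel) summable_on UNIV"
    and rem_tempered: "tempered (\<lambda>\<phi>. \<Sum>\<^sub>\<infinity>j. \<integral>x. rem u v j x * \<phi> x \<partial>lborel)"
proof -
  have sm: "(\<lambda>j. D * 2 powr (- (1 / 2) * real_of_int \<bar>j\<bar>)) summable_on UNIV" for D :: real
    by (intro summable_on_cmult_right powr_abs_summable_on) simp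
  obtain D where D: "\<And>j \<phi> B. \<phi> \<in> schwartz \<Longrightarrow> seminorm_le (2 * CARD('n)) \<phi> B \<Longrightarrow>
    norm (\<integral>x. para u v j x * \<phi> x \<partial>lborel) \<le> (D * 2 powr (- (1 / 2) * real_of_int \<bar>j\<bar>)) * B"
    using para_test[OF p u v] by blast
  note ti = tempered_infsum[of "\<lambda>j \<phi>. \<integral>x. para u v j x * \<phi> x \<partial>lborel" "\<lambda>j. D * 2 powr (- (1 / 2) * real_of_int \<bar>j\<bar>)"]
  show "(\<lambda>j. \<integral>x. para u v j x * \<phi> x \<partial>lborel) summable_on UNIV" if "\<phi> \<in> schwartz"
    using tempered_tame[OF para_tame[OF p u v]] D sm that by (intro ti(1)) auto
  show "tempered (\<lambda>\<phi>. \<Sum>\<^sub>\<infinity>j. \<integral>x. para u v j x * \<phi> x \<partial>lborel)"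
    using tempered_tame[OF para_tame[OF p u v]] D sm by (intro ti(2)) auto
  obtain E where E: "\<And>j \<phi> B. \<phi> \<in> schwartz \<Longrightarrow> seminorm_le (2 * CARD('n)) \<phi> B \<Longrightarrow>
    norm (\<integral>x. rem u v j x * \<phi> x \<partial>lborel) \<le> (E * 2 powr (- (1 / 2) * real_of_int \<bar>j\<bar>)) * B"
    using rem_test[OF p r u v] by blast
  note ti = tempered_infsum[of "\<lambda>j \<phi>. \<integral>x. rem u v j x * \<phi> x \<partial>lborel" "\<lambda>j. E * 2 powr (- (1 / 2) * real_of_int \<bar>j\<bar>)"]
  show "(\<lambda>j. \<integral>x. rem u v j x * \<phi> x \<partial>lborel) summable_on UNIV" if "\<phi> \<in> schwartz"
    using tempered_tame[OF rem_tame[OF p u v]] E sm that by (intro ti(1)) auto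
  show "tempered (\<lambda>\<phi>. \<Sum>\<^sub>\<infinity>j. \<integral>x. rem u v j x * \<phi> x \<partial>lborel)"
    using tempered_tame[OF rem_tame[OF p u v]] E sm by (intro ti(2)) auto
qed

lemma bony_eq:
  assumes p: "1 \<le> p" and u: "good p (rep A)" and v: "good p (rep B)"
  shows "bony chi (realization chi A) (realization chi B) =
    (\<lambda>\<phi>. (\<Sum>\<^sub>\<infinity>j. \<integral>x. para (rep A) (rep B) j x * \<phi> x \<partial>lborel) + (\<Sum>\<^sub>\<infinity>j. \<integral>x. rem (rep A) (rep B) j x * \<phi> x \<partial>lborel)
      + (\<Sum>\<^sub>\<infinity>j. \<integral>x. para (rep B) (rep A) j x * \<phi> x \<partial>lborel))"
  by (rule ext) (simp add: bony_def paraproduct_def remainder_def fun_of_Delta_realization[OF p] fun_of_Slow_realization[OF p]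
      u v para_def rem_def)

lemma product_defined_good:
  assumes p: "1 \<le> p" and r: "1 \<le> r" "r \<le> p" "p \<le> 2 * r" "r \<le> real CARD('n)" and u: "good p (rep A)" and v: "good p (rep B)"
  shows "product_defined chi A B" "tempered (bony chi (realization chi A) (realization chi B))"
proof -
  show t: "tempered (bony chi (realization chi A) (realization chi B))"
    unfolding bony_eq[OF p u v] by (intro tempered_sum para_tempered[OF p r] rem_tempered[OF p r] u v)
  show "product_defined chi A B"
    unfolding product_defined_def bony_converges_def
    using t para_summable[OF p r u v] para_summable[OF p r v u] rem_summable[OF p r u v] realizable_good[OF p u] realizable_good[OF p v]
    by (simp add: fun_of_Delta_realization[OF p] fun_of_Slow_realization[OF p] u v para_def rem_def)
qed

section \<open>Frequency blocks of the product\<close>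

lemma ann_off_para:
  assumes "j \<notin> {l - 5..l + 5}" and \<xi>: "1 / 12 * 2 powi j \<le> norm \<xi>" "norm \<xi> \<le> 10 / 3 * 2 powi j"
  shows "ann l \<xi> = 0"
proof (rule ccontr)
  assume "ann l \<xi> \<noteq> 0"
  then have a: "3 / 4 * 2 powi l \<le> norm \<xi>" "norm \<xi> \<le> 8 / 3 * 2 powi l" using ann_supp by blast+
  have pos: "0 < (2::real) powi j" "0 < (2::real) powi l" by auto
  consider "l + 6 \<le> j" | "j \<le> l - 6" using assms(1) by force
  then show False
  proof cases
    case 1
    then have "(2::real) powi (l + 6) \<le> 2 powi j" by (intro power_int_increasing) auto
    then have "(64::real) * 2 powi l \<le> 2 powi j" by (simp add: power_int_add)
    then show False using a \<xi> pos by linarith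
  next
    case 2
    then have "(2::real) powi j \<le> 2 powi (l - 6)" by (intro power_int_increasing) auto
    then have "(2::real) powi j \<le> 2 powi l / 64" by (simp add: power_int_diff)
    then show False using a \<xi> pos by linarith
  qed
qed

lemma para_test_zero:
  assumes p: "1 \<le> p" and u: "good p u" and v: "good p v" and \<phi>: "\<phi> \<in> schwartz" and j: "j \<notin> {l - 5..l + 5}"
  shows "(\<integral>x. para u v j x * test_multiplier (ann l) \<phi> x \<partial>lborel) = 0"
  by (rule spectrum_test_multiplier[OF spectrum_para[OF p u v] ann_schwartz \<phi>]) (use ann_off_para[OF j] in auto)

text \<open>
  The two factors have frequencies at most \<open>16/3 * 2\<^sup>j\<close> and \<open>8/3 *
  2\<^sup>j\<close>, and \<open>ann l\<close> vanishes below \<open>3/4 * 2\<^sup>l \<ge> 12 *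
  2\<^sup>j\<close>.
\<close>

lemma rem_test_zero:
  assumes p: "1 \<le> p" and u: "good p u" and v: "good p v" and \<phi>: "\<phi> \<in> schwartz" and j: "j < l - 3"
  shows "(\<integral>x. rem u v j x * test_multiplier (ann l) \<phi> x \<partial>lborel) = 0"
proof -
  let ?\<psi> = "test_multiplier (ann l) \<phi>"
  have \<psi>: "?\<psi> \<in> schwartz" by (intro test_multiplier_schwartz ann_schwartz \<phi>)
  have tu: "tempered u" and tv: "tempered v" using u v by (auto simp: good_def)
  obtain M where M: "\<And>k x. norm (blk u k x) \<le> M * 2 powr (real_of_int k / 4)" using good_sup[OF p u] by blast
  obtain M' where M': "\<And>k x. norm (blk v k x) \<le> M' * 2 powr (real_of_int k / 4)" using good_sup[OF p v] by blast
  note [measurable] = blk_measurable[OF p u] blk_measurable[OF p v]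
  have zero: "(\<integral>x. blk u k x * blk v j x * ?\<psi> x \<partial>lborel) = 0" if k: "\<bar>k - j\<bar> \<le> 1" for k
  proof (rule spectrum_test_multiplier[OF _ ann_schwartz \<phi>])
    show "spectrum_in {\<xi>. norm \<xi> \<le> 8 * 2 powi j} (\<lambda>x. blk u k x * blk v j x)"
    proof (rule spectrum_mult[OF spectrum_blk[OF tu blk_represents[OF p good_finite[OF u]]]
          spectrum_blk[OF tv blk_represents[OF p good_finite[OF v]]] blk_moderate[OF p good_finite[OF v]]])
      fix a b :: "real^'n" assume a: "a \<in> {\<xi>. 3 / 4 * 2 powi k \<le> norm \<xi> \<and> norm \<xi> \<le> 8 / 3 * 2 powi k}"
        and b: "b \<in> {\<xi>. 3 / 4 * 2 powi j \<le> norm \<xi> \<and> norm \<xi> \<le> 8 / 3 * 2 powi j}"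
      have "(2::real) powi k \<le> 2 powi (j + 1)" using k by (intro power_int_increasing) auto
      then have "(2::real) powi k \<le> 2 * 2 powi j" by (simp add: power_int_add)
      then show "a + b \<in> {\<xi>. norm \<xi> \<le> 8 * 2 powi j}"
        using a b norm_triangle_ineq[of a b] by auto
    qed
    fix \<xi> :: "real^'n" assume "\<xi> \<in> {\<xi>. norm \<xi> \<le> 8 * 2 powi j}"
    then have \<xi>: "norm \<xi> \<le> 8 * 2 powi j" by simp
    have "(2::real) powi j \<le> 2 powi (l - 4)" using j by (intro power_int_increasing) auto
    then have "(2::real) powi j \<le> 2 powi l / 16" by (simp add: power_int_diff)
    moreover have "0 < (2::real) powi l" by simp
    ultimately have "norm \<xi> < 3 / 4 * 2 powi l" using \<xi> by linarith
    then show "ann l \<xi> = 0" using ann_supp[of l \<xi>] by force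
  qed
  have int: "integrable lborel (\<lambda>x. blk u k x * blk v j x * ?\<psi> x)" for k
  proof (rule tame_mult_integrable[OF _ \<psi>], rule bounded_tame)
    show "norm (blk u k x * blk v j x) \<le> (M * 2 powr (real_of_int k / 4)) * (M' * 2 powr (real_of_int j / 4))" for x
      unfolding norm_mult by (intro mult_mono M M' norm_ge_zero order_trans[OF norm_ge_zero M])
  qed measurable
  have "(\<integral>x. rem u v j x * ?\<psi> x \<partial>lborel) = (\<integral>x. (\<Sum>k | \<bar>k - j\<bar> \<le> 1. blk u k x * blk v j x * ?\<psi> x) \<partial>lborel)"
    by (simp add: rem_def sum_distrib_right)
  also have "\<dots> = (\<Sum>k | \<bar>k - j\<bar> \<le> 1. \<integral>x. blk u k x * blk v j x * ?\<psi> x \<partial>lborel)"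
    by (intro Bochner_Integration.integral_sum int)
  also have "\<dots> = 0" using zero by (intro sum.neutral) auto
  finally show ?thesis .
qed

text \<open>
  The block \<open>l\<close> of the product as a function. The sums contain all terms of Bony's
  decomposition that meet the frequencies of \<open>ann l\<close>.
\<close>

definition prod_block :: "'n distr \<Rightarrow> 'n distr \<Rightarrow> int \<Rightarrow> real^'n \<Rightarrow> complex" where
  "prod_block u v l x = (\<Sum>j\<in>{l - 5..l + 5}. conv (inv_fourier (ann l)) (para u v j) x + conv (inv_fourier (ann l)) (para v u j) x)
    + (\<Sum>m. conv (inv_fourier (ann l)) (rem u v (l - 3 + int m)) x)"

text \<open>
  The bound of \<open>prod_block\<close> in \<open>L\<^sup>q\<close> that Hoelder's and
  Bernstein's inequalities give in terms of the \<open>L\<^sup>p\<close> norms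
  \<open>\<alpha>\<close> and \<open>\<beta>\<close> of the blocks of the factors. It is kept as
  a formula because its norm in time has to be taken term by term.
\<close>

definition prod_bound :: "real \<Rightarrow> real \<Rightarrow> real \<Rightarrow> (int \<Rightarrow> ennreal) \<Rightarrow> (int \<Rightarrow> ennreal) \<Rightarrow> int \<Rightarrow> ennreal" where
  "prod_bound p q r \<alpha> \<beta> l =
    (\<Sum>j\<in>{l - 5..l + 5}.
        ennreal kc * (\<integral>\<^sup>+m. ennreal (kc * dyadic_vol CARD('n) (j - 2 - int m) powr (2 / p - 1 / q)) * (\<alpha> (j - 2 - int m) * \<beta> j) \<partial>count_space UNIV)
      + ennreal kc * (\<integral>\<^sup>+m. ennreal (kc * dyadic_vol CARD('n) (j - 2 - int m) powr (2 / p - 1 / q)) * (\<beta> (j - 2 - int m) * \<alpha> j) \<partial>count_space UNIV))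
    + (\<integral>\<^sup>+m. ennreal (kc * dyadic_vol CARD('n) l powr (1 / r - 1 / q)) *
        (\<Sum>k | \<bar>k - (l - 3 + int m)\<bar> \<le> 1. ennreal (kc * dyadic_vol CARD('n) (l - 3 + int m) powr (2 / p - 1 / r)) * (\<alpha> k * \<beta> (l - 3 + int m)))
       \<partial>count_space UNIV)"

text \<open>
  At low frequencies by the supremum bound, at high frequencies by Bernstein's inequality from
  \<open>L\<^sup>r\<close>.
\<close>

lemma conv_rem_decay:
  assumes p: "1 \<le> p" and r: "1 \<le> r" "r \<le> p" "p \<le> 2 * r" "r \<le> real CARD('n)" and u: "good p u" and v: "good p v"
  shows "\<exists>D\<ge>0. \<forall>m x. norm (conv (inv_fourier (ann l)) (rem u v (l - 3 + int m)) x) \<le> D * (2 powr (- (1 / 2))) ^ m"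
proof -
  obtain D where D: "0 \<le> D" "\<And>j x. norm (rem u v j x) \<le> D * 2 powr (real_of_int j / 2)" using rem_sup[OF p u v] by blast
  obtain E where E: "0 \<le> E" "\<And>j. 0 \<le> j \<Longrightarrow> Lnorm (ennreal r) lborel (\<lambda>x. ennreal (norm (rem u v j x))) \<le> ennreal (E * 2 powr (- (1 / 2) * real_of_int \<bar>j\<bar>))"
    using rem_decay[OF p r u v] by blast
  have kc0: "0 < kc" using kc(1) by simp
  let ?K = "inv_fourier (ann l)"
  have meas: "rem u v j \<in> borel_measurable borel" for j by (intro borel_measurable_continuous_onI rem_continuous[OF p u v])
  define F where "F = kc * D + kc * dyadic_vol CARD('n) l powr (1 / r) * E"
  have F: "0 \<le> F" unfolding F_def using kc0 D(1) E(1) by simp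
  have F1: "kc * D \<le> F" and F2: "kc * dyadic_vol CARD('n) l powr (1 / r) * E \<le> F"
    unfolding F_def using kc0 D(1) E(1) by simp_all
  have "norm (conv ?K (rem u v j) x) \<le> F * 2 powr (- (1 / 2) * real_of_int \<bar>j\<bar>)" for j x
  proof (cases "0 \<le> j")
    case True
    have "ennreal (norm (conv ?K (rem u v j) x)) \<le> ennreal (kc * dyadic_vol CARD('n) l powr (1 / r)) * Lnorm (ennreal r) lborel (\<lambda>x. norm (rem u v j x))"
      by (rule dyadic_Bernstein(2)[OF kc(3) kernel_schwartz(2) r(1) order_refl meas])
    also have "\<dots> \<le> ennreal (kc * dyadic_vol CARD('n) l powr (1 / r)) * ennreal (E * 2 powr (- (1 / 2) * real_of_int \<bar>j\<bar>))"
      by (intro mult_left_mono E True) auto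
    also have "\<dots> = ennreal (kc * dyadic_vol CARD('n) l powr (1 / r) * E * 2 powr (- (1 / 2) * real_of_int \<bar>j\<bar>))"
      using E(1) kc0 by (simp add: mult.assoc flip: ennreal_mult)
    finally have "norm (conv ?K (rem u v j) x) \<le> kc * dyadic_vol CARD('n) l powr (1 / r) * E * 2 powr (- (1 / 2) * real_of_int \<bar>j\<bar>)"
      using E(1) kc0 by (subst (asm) ennreal_le_iff) auto
    also have "\<dots> \<le> F * 2 powr (- (1 / 2) * real_of_int \<bar>j\<bar>)" by (intro mult_right_mono F2) auto
    finally show ?thesis .
  next
    case False
    note [measurable] = schwartz_measurable[OF kernel_schwartz(2)]
    let ?d = "D * 2 powr (real_of_int j / 2)"
    have "ennreal (norm (conv ?K (rem u v j) x)) \<le> (\<integral>\<^sup>+y. ennreal (norm (?K (x - y))) * ennreal (norm (rem u v j y)) \<partial>lborel)"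
      by (rule norm_conv_le)
    also have "\<dots> \<le> (\<integral>\<^sup>+y. ennreal (norm (?K (x - y))) * ennreal ?d \<partial>lborel)"
      by (intro nn_integral_mono mult_left_mono ennreal_leI D) auto
    also have "\<dots> = (\<integral>\<^sup>+y. ennreal (norm (?K y)) \<partial>lborel) * ennreal ?d"
      using nn_integral_lborel_affine[of "\<lambda>y. ennreal (norm (?K y))" "-1" x] by (simp add: nn_integral_multc)
    also have "\<dots> \<le> ennreal kc * ennreal ?d"
      using kc(3)[of l] unfolding dyadic_kernel_bound_def by (intro mult_right_mono) auto
    also have "\<dots> = ennreal (kc * D * 2 powr (real_of_int j / 2))"
      using D(1) kc0 by (simp add: mult.assoc flip: ennreal_mult)
    finally have "norm (conv ?K (rem u v j) x) \<le> kc * D * 2 powr (real_of_int j / 2)"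
      using D(1) kc0 by (subst (asm) ennreal_le_iff) auto
    also have "\<dots> \<le> F * 2 powr (real_of_int j / 2)" by (intro mult_right_mono F1) auto
    finally show ?thesis using False by simp
  qed
  note le = this
  have "norm (conv ?K (rem u v (l - 3 + int m)) x) \<le> (F * 2 powr (1 / 2 * real_of_int \<bar>l - 3\<bar>)) * (2 powr (- (1 / 2))) ^ m" for m x
  proof -
    have "int m \<le> \<bar>l - 3 + int m\<bar> + \<bar>l - 3\<bar>" by linarith
    then have "real m \<le> real_of_int \<bar>l - 3 + int m\<bar> + real_of_int \<bar>l - 3\<bar>"
      by (metis of_int_add of_int_le_iff of_int_of_nat_eq)
    moreover have "- (1 / 2) * a \<le> 1 / 2 * b + - (1 / 2) * c" if "c \<le> a + b" for a b c :: real
      using that by simp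
    ultimately have "- (1 / 2) * real_of_int \<bar>l - 3 + int m\<bar> \<le> 1 / 2 * real_of_int \<bar>l - 3\<bar> + - (1 / 2) * real m"
      by blast
    then have "2 powr (- (1 / 2) * real_of_int \<bar>l - 3 + int m\<bar>) \<le> 2 powr (1 / 2 * real_of_int \<bar>l - 3\<bar> + - (1 / 2) * real m)"
      by (intro powr_mono) auto
    also have "\<dots> = 2 powr (1 / 2 * real_of_int \<bar>l - 3\<bar>) * (2 powr (- (1 / 2))) ^ m"
      unfolding powr_add powr_powr[symmetric] by (simp add: powr_realpow)
    finally have "F * 2 powr (- (1 / 2) * real_of_int \<bar>l - 3 + int m\<bar>)
        \<le> F * (2 powr (1 / 2 * real_of_int \<bar>l - 3\<bar>) * (2 powr (- (1 / 2))) ^ m)"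
      using F by (rule mult_left_mono)
    then show ?thesis
      using le[of "l - 3 + int m" x] unfolding mult.assoc[of F] by (rule order_trans[rotated])
  qed
  moreover have "0 \<le> F * 2 powr (1 / 2 * real_of_int \<bar>l - 3\<bar>)" using F by simp
  ultimately show ?thesis by blast
qed

text \<open>
  The pairings with \<open>test_multiplier (ann l) \<phi>\<close> move to convolutions with the
  kernel of \<open>ann l\<close>, which converge absolutely and uniformly by the preceding
  decay.
\<close>

lemma prod_block_props:
  fixes \<phi> :: "real^'n \<Rightarrow> complex"
  assumes p: "1 \<le> p" and r: "1 \<le> r" "r \<le> p" "p \<le> 2 * r" "r \<le> real CARD('n)"
    and u: "good p (rep A)" and v: "good p (rep B)"
  shows prod_block_continuous: "continuous_on UNIV (prod_block (rep A) (rep B) l)"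
    and prod_block_represents: "represents (prod_block (rep A) (rep B) l) (Delta chi l (rep (product_class chi A B)))"
    and Delta_product: "\<phi> \<in> schwartz \<Longrightarrow> Delta chi l (rep (product_class chi A B)) \<phi> =
      (\<Sum>j\<in>{l - 5..l + 5}. \<integral>x. para (rep A) (rep B) j x * test_multiplier (ann l) \<phi> x \<partial>lborel)
      + (\<Sum>j\<in>{l - 5..l + 5}. \<integral>x. para (rep B) (rep A) j x * test_multiplier (ann l) \<phi> x \<partial>lborel)
      + (\<Sum>m. \<integral>x. rem (rep A) (rep B) (l - 3 + int m) x * test_multiplier (ann l) \<phi> x \<partial>lborel)"
    and prod_block_Lnorm: "r \<le> q \<Longrightarrow> q \<le> p \<Longrightarrow> p \<le> 2 * q \<Longrightarrow>
      Lnorm (ennreal q) lborel (\<lambda>x. ennreal (norm (prod_block (rep A) (rep B) l x)))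
      \<le> prod_bound p q r (bnorm p (rep A)) (bnorm p (rep B)) l"
proof -
  let ?u = "rep A" and ?v = "rep B"
  let ?K = "inv_fourier (ann l)"
  let ?J = "{l - 5..l + 5}"
  have K: "?K \<in> schwartz" by (rule kernel_schwartz)
  obtain D where D: "0 \<le> D" "\<And>m x. norm (conv ?K (rem ?u ?v (l - 3 + int m)) x) \<le> D * (2 powr (- (1 / 2))) ^ m"
    using conv_rem_decay[OF p r u v] by blast
  have "2 powr (- (1 / 2)) < 2 powr (0 :: real)" by (intro powr_less_mono) auto
  then have sm: "summable (\<lambda>m. D * (2 powr (- (1 / 2))) ^ m)" by (intro summable_mult summable_geometric) auto
  have cR: "continuous_on UNIV (conv ?K (rem ?u ?v j))" and cP: "continuous_on UNIV (conv ?K (para ?u ?v j))"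
    and cP': "continuous_on UNIV (conv ?K (para ?v ?u j))" for j
    by (intro conv_continuous rem_tame[OF p u v] para_tame[OF p u v] para_tame[OF p v u] K)+
  note ser = dominated_series[of "\<lambda>m. conv ?K (rem ?u ?v (l - 3 + int m))", OF cR D(2) sm]
  let ?S = "\<lambda>x. \<Sum>m. conv ?K (rem ?u ?v (l - 3 + int m)) x"
  show c: "continuous_on UNIV (prod_block ?u ?v l)"
    unfolding prod_block_def by (intro continuous_intros cP cP' ser(1))
  have tS: "tame ?S" using ser(3) by (intro bounded_tame borel_measurable_continuous_onI ser(1))
  have intP: "integrable lborel (\<lambda>x. conv ?K (para ?u ?v j) x * \<phi> x)" "integrable lborel (\<lambda>x. conv ?K (para ?v ?u j) x * \<phi> x)"
    if "\<phi> \<in> schwartz" for j \<phi>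
    by (intro conv_duality(1) para_tame[OF p u v] para_tame[OF p v u] ann_schwartz that)+
  have int: "integrable lborel (\<lambda>x. prod_block ?u ?v l x * \<phi> x)" and
    val: "(\<integral>x. prod_block ?u ?v l x * \<phi> x \<partial>lborel) = (\<Sum>j\<in>?J. \<integral>x. para ?u ?v j x * test_multiplier (ann l) \<phi> x \<partial>lborel)
      + (\<Sum>j\<in>?J. \<integral>x. para ?v ?u j x * test_multiplier (ann l) \<phi> x \<partial>lborel)
      + (\<Sum>m. \<integral>x. rem ?u ?v (l - 3 + int m) x * test_multiplier (ann l) \<phi> x \<partial>lborel)" and
    form: "Delta chi l (rep (product_class chi A B)) \<phi> = (\<Sum>j\<in>?J. \<integral>x. para ?u ?v j x * test_multiplier (ann l) \<phi> x \<partial>lborel)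
      + (\<Sum>j\<in>?J. \<integral>x. para ?v ?u j x * test_multiplier (ann l) \<phi> x \<partial>lborel)
      + (\<Sum>m. \<integral>x. rem ?u ?v (l - 3 + int m) x * test_multiplier (ann l) \<phi> x \<partial>lborel)" if \<phi>: "\<phi> \<in> schwartz" for \<phi>
  proof -
    let ?\<psi> = "test_multiplier (ann l) \<phi>"
    have \<psi>: "?\<psi> \<in> schwartz" by (intro test_multiplier_schwartz ann_schwartz \<phi>)
    have eq: "prod_block ?u ?v l x * \<phi> x = (\<Sum>j\<in>?J. conv ?K (para ?u ?v j) x * \<phi> x + conv ?K (para ?v ?u j) x * \<phi> x) + ?S x * \<phi> x" for x
      by (simp add: prod_block_def distrib_right sum_distrib_right)
    have iS: "integrable lborel (\<lambda>x. ?S x * \<phi> x)" by (rule tame_mult_integrable[OF tS \<phi>])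
    show "integrable lborel (\<lambda>x. prod_block ?u ?v l x * \<phi> x)"
      unfolding eq by (intro Bochner_Integration.integrable_add Bochner_Integration.integrable_sum intP \<phi> iS)
    have "(\<integral>x. prod_block ?u ?v l x * \<phi> x \<partial>lborel)
      = (\<Sum>j\<in>?J. (\<integral>x. conv ?K (para ?u ?v j) x * \<phi> x \<partial>lborel) + (\<integral>x. conv ?K (para ?v ?u j) x * \<phi> x \<partial>lborel)) + (\<integral>x. ?S x * \<phi> x \<partial>lborel)"
      unfolding eq using intP[OF \<phi>] iS by (simp add: Bochner_Integration.integral_sum Bochner_Integration.integral_add)
    also have "\<dots> = (\<Sum>j\<in>?J. (\<integral>x. para ?u ?v j x * ?\<psi> x \<partial>lborel)) + (\<Sum>j\<in>?J. (\<integral>x. para ?v ?u j x * ?\<psi> x \<partial>lborel)) + (\<integral>x. ?S x * \<phi> x \<partial>lborel)"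
      by (simp add: conv_duality(2)[OF para_tame[OF p u v] ann_schwartz \<phi>] conv_duality(2)[OF para_tame[OF p v u] ann_schwartz \<phi>] sum.distrib)
    also have "(\<integral>x. ?S x * \<phi> x \<partial>lborel) = (\<Sum>m. \<integral>x. rem ?u ?v (l - 3 + int m) x * ?\<psi> x \<partial>lborel)"
      using sums_unique[OF ser(4)[OF \<phi>]] by (simp add: conv_duality(2)[OF rem_tame[OF p u v] ann_schwartz \<phi>])
    finally show "(\<integral>x. prod_block ?u ?v l x * \<phi> x \<partial>lborel) = (\<Sum>j\<in>?J. \<integral>x. para ?u ?v j x * ?\<psi> x \<partial>lborel)
      + (\<Sum>j\<in>?J. \<integral>x. para ?v ?u j x * ?\<psi> x \<partial>lborel) + (\<Sum>m. \<integral>x. rem ?u ?v (l - 3 + int m) x * ?\<psi> x \<partial>lborel)" .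
    have "Delta chi l (rep (product_class chi A B)) \<phi> = Delta chi l (bony chi (realization chi A) (realization chi B)) \<phi>"
      unfolding product_class_def by (rule Delta_poly_class[OF product_defined_good(2)[OF p r u v] \<phi>])
    also have "\<dots> = (\<Sum>\<^sub>\<infinity>j. \<integral>x. para ?u ?v j x * ?\<psi> x \<partial>lborel) + (\<Sum>\<^sub>\<infinity>j. \<integral>x. rem ?u ?v j x * ?\<psi> x \<partial>lborel)
        + (\<Sum>\<^sub>\<infinity>j. \<integral>x. para ?v ?u j x * ?\<psi> x \<partial>lborel)"
      unfolding bony_eq[OF p u v] Delta_eq ..
    also have "(\<Sum>\<^sub>\<infinity>j. \<integral>x. para ?u ?v j x * ?\<psi> x \<partial>lborel) = (\<Sum>\<^sub>\<infinity>j\<in>?J. \<integral>x. para ?u ?v j x * ?\<psi> x \<partial>lborel)"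
      using para_test_zero[OF p u v \<phi>] by (intro infsum_cong_neutral) auto
    also have "(\<Sum>\<^sub>\<infinity>j. \<integral>x. para ?v ?u j x * ?\<psi> x \<partial>lborel) = (\<Sum>\<^sub>\<infinity>j\<in>?J. \<integral>x. para ?v ?u j x * ?\<psi> x \<partial>lborel)"
      using para_test_zero[OF p v u \<phi>] by (intro infsum_cong_neutral) auto
    also have "(\<Sum>\<^sub>\<infinity>j. \<integral>x. rem ?u ?v j x * ?\<psi> x \<partial>lborel) = (\<Sum>m. \<integral>x. rem ?u ?v (l - 3 + int m) x * ?\<psi> x \<partial>lborel)"
      by (rule sums_unique[OF has_sum_int_tail[OF rem_summable[OF p r u v \<psi>] rem_test_zero[OF p u v \<phi>]]])
    finally show "Delta chi l (rep (product_class chi A B)) \<phi> = (\<Sum>j\<in>?J. \<integral>x. para ?u ?v j x * ?\<psi> x \<partial>lborel)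
      + (\<Sum>j\<in>?J. \<integral>x. para ?v ?u j x * ?\<psi> x \<partial>lborel) + (\<Sum>m. \<integral>x. rem ?u ?v (l - 3 + int m) x * ?\<psi> x \<partial>lborel)"
      by (simp add: add_ac)
  qed
  have meas [measurable]: "prod_block ?u ?v l \<in> borel_measurable borel" by (intro borel_measurable_continuous_onI c)
  show "represents (prod_block ?u ?v l) (Delta chi l (rep (product_class chi A B)))"
    unfolding represents_def using meas int val form by auto
  show "Delta chi l (rep (product_class chi A B)) \<phi> =
      (\<Sum>j\<in>?J. \<integral>x. para ?u ?v j x * test_multiplier (ann l) \<phi> x \<partial>lborel)
      + (\<Sum>j\<in>?J. \<integral>x. para ?v ?u j x * test_multiplier (ann l) \<phi> x \<partial>lborel)
      + (\<Sum>m. \<integral>x. rem ?u ?v (l - 3 + int m) x * test_multiplier (ann l) \<phi> x \<partial>lborel)" if "\<phi> \<in> schwartz" for \<phi>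
    using that by (rule form)
  assume q: "r \<le> q" "q \<le> p" "p \<le> 2 * q"
  have q1: "1 \<le> q" using q r by simp
  have q': "1 \<le> ennreal q" using q1 by (simp add: ennreal_ge_1)
  have meas': "para ?u ?v j \<in> borel_measurable borel" "para ?v ?u j \<in> borel_measurable borel" "rem ?u ?v j \<in> borel_measurable borel" for j
    by (intro borel_measurable_continuous_onI para_continuous[OF p u v] para_continuous[OF p v u] rem_continuous[OF p u v])+
  have [measurable]: "conv ?K (para ?u ?v j) \<in> borel_measurable borel" "conv ?K (para ?v ?u j) \<in> borel_measurable borel"
    "conv ?K (rem ?u ?v j) \<in> borel_measurable borel" for j
    by (intro borel_measurable_continuous_onI cP cP' cR)+
  let ?N = "\<lambda>f. Lnorm (ennreal q) lborel (\<lambda>x. ennreal (norm (f x)))"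
  have "ennreal (norm (prod_block ?u ?v l x)) \<le> (\<Sum>j\<in>?J. ennreal (norm (conv ?K (para ?u ?v j) x)) + ennreal (norm (conv ?K (para ?v ?u j) x)))
      + (\<integral>\<^sup>+m. ennreal (norm (conv ?K (rem ?u ?v (l - 3 + int m)) x)) \<partial>count_space UNIV)" for x
  proof -
    have "norm (prod_block ?u ?v l x) \<le> (\<Sum>j\<in>?J. norm (conv ?K (para ?u ?v j) x) + norm (conv ?K (para ?v ?u j) x)) + norm (?S x)"
      unfolding prod_block_def by (intro order_trans[OF norm_triangle_ineq] add_mono order_trans[OF norm_sum] sum_mono norm_triangle_ineq order_refl)
    then have "ennreal (norm (prod_block ?u ?v l x)) \<le> ennreal (\<Sum>j\<in>?J. norm (conv ?K (para ?u ?v j) x) + norm (conv ?K (para ?v ?u j) x)) + ennreal (norm (?S x))"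
      by (subst ennreal_plus[symmetric]) (auto intro!: ennreal_leI sum_nonneg)
    also have "ennreal (\<Sum>j\<in>?J. norm (conv ?K (para ?u ?v j) x) + norm (conv ?K (para ?v ?u j) x))
        = (\<Sum>j\<in>?J. ennreal (norm (conv ?K (para ?u ?v j) x)) + ennreal (norm (conv ?K (para ?v ?u j) x)))"
      by (subst sum_ennreal[symmetric]) auto
    also have "ennreal (norm (?S x)) \<le> (\<integral>\<^sup>+m. ennreal (norm (conv ?K (rem ?u ?v (l - 3 + int m)) x)) \<partial>count_space UNIV)"
      by (rule norm_suminf_le_nn_integral[OF ser(2)])
    finally show ?thesis by (simp add: add_left_mono)
  qed
  then have "?N (prod_block ?u ?v l) \<le> Lnorm (ennreal q) lborel (\<lambda>x. (\<Sum>j\<in>?J. ennreal (norm (conv ?K (para ?u ?v j) x)) + ennreal (norm (conv ?K (para ?v ?u j) x)))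
      + (\<integral>\<^sup>+m. ennreal (norm (conv ?K (rem ?u ?v (l - 3 + int m)) x)) \<partial>count_space UNIV))"
    by (intro Lnorm_mono_AE q' AE_I2) auto
  also have "\<dots> \<le> (\<Sum>j\<in>?J. ?N (conv ?K (para ?u ?v j)) + ?N (conv ?K (para ?v ?u j))) + (\<integral>\<^sup>+m. ?N (conv ?K (rem ?u ?v (l - 3 + int m))) \<partial>count_space UNIV)"
    by (intro order_trans[OF Lnorm_add[OF q']] add_mono order_trans[OF Lnorm_sum[OF q']] sum_mono Lnorm_add[OF q'] Minkowski_Lnorm[OF q'])
      (auto intro!: nn_integral_count_space_measurable)
  also have "\<dots> \<le> prod_bound p q r (bnorm p ?u) (bnorm p ?v) l"
    unfolding prod_bound_def
  proof (intro add_mono sum_mono nn_integral_mono)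
    have P: "?N (conv ?K f) \<le> ennreal kc * ?N f" if "f \<in> borel_measurable borel" for f
      using dyadic_Bernstein(1)[OF kc(3) kernel_schwartz(2) q1 order_refl that, of l] by simp
    show "?N (conv ?K (para ?u ?v j)) \<le> ennreal kc * (\<integral>\<^sup>+m. ennreal (kc * dyadic_vol CARD('n) (j - 2 - int m) powr (2 / p - 1 / q)) * (bnorm p ?u (j - 2 - int m) * bnorm p ?v j) \<partial>count_space UNIV)" for j
      by (intro order_trans[OF P] mult_left_mono para_Lnorm[OF p q1 q(2,3) u v] meas') auto
    show "?N (conv ?K (para ?v ?u j)) \<le> ennreal kc * (\<integral>\<^sup>+m. ennreal (kc * dyadic_vol CARD('n) (j - 2 - int m) powr (2 / p - 1 / q)) * (bnorm p ?v (j - 2 - int m) * bnorm p ?u j) \<partial>count_space UNIV)" for j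
      by (intro order_trans[OF P] mult_left_mono para_Lnorm[OF p q1 q(2,3) v u] meas') auto
    show "?N (conv ?K (rem ?u ?v (l - 3 + int m))) \<le> ennreal (kc * dyadic_vol CARD('n) l powr (1 / r - 1 / q)) *
        (\<Sum>k | \<bar>k - (l - 3 + int m)\<bar> \<le> 1. ennreal (kc * dyadic_vol CARD('n) (l - 3 + int m) powr (2 / p - 1 / r)) * (bnorm p ?u k * bnorm p ?v (l - 3 + int m)))" for m
      by (intro order_trans[OF dyadic_Bernstein(1)[OF kc(3) kernel_schwartz(2) r(1) q(1) meas'(3)]] mult_left_mono rem_Lnorm[OF p r(1-3) u v]) auto
  qed
  finally show "?N (prod_block ?u ?v l) \<le> prod_bound p q r (bnorm p ?u) (bnorm p ?v) l" .
qed

end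

section \<open>Measurability in time\<close>

text \<open>
  Functions that are measurable in one variable and continuous in the other: rounding the second
  variable to a point of a countable dense set gives measurable functions that converge
  pointwise.
\<close>

lemma borel_measurable_caratheodory:
  fixes F :: "'a \<Rightarrow> 'b::{second_countable_topology, metric_space} \<Rightarrow> 'c::metric_space"
  assumes meas: "\<And>x. (\<lambda>t. F t x) \<in> borel_measurable M" and cont: "\<And>t. t \<in> space M \<Longrightarrow> continuous_on UNIV (F t)"
  shows "(\<lambda>z. F (fst z) (snd z)) \<in> borel_measurable (M \<Otimes>\<^sub>M borel)"
proof -
  obtain D :: "'b set" where D: "countable D" "\<And>X. open X \<Longrightarrow> X \<noteq> {} \<Longrightarrow> \<exists>d\<in>D. d \<in> X"
    using countable_dense_exists by blast
  have "D \<noteq> {}" using D(2)[of UNIV] by auto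
  define d where "d = from_nat_into D"
  have d: "\<exists>i. dist x (d i) < 1 / real (Suc n)" for x n
  proof -
    obtain y where "y \<in> D" "y \<in> ball x (1 / real (Suc n))" using D(2)[of "ball x (1 / real (Suc n))"] by auto
    then show ?thesis using from_nat_into_surj[OF D(1)] unfolding d_def by (metis mem_ball)
  qed
  define ix where "ix n x = (LEAST i. dist x (d i) < 1 / real (Suc n))" for n x
  have ix: "dist x (d (ix n x)) < 1 / real (Suc n)" for n x
    unfolding ix_def using d by (rule LeastI_ex)
  have [measurable]: "ix n \<in> measurable borel (count_space UNIV)" for n
    unfolding ix_def[abs_def] by measurable
  show ?thesis
  proof (rule borel_measurable_LIMSEQ_metric)
    show "(\<lambda>z. F (fst z) (d (ix n (snd z)))) \<in> borel_measurable (M \<Otimes>\<^sub>M borel)" for n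
    proof (rule measurable_compose_countable[where f = "\<lambda>i z. F (fst z) (d i)" and g = "\<lambda>z. ix n (snd z)"])
      show "(\<lambda>z. F (fst z) (d i)) \<in> borel_measurable (M \<Otimes>\<^sub>M borel)" for i
        by (rule measurable_compose[OF measurable_fst meas])
    qed measurable
    fix z assume "z \<in> space (M \<Otimes>\<^sub>M (borel :: 'b measure))"
    then have "continuous_on UNIV (F (fst z))" by (intro cont) (auto simp: space_pair_measure)
    moreover have "(\<lambda>n. d (ix n (snd z))) \<longlonglongrightarrow> snd z"
    proof (rule metric_LIMSEQ_I)
      fix r :: real assume "0 < r"
      then obtain N where N: "1 / real (Suc N) < r" using nat_approx_posE by blast
      have "dist (d (ix n (snd z))) (snd z) < r" if "n \<ge> N" for n
      proof -
        have "1 / real (Suc n) \<le> 1 / real (Suc N)" using that by (intro divide_left_mono) auto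
        then show ?thesis using ix[of "snd z" n] N by (simp add: dist_commute)
      qed
      then show "\<exists>no. \<forall>n\<ge>no. dist (d (ix n (snd z))) (snd z) < r" by blast
    qed
    ultimately show "(\<lambda>n. F (fst z) (d (ix n (snd z)))) \<longlonglongrightarrow> F (fst z) (snd z)"
      by (rule continuous_on_tendsto_compose) auto
  qed
qed

text \<open>Subsets of null sets are measurable, because Lebesgue measure is complete.\<close>

lemma borel_measurable_AE_lebesgue_on:
  assumes S: "S \<in> sets lebesgue" and g: "g \<in> borel_measurable (lebesgue_on S)" and eq: "AE x in lebesgue_on S. f x = g x"
  shows "f \<in> borel_measurable (lebesgue_on S)"
proof (rule measurableI)
  obtain N where N: "N \<in> null_sets (lebesgue_on S)" "{x \<in> space (lebesgue_on S). f x \<noteq> g x} \<subseteq> N"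
    using eq by (auto elim!: AE_E simp: null_sets_def)
  then have N': "N \<in> null_sets lebesgue" using S by (simp add: null_sets_restrict_space)
  fix A :: "'b set" assume A: "A \<in> sets borel"
  have "f -` A \<inter> N \<inter> S \<in> null_sets lebesgue" by (rule null_sets_completion_subset[OF _ N']) auto
  then have "f -` A \<inter> N \<inter> S \<in> sets (lebesgue_on S)" using S by (simp add: sets_restrict_space_iff null_sets_def)
  moreover have "g -` A \<inter> space (lebesgue_on S) - N \<in> sets (lebesgue_on S)"
    using measurable_sets[OF g A] N(1) by auto
  moreover have "f -` A \<inter> space (lebesgue_on S) = (g -` A \<inter> space (lebesgue_on S) - N) \<union> (f -` A \<inter> N \<inter> S)"
    using N(2) by auto
  ultimately show "f -` A \<inter> space (lebesgue_on S) \<in> sets (lebesgue_on S)" by auto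
qed auto

context lp begin

lemma tempered_Delta: "tempered u \<Longrightarrow> tempered (Delta chi k u)"
  unfolding Delta_eq[abs_def] by (rule tempered_test_multiplier[OF _ ann_schwartz])

text \<open>
  The convolution with the kernel of \<open>fat_ann k\<close> reproduces the block, and for a
  tempered distribution it is the pairing with the translates of the kernel. This holds for
  every tempered distribution, whether or not the block belongs to a Lebesgue space.
\<close>

lemma blk_tempered:
  assumes u: "tempered (u :: 'n distr)"
  shows "blk u k = (\<lambda>x. Delta chi k u (\<lambda>y. inv_fourier (fat_ann k) (x - y)))"
    and "continuous_on UNIV (blk u k)" and "represents (blk u k) (Delta chi k u)"
proof -
  let ?w = "Delta chi k u" and ?K = "\<lambda>z. inv_fourier (fat_ann k) (- z)"
  let ?g = "\<lambda>x. ?w (\<lambda>y. inv_fourier (fat_ann k) (x - y))"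
  have w: "tempered ?w" by (rule tempered_Delta[OF u])
  have K: "?K \<in> schwartz" using schwartz_translate_reflect[OF kernel_schwartz(3), of k 0] by simp
  have cont: "continuous_on UNIV ?g" using tempered_translate(2)[OF w K] by simp
  have conv: "conv ?K \<phi> = test_multiplier (fat_ann k) \<phi>" if "\<phi> \<in> schwartz" for \<phi>
    using that by (simp add: fun_eq_iff conv_def test_multiplier_eq_convolution[OF fat_ann_schwartz])
  have "represents ?g ?w"
    unfolding represents_def
  proof (intro conjI ballI)
    show "?g \<in> borel_measurable borel" using cont by (rule borel_measurable_continuous_onI)
    fix \<phi> :: "real^'n \<Rightarrow> complex" assume \<phi>: "\<phi> \<in> schwartz"
    have c: "conv ?K \<phi> \<in> schwartz" unfolding conv[OF \<phi>] by (rule test_multiplier_schwartz[OF fat_ann_schwartz \<phi>])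
    show "integrable lborel (\<lambda>x. ?g x * \<phi> x)" using tempered_convolution(1)[OF w K \<phi> c] by simp
    have "?w \<phi> = ?w (conv ?K \<phi>)"
      unfolding conv[OF \<phi>]
      by (simp add: Delta_eq test_multiplier_compose[OF ann_schwartz fat_ann_schwartz \<phi>] mult.commute[of "ann k _"] fat_ann_mult)
    then show "?w \<phi> = (\<integral>x. ?g x * \<phi> x \<partial>lborel)" using tempered_convolution(2)[OF w K \<phi> c] by simp
  qed
  moreover from fun_of_eq[OF cont this] show "blk u k = ?g" by (simp add: blk_def)
  ultimately show "continuous_on UNIV (blk u k)" "represents (blk u k) ?w" using cont by auto
qed

lemma blk_jointly_measurable:
  fixes v :: "'a \<Rightarrow> 'n distr"
  assumes v: "\<And>t. t \<in> space M \<Longrightarrow> tempered (v t)"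
    and meas: "\<And>\<phi>. \<phi> \<in> schwartz \<Longrightarrow> (\<lambda>t. Delta chi k (v t) \<phi>) \<in> borel_measurable M"
  shows "(\<lambda>z. blk (v (fst z)) k (snd z)) \<in> borel_measurable (M \<Otimes>\<^sub>M borel)"
proof (rule borel_measurable_caratheodory)
  show "(\<lambda>t. blk (v t) k x) \<in> borel_measurable M" for x
    using meas[OF schwartz_translate_reflect[OF kernel_schwartz(3), of k x]]
    by (simp add: blk_tempered(1)[OF v] cong: measurable_cong)
qed (rule blk_tempered(2)[OF v])

text \<open>
  Integrals of nonnegative functions are additive only for measurable functions, so this has to
  be known before any finiteness in time can be used.
\<close>

lemma distr_Lnorm_measurable:
  fixes v :: "'a \<Rightarrow> 'n distr"
  assumes v: "\<And>t. t \<in> space M \<Longrightarrow> tempered (v t)"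
    and meas: "\<And>\<phi>. \<phi> \<in> schwartz \<Longrightarrow> (\<lambda>t. Delta chi k (v t) \<phi>) \<in> borel_measurable M" and q: "1 \<le> q"
  shows "(\<lambda>t. bnorm q (v t) k) \<in> borel_measurable M"
proof -
  have "(\<lambda>z. blk (v (fst z)) k (snd z)) \<in> borel_measurable (M \<Otimes>\<^sub>M borel)"
    by (rule blk_jointly_measurable[OF v meas])
  then have [measurable]: "(\<lambda>z. blk (v (fst z)) k (snd z)) \<in> borel_measurable (M \<Otimes>\<^sub>M lborel)"
    by (simp cong: measurable_cong_sets sets_pair_measure_cong)
  have "(\<lambda>t. enn_powr (\<integral>\<^sup>+x. enn_powr (ennreal (norm (blk (v t) k x))) q \<partial>lborel) (1 / q)) \<in> borel_measurable M"
  proof (intro measurable_compose[OF _ enn_powr_measurable[OF measurable_ident_sets[OF refl]]] lborel.borel_measurable_nn_integral)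
    show "(\<lambda>(t, x). enn_powr (ennreal (norm (blk (v t) k x))) q) \<in> borel_measurable (M \<Otimes>\<^sub>M lborel)"
      unfolding case_prod_beta by measurable
  qed
  then show ?thesis
    by (rule measurable_cong[THEN iffD1, rotated])
      (use q in \<open>simp add: distr_Lnorm_eq[OF q blk_tempered(2,3)[OF v]] Lnorm_real\<close>)
qed

lemma piece_integral_measurable:
  fixes u v :: "'a \<Rightarrow> 'n distr"
  assumes u: "\<And>t. t \<in> space M \<Longrightarrow> tempered (u t)" "\<And>k \<phi>. \<phi> \<in> schwartz \<Longrightarrow> (\<lambda>t. Delta chi k (u t) \<phi>) \<in> borel_measurable M"
    and v: "\<And>t. t \<in> space M \<Longrightarrow> tempered (v t)" "\<And>k \<phi>. \<phi> \<in> schwartz \<Longrightarrow> (\<lambda>t. Delta chi k (v t) \<phi>) \<in> borel_measurable M"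
    and \<psi>: "\<psi> \<in> schwartz"
  shows "(\<lambda>t. \<integral>x. para (u t) (v t) j x * \<psi> x \<partial>lborel) \<in> borel_measurable M"
    and "(\<lambda>t. \<integral>x. rem (u t) (v t) j x * \<psi> x \<partial>lborel) \<in> borel_measurable M"
proof -
  have cong: "borel_measurable (M \<Otimes>\<^sub>M borel) = borel_measurable (M \<Otimes>\<^sub>M (lborel :: (real^'n) measure))"
    by (intro measurable_cong_sets sets_pair_measure_cong) simp_all
  have [measurable]: "(\<lambda>z. blk (u (fst z)) k (snd z)) \<in> borel_measurable (M \<Otimes>\<^sub>M lborel)"
    "(\<lambda>z. blk (v (fst z)) k (snd z)) \<in> borel_measurable (M \<Otimes>\<^sub>M lborel)" for k
    using blk_jointly_measurable[where M = M, OF u] blk_jointly_measurable[where M = M, OF v] unfolding cong by blast+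
  note [measurable] = schwartz_measurable[OF \<psi>]
  show "(\<lambda>t. \<integral>x. para (u t) (v t) j x * \<psi> x \<partial>lborel) \<in> borel_measurable M"
    unfolding para_def low_def by (intro lborel.borel_measurable_lebesgue_integral) (unfold case_prod_beta, measurable)
  show "(\<lambda>t. \<integral>x. rem (u t) (v t) j x * \<psi> x \<partial>lborel) \<in> borel_measurable M"
    unfolding rem_def by (intro lborel.borel_measurable_lebesgue_integral) (unfold case_prod_beta, measurable)
qed

end

section \<open>Chemin-Lerner norms\<close>

text \<open>
  The counting measure has no nonempty null set, so its essential supremum is the supremum.
\<close>

lemma chemin_lerner_norm_infty:
  "chemin_lerner_norm chi \<theta> T s p \<infinity> f =
    (SUP j. ennreal (2 powr (of_int j * s)) * time_space_norm \<theta> T p (\<lambda>t. Delta chi j (rep (f t))))" (is "_ = (SUP j. ?f j)")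
proof (rule antisym)
  show "chemin_lerner_norm chi \<theta> T s p \<infinity> f \<le> (SUP j. ?f j)"
    unfolding chemin_lerner_norm_def Lnorm_def by (auto intro!: esssup_I AE_I2 SUP_upper)
  show "(SUP j. ?f j) \<le> chemin_lerner_norm chi \<theta> T s p \<infinity> f"
  proof (rule SUP_least)
    fix j
    have "AE j in count_space UNIV. ?f j \<le> esssup (count_space UNIV) ?f" by (rule esssup_AE)
    then show "?f j \<le> chemin_lerner_norm chi \<theta> T s p \<infinity> f"
      by (simp add: chemin_lerner_norm_def Lnorm_def AE_count_space)
  qed
qed

lemma chemin_lerner_finite:
  assumes fin: "chemin_lerner_norm chi \<theta> T s p \<infinity> f < \<infinity>"
  shows "\<phi> \<in> schwartz \<Longrightarrow> (\<lambda>t. Delta chi j (rep (f t)) \<phi>) \<in> borel_measurable (lebesgue_on {0<..<T})"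
    and "Lnorm \<theta> (lebesgue_on {0<..<T}) (\<lambda>t. distr_Lnorm p (Delta chi j (rep (f t))))
      \<le> ennreal (2 powr (- real_of_int j * s)) * chemin_lerner_norm chi \<theta> T s p \<infinity> f"
proof -
  let ?X = "chemin_lerner_norm chi \<theta> T s p \<infinity> f" and ?t = "time_space_norm \<theta> T p (\<lambda>t. Delta chi j (rep (f t)))"
  let ?c = "2 powr (of_int j * s) :: real"
  have le: "ennreal ?c * ?t \<le> ?X" unfolding chemin_lerner_norm_infty by (rule SUP_upper) simp
  then have "?t \<noteq> \<infinity>" using fin by (auto simp: ennreal_mult_top top_unique)
  then have meas: "\<forall>\<phi>\<in>schwartz. (\<lambda>t. Delta chi j (rep (f t)) \<phi>) \<in> borel_measurable (lebesgue_on {0<..<T})"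
    and t: "?t = Lnorm \<theta> (lebesgue_on {0<..<T}) (\<lambda>t. distr_Lnorm p (Delta chi j (rep (f t))))"
    unfolding time_space_norm_def by (auto split: if_splits)
  show "\<phi> \<in> schwartz \<Longrightarrow> (\<lambda>t. Delta chi j (rep (f t)) \<phi>) \<in> borel_measurable (lebesgue_on {0<..<T})" using meas by blast
  have "?t = ennreal (2 powr (- real_of_int j * s)) * (ennreal ?c * ?t)"
    by (simp add: ennreal_mult_assoc flip: powr_add)
  also have "\<dots> \<le> ennreal (2 powr (- real_of_int j * s)) * ?X" using le by (rule mult_left_mono) simp
  finally show "Lnorm \<theta> (lebesgue_on {0<..<T}) (\<lambda>t. distr_Lnorm p (Delta chi j (rep (f t)))) \<le> ennreal (2 powr (- real_of_int j * s)) * ?X"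
    unfolding t .
qed

context lp begin

text \<open>
  With the weight \<open>2\<^sup>k\<close> to the power \<open>d/p - 1/4\<close>, the block
  \<open>k\<close> has a norm in time that decreases like \<open>2\<^sup>k\<close> to the power
  \<open>7/4\<close> for \<open>k \<le> 0\<close>, by the bound with index \<open>d/p -
  2\<close>, and to the power \<open>-1/4\<close> for \<open>k \<ge> 0\<close>, by the bound
  with index \<open>d/p\<close>. So the sum of the weighted blocks is finite for almost every
  \<open>t\<close>.
\<close>

lemma AE_good:
  fixes d p :: real
  defines "d \<equiv> real CARD('n)"
  assumes v: "\<And>t. t \<in> space M \<Longrightarrow> tempered (v t)" and \<theta>: "1 \<le> \<theta>\<^sub>1" "1 \<le> \<theta>\<^sub>2"
    and meas: "\<And>k. (\<lambda>t. bnorm p (v t) k) \<in> borel_measurable M"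
    and lo: "\<And>k. Lnorm \<theta>\<^sub>1 M (\<lambda>t. bnorm p (v t) k) \<le> ennreal (2 powr (- real_of_int k * (d / p - 2))) * A" "A < \<infinity>"
    and hi: "\<And>k. Lnorm \<theta>\<^sub>2 M (\<lambda>t. bnorm p (v t) k) \<le> ennreal (2 powr (- real_of_int k * (d / p))) * B" "B < \<infinity>"
  shows "AE t in M. good p (v t)"
proof -
  have weighted: "AE t in M. (\<integral>\<^sup>+m. ennreal (2 powr (- real_of_int (k m) * (1 / 4 - d / p))) * bnorm p (v t) (k m) \<partial>count_space UNIV) < \<infinity>"
    if \<theta>: "1 \<le> \<theta>" and X: "X < \<infinity>" and le: "\<And>m. Lnorm \<theta> M (\<lambda>t. bnorm p (v t) (k m)) \<le> ennreal (2 powr (- real_of_int (k m) * s)) * X"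
      and decay: "\<And>m. - real_of_int (k m) * (1 / 4 - d / p + s) \<le> - real m / 4" for k :: "nat \<Rightarrow> int" and \<theta> X s
  proof (rule Lnorm_finite_AE[OF \<theta>])
    let ?F = "\<lambda>m t. ennreal (2 powr (- real_of_int (k m) * (1 / 4 - d / p))) * bnorm p (v t) (k m)"
    have mF: "?F m \<in> borel_measurable M" for m using meas by measurable
    show "(\<lambda>t. \<integral>\<^sup>+m. ?F m t \<partial>count_space UNIV) \<in> borel_measurable M" by (rule nn_integral_count_space_measurable[OF _ mF]) simp
    have "2 powr (- 1 / 4) < (2 powr 0 :: real)" by (intro powr_less_mono) auto
    then have g: "(2 powr (- 1 / 4) :: real) < 1" by simp
    have "Lnorm \<theta> M (\<lambda>t. \<integral>\<^sup>+m. ?F m t \<partial>count_space UNIV) \<le> ennreal (1 / (1 - 2 powr (- 1 / 4))) * X"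
    proof (rule Lnorm_geometric_series[OF \<theta> mF])
      fix m
      have "Lnorm \<theta> M (?F m) \<le> ennreal (2 powr (- real_of_int (k m) * (1 / 4 - d / p))) * Lnorm \<theta> M (\<lambda>t. bnorm p (v t) (k m))"
        by (intro Lnorm_cmult_le \<theta> meas) simp
      also have "\<dots> \<le> ennreal (2 powr (- real_of_int (k m) * (1 / 4 - d / p))) * (ennreal (2 powr (- real_of_int (k m) * s)) * X)"
        by (intro mult_left_mono le) simp
      also have "\<dots> = ennreal (2 powr (- real_of_int (k m) * (1 / 4 - d / p + s))) * X"
        by (simp add: ennreal_mult_assoc distrib_left flip: powr_add)
      also have "\<dots> \<le> ennreal (2 powr (- real m / 4)) * X"
        by (intro mult_right_mono ennreal_leI powr_mono decay) auto
      also have "2 powr (- real m / 4) = 1 * (2 powr (- 1 / 4)) ^ m"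
        by (simp add: powr_powr flip: powr_realpow)
      finally show "Lnorm \<theta> M (?F m) \<le> ennreal (1 * (2 powr (- 1 / 4)) ^ m) * X" .
    qed (use g in auto)
    also have "\<dots> < \<infinity>" using X by (simp add: ennreal_mult_less_top)
    finally show "Lnorm \<theta> M (\<lambda>t. \<integral>\<^sup>+m. ?F m t \<partial>count_space UNIV) < \<infinity>" .
  qed
  have "AE t in M. (\<integral>\<^sup>+m. ennreal (2 powr (- real_of_int (- int m) * (1 / 4 - d / p))) * bnorm p (v t) (- int m) \<partial>count_space UNIV) < \<infinity>"
    by (rule weighted[OF \<theta>(1) lo(2) lo(1)]) (simp add: field_simps)
  moreover have "AE t in M. (\<integral>\<^sup>+m. ennreal (2 powr (- real_of_int (int m) * (1 / 4 - d / p))) * bnorm p (v t) (int m) \<partial>count_space UNIV) < \<infinity>"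
    by (rule weighted[OF \<theta>(2) hi(2) hi(1)]) simp
  ultimately show ?thesis
  proof (rule AE_mp[OF _ AE_mp], intro AE_I2 impI)
    fix t assume t: "t \<in> space M"
      and 1: "(\<integral>\<^sup>+m. ennreal (2 powr (- real_of_int (- int m) * (1 / 4 - d / p))) * bnorm p (v t) (- int m) \<partial>count_space UNIV) < \<infinity>" (is "?S1 < _")
      and 2: "(\<integral>\<^sup>+m. ennreal (2 powr (- real_of_int (int m) * (1 / 4 - d / p))) * bnorm p (v t) (int m) \<partial>count_space UNIV) < \<infinity>" (is "?S2 < _")
    define Q where "Q = enn2real (?S1 + ?S2)"
    have Q: "ennreal Q = ?S1 + ?S2" using 1 2 by (simp add: Q_def)
    have "bnorm p (v t) k \<le> ennreal (Q * 2 powr (real_of_int k * (1 / 4 - d / p)))" for k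
    proof -
      let ?w = "ennreal (2 powr (- real_of_int k * (1 / 4 - d / p)))"
      have "?w * bnorm p (v t) k \<le> ?S1 + ?S2"
      proof (cases "k \<le> 0")
        case True
        then have k: "k = - int (nat (- k))" by simp
        have "?w * bnorm p (v t) k \<le> ?S1"
          using nn_integral_ge_point[of "nat (- k)" UNIV "\<lambda>m. ennreal (2 powr (- real_of_int (- int m) * (1 / 4 - d / p))) * bnorm p (v t) (- int m)"]
          unfolding k[symmetric] by simp
        then show ?thesis by (rule order_trans) simp
      next
        case False
        then have k: "k = int (nat k)" by simp
        have "?w * bnorm p (v t) k \<le> ?S2"
          using nn_integral_ge_point[of "nat k" UNIV "\<lambda>m. ennreal (2 powr (- real_of_int (int m) * (1 / 4 - d / p))) * bnorm p (v t) (int m)"]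
          unfolding k[symmetric] by simp
        then show ?thesis by (rule order_trans) simp
      qed
      then have "ennreal (2 powr (real_of_int k * (1 / 4 - d / p))) * (?w * bnorm p (v t) k) \<le> ennreal (2 powr (real_of_int k * (1 / 4 - d / p))) * ennreal Q"
        unfolding Q by (rule mult_left_mono) simp
      moreover have "ennreal (2 powr (real_of_int k * (1 / 4 - d / p))) * (?w * bnorm p (v t) k) = bnorm p (v t) k"
        by (simp add: ennreal_mult_assoc flip: powr_add)
      moreover have "ennreal (2 powr (real_of_int k * (1 / 4 - d / p))) * ennreal Q = ennreal (Q * 2 powr (real_of_int k * (1 / 4 - d / p)))"
        by (subst ennreal_mult[symmetric]) (simp_all add: Q_def mult.commute)
      ultimately show ?thesis by simp
    qed
    moreover have "0 \<le> Q" by (simp add: Q_def)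
    ultimately show "good p (v t)" unfolding good_def d_def[symmetric] using v[OF t] by blast
  qed
qed

end

section \<open>The product estimate\<close>

context lp begin

text \<open>
  The paraproduct terms with low frequency \<open>k = j - 2 - m\<close> decrease geometrically
  in \<open>m\<close> with the ratio \<open>2\<^sup>-\<^sup>\<delta>\<close>.
\<close>

lemma para_bound:
  fixes d p q \<delta> :: real
  defines "d \<equiv> real CARD('n)" and "\<delta> \<equiv> d / p - d / q + 2"
  assumes \<theta>: "1 \<le> \<theta>" "1 \<le> \<theta>\<^sub>1" "1 \<le> \<theta>\<^sub>2" "1 / \<theta> = 1 / \<theta>\<^sub>1 + 1 / \<theta>\<^sub>2"
    and \<alpha>: "\<And>k. (\<lambda>t. \<alpha> t k) \<in> borel_measurable M" "\<And>k. Lnorm \<theta>\<^sub>1 M (\<lambda>t. \<alpha> t k) \<le> ennreal (2 powr (- real_of_int k * (d / p - 2))) * A"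
    and \<beta>: "\<And>k. (\<lambda>t. \<beta> t k) \<in> borel_measurable M" "\<And>k. Lnorm \<theta>\<^sub>2 M (\<lambda>t. \<beta> t k) \<le> ennreal (2 powr (- real_of_int k * (d / p))) * B"
    and \<delta>: "0 < \<delta>"
  shows "Lnorm \<theta> M (\<lambda>t. \<integral>\<^sup>+m. ennreal (kc * dyadic_vol CARD('n) (j - 2 - int m) powr (2 / p - 1 / q)) * (\<alpha> t (j - 2 - int m) * \<beta> t j) \<partial>count_space UNIV)
    \<le> ennreal (kc * 2 powr (- 2 * \<delta>) * 2 powr (- real_of_int j * (d / q - 2)) / (1 - 2 powr (- \<delta>))) * (A * B)"
proof (rule Lnorm_geometric_series[OF \<theta>(1)])
  show "(\<lambda>t. ennreal (kc * dyadic_vol CARD('n) (j - 2 - int m) powr (2 / p - 1 / q)) * (\<alpha> t (j - 2 - int m) * \<beta> t j)) \<in> borel_measurable M" for m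
    using \<alpha>(1) \<beta>(1) by measurable
  have "2 powr (- \<delta>) < 2 powr 0" using \<delta> by (intro powr_less_mono) auto
  then show "2 powr (- \<delta>) < 1" by simp
  show "Lnorm \<theta> M (\<lambda>t. ennreal (kc * dyadic_vol CARD('n) (j - 2 - int m) powr (2 / p - 1 / q)) * (\<alpha> t (j - 2 - int m) * \<beta> t j))
    \<le> ennreal (kc * 2 powr (- 2 * \<delta>) * 2 powr (- real_of_int j * (d / q - 2)) * (2 powr (- \<delta>)) ^ m) * (A * B)" for m
  proof (rule Lnorm_weighted_product[OF \<theta> \<alpha> \<beta>])
    have e: "(real_of_int (j - 2 - int m) * d) * (2 / p - 1 / q) + (- real_of_int (j - 2 - int m) * (d / p - 2)) + (- real_of_int j * (d / p))
        = (- 2 * \<delta>) + (- real_of_int j * (d / q - 2)) + (- \<delta> * real m)"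
      by (simp add: \<delta>_def algebra_simps add_divide_distrib diff_divide_distrib)
    have "dyadic_vol CARD('n) (j - 2 - int m) powr (2 / p - 1 / q) * 2 powr (- real_of_int (j - 2 - int m) * (d / p - 2)) * 2 powr (- real_of_int j * (d / p))
        = 2 powr ((real_of_int (j - 2 - int m) * d) * (2 / p - 1 / q) + (- real_of_int (j - 2 - int m) * (d / p - 2)) + (- real_of_int j * (d / p)))"
      by (simp only: dyadic_vol_def d_def powr_powr powr_add)
    also have "\<dots> = 2 powr (- 2 * \<delta>) * 2 powr (- real_of_int j * (d / q - 2)) * (2 powr (- \<delta>)) ^ m"
      unfolding e by (simp only: powr_add powr_powr flip: powr_realpow[OF powr_gt_zero[THEN iffD2, OF zero_neq_numeral[symmetric]]])
    finally show "kc * dyadic_vol CARD('n) (j - 2 - int m) powr (2 / p - 1 / q) * 2 powr (- real_of_int (j - 2 - int m) * (d / p - 2)) * 2 powr (- real_of_int j * (d / p))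
      \<le> kc * 2 powr (- 2 * \<delta>) * 2 powr (- real_of_int j * (d / q - 2)) * (2 powr (- \<delta>)) ^ m"
      by (simp only: mult.assoc order_refl)
  qed (use kc(1) in auto)
qed (use kc(1) in auto)

text \<open>
  The remainder terms with \<open>j = l - 3 + m\<close> decrease geometrically in
  \<open>m\<close> with the ratio \<open>2\<^sup>-\<^sup>\<epsilon>\<close>. The factor 3 counts
  the indices \<open>k\<close> next to \<open>j\<close>.
\<close>

lemma rem_bound:
  fixes d p q r \<epsilon> :: real
  defines "d \<equiv> real CARD('n)" and "\<epsilon> \<equiv> d / r - 2"
  assumes \<theta>: "1 \<le> \<theta>" "1 \<le> \<theta>\<^sub>1" "1 \<le> \<theta>\<^sub>2" "1 / \<theta> = 1 / \<theta>\<^sub>1 + 1 / \<theta>\<^sub>2"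
    and \<alpha>: "\<And>k. (\<lambda>t. \<alpha> t k) \<in> borel_measurable M" "\<And>k. Lnorm \<theta>\<^sub>1 M (\<lambda>t. \<alpha> t k) \<le> ennreal (2 powr (- real_of_int k * (d / p - 2))) * A"
    and \<beta>: "\<And>k. (\<lambda>t. \<beta> t k) \<in> borel_measurable M" "\<And>k. Lnorm \<theta>\<^sub>2 M (\<lambda>t. \<beta> t k) \<le> ennreal (2 powr (- real_of_int k * (d / p))) * B"
    and \<epsilon>: "0 < \<epsilon>"
  shows "Lnorm \<theta> M (\<lambda>t. \<integral>\<^sup>+m. ennreal (kc * dyadic_vol CARD('n) l powr (1 / r - 1 / q)) *
        (\<Sum>k | \<bar>k - (l - 3 + int m)\<bar> \<le> 1. ennreal (kc * dyadic_vol CARD('n) (l - 3 + int m) powr (2 / p - 1 / r)) * (\<alpha> t k * \<beta> t (l - 3 + int m)))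
       \<partial>count_space UNIV)
    \<le> ennreal (3 * (kc * kc * 2 powr \<bar>d / p - 2\<bar> * 2 powr (3 * \<epsilon>)) * 2 powr (- real_of_int l * (d / q - 2)) / (1 - 2 powr (- \<epsilon>))) * (A * B)"
    (is "Lnorm \<theta> M (\<lambda>t. \<integral>\<^sup>+m. ennreal ?w * ?S m t \<partial>_) \<le> ennreal (3 * ?K * ?l / _) * _")
proof (rule Lnorm_geometric_series[OF \<theta>(1)])
  have [measurable]: "(\<lambda>t. \<alpha> t k) \<in> borel_measurable M" "(\<lambda>t. \<beta> t k) \<in> borel_measurable M" for k by (rule \<alpha> \<beta>)+
  show "(\<lambda>t. ennreal ?w * ?S m t) \<in> borel_measurable M" for m by measurable
  have "2 powr (- \<epsilon>) < 2 powr 0" using \<epsilon> by (intro powr_less_mono) auto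
  then show "2 powr (- \<epsilon>) < 1" by simp
  show "Lnorm \<theta> M (\<lambda>t. ennreal ?w * ?S m t) \<le> ennreal (3 * ?K * ?l * (2 powr (- \<epsilon>)) ^ m) * (A * B)" for m
  proof -
    define j where "j = l - 3 + int m"
    define c where "c = kc * dyadic_vol CARD('n) l powr (1 / r - 1 / q) * (kc * dyadic_vol CARD('n) j powr (2 / p - 1 / r))"
    have c: "0 \<le> c" using kc(1) by (simp add: c_def)
    have "ennreal ?w * ?S m t = (\<Sum>k | \<bar>k - j\<bar> \<le> 1. ennreal c * (\<alpha> t k * \<beta> t j))" for t
      unfolding sum_distrib_left j_def[symmetric] c_def using kc(1) by (intro sum.cong refl) (simp add: ennreal_mult mult.assoc)
    then have "Lnorm \<theta> M (\<lambda>t. ennreal ?w * ?S m t) = Lnorm \<theta> M (\<lambda>t. \<Sum>k | \<bar>k - j\<bar> \<le> 1. ennreal c * (\<alpha> t k * \<beta> t j))" by simp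
    also have "\<dots> \<le> (\<Sum>k | \<bar>k - j\<bar> \<le> 1. Lnorm \<theta> M (\<lambda>t. ennreal c * (\<alpha> t k * \<beta> t j)))"
      by (intro Lnorm_sum \<theta>) (auto simp: near_eq)
    also have "\<dots> \<le> (\<Sum>k | \<bar>k - j\<bar> \<le> 1. ennreal (?K * ?l * (2 powr (- \<epsilon>)) ^ m) * (A * B))"
    proof (intro sum_mono Lnorm_weighted_product[OF \<theta> \<alpha> \<beta>])
      fix k assume "k \<in> {k. \<bar>k - j\<bar> \<le> 1}"
      then have k: "\<bar>real_of_int j - real_of_int k\<bar> \<le> 1" by (simp add: abs_minus_commute flip: of_int_diff of_int_abs)
      have "(real_of_int j - real_of_int k) * (d / p - 2) \<le> \<bar>real_of_int j - real_of_int k\<bar> * \<bar>d / p - 2\<bar>" by (metis abs_ge_self abs_mult)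
      also have "\<dots> \<le> \<bar>d / p - 2\<bar>" using mult_right_mono[OF k, of "\<bar>d / p - 2\<bar>"] by simp
      finally have e: "(real_of_int l * d) * (1 / r - 1 / q) + (real_of_int j * d) * (2 / p - 1 / r) + (- real_of_int k * (d / p - 2)) + (- real_of_int j * (d / p))
          \<le> \<bar>d / p - 2\<bar> + 3 * \<epsilon> + (- real_of_int l * (d / q - 2)) + (- \<epsilon> * real m)"
        by (simp add: \<epsilon>_def j_def algebra_simps add_divide_distrib diff_divide_distrib)
      have "c * 2 powr (- real_of_int k * (d / p - 2)) * 2 powr (- real_of_int j * (d / p))
        = kc * kc * 2 powr ((real_of_int l * d) * (1 / r - 1 / q) + (real_of_int j * d) * (2 / p - 1 / r) + (- real_of_int k * (d / p - 2)) + (- real_of_int j * (d / p)))"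
        by (simp only: c_def dyadic_vol_def d_def powr_powr powr_add mult_ac)
      also have "\<dots> \<le> kc * kc * 2 powr (\<bar>d / p - 2\<bar> + 3 * \<epsilon> + (- real_of_int l * (d / q - 2)) + (- \<epsilon> * real m))"
        using e kc(1) by (intro mult_left_mono powr_mono) auto
      also have "\<dots> = ?K * ?l * (2 powr (- \<epsilon>)) ^ m"
        by (simp only: powr_add powr_powr mult.assoc flip: powr_realpow[OF powr_gt_zero[THEN iffD2, OF zero_neq_numeral[symmetric]]])
      finally show "c * 2 powr (- real_of_int k * (d / p - 2)) * 2 powr (- real_of_int j * (d / p)) \<le> ?K * ?l * (2 powr (- \<epsilon>)) ^ m" .
    qed (use c in auto)
    also have "\<dots> = ennreal 3 * (ennreal (?K * ?l * (2 powr (- \<epsilon>)) ^ m) * (A * B))" by (simp add: near_eq)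
    also have "\<dots> = ennreal (3 * (?K * ?l * (2 powr (- \<epsilon>)) ^ m)) * (A * B)"
      using kc(1) by (intro ennreal_mult_assoc) auto
    also have "3 * (?K * ?l * (2 powr (- \<epsilon>)) ^ m) = 3 * ?K * ?l * (2 powr (- \<epsilon>)) ^ m" by (simp only: mult.assoc)
    finally show ?thesis .
  qed
qed (use kc(1) in auto)

lemma prod_bound_measurable:
  assumes [measurable]: "\<And>k. (\<lambda>t. \<alpha> t k) \<in> borel_measurable M" "\<And>k. (\<lambda>t. \<beta> t k) \<in> borel_measurable M"
  shows "(\<lambda>t. prod_bound p q r (\<alpha> t) (\<beta> t) l) \<in> borel_measurable M"
  unfolding prod_bound_def
  by (intro borel_measurable_add borel_measurable_sum borel_measurable_times_ennreal borel_measurable_const nn_integral_count_space_measurable assms) auto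

lemma Lnorm_prod_bound:
  fixes d p q r \<delta> :: real
  defines "d \<equiv> real CARD('n)"
  assumes \<delta>: "0 < d / p - d / q + 2" and r: "0 < d / r - 2"
    and \<theta>: "1 \<le> \<theta>" "1 \<le> \<theta>\<^sub>1" "1 \<le> \<theta>\<^sub>2" "1 / \<theta> = 1 / \<theta>\<^sub>1 + 1 / \<theta>\<^sub>2"
    and \<theta>': "1 \<le> \<theta>\<^sub>1'" "1 \<le> \<theta>\<^sub>2'" "1 / \<theta> = 1 / \<theta>\<^sub>1' + 1 / \<theta>\<^sub>2'"
  shows "\<exists>C>0. \<forall>M \<alpha> \<beta> A\<^sub>1 B\<^sub>2 B\<^sub>1 A\<^sub>2 l.
    (\<forall>k. (\<lambda>t. \<alpha> t k) \<in> borel_measurable M \<and> (\<lambda>t. \<beta> t k) \<in> borel_measurable M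
      \<and> Lnorm \<theta>\<^sub>1 M (\<lambda>t. \<alpha> t k) \<le> ennreal (2 powr (- real_of_int k * (d / p - 2))) * A\<^sub>1
      \<and> Lnorm \<theta>\<^sub>2 M (\<lambda>t. \<beta> t k) \<le> ennreal (2 powr (- real_of_int k * (d / p))) * B\<^sub>2
      \<and> Lnorm \<theta>\<^sub>1' M (\<lambda>t. \<beta> t k) \<le> ennreal (2 powr (- real_of_int k * (d / p - 2))) * B\<^sub>1
      \<and> Lnorm \<theta>\<^sub>2' M (\<lambda>t. \<alpha> t k) \<le> ennreal (2 powr (- real_of_int k * (d / p))) * A\<^sub>2) \<longrightarrow>
    Lnorm \<theta> (M :: 'a measure) (\<lambda>t. prod_bound p q r (\<alpha> t) (\<beta> t) l)
      \<le> ennreal (C * 2 powr (- real_of_int l * (d / q - 2))) * (A\<^sub>1 * B\<^sub>2 + B\<^sub>1 * A\<^sub>2)"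
proof -
  define \<delta> where "\<delta> = d / p - d / q + 2"
  \<comment> \<open>the constants of one paraproduct term, with \<open>\<bar>j - l\<bar> \<le> 5\<close>, and of the remainder\<close>
  define c1 where "c1 = kc * (kc * 2 powr (- 2 * \<delta>) * 2 powr (5 * \<bar>d / q - 2\<bar>) / (1 - 2 powr (- \<delta>)))"
  define c2 where "c2 = 3 * (kc * kc * 2 powr \<bar>d / p - 2\<bar> * 2 powr (3 * (d / r - 2))) / (1 - 2 powr (- (d / r - 2)))"
  have "2 powr (- \<delta>) < 2 powr 0" "2 powr (- (d / r - 2)) < 2 powr 0" using assms by (intro powr_less_mono; simp add: \<delta>_def)+
  then have pos: "0 < 1 - 2 powr (- \<delta>)" "0 < 1 - 2 powr (- (d / r - 2))" by auto
  then have c: "0 < c1" "0 < c2" using kc(1) unfolding c1_def c2_def by (auto intro!: mult_pos_pos divide_pos_pos)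
  show ?thesis
  proof (intro exI[of _ "11 * c1 + c2"] conjI allI impI)
    \<comment> \<open>There are eleven values of \<open>j\<close>.\<close>
    show "0 < 11 * c1 + c2" using c by simp
    fix A\<^sub>1 B\<^sub>2 B\<^sub>1 A\<^sub>2 :: ennreal and M :: "'a measure" and \<alpha> \<beta> :: "'a \<Rightarrow> int \<Rightarrow> ennreal" and l :: int
    assume *: "\<forall>k. (\<lambda>t. \<alpha> t k) \<in> borel_measurable M \<and> (\<lambda>t. \<beta> t k) \<in> borel_measurable M
      \<and> Lnorm \<theta>\<^sub>1 M (\<lambda>t. \<alpha> t k) \<le> ennreal (2 powr (- real_of_int k * (d / p - 2))) * A\<^sub>1
      \<and> Lnorm \<theta>\<^sub>2 M (\<lambda>t. \<beta> t k) \<le> ennreal (2 powr (- real_of_int k * (d / p))) * B\<^sub>2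
      \<and> Lnorm \<theta>\<^sub>1' M (\<lambda>t. \<beta> t k) \<le> ennreal (2 powr (- real_of_int k * (d / p - 2))) * B\<^sub>1
      \<and> Lnorm \<theta>\<^sub>2' M (\<lambda>t. \<alpha> t k) \<le> ennreal (2 powr (- real_of_int k * (d / p))) * A\<^sub>2"
    then have \<alpha>: "\<And>k. (\<lambda>t. \<alpha> t k) \<in> borel_measurable M" and \<beta>: "\<And>k. (\<lambda>t. \<beta> t k) \<in> borel_measurable M" by blast+
    let ?P = "\<lambda>\<alpha> \<beta> j t. \<integral>\<^sup>+m. ennreal (kc * dyadic_vol CARD('n) (j - 2 - int m) powr (2 / p - 1 / q)) * (\<alpha> t (j - 2 - int m) * \<beta> t j) \<partial>count_space UNIV"
    let ?R = "\<lambda>t. \<integral>\<^sup>+m. ennreal (kc * dyadic_vol CARD('n) l powr (1 / r - 1 / q)) *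
        (\<Sum>k | \<bar>k - (l - 3 + int m)\<bar> \<le> 1. ennreal (kc * dyadic_vol CARD('n) (l - 3 + int m) powr (2 / p - 1 / r)) * (\<alpha> t k * \<beta> t (l - 3 + int m)))
       \<partial>count_space UNIV"
    let ?l = "2 powr (- real_of_int l * (d / q - 2))"
    have mP: "?P \<alpha> \<beta> j \<in> borel_measurable M" "?P \<beta> \<alpha> j \<in> borel_measurable M" for j
      by (intro nn_integral_count_space_measurable borel_measurable_times_ennreal borel_measurable_const \<alpha> \<beta>; simp)+
    have mR: "?R \<in> borel_measurable M"
      by (intro nn_integral_count_space_measurable borel_measurable_sum borel_measurable_times_ennreal borel_measurable_const \<alpha> \<beta>; simp)
    have P: "Lnorm \<theta> M (\<lambda>t. ennreal kc * ?P \<alpha> \<beta> j t) \<le> ennreal (c1 * ?l) * (A * B)"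
      if \<theta>: "1 \<le> \<theta>\<^sub>1" "1 \<le> \<theta>\<^sub>2" "1 / \<theta> = 1 / \<theta>\<^sub>1 + 1 / \<theta>\<^sub>2" and \<alpha>: "\<And>k. (\<lambda>t. \<alpha> t k) \<in> borel_measurable M"
        "\<And>k. Lnorm \<theta>\<^sub>1 M (\<lambda>t. \<alpha> t k) \<le> ennreal (2 powr (- real_of_int k * (d / p - 2))) * A"
        and \<beta>: "\<And>k. (\<lambda>t. \<beta> t k) \<in> borel_measurable M" "\<And>k. Lnorm \<theta>\<^sub>2 M (\<lambda>t. \<beta> t k) \<le> ennreal (2 powr (- real_of_int k * (d / p))) * B"
        and j: "j \<in> {l - 5..l + 5}" for \<theta>\<^sub>1 \<theta>\<^sub>2 \<alpha> \<beta> A B j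
    proof -
      have mP: "?P \<alpha> \<beta> j \<in> borel_measurable M"
        by (intro nn_integral_count_space_measurable borel_measurable_times_ennreal borel_measurable_const \<alpha> \<beta>) simp
      have "\<bar>real_of_int l - real_of_int j\<bar> \<le> 5" using j by (auto simp: abs_le_iff simp flip: of_int_diff)
      then have "\<bar>real_of_int l - real_of_int j\<bar> * \<bar>d / q - 2\<bar> \<le> 5 * \<bar>d / q - 2\<bar>" by (rule mult_right_mono) simp
      moreover have "(real_of_int l - real_of_int j) * (d / q - 2) \<le> \<bar>real_of_int l - real_of_int j\<bar> * \<bar>d / q - 2\<bar>"
        using abs_ge_self[of "(real_of_int l - real_of_int j) * (d / q - 2)"] by (simp only: abs_mult)
      ultimately have "(real_of_int l - real_of_int j) * (d / q - 2) \<le> 5 * \<bar>d / q - 2\<bar>" by (rule order_trans[rotated])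
      then have "2 powr (- real_of_int j * (d / q - 2)) \<le> 2 powr (5 * \<bar>d / q - 2\<bar> + (- real_of_int l * (d / q - 2)))"
        by (intro powr_mono) (auto simp: algebra_simps)
      then have le: "2 powr (- real_of_int j * (d / q - 2)) \<le> 2 powr (5 * \<bar>d / q - 2\<bar>) * ?l" by (simp only: powr_add)
      have "Lnorm \<theta> M (\<lambda>t. ennreal kc * ?P \<alpha> \<beta> j t) \<le> ennreal kc * Lnorm \<theta> M (?P \<alpha> \<beta> j)"
        using kc(1) by (intro Lnorm_cmult_le \<open>1 \<le> \<theta>\<close> mP) auto
      also have "\<dots> \<le> ennreal kc * (ennreal (kc * 2 powr (- 2 * \<delta>) * 2 powr (- real_of_int j * (d / q - 2)) / (1 - 2 powr (- \<delta>))) * (A * B))"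
      proof (rule mult_left_mono)
        show "Lnorm \<theta> M (?P \<alpha> \<beta> j) \<le> ennreal (kc * 2 powr (- 2 * \<delta>) * 2 powr (- real_of_int j * (d / q - 2)) / (1 - 2 powr (- \<delta>))) * (A * B)"
          unfolding \<delta>_def d_def by (rule para_bound[OF \<open>1 \<le> \<theta>\<close> \<theta>])
            (rule \<alpha>(1) \<alpha>(2)[unfolded d_def] \<beta>(1) \<beta>(2)[unfolded d_def] \<delta>[unfolded d_def])+
      qed simp
      also have "\<dots> \<le> ennreal kc * (ennreal (kc * 2 powr (- 2 * \<delta>) * (2 powr (5 * \<bar>d / q - 2\<bar>) * ?l) / (1 - 2 powr (- \<delta>))) * (A * B))"
        using le kc(1) pos(1) by (intro mult_left_mono mult_right_mono ennreal_leI divide_right_mono) auto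
      also have "\<dots> = ennreal (kc * (kc * 2 powr (- 2 * \<delta>) * (2 powr (5 * \<bar>d / q - 2\<bar>) * ?l) / (1 - 2 powr (- \<delta>)))) * (A * B)"
        using kc(1) pos(1) by (subst ennreal_mult[of kc]) (auto simp: mult.assoc)
      also have "kc * (kc * 2 powr (- 2 * \<delta>) * (2 powr (5 * \<bar>d / q - 2\<bar>) * ?l) / (1 - 2 powr (- \<delta>))) = c1 * ?l"
        by (simp add: c1_def)
      finally show ?thesis .
    qed
    have "Lnorm \<theta> M (\<lambda>t. prod_bound p q r (\<alpha> t) (\<beta> t) l)
        \<le> Lnorm \<theta> M (\<lambda>t. \<Sum>j\<in>{l - 5..l + 5}. ennreal kc * ?P \<alpha> \<beta> j t + ennreal kc * ?P \<beta> \<alpha> j t) + Lnorm \<theta> M ?R"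
      unfolding prod_bound_def by (intro Lnorm_add \<theta> borel_measurable_sum borel_measurable_add borel_measurable_times_ennreal borel_measurable_const mP mR)
    also have "Lnorm \<theta> M (\<lambda>t. \<Sum>j\<in>{l - 5..l + 5}. ennreal kc * ?P \<alpha> \<beta> j t + ennreal kc * ?P \<beta> \<alpha> j t)
        \<le> (\<Sum>j\<in>{l - 5..l + 5}. Lnorm \<theta> M (\<lambda>t. ennreal kc * ?P \<alpha> \<beta> j t + ennreal kc * ?P \<beta> \<alpha> j t))"
      by (intro Lnorm_sum \<theta> borel_measurable_add borel_measurable_times_ennreal borel_measurable_const mP) auto
    also have "\<dots> \<le> (\<Sum>j\<in>{l - 5..l + 5}. Lnorm \<theta> M (\<lambda>t. ennreal kc * ?P \<alpha> \<beta> j t) + Lnorm \<theta> M (\<lambda>t. ennreal kc * ?P \<beta> \<alpha> j t))"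
      by (intro sum_mono Lnorm_add \<theta> borel_measurable_times_ennreal borel_measurable_const mP)
    also have "\<dots> \<le> (\<Sum>j\<in>{l - 5..l + 5}. ennreal (c1 * ?l) * (A\<^sub>1 * B\<^sub>2) + ennreal (c1 * ?l) * (B\<^sub>1 * A\<^sub>2))"
      using * by (intro sum_mono add_mono P[OF \<theta>(2-4)] P[OF \<theta>']) auto
    also have "\<dots> = ennreal 11 * (ennreal (c1 * ?l) * (A\<^sub>1 * B\<^sub>2 + B\<^sub>1 * A\<^sub>2))" by (simp add: distrib_left)
    also have "\<dots> = ennreal (11 * (c1 * ?l)) * (A\<^sub>1 * B\<^sub>2 + B\<^sub>1 * A\<^sub>2)"
      using c by (intro ennreal_mult_assoc) auto
    also have "Lnorm \<theta> M ?R \<le> ennreal (c2 * ?l) * (A\<^sub>1 * B\<^sub>2)"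
    proof -
      have "Lnorm \<theta> M ?R \<le> ennreal (3 * (kc * kc * 2 powr \<bar>d / p - 2\<bar> * 2 powr (3 * (d / r - 2))) * ?l / (1 - 2 powr (- (d / r - 2)))) * (A\<^sub>1 * B\<^sub>2)"
        using * r unfolding d_def by (intro rem_bound[OF \<theta>]) blast+
      then show ?thesis by (simp add: c2_def)
    qed
    also have "ennreal (c2 * ?l) * (A\<^sub>1 * B\<^sub>2) \<le> ennreal (c2 * ?l) * (A\<^sub>1 * B\<^sub>2 + B\<^sub>1 * A\<^sub>2)"
      by (intro mult_left_mono) auto
    finally have "Lnorm \<theta> M (\<lambda>t. prod_bound p q r (\<alpha> t) (\<beta> t) l)
        \<le> ennreal (11 * (c1 * ?l)) * (A\<^sub>1 * B\<^sub>2 + B\<^sub>1 * A\<^sub>2) + ennreal (c2 * ?l) * (A\<^sub>1 * B\<^sub>2 + B\<^sub>1 * A\<^sub>2)"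
      by (simp add: add_mono)
    also have "\<dots> = (ennreal (11 * (c1 * ?l)) + ennreal (c2 * ?l)) * (A\<^sub>1 * B\<^sub>2 + B\<^sub>1 * A\<^sub>2)" by (rule distrib_right[symmetric])
    also have "ennreal (11 * (c1 * ?l)) + ennreal (c2 * ?l) = ennreal ((11 * c1 + c2) * ?l)"
      using c by (subst ennreal_plus[symmetric]) (auto simp: distrib_right)
    finally show "Lnorm \<theta> M (\<lambda>t. prod_bound p q r (\<alpha> t) (\<beta> t) l) \<le> ennreal ((11 * c1 + c2) * ?l) * (A\<^sub>1 * B\<^sub>2 + B\<^sub>1 * A\<^sub>2)" .
  qed
qed

lemma product_estimate:
  fixes \<rho> \<rho>\<^sub>1 \<rho>\<^sub>2 \<rho>\<^sub>1' \<rho>\<^sub>2' :: ennreal and p q d :: real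
  assumes d3: "CARD('n) \<ge> 3" and d: "d = real CARD('n)"
    and \<rho>: "1 \<le> \<rho>" "1 \<le> \<rho>\<^sub>1" "1 \<le> \<rho>\<^sub>2" "1 / \<rho> = 1 / \<rho>\<^sub>1 + 1 / \<rho>\<^sub>2"
    and \<rho>': "1 \<le> \<rho>\<^sub>1'" "1 \<le> \<rho>\<^sub>2'" "1 / \<rho> = 1 / \<rho>\<^sub>1' + 1 / \<rho>\<^sub>2'"
    and q: "1 \<le> q" "q \<le> p" "p \<le> 2 * q" "p < d" "1 / q < 1 / p + 2 / d"
  shows "\<exists>C>0. \<forall>T>0. \<forall>a b :: real \<Rightarrow> 'n distr set.
    (\<forall>t\<in>{0<..<T}. a t \<in> S0' \<and> b t \<in> S0') \<longrightarrow>
    chemin_lerner_norm chi \<rho>\<^sub>1 T (d / p - 2) p \<infinity> a < \<infinity> \<longrightarrow>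
    chemin_lerner_norm chi \<rho>\<^sub>2 T (d / p) p \<infinity> b < \<infinity> \<longrightarrow>
    chemin_lerner_norm chi \<rho>\<^sub>1' T (d / p - 2) p \<infinity> b < \<infinity> \<longrightarrow>
    chemin_lerner_norm chi \<rho>\<^sub>2' T (d / p) p \<infinity> a < \<infinity> \<longrightarrow>
    (AE t in lebesgue_on {0<..<T}. product_defined chi (a t) (b t)) \<and>
    chemin_lerner_norm chi \<rho> T (d / q - 2) q \<infinity> (\<lambda>t. product_class chi (a t) (b t))
      \<le> ennreal C *
        (chemin_lerner_norm chi \<rho>\<^sub>1 T (d / p - 2) p \<infinity> a * chemin_lerner_norm chi \<rho>\<^sub>2 T (d / p) p \<infinity> b
         + chemin_lerner_norm chi \<rho>\<^sub>1' T (d / p - 2) p \<infinity> b * chemin_lerner_norm chi \<rho>\<^sub>2' T (d / p) p \<infinity> a)"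
proof -
  \<comment> \<open>the exponent in which the remainder is estimated\<close>
  define r where "r = max 1 (p / 2)"
  have p: "1 \<le> p" using q by simp
  have r: "1 \<le> r" "r \<le> p" "p \<le> 2 * r" "r \<le> real CARD('n)" "r \<le> q" using p q d d3 by (auto simp: r_def)
  have "2 * r < d" using q d d3 by (auto simp: r_def)
  then have r': "0 < d / r - 2" using r(1) by (simp add: field_simps)
  have "d * (1 / q) < d * (1 / p + 2 / d)" using q(5) d d3 by (intro mult_strict_left_mono) auto
  then have \<delta>: "0 < d / p - d / q + 2" using d d3 by (simp add: distrib_left)
  obtain C where C: "0 < C" and bound: "\<forall>(M :: real measure) \<alpha> \<beta> A\<^sub>1 B\<^sub>2 B\<^sub>1 A\<^sub>2 l.
      (\<forall>k. (\<lambda>t. \<alpha> t k) \<in> borel_measurable M \<and> (\<lambda>t. \<beta> t k) \<in> borel_measurable M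
        \<and> Lnorm \<rho>\<^sub>1 M (\<lambda>t. \<alpha> t k) \<le> ennreal (2 powr (- real_of_int k * (d / p - 2))) * A\<^sub>1
        \<and> Lnorm \<rho>\<^sub>2 M (\<lambda>t. \<beta> t k) \<le> ennreal (2 powr (- real_of_int k * (d / p))) * B\<^sub>2
        \<and> Lnorm \<rho>\<^sub>1' M (\<lambda>t. \<beta> t k) \<le> ennreal (2 powr (- real_of_int k * (d / p - 2))) * B\<^sub>1
        \<and> Lnorm \<rho>\<^sub>2' M (\<lambda>t. \<alpha> t k) \<le> ennreal (2 powr (- real_of_int k * (d / p))) * A\<^sub>2)
      \<longrightarrow> Lnorm \<rho> M (\<lambda>t. prod_bound p q r (\<alpha> t) (\<beta> t) l)
        \<le> ennreal (C * 2 powr (- real_of_int l * (d / q - 2))) * (A\<^sub>1 * B\<^sub>2 + B\<^sub>1 * A\<^sub>2)"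
    using Lnorm_prod_bound[where 'a = real, OF \<delta>[unfolded d] r'[unfolded d] \<rho> \<rho>'] unfolding d by (elim exE conjE)
  show ?thesis
  proof (intro exI[of _ C] conjI allI impI)
    show "0 < C" by (rule C)
    fix T :: real and a b :: "real \<Rightarrow> 'n distr set"
    let ?M = "lebesgue_on {0<..<T}"
    let ?u = "\<lambda>t. rep (a t)" and ?v = "\<lambda>t. rep (b t)" and ?w = "\<lambda>t. rep (product_class chi (a t) (b t))"
    let ?A1 = "chemin_lerner_norm chi \<rho>\<^sub>1 T (d / p - 2) p \<infinity> a" and ?B2 = "chemin_lerner_norm chi \<rho>\<^sub>2 T (d / p) p \<infinity> b"
    let ?B1 = "chemin_lerner_norm chi \<rho>\<^sub>1' T (d / p - 2) p \<infinity> b" and ?A2 = "chemin_lerner_norm chi \<rho>\<^sub>2' T (d / p) p \<infinity> a"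
    assume S: "\<forall>t\<in>{0<..<T}. a t \<in> S0' \<and> b t \<in> S0'" and fin: "?A1 < \<infinity>" "?B2 < \<infinity>" "?B1 < \<infinity>" "?A2 < \<infinity>"
    have u: "tempered (?u t)" and v: "tempered (?v t)" if "t \<in> space ?M" for t
      using S that by (auto intro: tempered_rep)
    note mu = chemin_lerner_finite(1)[OF fin(1)] and mv = chemin_lerner_finite(1)[OF fin(2)]
    have nu: "(\<lambda>t. bnorm p (?u t) k) \<in> borel_measurable ?M" and nv: "(\<lambda>t. bnorm p (?v t) k) \<in> borel_measurable ?M" for k
      by (rule distr_Lnorm_measurable[OF u mu p] distr_Lnorm_measurable[OF v mv p]; assumption)+
    note N = chemin_lerner_finite(2)[OF fin(1)] chemin_lerner_finite(2)[OF fin(2)]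
      chemin_lerner_finite(2)[OF fin(3)] chemin_lerner_finite(2)[OF fin(4)]
    have "AE t in ?M. good p (?u t)"
      by (rule AE_good[OF u \<rho>(2) \<rho>'(2) nu N(1)[unfolded d] fin(1)[unfolded d] N(4)[unfolded d] fin(4)[unfolded d]])
    moreover have "AE t in ?M. good p (?v t)"
      by (rule AE_good[OF v \<rho>'(1) \<rho>(3) nv N(3)[unfolded d] fin(3)[unfolded d] N(2)[unfolded d] fin(2)[unfolded d]])
    ultimately have G: "AE t in ?M. good p (?u t) \<and> good p (?v t)" by eventually_elim simp
    then show "AE t in ?M. product_defined chi (a t) (b t)"
      by eventually_elim (auto intro: product_defined_good[OF p r(1-4)])
    \<comment> \<open>On the exceptional null set the class of the product is arbitrary, possibly without a tempered representative.\<close>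
    define w where "w t = (if good p (?u t) \<and> good p (?v t) then ?w t else (\<lambda>\<phi>. 0))" for t
    have w: "tempered (w t)" for t
      using product_defined_good(2)[OF p r(1-4), of "a t" "b t"]
      by (auto simp: w_def product_class_def intro: tempered_rep_poly_class tempered_0)
    have ww: "AE t in ?M. w t = ?w t" using G by eventually_elim (simp add: w_def)
    have S': "{0<..<T} \<in> sets lebesgue" by simp
    have m: "(\<lambda>t. Delta chi l (?w t) \<phi>) \<in> borel_measurable ?M" if \<phi>: "\<phi> \<in> schwartz" for l \<phi>
    proof (rule borel_measurable_AE_lebesgue_on[OF S'])
      let ?\<psi> = "test_multiplier (ann l) \<phi>"
      let ?F = "\<lambda>t. (\<Sum>j\<in>{l - 5..l + 5}. \<integral>x. para (?u t) (?v t) j x * ?\<psi> x \<partial>lborel)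
        + (\<Sum>j\<in>{l - 5..l + 5}. \<integral>x. para (?v t) (?u t) j x * ?\<psi> x \<partial>lborel)
        + (\<Sum>m. \<integral>x. rem (?u t) (?v t) (l - 3 + int m) x * ?\<psi> x \<partial>lborel)"
      have \<psi>: "?\<psi> \<in> schwartz" by (rule test_multiplier_schwartz[OF ann_schwartz \<phi>])
      note [measurable] = piece_integral_measurable[OF u mu v mv \<psi>] piece_integral_measurable(1)[OF v mv u mu \<psi>]
      show "?F \<in> borel_measurable ?M" by measurable
      show "AE t in ?M. Delta chi l (?w t) \<phi> = ?F t"
        using G by eventually_elim (rule Delta_product[OF p r(1-4) _ _ \<phi>]; simp)
    qed
    have mw: "(\<lambda>t. Delta chi l (w t) \<phi>) \<in> borel_measurable ?M" if \<phi>: "\<phi> \<in> schwartz" for l \<phi>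
      by (rule borel_measurable_AE_lebesgue_on[OF S' m[OF \<phi>]]) (use ww in \<open>eventually_elim, simp\<close>)
    show "chemin_lerner_norm chi \<rho> T (d / q - 2) q \<infinity> (\<lambda>t. product_class chi (a t) (b t))
        \<le> ennreal C * (?A1 * ?B2 + ?B1 * ?A2)"
      unfolding chemin_lerner_norm_infty[of chi \<rho> T "d / q - 2"]
    proof (rule SUP_least)
      fix l :: int
      have "(\<lambda>t. bnorm q (w t) l) \<in> borel_measurable ?M" by (rule distr_Lnorm_measurable[OF w mw q(1)])
      then have mb: "(\<lambda>t. bnorm q (?w t) l) \<in> borel_measurable ?M"
        by (rule borel_measurable_AE_lebesgue_on[OF S']) (use ww in \<open>eventually_elim, simp\<close>)
      have "time_space_norm \<rho> T q (\<lambda>t. Delta chi l (?w t)) = Lnorm \<rho> ?M (\<lambda>t. bnorm q (?w t) l)"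
        unfolding time_space_norm_def using m by simp
      also have "\<dots> \<le> Lnorm \<rho> ?M (\<lambda>t. prod_bound p q r (bnorm p (?u t)) (bnorm p (?v t)) l)"
      proof (rule Lnorm_mono_AE[OF \<rho>(1) mb])
        show "AE t in ?M. bnorm q (?w t) l \<le> prod_bound p q r (bnorm p (?u t)) (bnorm p (?v t)) l"
          using G
        proof eventually_elim
          case (elim t)
          then have g: "good p (?u t)" "good p (?v t)" by auto
          show ?case
            unfolding distr_Lnorm_eq[OF q(1) prod_block_continuous[OF p r(1-4) g] prod_block_represents[OF p r(1-4) g]]
            by (rule prod_block_Lnorm[OF p r(1-4) g r(5) q(2,3)])
        qed
      qed
      also have "\<dots> \<le> ennreal (C * 2 powr (- real_of_int l * (d / q - 2))) * (?A1 * ?B2 + ?B1 * ?A2)"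
        by (rule bound[rule_format]) (intro conjI nu nv N)
      finally have "ennreal (2 powr (of_int l * (d / q - 2))) * time_space_norm \<rho> T q (\<lambda>t. Delta chi l (?w t))
          \<le> ennreal (2 powr (of_int l * (d / q - 2))) * (ennreal (C * 2 powr (- real_of_int l * (d / q - 2))) * (?A1 * ?B2 + ?B1 * ?A2))"
        by (rule mult_left_mono) simp
      also have "\<dots> = ennreal (2 powr (of_int l * (d / q - 2)) * (C * 2 powr (- real_of_int l * (d / q - 2)))) * (?A1 * ?B2 + ?B1 * ?A2)"
        using C by (intro ennreal_mult_assoc) auto
      also have "2 powr (of_int l * (d / q - 2)) * (C * 2 powr (- real_of_int l * (d / q - 2))) = C"
        by (simp add: mult.left_commute flip: powr_add)
      finally show "ennreal (2 powr (of_int l * (d / q - 2))) * time_space_norm \<rho> T q (\<lambda>t. Delta chi l (?w t)) \<le> ennreal C * (?A1 * ?B2 + ?B1 * ?A2)" .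
    qed
  qed
qed

end

theorem corollary3p1:
  fixes chi :: "real^'n::finite \<Rightarrow> real"
    and \<rho> \<rho>\<^sub>1 \<rho>\<^sub>2 \<rho>\<^sub>1' \<rho>\<^sub>2' :: ennreal
    and p q d :: real
  assumes "littlewood_paley chi"
    and "CARD('n) \<ge> 3" and "d = real CARD('n)"
    and "1 \<le> \<rho>" "1 \<le> \<rho>\<^sub>1" "1 \<le> \<rho>\<^sub>2" "1 \<le> \<rho>\<^sub>1'" "1 \<le> \<rho>\<^sub>2'"
    and "1 / \<rho> = 1 / \<rho>\<^sub>1 + 1 / \<rho>\<^sub>2" and "1 / \<rho> = 1 / \<rho>\<^sub>1' + 1 / \<rho>\<^sub>2'"
    and "1 \<le> q" "q \<le> p" "p \<le> 2 * q" "p < d"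
    and "1 / q < 1 / p + 2 / d"
  shows "\<exists>C>0::real. \<forall>T>0. \<forall>a b :: real \<Rightarrow> 'n distr set.
    (\<forall>t\<in>{0<..<T}. a t \<in> S0' \<and> b t \<in> S0') \<longrightarrow>
    chemin_lerner_norm chi \<rho>\<^sub>1 T (d / p - 2) p \<infinity> a < \<infinity> \<longrightarrow>
    chemin_lerner_norm chi \<rho>\<^sub>2 T (d / p) p \<infinity> b < \<infinity> \<longrightarrow>
    chemin_lerner_norm chi \<rho>\<^sub>1' T (d / p - 2) p \<infinity> b < \<infinity> \<longrightarrow>
    chemin_lerner_norm chi \<rho>\<^sub>2' T (d / p) p \<infinity> a < \<infinity> \<longrightarrow>
    (AE t in lebesgue_on {0<..<T}. product_defined chi (a t) (b t)) \<and>
    chemin_lerner_norm chi \<rho> T (d / q - 2) q \<infinity> (\<lambda>t. product_class chi (a t) (b t))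
      \<le> ennreal C *
        (chemin_lerner_norm chi \<rho>\<^sub>1 T (d / p - 2) p \<infinity> a * chemin_lerner_norm chi \<rho>\<^sub>2 T (d / p) p \<infinity> b
         + chemin_lerner_norm chi \<rho>\<^sub>1' T (d / p - 2) p \<infinity> b * chemin_lerner_norm chi \<rho>\<^sub>2' T (d / p) p \<infinity> a)"
proof -
  interpret lp chi by unfold_locales (rule assms(1))
  show ?thesis by (rule product_estimate[OF assms(2-6) assms(9) assms(7,8) assms(10-)])
qed

end
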